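(* Let $\Omega$ be any open set in $\mathbb R^n$, $n\geq2$. Assume that $\mu$ is a Borel measure in $\Omega$ such that $\mu(B_r(x)\cap\Omega)\leq C_\mu r^\alpha$ for $x\in\Omega$ and $r>0$, for some exponent $\alpha\in(n-1,n]$ and some constant $C_\mu>0$. (i) Assume that $1<p<n$ and $1\leq q\leq\infty$. Then there exists a constant $C=C(n,p,q,\alpha,C_\mu)$ such that $$\|\mathbf u\|_{L^{\frac{\alpha p}{n-p},q}(\Omega,\mu)}\leq C\Big(\|\mathcal E\mathbf u\|_{L^{p,q}(\Omega)}+\|\mathbf u\|_{L^{\frac{p(n-1)}{n-p},q}(\partial\Omega)}\Big)$$ for every $\mathbf u\in E^1L^{p,q}(\Omega)\cap C_b(\overline\Omega)$. (ii) Assume that $p=n$ and $1<q<\infty$, and that $\mathcal L^n(\Omega)<\infty$, $\mu(\Omega)<\infty$ and $\mathcal H^{n-1}(\partial\Omega)<\infty$. Then there exists a constant $C=C(n,q,\alpha,C_\mu,\mathcal L^n(\Omega),\mu(\Omega),\mathcal H^{n-1}(\partial\Omega))$ such that $$\|\mathbf u\|_{L^{\infty,q;-1}(\Omega,\mu)}\leq C\Big(\|\mathcal E\mathbf u\|_{L^{n,q}(\Omega)}+\|\mathbf u\|_{L^{\infty,q;-1}(\partial\Omega)}\Big)$$ for every $\mathbf u\in E^1L^{n,q}(\Omega)\cap C_b(\overline\Omega)$. (iii) Assume that either $p=n$ and $q=1$, or $p>n$ and $1\leq q\leq\infty$, and that $\mathcal L^n(\Omega)<\infty$, $\mu(\Omega)<\infty$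 and $\mathcal H^{n-1}(\partial\Omega)<\infty$. Then there exists a constant $C=C(n,p,q,\alpha,C_\mu,\mathcal L^n(\Omega),\mu(\Omega),\mathcal H^{n-1}(\partial\Omega))$ such that $$\|\mathbf u\|_{L^\infty(\Omega)}\leq C\Big(\|\mathcal E\mathbf u\|_{L^{p,q}(\Omega)}+\|\mathbf u\|_{L^\infty(\partial\Omega)}\Big)$$ for every $\mathbf u\in E^1L^{p,q}(\Omega)\cap C_b(\overline\Omega)$.
   Context: Functions $\mathbf u$ are $\mathbb R^n$-valued. $\mathcal E\mathbf u=\tfrac12(\nabla\mathbf u+(\nabla\mathbf u)^T)$ is the symmetric part of the distributional gradient. For a function space $X(\Omega)$, $E^1X(\Omega)=\{\mathbf u\in L^1_{\rm loc}(\Omega):|\mathcal E\mathbf u|\in X(\Omega)\}$. $C_b(\overline\Omega)$ is the set of functions that are continuous in $\overline\Omega$ and have bounded support. $B_r(x)$ is the ball centered at $x$ with radius $r$; $\mathcal L^n$ is Lebesgue measure and $\mathcal H^{n-1}$ the $(n-1)$-dimensional Hausdorff measure. Norms over $\Omega$ with no measure indicated are with respect to $\mathcal L^n$; norms over $\partial\Omega$ are with respect to $\mathcal H^{n-1}$ and are applied to the restriction of $\mathbf u$ to $\partial\Omega$. Let $\mathcal R$ be a measure space with a $\sigma$-finite, non-atomic measure $\nu$, and $\phi^*_\nu(s)=\inf\{t\geq0:\nu(\{|\phi|>t\})\leq s\}$ the decreasing rearrangement of $\phi$. If either $1<p<\infty$ and $1\leq q\leq\infty$, or $p=q=1$, or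 $p=q=\infty$ (the only admissible pairs), the Lorentz space $L^{p,q}(\mathcal R)$ is defined via the functional $\|\phi\|_{L^{p,q}(\mathcal R)}=\big\|s^{\frac1p-\frac1q}\phi^*_\nu(s)\big\|_{L^q(0,\infty)}$. If $1<q<\infty$ and $\nu(\mathcal R)<\infty$, the Lorentz–Zygmund space $L^{\infty,q;-1}(\mathcal R)$ has the norm $$\|\phi\|_{L^{\infty,q;-1}(\mathcal R)}=\Big\|s^{-\frac1q}\log^{-1}\!\big(1+\tfrac{\nu(\mathcal R)}{s}\big)\phi^*_\nu(s)\Big\|_{L^q(0,\nu(\mathcal R))}.$$ *)

theory Defs
  imports "HOL-Probability.Essential_Supremum"
begin

section \<open>Hausdorff measure\<close>

text \<open>
  Standard normalisation: the factor \<open>unit_ball_vol d / 2 ^ d\<close> makes the \<open>d\<close>-dimensional Hausdorff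
  measure agree with Lebesgue measure in dimension \<open>d\<close>.  Covering sets have to be required to be
  bounded, since \<^const>\<open>diameter\<close> is meaningless on unbounded sets.
\<close>

definition hausdorff_weight :: "nat \<Rightarrow> 'a::metric_space set \<Rightarrow> ennreal" where
  "hausdorff_weight d S =
     (if S = {} then 0 else ennreal (unit_ball_vol (real d) * (diameter S / 2) ^ d))"

definition hausdorff_covers :: "real \<Rightarrow> 'a::metric_space set \<Rightarrow> (nat \<Rightarrow> 'a set) set" where
  "hausdorff_covers \<delta> A =
     {U. A \<subseteq> (\<Union>i. U i) \<and> (\<forall>i. bounded (U i) \<and> diameter (U i) \<le> \<delta>)}"

definition hausdorff_pre :: "nat \<Rightarrow> real \<Rightarrow> 'a::metric_space set \<Rightarrow> ennreal" where
  "hausdorff_pre d \<delta> A = (INF U\<in>hausdorff_covers \<delta> A. \<Sum>i. hausdorff_weight d (U i))"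

definition hausdorff_outer :: "nat \<Rightarrow> 'a::metric_space set \<Rightarrow> ennreal" where
  "hausdorff_outer d A = (SUP \<delta>\<in>{0<..}. hausdorff_pre d \<delta> A)"

definition hausdorff_measure :: "nat \<Rightarrow> 'a::metric_space measure" where
  "hausdorff_measure d = measure_of UNIV (sets borel) (hausdorff_outer d)"

text \<open>
  \<^const>\<open>measure_of\<close> yields the zero measure unless the given set function is countably additive.
  The following lemmas (Caratheodory's criterion for metric outer measures) rule this out; see
  \<open>emeasure_hausdorff_measure\<close> below.
\<close>

lemma metric_outer_closed_in_lambda_system:
  fixes f :: "'a::metric_space set \<Rightarrow> ennreal"
  assumes oms: "outer_measure_space (Pow UNIV) f"
    and metric: "\<And>A B e. e > 0 \<Longrightarrow> (\<And>x y. x \<in> A \<Longrightarrow> y \<in> B \<Longrightarrow> e \<le> dist x y)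
                   \<Longrightarrow> f A + f B \<le> f (A \<union> B)"
    and F: "closed F"
  shows "F \<in> lambda_system UNIV (Pow UNIV) f"
proof -
  have pos: "f {} = 0" and inc: "\<And>A B. A \<subseteq> B \<Longrightarrow> f A \<le> f B"
    and csa: "countably_subadditive (Pow UNIV) f"
    using oms by (auto simp: outer_measure_space_def positive_def increasing_def)
  have sa: "f (A \<union> B) \<le> f A + f B" for A B
  proof -
    interpret sigma_algebra UNIV "Pow UNIV :: 'a set set" by (rule sigma_algebra_Pow)
    have "subadditive (Pow UNIV) f"
      using countably_subadditive_subadditive[OF _ csa] oms by (simp add: outer_measure_space_def)
    then have "f (A \<union> (B - A)) \<le> f A + f (B - A)"
      by (rule subadditiveD) auto
    also have "\<dots> \<le> f A + f B" by (intro add_left_mono inc) auto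
    finally show ?thesis by simp
  qed
  have main: "f (F \<inter> X) + f (X - F) \<le> f X" for X
  proof (cases "F = {} \<or> f X = \<infinity>")
    case True
    then show ?thesis using pos by auto
  next
    case False
    then have Fne: "F \<noteq> {}" and fin: "f X < \<infinity>" by (auto simp: less_top)
    define g where "g x = infdist x F" for x
    have g0: "g x > 0 \<longleftrightarrow> x \<notin> F" for x
      using F Fne in_closed_iff_infdist_zero[of F x] infdist_nonneg[of x F] by (auto simp: g_def less_le)
    have gd: "g x \<le> g y + dist x y" for x y
      unfolding g_def by (rule infdist_triangle)
    define A where "A n = {x \<in> X. 1 / real (Suc n) \<le> g x}" for n
    define R where "R k = {x \<in> X. 1 / real (Suc (Suc k)) \<le> g x \<and> g x < 1 / real (Suc k)}" for k
    have alt: "(\<Sum>k<m. f (R (2 * k + c))) \<le> f (\<Union>k<m. R (2 * k + c))" for m c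
    proof (induction m)
      case 0
      then show ?case by simp
    next
      case (Suc m)
      define e where "e = (1::real) / (2 * m + c) - 1 / (2 * m + c + 1)"
      have "(\<Sum>k<Suc m. f (R (2 * k + c))) \<le> f (\<Union>k<m. R (2 * k + c)) + f (R (2 * m + c))"
        using Suc by (simp add: add_right_mono)
      also have "\<dots> \<le> f ((\<Union>k<m. R (2 * k + c)) \<union> R (2 * m + c))"
      proof (cases "m = 0")
        case True
        then show ?thesis using pos by simp
      next
        case False
        show ?thesis
        proof (rule metric[of e])
          have "1 / (real (2 * m + c) + 1) < 1 / real (2 * m + c)"
            using False by (intro divide_strict_left_mono) auto
          then show "e > 0" by (simp add: e_def add_ac)
          fix x y assume x: "x \<in> (\<Union>k<m. R (2 * k + c))" and y: "y \<in> R (2 * m + c)"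
          from x obtain k where k: "k < m" "x \<in> R (2 * k + c)" by auto
          have "1 / (2 * m + c) \<le> 1 / real (Suc (Suc (2 * k + c)))"
            using k(1) by (intro divide_left_mono) auto
          also have "\<dots> \<le> g x" using k by (simp add: R_def)
          finally have 1: "1 / (2 * m + c) \<le> g x" .
          have 2: "g y < 1 / (2 * m + c + 1)" using y by (simp add: R_def add_ac)
          show "e \<le> dist x y" using 1 2 gd[of x y] unfolding e_def by linarith
        qed
      qed
      also have "(\<Union>k<m. R (2 * k + c)) \<union> R (2 * m + c) = (\<Union>k<Suc m. R (2 * k + c))"
        by (auto simp: less_Suc_eq)
      finally show ?case .
    qed
    have RX: "f (\<Union>k<m. R (2 * k + c)) \<le> f X" for m c
      by (rule inc) (auto simp: R_def)
    have split: "(\<Sum>k<2 * m. h k) = (\<Sum>k<m. h (2 * k + 0)) + (\<Sum>k<m. h (2 * k + 1))"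
      for m and h :: "nat \<Rightarrow> ennreal"
      by (induction m) (simp_all add: add_ac)
    have part: "(\<Sum>k<m. f (R k)) \<le> f X + f X" for m
    proof -
      have "(\<Sum>k<m. f (R k)) \<le> (\<Sum>k<2 * m. f (R k))"
        by (intro sum_mono2) auto
      also have "\<dots> \<le> f X + f X"
        unfolding split by (intro add_mono order_trans[OF alt RX])
      finally show ?thesis .
    qed
    define a where "a k = enn2real (f (R k))" for k
    have fRa: "f (R k) = ennreal (a k)" for k
    proof -
      have "f (R k) \<le> f X" by (rule inc) (auto simp: R_def)
      then show ?thesis using fin by (simp add: a_def le_less_trans)
    qed
    have a0: "a k \<ge> 0" for k by (simp add: a_def)
    have suma: "summable a"
    proof (rule bounded_imp_summable[of _ "enn2real (f X + f X)"])
      show "0 \<le> a n" for n by (rule a0)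
      fix n
      have "ennreal (\<Sum>k\<le>n. a k) = (\<Sum>k<Suc n. f (R k))"
        using a0 by (simp add: fRa lessThan_Suc_atMost)
      also have "\<dots> \<le> f X + f X" by (rule part)
      also have "\<dots> = ennreal (enn2real (f X + f X))" using fin by simp
      finally show "(\<Sum>k\<le>n. a k) \<le> enn2real (f X + f X)" by simp
    qed
    have step: "f (F \<inter> X) + f (X - F) \<le> f X + ennreal (\<Sum>k. a (k + n))" for n
    proof -
      have dec: "X - F \<subseteq> A n \<union> (\<Union>k. R (k + n))"
      proof
        fix x assume x: "x \<in> X - F"
        then have gx: "g x > 0" using g0 by auto
        show "x \<in> A n \<union> (\<Union>k. R (k + n))"
        proof (cases "1 / real (Suc n) \<le> g x")
          case True
          then show ?thesis using x by (auto simp: A_def)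
        next
          case False
          obtain N where "inverse (real (Suc N)) < g x" using reals_Archimedean[OF gx] by auto
          then have ex: "1 / real (Suc N) \<le> g x" by (simp add: inverse_eq_divide)
          define M where "M = (LEAST N. 1 / real (Suc N) \<le> g x)"
          have M: "1 / real (Suc M) \<le> g x" unfolding M_def using ex by (rule LeastI)
          have Mn: "\<not> M \<le> n"
          proof
            assume "M \<le> n"
            then have "1 / real (Suc n) \<le> 1 / real (Suc M)" by (simp add: frac_le)
            with M False show False by linarith
          qed
          then obtain k where k: "M = Suc (k + n)" by (metis add.commute less_imp_Suc_add not_le)
          have "\<not> 1 / real (Suc (k + n)) \<le> g x"
            using not_less_Least[of "k + n" "\<lambda>N. 1 / real (Suc N) \<le> g x"] k unfolding M_def by auto
          then have "x \<in> R (k + n)" using M x k by (auto simp: R_def)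
          then show ?thesis by auto
        qed
      qed
      have disjR: "disjoint_family (\<lambda>k. R (k + n))"
      proof -
        have "R i \<inter> R j = {}" if "i < j" for i j
        proof -
          have "1 / real (Suc j) \<le> 1 / real (Suc (Suc i))" using that by (intro divide_left_mono) auto
          then show ?thesis by (auto simp: R_def)
        qed
        then show ?thesis unfolding disjoint_family_on_def
          by (metis add_right_cancel linorder_neqE_nat inf_commute)
      qed
      have "f (X - F) \<le> f (A n) + f (\<Union>k. R (k + n))"
        using inc[OF dec] sa order_trans by blast
      also have "f (\<Union>k. R (k + n)) \<le> (\<Sum>k. f (R (k + n)))"
        using csa disjR by (auto simp: countably_subadditive_def)
      also have "(\<Sum>k. f (R (k + n))) = ennreal (\<Sum>k. a (k + n))"
        unfolding fRa by (rule suminf_ennreal2) (use a0 suma in \<open>auto simp: summable_iff_shift\<close>)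
      finally have 1: "f (X - F) \<le> f (A n) + ennreal (\<Sum>k. a (k + n))"
        by (simp add: add_left_mono)
      have 2: "f (F \<inter> X) + f (A n) \<le> f (F \<inter> X \<union> A n)"
      proof (rule metric[of "1 / real (Suc n)"])
        fix x y assume x: "x \<in> F \<inter> X" and y: "y \<in> A n"
        have "g x = 0" using x by (simp add: g_def)
        moreover have "1 / real (Suc n) \<le> g y" using y by (simp add: A_def)
        ultimately show "1 / real (Suc n) \<le> dist x y" using gd[of y x] by (simp add: dist_commute)
      qed simp
      have "f (F \<inter> X) + f (X - F) \<le> f (F \<inter> X) + f (A n) + ennreal (\<Sum>k. a (k + n))"
        using add_left_mono[OF 1, of "f (F \<inter> X)"] by (simp add: add.assoc)
      also have "\<dots> \<le> f X + ennreal (\<Sum>k. a (k + n))"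
        by (intro add_right_mono order_trans[OF 2] inc) (auto simp: A_def)
      finally show ?thesis .
    qed
    show ?thesis
    proof (rule ennreal_le_epsilon)
      fix e :: real assume "e > 0"
      then obtain N where "\<And>n. n \<ge> N \<Longrightarrow> norm (\<Sum>i. a (i + n)) < e"
        using suminf_exist_split[OF _ suma] by blast
      then have "(\<Sum>i. a (i + N)) \<le> e" by (metis abs_le_D1 less_imp_le order_refl real_norm_def)
      then have "f X + ennreal (\<Sum>k. a (k + N)) \<le> f X + ennreal e"
        by (intro add_left_mono ennreal_leI)
      with step[of N] show "f (F \<inter> X) + f (X - F) \<le> f X + ennreal e" by (rule order_trans)
    qed
  qed
  have "f (F \<inter> X) + f (X - F) = f X" for X
  proof (rule antisym[OF main])
    have "X = (F \<inter> X) \<union> (X - F)" by auto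
    then show "f X \<le> f (F \<inter> X) + f (X - F)" by (metis sa)
  qed
  moreover have "(UNIV - F) \<inter> X = X - F" for X by auto
  ultimately show ?thesis by (auto simp: lambda_system_def)
qed

lemma hausdorff_pre_mono: "A \<subseteq> B \<Longrightarrow> hausdorff_pre d \<delta> A \<le> hausdorff_pre d \<delta> B"
  unfolding hausdorff_pre_def by (rule INF_superset_mono) (auto simp: hausdorff_covers_def)

lemma hausdorff_pre_antimono: "\<delta> \<le> \<epsilon> \<Longrightarrow> hausdorff_pre d \<epsilon> A \<le> hausdorff_pre d \<delta> A"
  unfolding hausdorff_pre_def
  by (rule INF_superset_mono) (auto simp: hausdorff_covers_def intro: order_trans)

lemma hausdorff_pre_countably_subadditive:
  "hausdorff_pre d \<delta> (\<Union>i. A i) \<le> (\<Sum>i. hausdorff_pre d \<delta> (A i))"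
proof (cases "(\<Sum>i. hausdorff_pre d \<delta> (A i)) = \<infinity>")
  case False
  then have fin: "hausdorff_pre d \<delta> (A i) < \<infinity>" for i
    by (metis ennreal_suminf_lessD infinity_ennreal_def less_top)
  show ?thesis
  proof (rule ennreal_le_epsilon)
    fix e :: real assume e: "e > 0"
    have "\<exists>U\<in>hausdorff_covers \<delta> (A i).
            (\<Sum>j. hausdorff_weight d (U j)) < hausdorff_pre d \<delta> (A i) + ennreal (e * (1/2) ^ Suc i)" for i
    proof -
      have "hausdorff_pre d \<delta> (A i) + 0 < hausdorff_pre d \<delta> (A i) + ennreal (e * (1/2) ^ Suc i)"
        using fin[of i] e by (subst ennreal_add_left_cancel_less) (auto simp: less_top)
      then have "(INF U\<in>hausdorff_covers \<delta> (A i). \<Sum>j. hausdorff_weight d (U j))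
          < hausdorff_pre d \<delta> (A i) + ennreal (e * (1/2) ^ Suc i)"
        unfolding add_0_right by (subst (asm) (1) hausdorff_pre_def)
      then show ?thesis by (simp only: INF_less_iff)
    qed
    then obtain U where U: "\<And>i. U i \<in> hausdorff_covers \<delta> (A i)"
      and Ub: "\<And>i. (\<Sum>j. hausdorff_weight d (U i j))
                  < hausdorff_pre d \<delta> (A i) + ennreal (e * (1/2) ^ Suc i)"
      by metis
    define V where "V k = (case prod_decode k of (i, j) \<Rightarrow> U i j)" for k
    have V: "V \<in> hausdorff_covers \<delta> (\<Union>i. A i)"
    proof -
      have "(\<Union>i. A i) \<subseteq> (\<Union>k. V k)"
      proof
        fix x assume "x \<in> (\<Union>i. A i)"
        then obtain i j where "x \<in> U i j" using U by (fastforce simp: hausdorff_covers_def)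
        then have "x \<in> V (prod_encode (i, j))" by (simp add: V_def)
        then show "x \<in> (\<Union>k. V k)" by blast
      qed
      then show ?thesis using U by (auto simp: hausdorff_covers_def V_def split: prod.split)
    qed
    have "hausdorff_pre d \<delta> (\<Union>i. A i) \<le> (\<Sum>k. hausdorff_weight d (V k))"
      unfolding hausdorff_pre_def by (rule INF_lower[OF V])
    also have "\<dots> = (\<Sum>i. \<Sum>j. hausdorff_weight d (U i j))"
      using suminf_ennreal_2dimen[of "\<lambda>i. \<Sum>j. hausdorff_weight d (U i j)"
          "\<lambda>(i, j). hausdorff_weight d (U i j)"]
      by (simp add: V_def comp_def prod.case_distrib[of "hausdorff_weight d"])
    also have "\<dots> \<le> (\<Sum>i. hausdorff_pre d \<delta> (A i) + ennreal (e * (1/2) ^ Suc i))"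
      using Ub by (intro suminf_le) (auto intro: less_imp_le)
    also have "\<dots> = (\<Sum>i. hausdorff_pre d \<delta> (A i)) + (\<Sum>i. ennreal (e * (1/2) ^ Suc i))"
      by (rule suminf_add[symmetric]) auto
    also have "(\<Sum>i. ennreal (e * (1/2) ^ Suc i)) = ennreal e"
    proof -
      have "(\<lambda>i. e * (1/2) ^ Suc i) sums (e * 1)"
        by (intro sums_mult power_half_series)
      then show ?thesis using e by (subst suminf_ennreal_eq[where x = e]) auto
    qed
    finally show "hausdorff_pre d \<delta> (\<Union>i. A i) \<le> (\<Sum>i. hausdorff_pre d \<delta> (A i)) + ennreal e" .
  qed
qed simp

lemma outer_measure_space_hausdorff:
  "outer_measure_space (Pow UNIV) (hausdorff_outer d :: 'a::metric_space set \<Rightarrow> ennreal)"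
  unfolding outer_measure_space_def
proof (intro conjI)
  have "hausdorff_pre d \<delta> ({} :: 'a set) = 0" if "\<delta> > 0" for \<delta>
  proof -
    have "(\<lambda>_. {}) \<in> hausdorff_covers \<delta> ({} :: 'a set)" using that by (simp add: hausdorff_covers_def)
    then have "hausdorff_pre d \<delta> ({} :: 'a set) \<le> (\<Sum>i::nat. hausdorff_weight d ({} :: 'a set))"
      unfolding hausdorff_pre_def by (rule INF_lower)
    then show ?thesis by (simp add: hausdorff_weight_def)
  qed
  then have "hausdorff_outer d ({} :: 'a set) \<le> 0"
    unfolding hausdorff_outer_def by (intro SUP_least) simp
  then show "positive (Pow UNIV) (hausdorff_outer d :: 'a set \<Rightarrow> ennreal)"
    by (simp add: positive_def)
  show "increasing (Pow UNIV) (hausdorff_outer d :: 'a set \<Rightarrow> ennreal)"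
    by (auto simp: increasing_def hausdorff_outer_def intro!: SUP_mono intro: hausdorff_pre_mono)
  show "countably_subadditive (Pow UNIV) (hausdorff_outer d :: 'a set \<Rightarrow> ennreal)"
    unfolding countably_subadditive_def
  proof (intro allI impI)
    fix A :: "nat \<Rightarrow> 'a set"
    show "hausdorff_outer d (\<Union>i. A i) \<le> (\<Sum>i. hausdorff_outer d (A i))"
      unfolding hausdorff_outer_def[of d "\<Union>i. A i"]
    proof (rule SUP_least)
      fix \<delta> :: real assume "\<delta> \<in> {0<..}"
      then show "hausdorff_pre d \<delta> (\<Union>i. A i) \<le> (\<Sum>i. hausdorff_outer d (A i))"
        by (intro order_trans[OF hausdorff_pre_countably_subadditive] suminf_le)
           (auto simp: hausdorff_outer_def intro: SUP_upper)
    qed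
  qed
qed

lemma hausdorff_pre_separated:
  assumes e: "\<And>x y. x \<in> A \<Longrightarrow> y \<in> B \<Longrightarrow> e \<le> dist x y" and \<delta>: "\<delta> < e"
  shows "hausdorff_pre d \<delta> A + hausdorff_pre d \<delta> B \<le> hausdorff_pre d \<delta> (A \<union> B)"
  unfolding hausdorff_pre_def[of d \<delta> "A \<union> B"]
proof (rule INF_greatest)
  fix U assume U: "U \<in> hausdorff_covers \<delta> (A \<union> B)"
  define P where "P i = (if U i \<inter> A = {} then {} else U i)" for i
  define Q where "Q i = (if U i \<inter> A = {} then U i else {})" for i
  have sep: "U i \<inter> A = {} \<or> U i \<inter> B = {}" for i
  proof (rule ccontr)
    assume "\<not> ?thesis"
    then obtain x y where xy: "x \<in> U i" "x \<in> A" "y \<in> U i" "y \<in> B" by auto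
    then have "dist x y \<le> diameter (U i)"
      using U by (auto simp: hausdorff_covers_def intro: diameter_bounded_bound)
    also have "\<dots> \<le> \<delta>" using U by (auto simp: hausdorff_covers_def)
    finally show False using e[OF xy(2,4)] \<delta> by linarith
  qed
  have d0: "0 \<le> \<delta>"
    using U diameter_ge_0[of "U 0"] by (auto simp: hausdorff_covers_def intro: order_trans)
  have cov: "A \<union> B \<subseteq> (\<Union>i. U i)" and Ud: "\<And>i. bounded (U i)" "\<And>i. diameter (U i) \<le> \<delta>"
    using U by (auto simp: hausdorff_covers_def)
  have "A \<subseteq> (\<Union>i. P i)"
  proof
    fix x assume x: "x \<in> A"
    then obtain i where "x \<in> U i" using cov by blast
    with x have "x \<in> P i" by (auto simp: P_def)
    then show "x \<in> (\<Union>i. P i)" by blast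
  qed
  then have "P \<in> hausdorff_covers \<delta> A"
    using Ud d0 by (simp add: hausdorff_covers_def P_def)
  moreover have "B \<subseteq> (\<Union>i. Q i)"
  proof
    fix x assume x: "x \<in> B"
    then obtain i where i: "x \<in> U i" using cov by blast
    with x sep[of i] have "x \<in> Q i" by (auto simp: Q_def)
    then show "x \<in> (\<Union>i. Q i)" by blast
  qed
  then have "Q \<in> hausdorff_covers \<delta> B"
    using Ud d0 by (simp add: hausdorff_covers_def Q_def)
  ultimately have "hausdorff_pre d \<delta> A + hausdorff_pre d \<delta> B
      \<le> (\<Sum>i. hausdorff_weight d (P i)) + (\<Sum>i. hausdorff_weight d (Q i))"
    unfolding hausdorff_pre_def by (intro add_mono INF_lower)
  also have "\<dots> = (\<Sum>i. hausdorff_weight d (P i) + hausdorff_weight d (Q i))"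
    by (rule suminf_add) auto
  also have "\<dots> = (\<Sum>i. hausdorff_weight d (U i))"
    by (rule arg_cong[where f = suminf]) (auto simp: P_def Q_def hausdorff_weight_def)
  finally show "hausdorff_pre d \<delta> A + hausdorff_pre d \<delta> B \<le> (\<Sum>i. hausdorff_weight d (U i))" .
qed

lemma hausdorff_outer_separated:
  assumes "e > 0" and e: "\<And>x y. x \<in> A \<Longrightarrow> y \<in> B \<Longrightarrow> e \<le> dist x y"
  shows "hausdorff_outer d A + hausdorff_outer d B \<le> hausdorff_outer d (A \<union> B)"
proof -
  have "hausdorff_outer d A + hausdorff_outer d B
      = (SUP \<delta>\<in>{0<..}. hausdorff_pre d \<delta> A + hausdorff_pre d \<delta> B)"
    unfolding hausdorff_outer_def
  proof (rule SUP_add_directed_ennreal[symmetric])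
    fix i j :: real assume "i \<in> {0<..}" "j \<in> {0<..}"
    then show "\<exists>k\<in>{0<..}. hausdorff_pre d i A + hausdorff_pre d j B
        \<le> hausdorff_pre d k A + hausdorff_pre d k B"
      by (intro bexI[of _ "min i j"] add_mono hausdorff_pre_antimono) auto
  qed
  also have "\<dots> \<le> hausdorff_outer d (A \<union> B)"
  proof (rule SUP_least)
    fix \<delta> :: real assume \<delta>: "\<delta> \<in> {0<..}"
    define \<eta> where "\<eta> = min \<delta> (e / 2)"
    have \<eta>: "\<eta> > 0" "\<eta> \<le> \<delta>" "\<eta> < e" using \<delta> assms(1) by (auto simp: \<eta>_def)
    have "hausdorff_pre d \<delta> A + hausdorff_pre d \<delta> B \<le> hausdorff_pre d \<eta> A + hausdorff_pre d \<eta> B"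
      using \<eta> by (intro add_mono hausdorff_pre_antimono)
    also have "\<dots> \<le> hausdorff_pre d \<eta> (A \<union> B)"
      using hausdorff_pre_separated[OF e] \<eta> by blast
    also have "\<dots> \<le> hausdorff_outer d (A \<union> B)"
      unfolding hausdorff_outer_def using \<eta> by (intro SUP_upper) auto
    finally show "hausdorff_pre d \<delta> A + hausdorff_pre d \<delta> B \<le> hausdorff_outer d (A \<union> B)" .
  qed
  finally show ?thesis .
qed

lemma sets_hausdorff_measure [simp, measurable_cong]: "sets (hausdorff_measure d) = sets borel"
  unfolding hausdorff_measure_def
  by (subst sets_measure_of) (auto simp: sets.sigma_sets_eq[of borel, simplified])

lemma space_hausdorff_measure [simp]: "space (hausdorff_measure d) = UNIV"
  by (simp add: hausdorff_measure_def space_measure_of)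

lemma emeasure_hausdorff_measure:
  fixes A :: "'a::metric_space set"
  assumes "A \<in> sets borel"
  shows "emeasure (hausdorff_measure d) A = hausdorff_outer d A"
proof -
  let ?f = "hausdorff_outer d :: 'a set \<Rightarrow> ennreal"
  let ?L = "lambda_system UNIV (Pow UNIV) ?f"
  interpret sigma_algebra UNIV "Pow UNIV :: 'a set set" by (rule sigma_algebra_Pow)
  have ms: "measure_space UNIV ?L ?f"
    by (rule caratheodory_lemma[OF outer_measure_space_hausdorff])
  then have sa: "sigma_algebra UNIV ?L" by (simp add: measure_space_def)
  have "Collect closed \<subseteq> ?L"
    using metric_outer_closed_in_lambda_system[OF outer_measure_space_hausdorff]
      hausdorff_outer_separated by blast
  then have "sigma_sets UNIV (Collect closed) \<subseteq> ?L"
    by (rule sigma_algebra.sigma_sets_subset[OF sa])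
  then have sub: "sets borel \<subseteq> ?L"
    by (simp add: borel_eq_closed)
  have "measure_space UNIV (sets borel) ?f"
    by (rule measure_down[OF ms _ sub]) (metis sets.sigma_algebra_axioms space_borel)
  then have "positive (sets (hausdorff_measure d)) ?f" "countably_additive (sets (hausdorff_measure d)) ?f"
    by (simp_all add: measure_space_def)
  then show ?thesis
    using assms by (intro emeasure_measure_of[OF hausdorff_measure_def]) auto
qed


section \<open>Lorentz and Lorentz-Zygmund norms\<close>

text \<open>Intended for positive exponents only.\<close>

definition epowr :: "ennreal \<Rightarrow> real \<Rightarrow> ennreal" where
  "epowr x a = (if x = \<infinity> then \<infinity> else ennreal (enn2real x powr a))"

definition Lq_norm :: "ennreal \<Rightarrow> 'a measure \<Rightarrow> ('a \<Rightarrow> ennreal) \<Rightarrow> ennreal" where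
  "Lq_norm q M f =
     (if q = \<infinity> then esssup M f
      else epowr (\<integral>\<^sup>+x. epowr (f x) (enn2real q) \<partial>M) (1 / enn2real q))"

abbreviation Linf_norm :: "'a measure \<Rightarrow> ('a \<Rightarrow> 'b::real_normed_vector) \<Rightarrow> ennreal" where
  "Linf_norm M \<phi> \<equiv> Lq_norm \<infinity> M (\<lambda>x. ennreal (norm (\<phi> x)))"

definition rearrangement :: "'a measure \<Rightarrow> ('a \<Rightarrow> 'b::real_normed_vector) \<Rightarrow> real \<Rightarrow> ennreal" where
  "rearrangement M \<phi> s =
     Inf {t. emeasure M {x \<in> space M. ennreal (norm (\<phi> x)) > t} \<le> ennreal s}"

definition lorentz_admissible :: "ennreal \<Rightarrow> ennreal \<Rightarrow> bool" where
  "lorentz_admissible p q \<longleftrightarrow>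
     1 < p \<and> p < \<infinity> \<and> 1 \<le> q \<or> p = 1 \<and> q = 1 \<or> p = \<infinity> \<and> q = \<infinity>"

text \<open>In \<^typ>\<open>ennreal\<close>, \<open>inverse \<infinity> = 0\<close>, so the exponents below follow the convention \<open>1/\<infinity> = 0\<close>.\<close>

definition lorentz_norm ::
    "'a measure \<Rightarrow> ennreal \<Rightarrow> ennreal \<Rightarrow> ('a \<Rightarrow> 'b::real_normed_vector) \<Rightarrow> ennreal" where
  "lorentz_norm M p q \<phi> =
     Lq_norm q (restrict_space lborel {0<..})
       (\<lambda>s. ennreal (s powr (enn2real (inverse p) - enn2real (inverse q))) * rearrangement M \<phi> s)"

definition lorentz_space ::
    "'a measure \<Rightarrow> ennreal \<Rightarrow> ennreal \<Rightarrow> ('a \<Rightarrow> 'b::{real_normed_vector, second_countable_topology}) set" where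
  "lorentz_space M p q = {\<phi> \<in> borel_measurable M. lorentz_norm M p q \<phi> < \<infinity>}"

text \<open>The norm of \<open>L\<^bsup>\<infinity>,q;-1\<^esup>\<close>, for \<open>1 < q < \<infinity>\<close> and measures of finite total mass.\<close>

definition lorentz_zygmund_norm ::
    "'a measure \<Rightarrow> real \<Rightarrow> ('a \<Rightarrow> 'b::real_normed_vector) \<Rightarrow> ennreal" where
  "lorentz_zygmund_norm M q \<phi> =
     (let m = measure M (space M) in
      Lq_norm (ennreal q) (restrict_space lborel {0<..<m})
        (\<lambda>s. ennreal (s powr (- 1 / q) * inverse (ln (1 + m / s))) * rearrangement M \<phi> s))"


section \<open>The symmetric gradient\<close>

definition partial :: "'n \<Rightarrow> (real^'n::finite \<Rightarrow> real) \<Rightarrow> real^'n \<Rightarrow> real" where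
  "partial j \<phi> x = frechet_derivative \<phi> (at x) (axis j 1)"

fun Ck :: "nat \<Rightarrow> (real^'n::finite \<Rightarrow> real) \<Rightarrow> bool" where
  "Ck 0 \<phi> \<longleftrightarrow> continuous_on UNIV \<phi>"
| "Ck (Suc k) \<phi> \<longleftrightarrow> (\<forall>x. \<phi> differentiable (at x)) \<and> (\<forall>j. Ck k (partial j \<phi>))"

text \<open>The space of test functions: smooth with compact support in \<open>\<Omega>\<close>.\<close>

definition test_functions :: "(real^'n::finite) set \<Rightarrow> (real^'n \<Rightarrow> real) set" where
  "test_functions \<Omega> =
     {\<phi>. (\<forall>k. Ck k \<phi>) \<and> compact (closure {x. \<phi> x \<noteq> 0}) \<and> closure {x. \<phi> x \<noteq> 0} \<subseteq> \<Omega>}"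

definition locally_integrable :: "'a::euclidean_space set \<Rightarrow> ('a \<Rightarrow> 'b::euclidean_space) \<Rightarrow> bool" where
  "locally_integrable \<Omega> f \<longleftrightarrow> (\<forall>K. compact K \<and> K \<subseteq> \<Omega> \<longrightarrow> f absolutely_integrable_on K)"

text \<open>The distributional partial derivative \<open>\<partial>\<^sub>j v\<close> on \<open>\<Omega>\<close>, evaluated at a test function \<open>\<phi>\<close>.\<close>

definition distr_partial ::
    "(real^'n::finite) set \<Rightarrow> 'n \<Rightarrow> (real^'n \<Rightarrow> real) \<Rightarrow> (real^'n \<Rightarrow> real) \<Rightarrow> real" where
  "distr_partial \<Omega> j v \<phi> = - (LINT x:\<Omega>|lebesgue. v x * partial j \<phi> x)"

text \<open>
  \<open>E\<close> represents the distribution \<open>(\<nabla>u + (\<nabla>u)\<^sup>T) / 2\<close> on \<open>\<Omega>\<close>.  The norm on \<^typ>\<open>real^'n^'n\<close>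
  used for \<open>E\<close> is the Frobenius norm.
\<close>

definition is_sym_gradient ::
    "(real^'n::finite) set \<Rightarrow> (real^'n \<Rightarrow> real^'n) \<Rightarrow> (real^'n \<Rightarrow> real^'n^'n) \<Rightarrow> bool" where
  "is_sym_gradient \<Omega> u E \<longleftrightarrow>
     locally_integrable \<Omega> E \<and>
     (\<forall>\<phi>\<in>test_functions \<Omega>. \<forall>i j.
        (LINT x:\<Omega>|lebesgue. E x $ i $ j * \<phi> x) =
          (distr_partial \<Omega> j (\<lambda>x. u x $ i) \<phi> + distr_partial \<Omega> i (\<lambda>x. u x $ j) \<phi>) / 2)"

text \<open>An arbitrary representative; it is unique up to null sets in \<open>\<Omega>\<close>, if it exists.\<close>

definition sym_gradient ::
    "(real^'n::finite) set \<Rightarrow> (real^'n \<Rightarrow> real^'n) \<Rightarrow> real^'n \<Rightarrow> real^'n^'n" where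
  "sym_gradient \<Omega> u = (SOME E. is_sym_gradient \<Omega> u E)"

definition E1 :: "(real^'n::finite) set \<Rightarrow> (real^'n \<Rightarrow> real) set \<Rightarrow> (real^'n \<Rightarrow> real^'n) set" where
  "E1 \<Omega> X =
     {u. locally_integrable \<Omega> u \<and> (\<exists>E. is_sym_gradient \<Omega> u E) \<and>
         (\<lambda>x. norm (sym_gradient \<Omega> u x)) \<in> X}"

text \<open>Functions are total in HOL; only the values on \<open>S\<close> matter.\<close>

definition Cb :: "'a::metric_space set \<Rightarrow> ('a \<Rightarrow> 'b::real_normed_vector) set" where
  "Cb S = {u. continuous_on S u \<and> bounded {x \<in> S. u x \<noteq> 0}}"


section \<open>Measures\<close>

definition boundary_measure :: "(real^'n::finite) set \<Rightarrow> (real^'n) measure" where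
  "boundary_measure \<Omega> = restrict_space (hausdorff_measure (CARD('n) - 1)) (frontier \<Omega>)"

definition growth_measure ::
    "(real^'n::finite) set \<Rightarrow> real \<Rightarrow> real \<Rightarrow> (real^'n) measure \<Rightarrow> bool" where
  "growth_measure \<Omega> \<alpha> C \<mu> \<longleftrightarrow>
     sets \<mu> = sets (restrict_space borel \<Omega>) \<and>
     (\<forall>x\<in>\<Omega>. \<forall>r>0. emeasure \<mu> (ball x r \<inter> \<Omega>) \<le> ennreal (C * r powr \<alpha>))"

end

theory Submission
  imports Defs
begin

text \<open>
  For a direction \<open>\<omega>\<close> the derivative of \<open>u \<bullet> \<omega>\<close> along \<open>\<omega>\<close> is the quadratic form of the symmetric gradient
  at \<open>\<omega>\<close>. Following the ray from \<open>x\<close> in direction \<open>\<omega>\<close> until it leaves \<open>\<Omega>\<close> or the support of \<open>u\<close> therefore bounds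
  \<open>\<bar>u x \<bullet> \<omega>\<bar>\<close> by a line integral of the symmetric gradient plus a boundary value of \<open>u\<close>. Averaging over the directions
  \<open>\<omega>\<close> in the unit ball (not the sphere, so that only Fubini and scaling are needed) turns the line integrals into
  a Riesz potential \<open>I\<close> of order one. The rays hitting the part of the boundary where \<open>\<bar>u\<bar> > t\<close> are few unless \<open>I f \<ge> c\<close>
  for a function \<open>f\<close> built from a cover of that part, whose \<open>L\<^sup>1\<close> norm is comparable to its Hausdorff content.
  Hence \<open>\<bar>u\<bar> > 2 (t + l)\<close> forces one of two potentials to be large, and the growth condition on the measure,
  with exponent \<open>\<alpha> > n - 1\<close>, gives the rearrangement inequality
  \<open>u*(s) \<le> 2 g*(a s\<^bsup>(n-1)/\<alpha>\<^esup>) + K \<integral> f*(r) max(c s\<^bsup>n/\<alpha>\<^esup>, r)\<^bsup>1/n-1\<^esup> dr\<close>,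
  where \<open>g\<close> is \<open>u\<close> on the boundary and \<open>f\<close> is the symmetric gradient. The three estimates follow by a power
  substitution in the first term and Schur's test in the second.
\<close>

section \<open>Riesz potentials and measures of ball growth\<close>

text \<open>Levels enter through the choice of rays instead: a ray along which
  \<open>u \<bullet> \<omega>\<close> falls from above \<open>t + l\<close> to at most
  \<open>t\<close> collects at least \<open>l\<close> of the symmetric gradient, and every other ray
  is charged to a cover of the bad part of the boundary. The exponents come from two endpoints of
  the potential. From L^1 it maps into weak L^(\<alpha>/(n-1)) of the measure; a boundary content c
  is such an L^1 norm, so c is comparable to s^((n-1)/\<alpha>). From L^(n,1) it is bounded, and the
  two endpoint bounds for the potential of an indicator balance at volume s^(n/\<alpha>). The
  condition \<alpha> > n - 1 is the convergence at 0 of the integral of \<tau>^(\<alpha>-n). The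
  factor 2 before g* is the loss in |u x| \<le> 2 u x \<bullet> \<omega> on a fixed ball of
  directions. Since \<open>u\<close> is merely continuous and its symmetric gradient is known only
  through test functions, the fundamental theorem of calculus is applied to mollifications; the
  limit survives as a liminf on each ray and as Fatou's lemma over the directions.\<close>

lemma nn_integral_powr_below:
  fixes a c :: real
  assumes "a > -1" "c \<ge> 0"
  shows "(\<integral>\<^sup>+x\<in>{0..c}. ennreal (x powr a) \<partial>lborel) = ennreal (c powr (a + 1) / (a + 1))"
  by (rule nn_integral_has_integral_lebesgue'[OF _ has_integral_powr_from_0[OF assms]]) auto

lemma nn_integral_powr_above:
  fixes a c :: real
  assumes "a < -1" "c > 0"
  shows "(\<integral>\<^sup>+x\<in>{c..}. ennreal (x powr a) \<partial>lborel) = ennreal (c powr (a + 1) / (- (a + 1)))"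
proof -
  have "(\<integral>\<^sup>+x\<in>{c..}. ennreal (x powr a) \<partial>lborel) = ennreal (- (c powr (a + 1)) / (a + 1))"
    by (rule nn_integral_has_integral_lebesgue'[OF _ has_integral_powr_to_inf[OF assms]]) auto
  also have "- (c powr (a + 1)) / (a + 1) = c powr (a + 1) / (- (a + 1))"
    using assms by (simp add: field_simps)
  finally show ?thesis .
qed

text \<open>The integral is split at \<open>m powr (1 / b)\<close>, where
  \<open>\<tau> powr b\<close> reaches \<open>m\<close>. Below it the growth term is used, and
  \<open>b > n - 1\<close> gives convergence at 0; above it the constant \<open>m\<close> is used,
  and \<open>n > 1\<close> gives convergence at infinity. Both pieces are multiples of the same
  power of \<open>m\<close>.\<close>

lemma nn_integral_powr_min_le:
  fixes n b C m :: real
  assumes n: "n > 1" and b: "b > n - 1" and C: "C \<ge> 0" and m: "m > 0"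
  shows "(\<integral>\<^sup>+\<tau>\<in>{0<..}. ennreal (\<tau> powr - n) * min (ennreal (C * \<tau> powr b)) (ennreal m) \<partial>lborel)
    \<le> ennreal ((C / (b - n + 1) + 1 / (n - 1)) * m powr (1 - (n - 1) / b))"
proof -
  define \<rho> where "\<rho> = m powr (1 / b)"
  have b0: "b > 0" using n b by simp
  have \<rho>: "\<rho> > 0" using m by (simp add: \<rho>_def)
  have e1: "\<rho> powr (b - n + 1) = m powr (1 - (n - 1) / b)"
    unfolding \<rho>_def powr_powr using b0 by (simp add: field_simps)
  have e2: "m * \<rho> powr (1 - n) = m powr (1 - (n - 1) / b)"
  proof -
    have "m * \<rho> powr (1 - n) = m powr 1 * m powr ((1 - n) / b)"
      unfolding \<rho>_def powr_powr using m by simp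
    also have "\<dots> = m powr (1 - (n - 1) / b)"
      unfolding powr_add[symmetric] using b0 by (simp add: field_simps)
    finally show ?thesis .
  qed
  have "(\<integral>\<^sup>+\<tau>\<in>{0<..}. ennreal (\<tau> powr - n) * min (ennreal (C * \<tau> powr b)) (ennreal m) \<partial>lborel)
    \<le> (\<integral>\<^sup>+\<tau>. ennreal C * (ennreal (\<tau> powr (b - n)) * indicator {0..\<rho>} \<tau>)
            + ennreal m * (ennreal (\<tau> powr (- n)) * indicator {\<rho>..} \<tau>) \<partial>lborel)"
  proof (rule nn_integral_mono)
    fix \<tau> :: real
    have "\<tau> \<le> 0 \<or> 0 < \<tau> \<and> \<tau> < \<rho> \<or> \<tau> = \<rho> \<or> \<tau> > \<rho>" using \<rho> by linarith
    moreover have "ennreal (\<tau> powr - n) * min (ennreal (C * \<tau> powr b)) (ennreal m)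
        \<le> ennreal C * ennreal (\<tau> powr (b - n))" if "\<tau> > 0"
    proof -
      have "ennreal (\<tau> powr - n) * min (ennreal (C * \<tau> powr b)) (ennreal m) \<le> ennreal (\<tau> powr - n) * ennreal (C * \<tau> powr b)"
        by (intro mult_left_mono) auto
      also have "\<dots> = ennreal C * ennreal (\<tau> powr (b - n))"
        using C that by (simp add: ennreal_mult[symmetric] powr_diff powr_minus divide_inverse mult_ac)
      finally show ?thesis .
    qed
    moreover have "ennreal (\<tau> powr - n) * min (ennreal (C * \<tau> powr b)) (ennreal m)
        \<le> ennreal m * ennreal (\<tau> powr (- n))"
      by (subst mult.commute) (intro mult_right_mono, auto)
    ultimately show "ennreal (\<tau> powr - n) * min (ennreal (C * \<tau> powr b)) (ennreal m) * indicator {0<..} \<tau>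
      \<le> ennreal C * (ennreal (\<tau> powr (b - n)) * indicator {0..\<rho>} \<tau>)
            + ennreal m * (ennreal (\<tau> powr (- n)) * indicator {\<rho>..} \<tau>)"
      using \<rho> by (elim disjE) (simp_all add: indicator_def add_increasing2)
  qed
  also have "\<dots> = ennreal C * ennreal (\<rho> powr (b - n + 1) / (b - n + 1))
      + ennreal m * ennreal (\<rho> powr (- n + 1) / (- (- n + 1)))"
    using n b \<rho> by (simp add: nn_integral_add nn_integral_cmult nn_integral_powr_below nn_integral_powr_above)
  also have "\<dots> = ennreal (C * (\<rho> powr (b - n + 1) / (b - n + 1)) + m * (\<rho> powr (1 - n) / (n - 1)))"
    using C m n b by (simp add: ennreal_mult[symmetric] ennreal_plus[symmetric] del: ennreal_plus)
  also have "C * (\<rho> powr (b - n + 1) / (b - n + 1)) + m * (\<rho> powr (1 - n) / (n - 1))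
     = (C / (b - n + 1) + 1 / (n - 1)) * m powr (1 - (n - 1) / b)"
  proof -
    have "m * (\<rho> powr (1 - n) / (n - 1)) = m powr (1 - (n - 1) / b) / (n - 1)"
      by (metis e2 times_divide_eq_right)
    then show ?thesis unfolding e1 by (simp add: distrib_right)
  qed
  finally show ?thesis .
qed

text \<open>Comparable to \<open>dist x y\<close> to the power \<open>1 - n\<close>; in this form all estimates reduce to measures of balls, and the
  value on the diagonal is infinite. The factor 2 absorbs the support of a mollifier.\<close>

definition riesz_kernel :: "'a::euclidean_space \<Rightarrow> 'a \<Rightarrow> ennreal" where
  "riesz_kernel x y =
     (\<integral>\<^sup>+\<tau>. (if dist x y < 2 * \<tau> then ennreal (\<tau> powr - real DIM('a)) else 0) \<partial>lborel)"

definition riesz :: "('a::euclidean_space \<Rightarrow> ennreal) \<Rightarrow> 'a \<Rightarrow> ennreal" where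
  "riesz g x = (\<integral>\<^sup>+y. riesz_kernel x y * g y \<partial>lborel)"

lemma riesz_kernel_measurable [measurable]:
  "(\<lambda>(x, y). riesz_kernel x (y::'a::euclidean_space)) \<in> borel_measurable (borel \<Otimes>\<^sub>M borel)"
  unfolding riesz_kernel_def by measurable

lemma riesz_measurable [measurable]:
  fixes g :: "'a::euclidean_space \<Rightarrow> ennreal"
  assumes [measurable]: "g \<in> borel_measurable borel"
  shows "riesz g \<in> borel_measurable borel"
proof -
  have "(\<lambda>x. \<integral>\<^sup>+y. riesz_kernel x y * g y \<partial>lborel) \<in> borel_measurable borel"
    by measurable
  then show ?thesis unfolding riesz_def[abs_def] .
qed

lemma riesz_kernel_commute: "riesz_kernel x y = riesz_kernel y x"
  by (simp add: riesz_kernel_def dist_commute)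

text \<open>In contrast to \<open>growth_measure\<close>, the measure lives on the whole space and
  the balls have arbitrary centres: after exchanging integrals the kernel has to be integrated
  around every \<open>y\<close>, not only around points of an open set.\<close>

definition ball_growth :: "'a::metric_space measure \<Rightarrow> real \<Rightarrow> real \<Rightarrow> bool" where
  "ball_growth \<nu> b C \<longleftrightarrow> sets \<nu> = sets borel \<and> (\<forall>y. \<forall>r>0. emeasure \<nu> (ball y r) \<le> ennreal (C * r powr b))"

lemma ball_growthD:
  assumes "ball_growth \<nu> b C"
  shows "sets \<nu> = sets borel" "r > 0 \<Longrightarrow> emeasure \<nu> (ball y r) \<le> ennreal (C * r powr b)"
  using assms by (auto simp: ball_growth_def)

lemma ball_growth_sigma_finite:
  fixes \<nu> :: "'a::euclidean_space measure"
  assumes "ball_growth \<nu> b C"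
  shows "sigma_finite_measure \<nu>"
proof
  note s = ball_growthD(1)[OF assms]
  have "emeasure \<nu> (ball 0 (real (Suc i))) \<noteq> \<infinity>" for i
    using ball_growthD(2)[OF assms, of "real (Suc i)" 0] by (auto simp: top_unique)
  moreover have "(\<Union>i. ball (0::'a) (real (Suc i))) = UNIV"
  proof -
    have "\<exists>i. norm x < real (Suc i)" for x :: 'a
      by (metis less_Suc_eq of_nat_less_iff order_less_trans reals_Archimedean2)
    then show ?thesis by (auto simp: dist_norm)
  qed
  ultimately show "\<exists>A. countable A \<and> A \<subseteq> sets \<nu> \<and> \<Union> A = space \<nu> \<and> (\<forall>a\<in>A. emeasure \<nu> a \<noteq> \<infinity>)"
    using s sets_eq_imp_space_eq[OF s]
    by (intro exI[of _ "range (\<lambda>i. ball 0 (real (Suc i)))"]) (auto simp del: of_nat_Suc)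
qed

text \<open>The constant of \<open>nn_integral_powr_min_le\<close> for the growth constant
  \<open>C * 2 powr b\<close>; the power of 2 stems from the radius \<open>2 * \<tau>\<close> in
  \<open>riesz_kernel\<close>.\<close>

definition riesz_const :: "real \<Rightarrow> real \<Rightarrow> real \<Rightarrow> real" where
  "riesz_const n b C = C * 2 powr b / (b - n + 1) + 1 / (n - 1)"

lemma riesz_const_pos: "n > 1 \<Longrightarrow> b > n - 1 \<Longrightarrow> C \<ge> 0 \<Longrightarrow> riesz_const n b C > 0"
  unfolding riesz_const_def by (rule add_nonneg_pos) simp_all

text \<open>Tonelli turns the left side into the integral of \<open>\<tau> powr - n\<close> times
  the measure of \<open>M \<inter> ball y (2 * \<tau>)\<close>, which is bounded both by ball growth
  and by \<open>m\<close>. The bound does not depend on \<open>y\<close>.\<close>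

lemma riesz_kernel_mass:
  fixes \<nu> :: "'a::euclidean_space measure"
  assumes gr: "ball_growth \<nu> b C" and n: "DIM('a) \<ge> 2" and b: "b > real DIM('a) - 1" and C: "C \<ge> 0"
    and M: "M \<in> sets borel" "emeasure \<nu> M \<le> ennreal m" and m: "m > 0"
  shows "(\<integral>\<^sup>+x\<in>M. riesz_kernel x y \<partial>\<nu>)
     \<le> ennreal (riesz_const (real DIM('a)) b C * m powr (1 - (real DIM('a) - 1) / b))"
proof -
  interpret sigma_finite_measure \<nu> by (rule ball_growth_sigma_finite[OF gr])
  interpret pair_sigma_finite \<nu> "lborel :: real measure" ..
  have [measurable_cong]: "sets \<nu> = sets borel" using gr by (rule ball_growthD)
  have [measurable]: "M \<in> sets borel" by fact
  let ?n = "real DIM('a)"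
  have "(\<integral>\<^sup>+x\<in>M. riesz_kernel x y \<partial>\<nu>)
      = (\<integral>\<^sup>+x. (\<integral>\<^sup>+\<tau>. (if dist x y < 2 * \<tau> then ennreal (\<tau> powr - ?n) else 0) * indicator M x \<partial>lborel) \<partial>\<nu>)"
    unfolding riesz_kernel_def by (simp add: nn_integral_multc)
  also have "\<dots> = (\<integral>\<^sup>+\<tau>. (\<integral>\<^sup>+x. (if dist x y < 2 * \<tau> then ennreal (\<tau> powr - ?n) else 0) * indicator M x \<partial>\<nu>) \<partial>lborel)"
    by (rule Fubini'[symmetric]) simp
  also have "\<dots> \<le> (\<integral>\<^sup>+\<tau>\<in>{0<..}. ennreal (\<tau> powr - ?n) * min (ennreal (C * 2 powr b * \<tau> powr b)) (ennreal m) \<partial>lborel)"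
  proof (rule nn_integral_mono)
    fix \<tau> :: real
    show "(\<integral>\<^sup>+x. (if dist x y < 2 * \<tau> then ennreal (\<tau> powr - ?n) else 0) * indicator M x \<partial>\<nu>)
      \<le> ennreal (\<tau> powr - ?n) * min (ennreal (C * 2 powr b * \<tau> powr b)) (ennreal m) * indicator {0<..} \<tau>"
    proof (cases "\<tau> > 0")
      case False
      then have "\<not> dist x y < 2 * \<tau>" for x using zero_le_dist[of x y] by linarith
      then show ?thesis by simp
    next
      case True
      have "(\<integral>\<^sup>+x. (if dist x y < 2 * \<tau> then ennreal (\<tau> powr - ?n) else 0) * indicator M x \<partial>\<nu>)
        = (\<integral>\<^sup>+x. ennreal (\<tau> powr - ?n) * indicator (M \<inter> ball y (2 * \<tau>)) x \<partial>\<nu>)"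
        by (intro nn_integral_cong) (auto simp: indicator_def dist_commute)
      also have "\<dots> = ennreal (\<tau> powr - ?n) * emeasure \<nu> (M \<inter> ball y (2 * \<tau>))"
        by (rule nn_integral_cmult_indicator) simp
      also have "\<dots> \<le> ennreal (\<tau> powr - ?n) * min (ennreal (C * 2 powr b * \<tau> powr b)) (ennreal m)"
      proof (intro mult_left_mono min.boundedI)
        have "emeasure \<nu> (M \<inter> ball y (2 * \<tau>)) \<le> emeasure \<nu> (ball y (2 * \<tau>))"
          by (rule emeasure_mono) auto
        also have "\<dots> \<le> ennreal (C * (2 * \<tau>) powr b)"
          using ball_growthD(2)[OF gr] True by simp
        finally show "emeasure \<nu> (M \<inter> ball y (2 * \<tau>)) \<le> ennreal (C * 2 powr b * \<tau> powr b)"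
          using True by (simp add: powr_mult mult_ac)
        have "emeasure \<nu> (M \<inter> ball y (2 * \<tau>)) \<le> emeasure \<nu> M"
          by (rule emeasure_mono) auto
        then show "emeasure \<nu> (M \<inter> ball y (2 * \<tau>)) \<le> ennreal m" using M(2) by (rule order_trans)
      qed simp
      finally show ?thesis using True by simp
    qed
  qed
  also have "\<dots> \<le> ennreal ((C * 2 powr b / (b - ?n + 1) + 1 / (?n - 1)) * m powr (1 - (?n - 1) / b))"
    using n b C m by (intro nn_integral_powr_min_le) auto
  finally show ?thesis by (simp add: riesz_const_def)
qed

text \<open>The L^1 endpoint: Tonelli and the bound of \<open>riesz_kernel_mass\<close>, which is
  uniform in \<open>y\<close>.\<close>

lemma riesz_mass:
  fixes \<nu> :: "'a::euclidean_space measure"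
  assumes gr: "ball_growth \<nu> b C" and n: "DIM('a) \<ge> 2" and b: "b > real DIM('a) - 1" and C: "C \<ge> 0"
    and M: "M \<in> sets borel" "emeasure \<nu> M \<le> ennreal m" and m: "m > 0"
    and g [measurable]: "g \<in> borel_measurable borel"
  shows "(\<integral>\<^sup>+x\<in>M. riesz g x \<partial>\<nu>)
     \<le> ennreal (riesz_const (real DIM('a)) b C * m powr (1 - (real DIM('a) - 1) / b)) * (\<integral>\<^sup>+y. g y \<partial>lborel)"
proof -
  interpret sigma_finite_measure \<nu> by (rule ball_growth_sigma_finite[OF gr])
  interpret pair_sigma_finite \<nu> "lborel :: 'a measure" ..
  have [measurable_cong]: "sets \<nu> = sets borel" using gr by (rule ball_growthD)
  have [measurable]: "M \<in> sets borel" by fact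
  have "(\<integral>\<^sup>+x\<in>M. riesz g x \<partial>\<nu>) = (\<integral>\<^sup>+x. (\<integral>\<^sup>+y. riesz_kernel x y * g y * indicator M x \<partial>lborel) \<partial>\<nu>)"
    unfolding riesz_def by (simp add: nn_integral_multc)
  also have "\<dots> = (\<integral>\<^sup>+y. (\<integral>\<^sup>+x. riesz_kernel x y * g y * indicator M x \<partial>\<nu>) \<partial>lborel)"
    by (rule Fubini'[symmetric]) simp
  also have "\<dots> = (\<integral>\<^sup>+y. (\<integral>\<^sup>+x\<in>M. riesz_kernel x y \<partial>\<nu>) * g y \<partial>lborel)"
    by (intro nn_integral_cong, subst nn_integral_multc[symmetric]) (auto simp: mult_ac)
  also have "\<dots> \<le> (\<integral>\<^sup>+y. ennreal (riesz_const (real DIM('a)) b C * m powr (1 - (real DIM('a) - 1) / b)) * g y \<partial>lborel)"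
    by (intro nn_integral_mono mult_right_mono riesz_kernel_mass[OF gr n b C M m]) auto
  also have "\<dots> = ennreal (riesz_const (real DIM('a)) b C * m powr (1 - (real DIM('a) - 1) / b)) * (\<integral>\<^sup>+y. g y \<partial>lborel)"
    by (rule nn_integral_cmult) simp
  finally show ?thesis .
qed

lemma ball_growth_lborel:
  "ball_growth (lborel :: 'a::euclidean_space measure) (real DIM('a)) (unit_ball_vol (real DIM('a)))"
  unfolding ball_growth_def by (auto simp: emeasure_ball powr_realpow)

text \<open>The endpoint L^(n,1) to L^infinity, on indicators. As the kernel is symmetric, the
  potential at \<open>x\<close> is the kernel mass of \<open>B\<close> seen from \<open>x\<close>,
  so \<open>riesz_kernel_mass\<close> applies with Lebesgue measure as the measure and exponent
  n.\<close>

lemma riesz_indicator_le: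
  fixes B :: "'a::euclidean_space set"
  assumes n: "DIM('a) \<ge> 2" and B: "B \<in> sets borel" "emeasure lborel B \<le> ennreal m" and m: "m > 0"
  shows "riesz (indicator B) x
    \<le> ennreal (riesz_const (real DIM('a)) (real DIM('a)) (unit_ball_vol (real DIM('a))) * m powr (1 / real DIM('a)))"
proof -
  have "riesz (indicator B) x = (\<integral>\<^sup>+y\<in>B. riesz_kernel y x \<partial>lborel)"
    unfolding riesz_def by (simp add: riesz_kernel_commute)
  also have "\<dots> \<le> ennreal (riesz_const (real DIM('a)) (real DIM('a)) (unit_ball_vol (real DIM('a)))
      * m powr (1 - (real DIM('a) - 1) / real DIM('a)))"
    by (rule riesz_kernel_mass[OF ball_growth_lborel n _ _ B m]) auto
  also have "1 - (real DIM('a) - 1) / real DIM('a) = 1 / real DIM('a)"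
    by (simp add: field_simps)
  finally show ?thesis .
qed

section \<open>Layer cake decomposition and rearranged potentials\<close>

lemma nn_integral_layer_cake:
  fixes v :: ennreal
  shows "(\<integral>\<^sup>+t. (if 0 < t \<and> ennreal t < v then 1 else 0) \<partial>lborel) = v"
proof (cases v)
  case (real r)
  have "(\<integral>\<^sup>+t. (if 0 < t \<and> ennreal t < v then 1 else 0) \<partial>lborel) = (\<integral>\<^sup>+t. indicator {0<..<r} t \<partial>lborel)"
    using real by (intro nn_integral_cong) (auto simp: indicator_def ennreal_less_iff)
  then show ?thesis using real by simp
next
  case top
  have "(\<integral>\<^sup>+t. (if 0 < t \<and> ennreal t < v then 1 else 0) \<partial>lborel) = (\<integral>\<^sup>+t. indicator {0::real<..} t \<partial>lborel)"
    using top by (intro nn_integral_cong) (auto simp: indicator_def)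
  also have "\<dots> = emeasure lborel {0::real<..}" by simp
  also have "\<dots> = \<infinity>"
  proof (rule ccontr)
    assume "emeasure lborel {0::real<..} \<noteq> \<infinity>"
    then obtain p where p: "emeasure lborel {0::real<..} = ennreal p" "p \<ge> 0"
      by (cases "emeasure lborel {0::real<..}") auto
    have "emeasure lborel {0<..<p + 1} \<le> emeasure lborel {0::real<..}" by (rule emeasure_mono) auto
    then show False using p by simp
  qed
  finally show ?thesis using top by simp
qed

lemma riesz_layer_cake:
  fixes g :: "'a::euclidean_space \<Rightarrow> ennreal"
  assumes [measurable]: "g \<in> borel_measurable borel"
  shows "riesz g x = (\<integral>\<^sup>+t. (if 0 < t then riesz (indicator {y. ennreal t < g y}) x else 0) \<partial>lborel)"
proof -
  have "riesz g x = (\<integral>\<^sup>+y. riesz_kernel x y * (\<integral>\<^sup>+t. (if 0 < t \<and> ennreal t < g y then 1 else 0) \<partial>lborel) \<partial>lborel)"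
    by (simp add: riesz_def nn_integral_layer_cake)
  also have "\<dots> = (\<integral>\<^sup>+y. (\<integral>\<^sup>+t. riesz_kernel x y * (if 0 < t \<and> ennreal t < g y then 1 else 0) \<partial>lborel) \<partial>lborel)"
    by (intro nn_integral_cong nn_integral_cmult[symmetric]) measurable
  also have "\<dots> = (\<integral>\<^sup>+t. (\<integral>\<^sup>+y. riesz_kernel x y * (if 0 < t \<and> ennreal t < g y then 1 else 0) \<partial>lborel) \<partial>lborel)"
    by (rule lborel_pair.Fubini') measurable
  also have "\<dots> = (\<integral>\<^sup>+t. (if 0 < t then riesz (indicator {y. ennreal t < g y}) x else 0) \<partial>lborel)"
    unfolding riesz_def by (intro nn_integral_cong) (auto simp: indicator_def intro!: nn_integral_cong)
  finally show ?thesis .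
qed

text \<open>Split at \<open>r = \<sigma>\<close>, this is \<sigma>^(1/n-1) times the integral of f
  over (0,\<sigma>) plus the integral of f(r) r^(1/n-1) over (\<sigma>,infinity): the Calderon
  operator of the two endpoints L^1 and L^(n,1), a Hardy operator plus a dual one. The maximum keeps
  both in a single kernel.\<close>

definition hardy_op :: "real \<Rightarrow> (real \<Rightarrow> ennreal) \<Rightarrow> real \<Rightarrow> ennreal" where
  "hardy_op n f \<sigma> = (\<integral>\<^sup>+r\<in>{0<..}. f r * ennreal (max \<sigma> r powr (1 / n - 1)) \<partial>lborel)"

lemma hardy_op_antimono:
  assumes "n > 1" "0 < \<sigma>" "\<sigma> \<le> \<tau>"
  shows "hardy_op n f \<tau> \<le> hardy_op n f \<sigma>"
  unfolding hardy_op_def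
proof (intro nn_integral_mono mult_right_mono mult_left_mono ennreal_leI)
  fix r show "max \<tau> r powr (1 / n - 1) \<le> max \<sigma> r powr (1 / n - 1)"
    using assms by (intro powr_mono2') auto
qed auto

text \<open>The kernel is nonincreasing in \<open>r\<close>, so on the interval from 0 to
  \<open>\<beta>\<close> it is at least its value at \<open>\<beta>\<close>. The bound
  \<open>d\<close> is an extended real so that a set of infinite measure can be probed with every
  \<open>\<beta>\<close>.\<close>

lemma hardy_layer_lower:
  fixes n \<sigma> \<beta> :: real
  assumes "n > 1" "\<sigma> > 0" "\<beta> > 0" "ennreal \<beta> \<le> d"
  shows "ennreal (\<beta> * max \<sigma> \<beta> powr (1 / n - 1))
     \<le> (\<integral>\<^sup>+r. (if 0 < r \<and> ennreal r < d then ennreal (max \<sigma> r powr (1 / n - 1)) else 0) \<partial>lborel)"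
proof -
  have "ennreal (\<beta> * max \<sigma> \<beta> powr (1 / n - 1)) = (\<integral>\<^sup>+r. ennreal (max \<sigma> \<beta> powr (1 / n - 1)) * indicator {0<..<\<beta>} r \<partial>lborel)"
    using assms by (subst nn_integral_cmult_indicator) (simp_all add: ennreal_mult[symmetric] mult.commute)
  also have "\<dots> \<le> (\<integral>\<^sup>+r. (if 0 < r \<and> ennreal r < d then ennreal (max \<sigma> r powr (1 / n - 1)) else 0) \<partial>lborel)"
  proof (rule nn_integral_mono)
    fix r :: real
    have "ennreal r < d" if "0 < r" "r < \<beta>"
      using that assms by (metis ennreal_less_iff less_imp_le order_less_le_trans)
    moreover have "max \<sigma> \<beta> powr (1 / n - 1) \<le> max \<sigma> r powr (1 / n - 1)" if "r < \<beta>"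
      using assms that by (intro powr_mono2') auto
    ultimately show "ennreal (max \<sigma> \<beta> powr (1 / n - 1)) * indicator {0<..<\<beta>} r
       \<le> (if 0 < r \<and> ennreal r < d then ennreal (max \<sigma> r powr (1 / n - 1)) else 0)"
      by (auto simp: indicator_def intro!: ennreal_leI)
  qed
  finally show ?thesis .
qed

text \<open>Up to constants, the bounds of \<open>riesz_mass\<close> and
  \<open>riesz_indicator_le\<close> agree when the volume of \<open>B\<close> equals
  \<open>m powr (n / b)\<close>. Each is used on its better side of this threshold, which produces
  the maximum in the kernel, and \<open>hardy_layer_lower\<close> turns the value into an integral
  that can be summed over levels.\<close>

lemma riesz_indicator_mass:
  fixes \<nu> :: "'a::euclidean_space measure"
  assumes gr: "ball_growth \<nu> b C" and n: "DIM('a) \<ge> 2" and b: "b > real DIM('a) - 1" and C: "C \<ge> 0"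
    and M: "M \<in> sets borel" "emeasure \<nu> M = ennreal m" and m: "m > 0"
    and B: "B \<in> sets borel"
    and K: "riesz_const (real DIM('a)) b C \<le> K"
       "riesz_const (real DIM('a)) (real DIM('a)) (unit_ball_vol (real DIM('a))) \<le> K"
  shows "(\<integral>\<^sup>+x\<in>M. riesz (indicator B) x \<partial>\<nu>)
     \<le> ennreal (K * m) * (\<integral>\<^sup>+r. (if 0 < r \<and> ennreal r < emeasure lborel B
            then ennreal (max (m powr (real DIM('a) / b)) r powr (1 / real DIM('a) - 1)) else 0) \<partial>lborel)"
    (is "_ \<le> _ * ?P")
proof -
  let ?n = "real DIM('a)"
  have [measurable_cong]: "sets \<nu> = sets borel" using gr by (rule ball_growthD)
  have [measurable]: "M \<in> sets borel" "B \<in> sets borel" by fact+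
  define \<sigma> where "\<sigma> = m powr (?n / b)"
  have n1: "?n > 1" using n by simp
  have b0: "b > 0" using n1 b by simp
  have \<sigma>: "\<sigma> > 0" using m by (simp add: \<sigma>_def)
  have K0: "K > 0" using riesz_const_pos[OF n1 b C] K by linarith
  note low = hardy_layer_lower[OF n1 \<sigma>, of _ "emeasure lborel B"]
  show ?thesis
  proof (cases "emeasure lborel B = 0")
    case True
    have "(\<integral>\<^sup>+y. riesz_kernel x y * indicator B y \<partial>lborel) = 0" for x
    proof -
      have "AE y in lborel. y \<notin> B" using True B by (auto simp: AE_not_in null_sets_def)
      then show ?thesis by (subst nn_integral_0_iff_AE) (auto simp: indicator_def)
    qed
    then have "riesz (indicator B) x = 0" for x :: 'a by (simp add: riesz_def)
    then show ?thesis by simp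
  next
    case False
    show ?thesis
    proof (cases "emeasure lborel B")
      case (real \<beta>)
      with False have \<beta>: "\<beta> > 0" by (cases "\<beta> = 0") auto
      have l: "ennreal (\<beta> * max \<sigma> \<beta> powr (1 / ?n - 1)) \<le> ?P"
        using low[OF \<beta>] real unfolding \<sigma>_def by simp
      have "(\<integral>\<^sup>+x\<in>M. riesz (indicator B) x \<partial>\<nu>) \<le> ennreal (K * m) * ennreal (\<beta> * max \<sigma> \<beta> powr (1 / ?n - 1))"
      proof (cases "\<beta> \<le> \<sigma>")
        case True
        have ex: "1 + k / b * (1 / k - 1) = 1 - (k - 1) / b" if "k > 1" for k :: real
          using that b0 by (simp add: field_simps)
        have "(\<integral>\<^sup>+x\<in>M. riesz (indicator B) x \<partial>\<nu>)
          \<le> ennreal (riesz_const ?n b C * m powr (1 - (?n - 1) / b)) * (\<integral>\<^sup>+y. indicator B y \<partial>lborel)"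
          using M by (intro riesz_mass[OF gr n b C _ _ m]) auto
        also have "\<dots> = ennreal (riesz_const ?n b C * m powr (1 - (?n - 1) / b)) * ennreal \<beta>"
          using real by simp
        also have "\<dots> = ennreal (riesz_const ?n b C * m powr (1 - (?n - 1) / b) * \<beta>)"
          using \<beta> by (simp add: ennreal_mult''[symmetric])
        also have "\<dots> \<le> ennreal (K * m powr (1 - (?n - 1) / b) * \<beta>)"
          using K \<beta> by (intro ennreal_leI mult_right_mono) auto
        also have "m powr (1 - (?n - 1) / b) = m * \<sigma> powr (1 / ?n - 1)"
        proof -
          have "m * \<sigma> powr (1 / ?n - 1) = m powr 1 * m powr (?n / b * (1 / ?n - 1))"
            using m by (simp add: \<sigma>_def powr_powr)
          also have "\<dots> = m powr (1 - (?n - 1) / b)"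
            unfolding powr_add[symmetric] by (simp only: ex[OF n1])
          finally show ?thesis by simp
        qed
        finally show ?thesis using True K0 m \<beta> \<sigma> by (simp add: ennreal_mult[symmetric] mult_ac max_absorb1)
      next
        case False
        have "(\<integral>\<^sup>+x\<in>M. riesz (indicator B) x \<partial>\<nu>)
          \<le> (\<integral>\<^sup>+x\<in>M. ennreal (riesz_const ?n ?n (unit_ball_vol ?n) * \<beta> powr (1 / ?n)) \<partial>\<nu>)"
          using real \<beta> by (intro nn_integral_mono mult_right_mono riesz_indicator_le n) auto
        also have "\<dots> = ennreal (riesz_const ?n ?n (unit_ball_vol ?n) * \<beta> powr (1 / ?n)) * ennreal m"
          using M by (simp add: nn_integral_cmult_indicator)
        also have "\<dots> \<le> ennreal (K * \<beta> powr (1 / ?n)) * ennreal m"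
          using K by (intro mult_right_mono ennreal_leI) auto
        also have "\<beta> powr (1 / ?n) = \<beta> * \<beta> powr (1 / ?n - 1)"
          using \<beta> by (simp add: powr_diff)
        finally show ?thesis using False K0 m \<beta> \<sigma> by (simp add: ennreal_mult[symmetric] mult_ac max_absorb2)
      qed
      also have "\<dots> \<le> ennreal (K * m) * ?P" by (intro mult_left_mono l) auto
      finally show ?thesis .
    next
      case top
      have "?P = \<infinity>"
      proof (rule ccontr)
        assume "?P \<noteq> \<infinity>"
        then obtain p where p: "?P = ennreal p" "p \<ge> 0" by (cases ?P) auto
        \<comment> \<open>The second entry forces \<open>\<beta> powr (1 / ?n) \<ge> p + 1\<close>;
          the first makes \<open>max \<sigma> \<beta>\<close> equal to \<open>\<beta>\<close>, so
          that the lower bound is exactly this power.\<close>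
        define \<beta> where "\<beta> = max \<sigma> ((p + 1) powr ?n)"
        have \<beta>: "\<beta> > 0" "\<beta> \<ge> \<sigma>" using \<sigma> by (auto simp: \<beta>_def)
        have "ennreal (\<beta> * max \<sigma> \<beta> powr (1 / ?n - 1)) \<le> ennreal p"
          using low[OF \<beta>(1)] top p unfolding \<sigma>_def by simp
        then have "\<beta> * \<beta> powr (1 / ?n - 1) \<le> p" using \<beta> p by (simp add: max_absorb2)
        then have "\<beta> powr (1 / ?n) \<le> p" using \<beta> by (simp add: powr_diff)
        moreover have "p + 1 = ((p + 1) powr ?n) powr (1 / ?n)" using p n1 by (simp add: powr_powr)
        moreover have "\<dots> \<le> \<beta> powr (1 / ?n)" by (intro powr_mono2) (auto simp: \<beta>_def)
        ultimately show False by simp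
      qed
      then show ?thesis using K0 m by (simp add: ennreal_mult_top)
    qed
  qed
qed

text \<open>This replaces the interpolation between \<open>L\<^sup>1\<close> and \<open>L\<^bsup>n,1\<^esup>\<close>: each super-level set of \<open>g\<close> satisfies both endpoint bounds.\<close>

lemma riesz_mass_rearrangement:
  fixes \<nu> :: "'a::euclidean_space measure"
  assumes gr: "ball_growth \<nu> b C" and n: "DIM('a) \<ge> 2" and b: "b > real DIM('a) - 1" and C: "C \<ge> 0"
    and M: "M \<in> sets borel" "emeasure \<nu> M = ennreal m" and m: "m > 0"
    and g [measurable]: "g \<in> borel_measurable borel"
    and K: "riesz_const (real DIM('a)) b C \<le> K"
       "riesz_const (real DIM('a)) (real DIM('a)) (unit_ball_vol (real DIM('a))) \<le> K"
    and fs: "\<And>r t. r > 0 \<Longrightarrow> t > 0 \<Longrightarrow> fs r < ennreal t \<Longrightarrow> emeasure lborel {y. ennreal t < g y} \<le> ennreal r"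
  shows "(\<integral>\<^sup>+x\<in>M. riesz g x \<partial>\<nu>) \<le> ennreal (K * m) * hardy_op (real DIM('a)) fs (m powr (real DIM('a) / b))"
proof -
  interpret sigma_finite_measure \<nu> by (rule ball_growth_sigma_finite[OF gr])
  interpret pair_sigma_finite \<nu> "lborel :: real measure" ..
  have [measurable_cong]: "sets \<nu> = sets borel" using gr by (rule ball_growthD)
  have [measurable]: "M \<in> sets borel" by fact
  let ?n = "real DIM('a)" let ?k = "\<lambda>r. ennreal (max (m powr (?n / b)) r powr (1 / ?n - 1))"
  let ?d = "\<lambda>t. emeasure lborel {y. ennreal t < g y}"
  have d [measurable]: "?d \<in> borel_measurable borel"
  proof -
    have "?d = (\<lambda>t. \<integral>\<^sup>+y. (if ennreal t < g y then 1 else 0) \<partial>lborel)"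
    proof
      fix t
      have "?d t = (\<integral>\<^sup>+y. indicator {y. ennreal t < g y} y \<partial>lborel)" by simp
      also have "\<dots> = (\<integral>\<^sup>+y. (if ennreal t < g y then 1 else 0) \<partial>lborel)"
        by (intro nn_integral_cong) (auto simp: indicator_def)
      finally show "?d t = \<dots>" .
    qed
    then show ?thesis by simp
  qed
  have [measurable]: "(\<lambda>(x, t). riesz (indicator {y. ennreal t < g y}) x) \<in> borel_measurable (borel \<Otimes>\<^sub>M borel)"
  proof -
    have "(\<lambda>(x, t). \<integral>\<^sup>+y. riesz_kernel x y * (if ennreal t < g y then 1 else 0) \<partial>lborel)
        \<in> borel_measurable (borel \<Otimes>\<^sub>M borel)" by measurable
    moreover have "riesz (indicator {y. ennreal t < g y}) x = (\<integral>\<^sup>+y. riesz_kernel x y * (if ennreal t < g y then 1 else 0) \<partial>lborel)" for x t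
      unfolding riesz_def by (intro nn_integral_cong) (auto simp: indicator_def)
    ultimately show ?thesis by simp
  qed
  have "(\<integral>\<^sup>+x\<in>M. riesz g x \<partial>\<nu>)
    = (\<integral>\<^sup>+x. (\<integral>\<^sup>+t. (if 0 < t then riesz (indicator {y. ennreal t < g y}) x else 0) * indicator M x \<partial>lborel) \<partial>\<nu>)"
    unfolding riesz_layer_cake[OF g] by (simp add: nn_integral_multc)
  also have "\<dots> = (\<integral>\<^sup>+t. (\<integral>\<^sup>+x. (if 0 < t then riesz (indicator {y. ennreal t < g y}) x else 0) * indicator M x \<partial>\<nu>) \<partial>lborel)"
    by (rule Fubini'[symmetric]) measurable
  also have "\<dots> \<le> (\<integral>\<^sup>+t. ennreal (K * m) * (if 0 < t then (\<integral>\<^sup>+r. (if 0 < r \<and> ennreal r < ?d t then ?k r else 0) \<partial>lborel) else 0) \<partial>lborel)"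
  proof (rule nn_integral_mono)
    fix t :: real
    show "(\<integral>\<^sup>+x. (if 0 < t then riesz (indicator {y. ennreal t < g y}) x else 0) * indicator M x \<partial>\<nu>)
      \<le> ennreal (K * m) * (if 0 < t then (\<integral>\<^sup>+r. (if 0 < r \<and> ennreal r < ?d t then ?k r else 0) \<partial>lborel) else 0)"
      using riesz_indicator_mass[OF gr n b C M m _ K, of "{y. ennreal t < g y}"] by (cases "0 < t") auto
  qed
  also have "\<dots> = ennreal (K * m) * (\<integral>\<^sup>+t. (if 0 < t then (\<integral>\<^sup>+r. (if 0 < r \<and> ennreal r < ?d t then ?k r else 0) \<partial>lborel) else 0) \<partial>lborel)"
    by (rule nn_integral_cmult) measurable
  also have "(\<integral>\<^sup>+t. (if 0 < t then (\<integral>\<^sup>+r. (if 0 < r \<and> ennreal r < ?d t then ?k r else 0) \<partial>lborel) else 0) \<partial>lborel)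
    = (\<integral>\<^sup>+t. (\<integral>\<^sup>+r. (if 0 < t \<and> 0 < r \<and> ennreal r < ?d t then ?k r else 0) \<partial>lborel) \<partial>lborel)"
    by (intro nn_integral_cong) auto
  also have "\<dots> = (\<integral>\<^sup>+r. (\<integral>\<^sup>+t. (if 0 < t \<and> 0 < r \<and> ennreal r < ?d t then ?k r else 0) \<partial>lborel) \<partial>lborel)"
    by (rule lborel_pair.Fubini') measurable
  \<comment> \<open>For fixed \<open>r\<close> every level \<open>t\<close> whose super-level set
    has measure above \<open>r\<close> is at most \<open>fs r\<close>. Integrating over
    \<open>t\<close> first therefore converts the distribution function back into
    \<open>fs\<close>.\<close>
  also have "\<dots> \<le> hardy_op ?n fs (m powr (?n / b))"
    unfolding hardy_op_def
  proof (rule nn_integral_mono)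
    fix r :: real
    show "(\<integral>\<^sup>+t. (if 0 < t \<and> 0 < r \<and> ennreal r < ?d t then ?k r else 0) \<partial>lborel) \<le> fs r * ?k r * indicator {0<..} r"
    proof (cases "r > 0")
      case True
      show ?thesis
      proof (cases "fs r")
        case (real \<phi>)
        have "(\<integral>\<^sup>+t. (if 0 < t \<and> 0 < r \<and> ennreal r < ?d t then ?k r else 0) \<partial>lborel)
          \<le> (\<integral>\<^sup>+t. ?k r * indicator {0..\<phi>} t \<partial>lborel)"
        proof (rule nn_integral_mono)
          fix t :: real
          have "t \<le> \<phi>" if "0 < t" "ennreal r < ?d t"
          proof (rule ccontr)
            assume "\<not> t \<le> \<phi>"
            then have "fs r < ennreal t" using real by (simp add: ennreal_less_iff)
            from fs[OF True that(1) this] that(2) show False by simp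
          qed
          then show "(if 0 < t \<and> 0 < r \<and> ennreal r < ?d t then ?k r else 0) \<le> ?k r * indicator {0..\<phi>} t"
            by (auto simp: indicator_def)
        qed
        also have "\<dots> = ?k r * ennreal \<phi>" using real by (simp add: nn_integral_cmult_indicator)
        finally show ?thesis using real True by (simp add: mult.commute)
      next
        case top
        \<comment> \<open>In \<open>ennreal\<close> the product of 0 and infinity is 0, so the
          kernel must be seen to be nonzero before the right side can be called infinite.\<close>
        have "max (m powr (?n / b)) r \<noteq> 0" using True by linarith
        then have "?k r \<noteq> 0" by simp
        then show ?thesis using True top by (simp add: ennreal_top_mult)
      qed
    qed simp
  qed
  finally show ?thesis by (simp add: mult_left_mono)
qed

text \<open>The Chebyshev arguments below cancel the measure of a level set, which is only known to
  be finite inside a ball. Monotone exhaustion removes the ball afterwards.\<close>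

lemma emeasure_le_by_balls:
  fixes M :: "'a::euclidean_space set"
  assumes s: "sets \<nu> = sets borel" and M: "M \<in> sets borel"
    and le: "\<And>R. R > 0 \<Longrightarrow> emeasure \<nu> (M \<inter> ball 0 R) \<le> c"
  shows "emeasure \<nu> M \<le> c"
proof -
  have "(\<Union>i. M \<inter> ball 0 (real (Suc i))) = M"
  proof -
    have "\<exists>i. norm x < real (Suc i)" for x :: 'a
      by (metis less_Suc_eq of_nat_less_iff order_less_trans reals_Archimedean2)
    then show ?thesis by (auto simp: dist_norm)
  qed
  moreover have "incseq (\<lambda>i. M \<inter> ball 0 (real (Suc i)))" by (auto simp: incseq_def)
  moreover have "range (\<lambda>i. M \<inter> ball 0 (real (Suc i))) \<subseteq> sets \<nu>" unfolding s using M by (intro image_subsetI sets.Int) simp_all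
  ultimately have "emeasure \<nu> M = (SUP i. emeasure \<nu> (M \<inter> ball 0 (real (Suc i))))"
    using SUP_emeasure_incseq[of "\<lambda>i. M \<inter> ball 0 (real (Suc i))" \<nu>] by simp
  also have "\<dots> \<le> c" by (intro SUP_least le) simp
  finally show ?thesis .
qed

lemma ball_growth_bounded_finite:
  assumes gr: "ball_growth \<nu> b C" and "R > 0"
  obtains m where "emeasure \<nu> (M \<inter> ball y R) = ennreal m" "m \<ge> 0"
proof -
  have "emeasure \<nu> (M \<inter> ball y R) \<le> emeasure \<nu> (ball y R)"
    using ball_growthD(1)[OF gr] by (intro emeasure_mono) auto
  also have "\<dots> \<le> ennreal (C * R powr b)" using assms by (intro ball_growthD(2))
  finally show ?thesis using that by (cases "emeasure \<nu> (M \<inter> ball y R)") (auto simp: top_unique)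
qed

text \<open>Chebyshev by contradiction: if the level set inside a ball had measure
  \<open>m > s\<close>, then \<open>m * lam\<close> would be at most \<open>K * m\<close> times
  \<open>hardy_op\<close> at \<open>m powr (n / b)\<close>, hence at most the same with
  \<open>s\<close> because \<open>hardy_op\<close> is antitone, and this is less than
  \<open>m * lam\<close>.\<close>

lemma riesz_weak_rearrangement:
  fixes \<nu> :: "'a::euclidean_space measure"
  assumes gr: "ball_growth \<nu> b C" and n: "DIM('a) \<ge> 2" and b: "b > real DIM('a) - 1" and C: "C \<ge> 0"
    and g [measurable]: "g \<in> borel_measurable borel"
    and K: "riesz_const (real DIM('a)) b C \<le> K"
       "riesz_const (real DIM('a)) (real DIM('a)) (unit_ball_vol (real DIM('a))) \<le> K"
    and fs: "\<And>r t. r > 0 \<Longrightarrow> t > 0 \<Longrightarrow> fs r < ennreal t \<Longrightarrow> emeasure lborel {y. ennreal t < g y} \<le> ennreal r"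
    and s: "s > 0" and lam: "ennreal K * hardy_op (real DIM('a)) fs (s powr (real DIM('a) / b)) < lam"
  shows "emeasure \<nu> {x. lam \<le> riesz g x} \<le> ennreal s"
proof (rule emeasure_le_by_balls)
  let ?M = "{x. lam \<le> riesz g x}" let ?n = "real DIM('a)"
  show [measurable_cong]: "sets \<nu> = sets borel" using gr by (rule ball_growthD)
  show M [measurable]: "?M \<in> sets borel" by measurable
  fix R :: real assume R: "R > 0"
  obtain m where m: "emeasure \<nu> (?M \<inter> ball 0 R) = ennreal m" "m \<ge> 0"
    using ball_growth_bounded_finite[OF gr R] by blast
  have n1: "?n > 1" using n by simp
  have b0: "b > 0" using n1 b by simp
  have K0: "K > 0" using riesz_const_pos[OF n1 b C] K by linarith
  show "emeasure \<nu> (?M \<inter> ball 0 R) \<le> ennreal s"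
  proof (rule ccontr)
    assume "\<not> ?thesis"
    then have ms: "m > s" using m s by (simp add: not_le ennreal_less_iff)
    have "ennreal m * lam = (\<integral>\<^sup>+x\<in>?M \<inter> ball 0 R. lam \<partial>\<nu>)"
      using m by (simp add: nn_integral_cmult_indicator mult.commute)
    also have "\<dots> \<le> (\<integral>\<^sup>+x\<in>?M \<inter> ball 0 R. riesz g x \<partial>\<nu>)"
      by (intro nn_integral_mono) (auto simp: indicator_def)
    also have "\<dots> \<le> ennreal (K * m) * hardy_op ?n fs (m powr (?n / b))"
      using m ms s by (intro riesz_mass_rearrangement[OF gr n b C _ _ _ g K fs]) auto
    also have "\<dots> \<le> ennreal (K * m) * hardy_op ?n fs (s powr (?n / b))"
      using ms s n1 b0 by (intro mult_left_mono hardy_op_antimono powr_mono2) auto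
    also have "\<dots> = ennreal m * (ennreal K * hardy_op ?n fs (s powr (?n / b)))"
      using K0 m by (simp add: ennreal_mult mult_ac)
    also have "\<dots> < ennreal m * lam"
      using lam ms s by (intro ennreal_mult_strict_left_mono) auto
    finally show False by simp
  qed
qed

text \<open>Chebyshev combined with \<open>riesz_mass\<close>: the measure \<open>m\<close> of the
  level set appears on the right with an exponent below 1, and the inequality is solved for
  \<open>m\<close>.\<close>

lemma riesz_weak_L1:
  fixes \<nu> :: "'a::euclidean_space measure"
  assumes gr: "ball_growth \<nu> b C" and n: "DIM('a) \<ge> 2" and b: "b > real DIM('a) - 1" and C: "C \<ge> 0"
    and g [measurable]: "g \<in> borel_measurable borel"
    and F: "(\<integral>\<^sup>+y. g y \<partial>lborel) \<le> ennreal F" "F \<ge> 0" and c: "c > 0"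
  shows "emeasure \<nu> {x. ennreal c \<le> riesz g x}
    \<le> ennreal ((riesz_const (real DIM('a)) b C * F / c) powr (b / (real DIM('a) - 1)))"
proof (rule emeasure_le_by_balls)
  let ?M = "{x. ennreal c \<le> riesz g x}" let ?n = "real DIM('a)"
  show [measurable_cong]: "sets \<nu> = sets borel" using gr by (rule ball_growthD)
  show M [measurable]: "?M \<in> sets borel" by measurable
  fix R :: real assume R: "R > 0"
  obtain m where m: "emeasure \<nu> (?M \<inter> ball 0 R) = ennreal m" "m \<ge> 0"
    using ball_growth_bounded_finite[OF gr R] by blast
  have n1: "?n > 1" using n by simp
  have b0: "b > 0" using n1 b by simp
  define K where "K = riesz_const ?n b C"
  have K0: "K > 0" using riesz_const_pos[OF n1 b C] by (simp add: K_def)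
  show "emeasure \<nu> (?M \<inter> ball 0 R) \<le> ennreal ((riesz_const ?n b C * F / c) powr (b / (?n - 1)))"
  proof (cases "m = 0")
    case False
    with m have m0: "m > 0" by simp
    have "ennreal (c * m) = (\<integral>\<^sup>+x\<in>?M \<inter> ball 0 R. ennreal c \<partial>\<nu>)"
      using m c by (simp add: nn_integral_cmult_indicator ennreal_mult)
    also have "\<dots> \<le> (\<integral>\<^sup>+x\<in>?M \<inter> ball 0 R. riesz g x \<partial>\<nu>)"
      by (intro nn_integral_mono) (auto simp: indicator_def)
    also have "\<dots> \<le> ennreal (riesz_const ?n b C * m powr (1 - (?n - 1) / b)) * (\<integral>\<^sup>+y. g y \<partial>lborel)"
      using m m0 by (intro riesz_mass[OF gr n b C _ _ _ g]) auto
    also have "\<dots> \<le> ennreal (riesz_const ?n b C * m powr (1 - (?n - 1) / b)) * ennreal F"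
      by (intro mult_left_mono F) auto
    also have "\<dots> = ennreal (K * m powr (1 - (?n - 1) / b) * F)"
      using K0 F by (simp add: ennreal_mult K_def)
    finally have "c * m \<le> K * m powr (1 - (?n - 1) / b) * F"
      using K0 F by (subst (asm) ennreal_le_iff) auto
    also have "m powr (1 - (?n - 1) / b) = m / m powr ((?n - 1) / b)"
      using m0 by (simp add: powr_diff)
    finally have "m powr ((?n - 1) / b) \<le> K * F / c"
      using m0 c by (simp add: field_simps)
    then have "(m powr ((?n - 1) / b)) powr (b / (?n - 1)) \<le> (K * F / c) powr (b / (?n - 1))"
      using n1 b0 by (intro powr_mono2) auto
    then have "m \<le> (K * F / c) powr (b / (?n - 1))"
      using n1 b0 m0 by (simp add: powr_powr)
    then show ?thesis using m by (simp add: K_def ennreal_leI)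
  qed (use m in simp)
qed

section \<open>Mollifiers\<close>

text \<open>The classical flat function exp(-1/x) with an extra power of 1/x. The power makes the
  family closed under differentiation up to linear combinations, which is what an induction over the
  order of smoothness needs.\<close>

definition flat_exp :: "nat \<Rightarrow> real \<Rightarrow> real" where
  "flat_exp m x = (if x > 0 then inverse x ^ m * exp (- inverse x) else 0)"

lemma flat_exp_tendsto_0: "((flat_exp m) \<longlongrightarrow> 0) (at 0)"
proof (rule filterlim_split_at)
  have "eventually (\<lambda>x. flat_exp m x = 0) (at_left 0)"
    by (auto simp: eventually_at_filter flat_exp_def intro!: always_eventually)
  then show "(flat_exp m \<longlongrightarrow> 0) (at_left 0)"
    by (rule tendsto_eventually)
  have "((\<lambda>x. x ^ m / exp x) \<longlongrightarrow> (0::real)) at_top"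
    by (rule tendsto_power_div_exp_0)
  moreover have "eventually (\<lambda>x. x ^ m / exp x = flat_exp m (inverse x)) at_top"
    using eventually_gt_at_top[of "0::real"]
    by eventually_elim (simp add: flat_exp_def exp_minus field_simps)
  ultimately have "((\<lambda>x. flat_exp m (inverse x)) \<longlongrightarrow> 0) at_top"
    by (rule Lim_transform_eventually)
  then show "(flat_exp m \<longlongrightarrow> 0) (at_right 0)"
    by (simp add: filterlim_at_right_to_top)
qed

lemma flat_exp_has_derivative:
  "(flat_exp m has_real_derivative flat_exp (m + 2) x - real m * flat_exp (m + 1) x) (at x)"
proof -
  consider "x < 0" | "x = 0" | "x > 0" by linarith
  then show ?thesis
  proof cases
    case 1
    have "((\<lambda>_. 0) has_real_derivative flat_exp (m + 2) x - real m * flat_exp (m + 1) x) (at x)"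
      using 1 by (simp add: flat_exp_def)
    then show ?thesis
      by (rule has_field_derivative_transform_within_open[of _ _ _ "{..<0}"]) (use 1 in \<open>auto simp: flat_exp_def\<close>)
  next
    case 3
    have "((\<lambda>x. inverse x ^ m * exp (- inverse x)) has_real_derivative
        real m * inverse x ^ (m - 1) * (- (inverse x ^ 2)) * exp (- inverse x)
         + inverse x ^ m * (exp (- inverse x) * inverse x ^ 2)) (at x)"
      using 3 by (auto intro!: derivative_eq_intros simp: power2_eq_square)
    moreover have "real m * inverse x ^ (m - 1) * (- (inverse x ^ 2)) * exp (- inverse x)
         + inverse x ^ m * (exp (- inverse x) * inverse x ^ 2) = flat_exp (m + 2) x - real m * flat_exp (m + 1) x"
      using 3 by (cases m) (simp_all add: flat_exp_def power2_eq_square algebra_simps)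
    ultimately have "((\<lambda>x. inverse x ^ m * exp (- inverse x)) has_real_derivative
        flat_exp (m + 2) x - real m * flat_exp (m + 1) x) (at x)" by simp
    then show ?thesis
      by (rule has_field_derivative_transform_within_open[of _ _ _ "{0<..}"]) (use 3 in \<open>auto simp: flat_exp_def\<close>)
  next
    case 2
    \<comment> \<open>At 0 the difference quotient is again a member of the family, namely
      \<open>flat_exp (Suc m)\<close>, whose limit is already known.\<close>
    have "((\<lambda>h. (flat_exp m (0 + h) - flat_exp m 0) / h) \<longlongrightarrow> 0) (at 0)"
    proof (rule Lim_transform_eventually[OF flat_exp_tendsto_0[of "Suc m"]])
      show "\<forall>\<^sub>F h in at 0. flat_exp (Suc m) h = (flat_exp m (0 + h) - flat_exp m 0) / h"
        by (auto simp: flat_exp_def eventually_at_filter divide_inverse intro!: always_eventually)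
    qed
    then show ?thesis using 2 by (simp add: DERIV_def flat_exp_def)
  qed
qed

section \<open>Calculus of the classes \<open>Ck\<close>\<close>

lemma partial_eq: "(\<phi> has_derivative D) (at x) \<Longrightarrow> partial j \<phi> x = D (axis j 1)"
  by (simp add: partial_def frechet_derivative_at[symmetric])

lemma differentiable_has_derivative_partial:
  fixes \<phi> :: "real^'n::finite \<Rightarrow> real"
  assumes "\<phi> differentiable (at x)"
  shows "(\<phi> has_derivative (\<lambda>h. \<Sum>j\<in>UNIV. h $ j * partial j \<phi> x)) (at x)"
proof -
  obtain D where D: "(\<phi> has_derivative D) (at x)" using assms by (auto simp: differentiable_def)
  interpret bounded_linear D using D by (rule has_derivative_bounded_linear)
  have "D h = (\<Sum>j\<in>UNIV. h $ j * partial j \<phi> x)" for h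
  proof -
    have "D h = D (\<Sum>j\<in>UNIV. h $ j *\<^sub>R axis j 1)"
      using basis_expansion[of h] by (simp add: scalar_mult_eq_scaleR)
    also have "\<dots> = (\<Sum>j\<in>UNIV. h $ j * D (axis j 1))"
      by (simp add: sum scale)
    finally show ?thesis by (simp add: partial_eq[OF D])
  qed
  then have "D = (\<lambda>h. \<Sum>j\<in>UNIV. h $ j * partial j \<phi> x)" by (rule ext)
  with D show ?thesis by simp
qed

lemma Ck_SucD: "Ck (Suc k) \<phi> \<Longrightarrow> Ck k \<phi>"
proof (induction k arbitrary: \<phi>)
  case 0
  then show ?case
    by (auto simp: continuous_at_imp_continuous_on differentiable_imp_continuous_within)
next
  case (Suc k)
  then show ?case by (metis Ck.simps(2))
qed

lemma Ck_const: "Ck k (\<lambda>_::real^'n::finite. c)"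
proof (induction k arbitrary: c)
  case (Suc k)
  have "partial j (\<lambda>_::real^'n. c) = (\<lambda>_. 0)" for j by (rule ext) (simp add: partial_eq[OF has_derivative_const])
  with Suc show ?case by simp
qed simp

lemma Ck_add: "Ck k \<phi> \<Longrightarrow> Ck k \<psi> \<Longrightarrow> Ck k (\<lambda>x. \<phi> x + \<psi> x)"
proof (induction k arbitrary: \<phi> \<psi>)
  case 0
  then show ?case by (auto intro: continuous_intros)
next
  case (Suc k)
  then have d: "\<phi> differentiable (at x)" "\<psi> differentiable (at x)" for x by auto
  have "partial j (\<lambda>x. \<phi> x + \<psi> x) = (\<lambda>x. partial j \<phi> x + partial j \<psi> x)" for j
  proof
    fix x
    obtain D E where "(\<phi> has_derivative D) (at x)" "(\<psi> has_derivative E) (at x)"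
      using d unfolding differentiable_def by blast
    then show "partial j (\<lambda>x. \<phi> x + \<psi> x) x = partial j \<phi> x + partial j \<psi> x"
      using partial_eq[OF has_derivative_add] by (simp add: partial_eq)
  qed
  with Suc d show ?case by (auto intro: differentiable_add)
qed

lemma Ck_mult: "Ck k \<phi> \<Longrightarrow> Ck k \<psi> \<Longrightarrow> Ck k (\<lambda>x. \<phi> x * \<psi> x)"
proof (induction k arbitrary: \<phi> \<psi>)
  case 0
  then show ?case by (auto intro: continuous_intros)
next
  case (Suc k)
  then have d: "\<phi> differentiable (at x)" "\<psi> differentiable (at x)" for x by auto
  have "partial j (\<lambda>x. \<phi> x * \<psi> x) = (\<lambda>x. \<phi> x * partial j \<psi> x + partial j \<phi> x * \<psi> x)" for j
  proof
    fix x
    obtain D E where "(\<phi> has_derivative D) (at x)" "(\<psi> has_derivative E) (at x)"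
      using d unfolding differentiable_def by blast
    then show "partial j (\<lambda>x. \<phi> x * \<psi> x) x = \<phi> x * partial j \<psi> x + partial j \<phi> x * \<psi> x"
      using partial_eq[OF has_derivative_mult] by (simp add: partial_eq)
  qed
  with Suc d Ck_SucD[OF Suc.prems(1)] Ck_SucD[OF Suc.prems(2)] show ?case
    by (auto intro!: differentiable_mult Ck_add)
qed

lemma Ck_prod: "finite I \<Longrightarrow> (\<And>i. i \<in> I \<Longrightarrow> Ck k (f i)) \<Longrightarrow> Ck k (\<lambda>x. \<Prod>i\<in>I. f i x)"
  by (induction I rule: finite_induct) (simp_all add: Ck_const Ck_mult)

text \<open>Induction over \<open>k\<close> with \<open>m\<close> arbitrary: a partial derivative is
  a combination of the same functions with \<open>m + 1\<close> and \<open>m + 2\<close>. The signs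
  \<open>c = 1\<close> and \<open>c = - 1\<close> give the two opposite faces of a cube.\<close>

lemma Ck_flat_exp: "Ck k (\<lambda>y::real^'n::finite. flat_exp m (a + c * y $ i))"
proof (induction k arbitrary: m)
  case 0
  have "isCont (flat_exp m) x" for x using flat_exp_has_derivative DERIV_isCont by blast
  then have c: "continuous_on UNIV (flat_exp m)" by (simp add: continuous_at_imp_continuous_on)
  have "continuous_on UNIV (\<lambda>y::real^'n. flat_exp m (a + c * y $ i))"
    by (rule continuous_on_compose2[OF c]) (auto intro!: continuous_intros)
  then show ?case by simp
next
  case (Suc k)
  have d: "((\<lambda>y::real^'n. flat_exp m (a + c * y $ i)) has_derivative
     (\<lambda>h. (c * h $ i) * (flat_exp (m + 2) (a + c * x $ i) - real m * flat_exp (m + 1) (a + c * x $ i)))) (at x)" for x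
  proof -
    have l: "((\<lambda>y::real^'n. a + c * y $ i) has_derivative (\<lambda>h. c * h $ i)) (at x)"
      by (auto intro!: derivative_eq_intros bounded_linear_vec_nth bounded_linear_imp_has_derivative)
    have "((\<lambda>y::real^'n. flat_exp m (a + c * y $ i)) has_derivative
       (\<lambda>h. (flat_exp (m + 2) (a + c * x $ i) - real m * flat_exp (m + 1) (a + c * x $ i)) * (c * h $ i))) (at x)"
      using has_derivative_compose[OF l flat_exp_has_derivative[unfolded has_field_derivative_def]] .
    then show ?thesis by (simp add: mult.commute)
  qed
  have p: "partial j (\<lambda>y::real^'n. flat_exp m (a + c * y $ i))
     = (\<lambda>y. (if i = j then c else 0) * (flat_exp (m + 2) (a + c * y $ i) + (- real m) * flat_exp (m + 1) (a + c * y $ i)))" for j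
    by (rule ext) (auto simp: partial_eq[OF d] axis_def)
  have "Ck k (partial j (\<lambda>y::real^'n. flat_exp m (a + c * y $ i)))" for j
    unfolding p by (intro Ck_mult Ck_add Ck_const Suc.IH)
  moreover have "(\<lambda>y::real^'n. flat_exp m (a + c * y $ i)) differentiable (at x)" for x
    using d unfolding differentiable_def by blast
  ultimately show ?case by simp
qed

lemma has_derivative_reflect:
  fixes \<phi> :: "real^'n::finite \<Rightarrow> real"
  assumes "\<phi> differentiable (at (z - y))"
  shows "((\<lambda>y. \<phi> (z - y)) has_derivative (\<lambda>h. \<Sum>j\<in>UNIV. (- h) $ j * partial j \<phi> (z - y))) (at y)"
proof -
  have l: "((\<lambda>y. z - y) has_derivative (\<lambda>h. - h)) (at y)" by (auto intro!: derivative_eq_intros)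
  show ?thesis using has_derivative_compose[OF l differentiable_has_derivative_partial[OF assms]] .
qed

lemma partial_reflect:
  assumes "\<phi> differentiable (at (z - y))"
  shows "partial i (\<lambda>y. \<phi> (z - y)) y = - partial i \<phi> (z - y)"
proof -
  have "partial i (\<lambda>y. \<phi> (z - y)) y = (\<Sum>j\<in>UNIV. (if j = i then - partial j \<phi> (z - y) else 0))"
    unfolding partial_eq[OF has_derivative_reflect[OF assms]] by (intro sum.cong) (auto simp: axis_def)
  then show ?thesis by simp
qed

lemma Ck_reflect: "Ck k \<phi> \<Longrightarrow> Ck k (\<lambda>y. \<phi> (z - y))"
proof (induction k arbitrary: \<phi>)
  case 0
  then show ?case by (auto intro!: continuous_on_compose2[of UNIV \<phi>] continuous_intros)
next
  case (Suc k)
  then have d: "\<phi> differentiable (at x)" for x by simp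
  have p: "partial i (\<lambda>y. \<phi> (z - y)) = (\<lambda>y. (- 1) * partial i \<phi> (z - y))" for i
    by (rule ext) (simp add: partial_reflect[OF d])
  have "Ck k (partial i (\<lambda>y. \<phi> (z - y)))" for i
    unfolding p using Suc.prems by (intro Ck_mult Ck_const Suc.IH) simp
  moreover have "(\<lambda>y. \<phi> (z - y)) differentiable (at y)" for y
    using has_derivative_reflect[OF d] unfolding differentiable_def by blast
  ultimately show ?case by simp
qed

text \<open>The bump is a product of one-variable bumps rather than a function of the norm, so
  smoothness follows from \<open>Ck_flat_exp\<close> and the product rule alone. Its integral is
  positive by continuity at 0 and finite by boundedness on the support, and it is divided
  out.\<close>

lemma mollifier_exists:
  assumes "\<delta> > 0"
  obtains \<psi> :: "real^'n::finite \<Rightarrow> real" where "\<And>k. Ck k \<psi>" "\<And>x. \<psi> x \<ge> 0"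
    "\<And>x. \<psi> x \<noteq> 0 \<Longrightarrow> norm x \<le> \<delta>" "(\<integral>\<^sup>+x. ennreal (\<psi> x) \<partial>lborel) = 1"
proof -
  \<comment> \<open>If every coordinate is at most \<open>\<eta>\<close> in absolute value, then the
    l1 norm, and with it the Euclidean norm, is at most \<open>\<delta>\<close>.\<close>
  define \<eta> where "\<eta> = \<delta> / real CARD('n)"
  have \<eta>: "\<eta> > 0" using assms by (simp add: \<eta>_def)
  define b :: "real^'n \<Rightarrow> real" where
    "b y = (\<Prod>i\<in>UNIV. flat_exp 0 (\<eta> + 1 * y $ i) * flat_exp 0 (\<eta> + (- 1) * y $ i))" for y
  have Cb: "Ck k b" for k
    unfolding b_def[abs_def] by (intro Ck_prod Ck_mult Ck_flat_exp) simp
  have b0: "b y \<ge> 0" for y unfolding b_def by (intro prod_nonneg) (auto simp: flat_exp_def)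
  have bs: "norm y \<le> \<delta>" if "b y \<noteq> 0" for y
  proof -
    have "\<bar>y $ i\<bar> \<le> \<eta>" for i
    proof -
      have "flat_exp 0 (\<eta> + 1 * y $ i) * flat_exp 0 (\<eta> + (- 1) * y $ i) \<noteq> 0"
        using that unfolding b_def by (metis UNIV_I finite prod_zero_iff)
      then show ?thesis by (auto simp: flat_exp_def split: if_splits)
    qed
    then have "(\<Sum>i\<in>UNIV. \<bar>y $ i\<bar>) \<le> (\<Sum>i\<in>(UNIV::'n set). \<eta>)" by (intro sum_mono)
    then show ?thesis using norm_le_l1_cart[of y] by (simp add: \<eta>_def)
  qed
  have cont: "continuous_on UNIV b" using Cb[of 0] by simp
  then have [measurable]: "b \<in> borel_measurable borel" by (rule borel_measurable_continuous_onI)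
  have bp: "b 0 > 0" unfolding b_def using \<eta> by (intro prod_pos) (auto simp: flat_exp_def)
  have "isCont b 0" using cont by (simp add: continuous_on_eq_continuous_at)
  then have "eventually (\<lambda>y. b y > b 0 / 2) (nhds 0)"
    using bp by (intro order_tendstoD) (auto simp: isCont_def tendsto_nhds_iff)
  then obtain \<rho> where \<rho>: "\<rho> > 0" "\<And>y. dist y 0 < \<rho> \<Longrightarrow> b y > b 0 / 2"
    by (auto simp: eventually_nhds_metric)
  have pos: "(\<integral>\<^sup>+x. ennreal (b x) \<partial>lborel) > 0"
  proof -
    have "0 < ennreal (b 0 / 2) * emeasure lborel (ball (0::real^'n) \<rho>)"
      using bp \<rho> by (simp add: emeasure_ball ennreal_zero_less_mult_iff)
    also have "\<dots> = (\<integral>\<^sup>+x. ennreal (b 0 / 2) * indicator (ball (0::real^'n) \<rho>) x \<partial>lborel)"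
      by (simp add: nn_integral_cmult_indicator)
    also have "\<dots> \<le> (\<integral>\<^sup>+x. ennreal (b x) \<partial>lborel)"
    proof (rule nn_integral_mono)
      fix x show "ennreal (b 0 / 2) * indicator (ball 0 \<rho>) x \<le> ennreal (b x)"
        using \<rho>(2)[of x] by (auto simp: indicator_def dist_commute intro!: ennreal_leI)
    qed
    finally show ?thesis .
  qed
  have "compact (b ` cball 0 \<delta>)"
    by (intro compact_continuous_image continuous_on_subset[OF cont]) auto
  then have "bounded (b ` cball 0 \<delta>)" by (rule compact_imp_bounded)
  then obtain B where B: "\<And>y. norm y \<le> \<delta> \<Longrightarrow> \<bar>b y\<bar> \<le> B"
    unfolding bounded_iff by (metis dist_0_norm imageI mem_cball real_norm_def)
  have fin: "(\<integral>\<^sup>+x. ennreal (b x) \<partial>lborel) < \<infinity>"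
  proof -
    have "(\<integral>\<^sup>+x. ennreal (b x) \<partial>lborel) \<le> (\<integral>\<^sup>+x. ennreal B * indicator (cball (0::real^'n) \<delta>) x \<partial>lborel)"
    proof (intro nn_integral_mono)
      fix y show "ennreal (b y) \<le> ennreal B * indicator (cball 0 \<delta>) y"
        using bs[of y] B[of y] by (cases "b y = 0") (auto simp: indicator_def intro!: ennreal_leI)
    qed
    also have "\<dots> < \<infinity>"
      using emeasure_lborel_cball_finite[of "0::real^'n" \<delta>]
      by (simp add: nn_integral_cmult_indicator ennreal_mult_less_top)
    finally show ?thesis .
  qed
  define c where "c = enn2real (\<integral>\<^sup>+x. ennreal (b x) \<partial>lborel)"
  have c: "(\<integral>\<^sup>+x. ennreal (b x) \<partial>lborel) = ennreal c" "c > 0"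
    using pos fin by (auto simp: c_def enn2real_positive_iff)
  show thesis
  proof (rule that[of "\<lambda>x. inverse c * b x"])
    show "Ck k (\<lambda>x. inverse c * b x)" for k by (intro Ck_mult Ck_const Cb)
    show "inverse c * b x \<ge> 0" for x using c b0 by simp
    show "norm x \<le> \<delta>" if "inverse c * b x \<noteq> 0" for x using bs that by auto
    have "(\<integral>\<^sup>+x. ennreal (inverse c * b x) \<partial>lborel) = ennreal (inverse c) * ennreal c"
      using b0 c by (simp add: ennreal_mult nn_integral_cmult)
    then show "(\<integral>\<^sup>+x. ennreal (inverse c * b x) \<partial>lborel) = 1"
      using c by (simp add: ennreal_mult[symmetric])
  qed
qed

section \<open>Symmetric gradients along rays\<close>

text \<open>Cauchy-Schwarz for each row and once more for the outer product with
  \<open>\<omega>\<close>. The norm on nested vectors is the Frobenius norm, which is the l2 norm of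
  the row norms.\<close>

lemma abs_quadratic_form_le:
  fixes A :: "real^'n^'n::finite" and \<omega> :: "real^'n"
  shows "\<bar>\<Sum>i\<in>UNIV. \<Sum>j\<in>UNIV. \<omega> $ i * \<omega> $ j * A $ i $ j\<bar> \<le> (norm \<omega>)\<^sup>2 * norm A"
proof -
  define v :: "real^'n" where "v = (\<chi> i. A $ i \<bullet> \<omega>)"
  have "(\<Sum>i\<in>UNIV. \<Sum>j\<in>UNIV. \<omega> $ i * \<omega> $ j * A $ i $ j) = \<omega> \<bullet> v"
    by (simp add: inner_vec_def v_def sum_distrib_left mult_ac)
  moreover have "norm v \<le> norm A * norm \<omega>"
  proof -
    have "norm v = L2_set (\<lambda>i. norm (v $ i)) UNIV" by (rule norm_vec_def)
    also have "\<dots> \<le> L2_set (\<lambda>i. norm (A $ i) * norm \<omega>) UNIV"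
    proof (rule L2_set_mono)
      fix i show "norm (v $ i) \<le> norm (A $ i) * norm \<omega>"
        using Cauchy_Schwarz_ineq2[of "A $ i" \<omega>] by (simp add: v_def)
    qed simp
    also have "\<dots> = L2_set (\<lambda>i. norm (A $ i)) UNIV * norm \<omega>" by (simp add: L2_set_left_distrib)
    also have "L2_set (\<lambda>i. norm (A $ i)) UNIV = norm A" by (rule norm_vec_def[symmetric])
    finally show ?thesis .
  qed
  ultimately show ?thesis
    using Cauchy_Schwarz_ineq2[of \<omega> v] mult_left_mono[of "norm v" "norm A * norm \<omega>" "norm \<omega>"]
    by (simp add: power2_eq_square mult_ac)
qed

text \<open>For a function that is not integrable the left side is 0, the default value of the
  Bochner integral.\<close>

lemma norm_integral_le_nn_integral:
  fixes f :: "'a \<Rightarrow> 'b::{banach, second_countable_topology}"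
  shows "ennreal (norm (LINT x|M. f x)) \<le> (\<integral>\<^sup>+x. ennreal (norm (f x)) \<partial>M)"
  by (cases "integrable M f") (simp_all add: integral_norm_bound_ennreal not_integrable_integral_eq)

definition dir_deriv :: "(real^'n::finite \<Rightarrow> real) \<Rightarrow> real^'n \<Rightarrow> real^'n \<Rightarrow> real" where
  "dir_deriv \<psi> \<omega> z = (\<Sum>j\<in>UNIV. \<omega> $ j * partial j \<psi> z)"

lemma test_function_reflect:
  assumes C: "\<And>k. Ck k \<psi>" and supp: "\<And>x. \<psi> x \<noteq> 0 \<Longrightarrow> norm x \<le> \<delta>" and sub: "cball z \<delta> \<subseteq> \<Omega>"
  shows "(\<lambda>y. \<psi> (z - y)) \<in> test_functions \<Omega>"
proof -
  have "{y. \<psi> (z - y) \<noteq> 0} \<subseteq> cball z \<delta>" using supp by (auto simp: dist_norm)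
  then have cl: "closure {y. \<psi> (z - y) \<noteq> 0} \<subseteq> cball z \<delta>" by (rule closure_minimal) simp
  then have "compact (closure {y. \<psi> (z - y) \<noteq> 0})"
    by (meson bounded_cball bounded_subset closed_closure compact_eq_bounded_closed)
  then show ?thesis using cl sub C by (auto simp: test_functions_def intro: Ck_reflect)
qed

lemma partial_support:
  fixes \<psi> :: "real^'n::finite \<Rightarrow> real"
  assumes supp: "\<And>x. \<psi> x \<noteq> 0 \<Longrightarrow> norm x \<le> \<delta>" and "partial j \<psi> x \<noteq> 0"
  shows "norm x \<le> \<delta>"
proof (rule ccontr)
  assume n: "\<not> norm x \<le> \<delta>"
  have "((\<lambda>_. 0) has_derivative (\<lambda>_. 0)) (at x)" by simp
  then have "(\<psi> has_derivative (\<lambda>_. 0)) (at x)"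
  proof (rule has_derivative_transform_within_open)
    show "open (- cball (0::real^'n) \<delta>)" by (simp add: open_Compl)
    show "x \<in> - cball 0 \<delta>" using n by simp
    show "0 = \<psi> y" if "y \<in> - cball 0 \<delta>" for y using supp[of y] that by fastforce
  qed
  from partial_eq[OF this] assms(2) show False by simp
qed

text \<open>The defining identity is tested with \<open>\<lambda>y. \<psi> (z - y)\<close>.
  Reflection changes the sign of the partial derivatives and cancels the minus sign of
  \<open>distr_partial\<close>; since \<open>\<omega> $ i * \<omega> $ j\<close> is symmetric in the
  indices, both halves of the symmetrised gradient contribute equally. The right side is the
  derivative along \<open>\<omega>\<close> of the mollified \<open>u \<bullet> \<omega>\<close>. The
  compact set \<open>K\<close> replaces the open set, on which \<open>u\<close> might fail to be
  integrable.\<close>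

lemma sym_gradient_quadratic_test:
  fixes u :: "real^'n::finite \<Rightarrow> real^'n"
  assumes op: "open \<Omega>" and E: "is_sym_gradient \<Omega> u E" and u: "continuous_on \<Omega> u"
    and C: "\<And>k. Ck k \<psi>" and supp: "\<And>x. \<psi> x \<noteq> 0 \<Longrightarrow> norm x \<le> \<delta>"
    and sub: "cball z \<delta> \<subseteq> K" "compact K" "K \<subseteq> \<Omega>"
  shows "(\<Sum>i\<in>UNIV. \<Sum>j\<in>UNIV. \<omega> $ i * \<omega> $ j * (LINT y:\<Omega>|lebesgue. E y $ i $ j * \<psi> (z - y)))
     = (LINT y|lborel. indicator K y * (u y \<bullet> \<omega>) * dir_deriv \<psi> \<omega> (z - y))"
proof -
  let ?\<phi> = "\<lambda>y. \<psi> (z - y)"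
  have \<phi>: "?\<phi> \<in> test_functions \<Omega>"
    using sub by (intro test_function_reflect[OF C supp]) auto
  have d: "\<psi> differentiable (at x)" for x using C[of 1] by simp
  have pc: "continuous_on UNIV (partial j \<psi>)" for j using C[of 1] by simp
  have [measurable]: "K \<in> sets borel" using sub by (simp add: borel_compact)
  have p0: "partial j \<psi> (z - y) = 0" if "y \<notin> K" for j y
  proof (rule ccontr)
    assume "partial j \<psi> (z - y) \<noteq> 0"
    from partial_support[OF supp this] have "y \<in> cball z \<delta>" by (simp add: dist_norm)
    with sub that show False by auto
  qed
  have int: "integrable lborel (\<lambda>y. indicator K y * (u y $ i * partial j \<psi> (z - y)))" for i j
  proof -
    have "continuous_on K (\<lambda>y. u y $ i * partial j \<psi> (z - y))"
      using continuous_on_subset[OF u sub(3)]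
      by (intro continuous_intros continuous_on_compose2[OF pc]) auto
    from borel_integrable_compact[OF sub(2) this] show ?thesis
      by (rule Bochner_Integration.integrable_cong[THEN iffD1, rotated 2]) (auto simp: indicator_def)
  qed
  have dp: "distr_partial \<Omega> j (\<lambda>x. u x $ i) ?\<phi> = (LINT y|lborel. indicator K y * (u y $ i * partial j \<psi> (z - y)))" for i j
  proof -
    have "distr_partial \<Omega> j (\<lambda>x. u x $ i) ?\<phi> = - (LINT y|lebesgue. - (indicator K y * (u y $ i * partial j \<psi> (z - y))))"
      unfolding distr_partial_def set_lebesgue_integral_def using sub p0
      by (auto simp: partial_reflect[OF d] indicator_def intro!: Bochner_Integration.integral_cong)
    also have "\<dots> = (LINT y|lebesgue. indicator K y * (u y $ i * partial j \<psi> (z - y)))" by simp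
    also have "\<dots> = (LINT y|lborel. indicator K y * (u y $ i * partial j \<psi> (z - y)))"
      by (rule integral_completion) (use int in \<open>auto dest: borel_measurable_integrable\<close>)
    finally show ?thesis .
  qed
  let ?P = "\<lambda>i j. LINT y|lborel. indicator K y * (u y $ i * partial j \<psi> (z - y))"
  have Eij: "(LINT y:\<Omega>|lebesgue. E y $ i $ j * ?\<phi> y) = (?P i j + ?P j i) / 2" for i j
    unfolding dp[symmetric] using bspec[OF conjunct2[OF E[unfolded is_sym_gradient_def]] \<phi>] by blast
  have "(\<Sum>i\<in>UNIV. \<Sum>j\<in>UNIV. \<omega> $ i * \<omega> $ j * (LINT y:\<Omega>|lebesgue. E y $ i $ j * ?\<phi> y))
    = (\<Sum>i\<in>UNIV. \<Sum>j\<in>UNIV. \<omega> $ i * \<omega> $ j * ((?P i j + ?P j i) / 2))"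
    unfolding Eij ..
  also have "\<dots> = (\<Sum>i\<in>UNIV. \<Sum>j\<in>UNIV. \<omega> $ i * \<omega> $ j * ?P i j) / 2 + (\<Sum>i\<in>UNIV. \<Sum>j\<in>UNIV. \<omega> $ i * \<omega> $ j * ?P j i) / 2"
    by (simp add: sum_divide_distrib sum.distrib[symmetric] field_simps)
  also have "(\<Sum>i\<in>UNIV. \<Sum>j\<in>UNIV. \<omega> $ i * \<omega> $ j * ?P j i) = (\<Sum>i\<in>UNIV. \<Sum>j\<in>UNIV. \<omega> $ i * \<omega> $ j * ?P i j)"
    by (subst sum.swap) (simp add: mult_ac)
  also have "(\<Sum>i\<in>UNIV. \<Sum>j\<in>UNIV. \<omega> $ i * \<omega> $ j * ?P i j) / 2 + (\<Sum>i\<in>UNIV. \<Sum>j\<in>UNIV. \<omega> $ i * \<omega> $ j * ?P i j) / 2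
     = (\<Sum>i\<in>UNIV. \<Sum>j\<in>UNIV. \<omega> $ i * \<omega> $ j * ?P i j)" by simp
  also have "\<dots> = (LINT y|lborel. (\<Sum>i\<in>UNIV. \<Sum>j\<in>UNIV. \<omega> $ i * \<omega> $ j * (indicator K y * (u y $ i * partial j \<psi> (z - y)))))"
    using int by (simp add: Bochner_Integration.integral_sum)
  also have "\<dots> = (LINT y|lborel. indicator K y * (u y \<bullet> \<omega>) * dir_deriv \<psi> \<omega> (z - y))"
    by (intro Bochner_Integration.integral_cong)
       (auto simp: dir_deriv_def inner_vec_def sum_product sum_distrib_left sum_distrib_right mult_ac intro!: sum.cong)
  finally show ?thesis .
qed

text \<open>A Borel majorant \<open>g\<close> stands in for the norm of \<open>E\<close>, which is
  only Lebesgue measurable; this allows the passage from \<open>lebesgue\<close> to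
  \<open>lborel\<close>, where products and Fubini are convenient. An almost everywhere bound
  suffices because \<open>E\<close> enters only under the integral.\<close>

lemma sym_gradient_quadratic_bound:
  fixes u :: "real^'n::finite \<Rightarrow> real^'n"
  assumes E: "is_sym_gradient \<Omega> u E"
    and C: "\<And>k. Ck k \<psi>" and \<psi>0: "\<And>x. \<psi> x \<ge> 0" and supp: "\<And>x. \<psi> x \<noteq> 0 \<Longrightarrow> norm x \<le> \<delta>"
    and sub: "cball z \<delta> \<subseteq> \<Omega>"
    and gm [measurable]: "g \<in> borel_measurable borel"
    and g: "AE y in lebesgue. y \<in> \<Omega> \<longrightarrow> ennreal (norm (E y)) \<le> g y"
  shows "ennreal \<bar>\<Sum>i\<in>UNIV. \<Sum>j\<in>UNIV. \<omega> $ i * \<omega> $ j * (LINT y:\<Omega>|lebesgue. E y $ i $ j * \<psi> (z - y))\<bar>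
     \<le> ennreal ((norm \<omega>)\<^sup>2) * (\<integral>\<^sup>+y. g y * ennreal (\<psi> (z - y)) \<partial>lborel)"
proof -
  let ?B = "cball z \<delta>"
  have "continuous_on UNIV \<psi>" using C[of 0] by simp
  then have \<psi>m [measurable]: "\<psi> \<in> borel_measurable borel" by (rule borel_measurable_continuous_onI)
  have \<psi>c: "continuous_on UNIV (\<lambda>y. \<psi> (z - y))" using Ck_reflect[OF C[of 0]] by simp
  then have cB: "continuous_on ?B (\<lambda>y. \<psi> (z - y))" by (rule continuous_on_subset) simp
  obtain M where "M \<ge> 0" and M: "\<And>y. y \<in> ?B \<Longrightarrow> \<bar>\<psi> (z - y)\<bar> \<le> M"
    by (rule continuous_on_compact_bound[OF compact_cball cB, unfolded real_norm_def]) blast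
  have z0: "\<psi> (z - y) = 0" if "y \<notin> ?B" for y
    using supp[of "z - y"] that by (auto simp: dist_norm)
  have EB: "set_integrable lebesgue ?B E"
    using E sub by (simp add: is_sym_gradient_def locally_integrable_def)
  have m1: "(\<lambda>y. \<psi> (z - y)) \<in> borel_measurable lebesgue"
    using borel_measurable_continuous_onI[OF \<psi>c] by (simp add: measurable_completion)
  have int: "integrable lebesgue (\<lambda>y. indicator ?B y * (E y $ i $ j * \<psi> (z - y)))" for i j
  proof -
    have 1: "integrable lebesgue (\<lambda>y. indicator ?B y *\<^sub>R E y)" using EB by (simp add: set_integrable_def)
    have "integrable lebesgue (\<lambda>y. (indicator ?B y *\<^sub>R E y) $ i $ j)"
      using integrable_bounded_linear[OF bounded_linear_vec_nth integrable_bounded_linear[OF bounded_linear_vec_nth 1]] .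
    then have 2: "integrable lebesgue (\<lambda>y. M * (indicator ?B y * E y $ i $ j))" by simp
    show ?thesis
    proof (rule Bochner_Integration.integrable_bound[OF 2])
      have "(\<lambda>y. (indicator ?B y *\<^sub>R E y) $ i $ j) \<in> borel_measurable lebesgue"
        using \<open>integrable lebesgue (\<lambda>y. (indicator ?B y *\<^sub>R E y) $ i $ j)\<close> by (rule borel_measurable_integrable)
      then have "(\<lambda>y. (indicator ?B y *\<^sub>R E y) $ i $ j * \<psi> (z - y)) \<in> borel_measurable lebesgue"
        using m1 by (rule borel_measurable_times)
      then show "(\<lambda>y. indicator ?B y * (E y $ i $ j * \<psi> (z - y))) \<in> borel_measurable lebesgue"
        by (simp add: mult.assoc)
      show "AE y in lebesgue. norm (indicator ?B y * (E y $ i $ j * \<psi> (z - y))) \<le> norm (M * (indicator ?B y * E y $ i $ j))"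
      proof (intro AE_I2)
        fix y
        have "\<bar>\<psi> (z - y)\<bar> \<le> \<bar>M\<bar>" if "y \<in> ?B" using M[OF that] by linarith
        then show "norm (indicator ?B y * (E y $ i $ j * \<psi> (z - y))) \<le> norm (M * (indicator ?B y * E y $ i $ j))"
          by (auto simp: indicator_def abs_mult mult.commute intro: mult_right_mono)
      qed
    qed
  qed
  have "(LINT y:\<Omega>|lebesgue. E y $ i $ j * \<psi> (z - y)) = (LINT y|lebesgue. indicator ?B y * (E y $ i $ j * \<psi> (z - y)))" for i j
    unfolding set_lebesgue_integral_def using sub z0
    by (intro Bochner_Integration.integral_cong) (auto simp: indicator_def)
  then have "(\<Sum>i\<in>UNIV. \<Sum>j\<in>UNIV. \<omega> $ i * \<omega> $ j * (LINT y:\<Omega>|lebesgue. E y $ i $ j * \<psi> (z - y)))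
    = (LINT y|lebesgue. (\<Sum>i\<in>UNIV. \<Sum>j\<in>UNIV. \<omega> $ i * \<omega> $ j * (indicator ?B y * (E y $ i $ j * \<psi> (z - y)))))"
    using int by (simp add: Bochner_Integration.integral_sum)
  also have "\<dots> = (LINT y|lebesgue. indicator ?B y * \<psi> (z - y) * (\<Sum>i\<in>UNIV. \<Sum>j\<in>UNIV. \<omega> $ i * \<omega> $ j * E y $ i $ j))"
    by (intro Bochner_Integration.integral_cong) (auto simp: sum_distrib_left mult_ac)
  finally have "ennreal \<bar>\<Sum>i\<in>UNIV. \<Sum>j\<in>UNIV. \<omega> $ i * \<omega> $ j * (LINT y:\<Omega>|lebesgue. E y $ i $ j * \<psi> (z - y))\<bar>
    = ennreal (norm (LINT y|lebesgue. indicator ?B y * \<psi> (z - y) * (\<Sum>i\<in>UNIV. \<Sum>j\<in>UNIV. \<omega> $ i * \<omega> $ j * E y $ i $ j)))"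
    by simp
  also have "\<dots> \<le> (\<integral>\<^sup>+y. ennreal (norm (indicator ?B y * \<psi> (z - y) * (\<Sum>i\<in>UNIV. \<Sum>j\<in>UNIV. \<omega> $ i * \<omega> $ j * E y $ i $ j))) \<partial>lebesgue)"
    by (rule norm_integral_le_nn_integral)
  also have "\<dots> \<le> (\<integral>\<^sup>+y. ennreal ((norm \<omega>)\<^sup>2) * (g y * ennreal (\<psi> (z - y))) \<partial>lebesgue)"
  proof (rule nn_integral_mono_AE, use g in eventually_elim)
    fix y assume gy: "y \<in> \<Omega> \<longrightarrow> ennreal (norm (E y)) \<le> g y"
    show "ennreal (norm (indicator ?B y * \<psi> (z - y) * (\<Sum>i\<in>UNIV. \<Sum>j\<in>UNIV. \<omega> $ i * \<omega> $ j * E y $ i $ j)))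
      \<le> ennreal ((norm \<omega>)\<^sup>2) * (g y * ennreal (\<psi> (z - y)))"
    proof (cases "y \<in> ?B")
      case True
      have "ennreal (norm (indicator ?B y * \<psi> (z - y) * (\<Sum>i\<in>UNIV. \<Sum>j\<in>UNIV. \<omega> $ i * \<omega> $ j * E y $ i $ j)))
        \<le> ennreal (\<psi> (z - y) * ((norm \<omega>)\<^sup>2 * norm (E y)))"
        using True \<psi>0 abs_quadratic_form_le[of \<omega> "E y"]
        by (intro ennreal_leI) (simp add: abs_mult mult_left_mono)
      also have "\<dots> = ennreal ((norm \<omega>)\<^sup>2) * (ennreal (norm (E y)) * ennreal (\<psi> (z - y)))"
        using \<psi>0 by (simp add: ennreal_mult[symmetric] mult_ac)
      also have "\<dots> \<le> ennreal ((norm \<omega>)\<^sup>2) * (g y * ennreal (\<psi> (z - y)))"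
        using gy True sub by (intro mult_left_mono mult_right_mono) auto
      finally show ?thesis .
    qed simp
  qed
  also have "\<dots> = (\<integral>\<^sup>+y. ennreal ((norm \<omega>)\<^sup>2) * (g y * ennreal (\<psi> (z - y))) \<partial>lborel)"
    by (rule nn_integral_completion)
  also have "\<dots> = ennreal ((norm \<omega>)\<^sup>2) * (\<integral>\<^sup>+y. g y * ennreal (\<psi> (z - y)) \<partial>lborel)"
    by (rule nn_integral_cmult) simp
  finally show ?thesis .
qed

text \<open>\<open>U\<close> is the mollified \<open>u \<bullet> \<omega>\<close> along the ray. The
  fundamental theorem of calculus is applied to \<open>\<psi>\<close> for each fixed
  \<open>y\<close>, Fubini moves the ray parameter outside, and for each \<open>\<tau>\<close> the
  two preceding lemmas identify and bound the inner integral. One compact set \<open>K\<close> must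
  contain the whole tube, so that \<open>U\<close> is a single function of
  \<open>\<tau>\<close>.\<close>

lemma ray_difference:
  fixes u :: "real^'n::finite \<Rightarrow> real^'n"
  assumes op: "open \<Omega>" and E: "is_sym_gradient \<Omega> u E" and u: "continuous_on \<Omega> u"
    and C: "\<And>k. Ck k \<psi>" and \<psi>0: "\<And>x. \<psi> x \<ge> 0" and supp: "\<And>x. \<psi> x \<noteq> 0 \<Longrightarrow> norm x \<le> \<delta>"
    and gm [measurable]: "g \<in> borel_measurable borel"
    and g: "AE y in lebesgue. y \<in> \<Omega> \<longrightarrow> ennreal (norm (E y)) \<le> g y"
    and \<eta>s: "\<eta> \<le> s"
    and tube: "\<And>\<tau>. \<eta> \<le> \<tau> \<Longrightarrow> \<tau> \<le> s \<Longrightarrow> cball (x + \<tau> *\<^sub>R \<omega>) \<delta> \<subseteq> K" and K: "compact K" "K \<subseteq> \<Omega>"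
  defines "U \<equiv> \<lambda>\<tau>. LINT y|lborel. indicator K y * (u y \<bullet> \<omega>) * \<psi> (x + \<tau> *\<^sub>R \<omega> - y)"
  shows "ennreal \<bar>U s - U \<eta>\<bar>
    \<le> ennreal ((norm \<omega>)\<^sup>2) * (\<integral>\<^sup>+\<tau>\<in>{\<eta>..s}. (\<integral>\<^sup>+y. g y * ennreal (\<psi> (x + \<tau> *\<^sub>R \<omega> - y)) \<partial>lborel) \<partial>lborel)"
proof -
  define v where "v y = indicator K y * (u y \<bullet> \<omega>)" for y
  define D where "D = dir_deriv \<psi> \<omega>"
  have \<psi>c: "continuous_on UNIV \<psi>" using C[of 0] by simp
  have [measurable]: "\<psi> \<in> borel_measurable borel" using \<psi>c by (rule borel_measurable_continuous_onI)
  have pc: "continuous_on UNIV (partial j \<psi>)" for j using C[of 1] by simp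
  have Dc: "continuous_on UNIV D" unfolding D_def dir_deriv_def[abs_def] by (intro continuous_intros pc)
  have [measurable]: "D \<in> borel_measurable borel" using Dc by (rule borel_measurable_continuous_onI)
  have cB: "continuous_on (cball 0 \<delta>) D" using Dc by (rule continuous_on_subset) simp
  obtain B where B0: "B \<ge> 0" and B1: "\<And>z. z \<in> cball 0 \<delta> \<Longrightarrow> \<bar>D z\<bar> \<le> B"
    by (rule continuous_on_compact_bound[OF compact_cball cB, unfolded real_norm_def]) blast
  have B: "\<bar>D z\<bar> \<le> B" for z
  proof (cases "z \<in> cball 0 \<delta>")
    case False
    then have "partial j \<psi> z = 0" for j using partial_support[of \<psi> \<delta> j z, OF supp] by force
    then show ?thesis using B0 by (simp add: D_def dir_deriv_def)
  qed (rule B1)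
  have vi: "integrable lborel v"
  proof -
    have "continuous_on K (\<lambda>y. u y \<bullet> \<omega>)" using continuous_on_subset[OF u K(2)] by (intro continuous_intros)
    from borel_integrable_compact[OF K(1) this] show ?thesis
      by (rule Bochner_Integration.integrable_cong[THEN iffD1, rotated 2]) (auto simp: indicator_def v_def)
  qed
  then have [measurable]: "v \<in> borel_measurable borel" by (simp add: borel_measurable_integrable)
  have iv\<psi>: "integrable lborel (\<lambda>y. v y * \<psi> (x + \<tau> *\<^sub>R \<omega> - y))" for \<tau>
  proof -
    have c\<psi>: "continuous_on (cball 0 \<delta>) \<psi>" using \<psi>c by (rule continuous_on_subset) simp
    obtain M where M0: "M \<ge> 0" and M1: "\<And>z. z \<in> cball 0 \<delta> \<Longrightarrow> \<bar>\<psi> z\<bar> \<le> M"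
      by (rule continuous_on_compact_bound[OF compact_cball c\<psi>, unfolded real_norm_def]) blast
    have M: "\<bar>\<psi> z\<bar> \<le> M" for z
      using M1[of z] M0 supp[of z] by (cases "\<psi> z = 0") auto
    show ?thesis
    proof (rule Bochner_Integration.integrable_bound[OF integrable_mult_right[OF vi, of M]])
      show "AE y in lborel. norm (v y * \<psi> (x + \<tau> *\<^sub>R \<omega> - y)) \<le> norm (M * v y)"
        using M M0 by (intro AE_I2) (simp add: abs_mult mult.commute[of "\<bar>v _\<bar>"] mult_right_mono)
    qed simp
  qed
  have dD: "((\<lambda>\<tau>. \<psi> (x + \<tau> *\<^sub>R \<omega> - y)) has_real_derivative D (x + \<tau> *\<^sub>R \<omega> - y)) (at \<tau>)" for \<tau> y
  proof -
    have l: "((\<lambda>\<tau>. x + \<tau> *\<^sub>R \<omega> - y) has_derivative (\<lambda>h. h *\<^sub>R \<omega>)) (at \<tau>)" by (auto intro!: derivative_eq_intros)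
    have d: "\<psi> differentiable (at (x + \<tau> *\<^sub>R \<omega> - y))" using C[of 1] by simp
    have eq: "(\<lambda>h. \<Sum>j\<in>UNIV. (h *\<^sub>R \<omega>) $ j * partial j \<psi> (x + \<tau> *\<^sub>R \<omega> - y)) = (*) (D (x + \<tau> *\<^sub>R \<omega> - y))"
      by (rule ext) (simp add: D_def dir_deriv_def sum_distrib_left mult_ac)
    show ?thesis
      using has_derivative_compose[OF l differentiable_has_derivative_partial[OF d]]
      unfolding has_field_derivative_def eq .
  qed
  have isD: "isCont (\<lambda>\<tau>. D (x + \<tau> *\<^sub>R \<omega> - y)) \<tau>" for \<tau> y
  proof -
    have "continuous_on UNIV (\<lambda>\<tau>. D (x + \<tau> *\<^sub>R \<omega> - y))"
      by (rule continuous_on_compose2[OF Dc]) (auto intro!: continuous_intros)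
    then show ?thesis by (simp add: continuous_on_eq_continuous_at)
  qed
  have FTC: "(LINT \<tau>|lborel. D (x + \<tau> *\<^sub>R \<omega> - y) * indicator {\<eta>..s} \<tau>) = \<psi> (x + s *\<^sub>R \<omega> - y) - \<psi> (x + \<eta> *\<^sub>R \<omega> - y)" for y
    using integral_FTC_Icc_real[OF \<eta>s dD isD] by simp
  define F where "F \<tau> y = indicator {\<eta>..s} \<tau> * (v y * D (x + \<tau> *\<^sub>R \<omega> - y))" for \<tau> y
  have [measurable]: "case_prod F \<in> borel_measurable (borel \<Otimes>\<^sub>M borel)" unfolding F_def by measurable
  have Fint: "integrable (lborel \<Otimes>\<^sub>M lborel) (case_prod F)"
  proof (rule integrableI_bounded)
    have "(\<integral>\<^sup>+p. ennreal (norm (case_prod F p)) \<partial>(lborel \<Otimes>\<^sub>M lborel)) = (\<integral>\<^sup>+\<tau>. (\<integral>\<^sup>+y. ennreal (norm (F \<tau> y)) \<partial>lborel) \<partial>lborel)"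
      by (subst lborel.nn_integral_fst[symmetric]) auto
    also have "\<dots> \<le> (\<integral>\<^sup>+\<tau>. (\<integral>\<^sup>+y. ennreal (norm (v y)) \<partial>lborel) * ennreal B * indicator {\<eta>..s} \<tau> \<partial>lborel)"
    proof (rule nn_integral_mono)
      fix \<tau> :: real
      have "(\<integral>\<^sup>+y. ennreal (norm (F \<tau> y)) \<partial>lborel) \<le> (\<integral>\<^sup>+y. ennreal (norm (v y)) * (ennreal B * indicator {\<eta>..s} \<tau>) \<partial>lborel)"
      proof (rule nn_integral_mono)
        fix y
        have "ennreal (norm (v y * D (x + \<tau> *\<^sub>R \<omega> - y))) \<le> ennreal (norm (v y) * B)"
          using B by (intro ennreal_leI) (simp add: abs_mult mult_left_mono)
        then show "ennreal (norm (F \<tau> y)) \<le> ennreal (norm (v y)) * (ennreal B * indicator {\<eta>..s} \<tau>)"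
          using B0 by (auto simp: F_def indicator_def ennreal_mult)
      qed
      then show "(\<integral>\<^sup>+y. ennreal (norm (F \<tau> y)) \<partial>lborel) \<le> (\<integral>\<^sup>+y. ennreal (norm (v y)) \<partial>lborel) * ennreal B * indicator {\<eta>..s} \<tau>"
        by (simp add: nn_integral_multc mult.assoc)
    qed
    also have "\<dots> = (\<integral>\<^sup>+y. ennreal (norm (v y)) \<partial>lborel) * ennreal B * ennreal (s - \<eta>)"
      using \<eta>s by (simp add: nn_integral_cmult_indicator)
    also have "\<dots> < \<infinity>"
      using vi by (simp add: integrable_iff_bounded ennreal_mult_less_top)
    finally show "(\<integral>\<^sup>+p. ennreal (norm (case_prod F p)) \<partial>(lborel \<Otimes>\<^sub>M lborel)) < \<infinity>" .
  qed simp
  have "U s - U \<eta> = (LINT y|lborel. v y * (\<psi> (x + s *\<^sub>R \<omega> - y) - \<psi> (x + \<eta> *\<^sub>R \<omega> - y)))"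
    unfolding U_def v_def[symmetric] using iv\<psi> by (simp add: right_diff_distrib)
  also have "\<dots> = (LINT y|lborel. (LINT \<tau>|lborel. F \<tau> y))"
    unfolding FTC[symmetric] F_def by (simp add: mult_ac flip: integral_mult_right_zero)
  also have "\<dots> = (LINT \<tau>|lborel. (LINT y|lborel. F \<tau> y))"
    by (rule lborel_pair.Fubini_integral[OF Fint])
  finally have "ennreal \<bar>U s - U \<eta>\<bar> = ennreal (norm (LINT \<tau>|lborel. (LINT y|lborel. F \<tau> y)))" by simp
  also have "\<dots> \<le> (\<integral>\<^sup>+\<tau>. ennreal (norm (LINT y|lborel. F \<tau> y)) \<partial>lborel)"
    by (rule norm_integral_le_nn_integral)
  also have "\<dots> \<le> (\<integral>\<^sup>+\<tau>. ennreal ((norm \<omega>)\<^sup>2) * ((\<integral>\<^sup>+y. g y * ennreal (\<psi> (x + \<tau> *\<^sub>R \<omega> - y)) \<partial>lborel) * indicator {\<eta>..s} \<tau>) \<partial>lborel)"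
  proof (rule nn_integral_mono)
    fix \<tau> :: real
    show "ennreal (norm (LINT y|lborel. F \<tau> y))
      \<le> ennreal ((norm \<omega>)\<^sup>2) * ((\<integral>\<^sup>+y. g y * ennreal (\<psi> (x + \<tau> *\<^sub>R \<omega> - y)) \<partial>lborel) * indicator {\<eta>..s} \<tau>)"
    proof (cases "\<tau> \<in> {\<eta>..s}")
      case True
      then have sub: "cball (x + \<tau> *\<^sub>R \<omega>) \<delta> \<subseteq> K" using tube by auto
      have "(LINT y|lborel. F \<tau> y) = (\<Sum>i\<in>UNIV. \<Sum>j\<in>UNIV. \<omega> $ i * \<omega> $ j * (LINT y:\<Omega>|lebesgue. E y $ i $ j * \<psi> (x + \<tau> *\<^sub>R \<omega> - y)))"
        using sym_gradient_quadratic_test[OF op E u C supp sub K, of \<omega>] True by (simp add: F_def v_def D_def)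
      then show ?thesis
        using sym_gradient_quadratic_bound[OF E C \<psi>0 supp order_trans[OF sub K(2)] gm g, of \<omega>] True by simp
    qed (simp add: F_def)
  qed
  also have "\<dots> = ennreal ((norm \<omega>)\<^sup>2) * (\<integral>\<^sup>+\<tau>\<in>{\<eta>..s}. (\<integral>\<^sup>+y. g y * ennreal (\<psi> (x + \<tau> *\<^sub>R \<omega> - y)) \<partial>lborel) \<partial>lborel)"
    by (rule nn_integral_cmult) simp
  finally show ?thesis .
qed

section \<open>Averages of ray integrals over the ball of directions\<close>

lemma nn_integral_lborel_affine:
  fixes f :: "'a::euclidean_space \<Rightarrow> ennreal"
  assumes [measurable]: "f \<in> borel_measurable borel" and c: "c \<noteq> 0"
  shows "(\<integral>\<^sup>+z. f z \<partial>lborel) = ennreal (\<bar>c\<bar> ^ DIM('a)) * (\<integral>\<^sup>+w. f (x + c *\<^sub>R w) \<partial>lborel)"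
  by (subst lborel_affine[OF c, of x]) (simp add: nn_integral_density nn_integral_distr nn_integral_cmult)

lemma borel_measurable_ball [measurable]: "ball (x::'a::metric_space) r \<in> sets borel"
  by simp

lemma nn_integral_unit_ball_ray:
  fixes f :: "'a::euclidean_space \<Rightarrow> ennreal"
  assumes [measurable]: "f \<in> borel_measurable borel" and \<tau>: "\<tau> > 0"
  shows "(\<integral>\<^sup>+w\<in>ball 0 1. f (x + \<tau> *\<^sub>R w) \<partial>lborel) = ennreal (\<tau> powr - real DIM('a)) * (\<integral>\<^sup>+z\<in>ball x \<tau>. f z \<partial>lborel)"
proof -
  have \<tau>0: "\<tau> \<noteq> 0" using \<tau> by simp
  have "(\<integral>\<^sup>+z\<in>ball x \<tau>. f z \<partial>lborel)
      = ennreal (\<bar>\<tau>\<bar> ^ DIM('a)) * (\<integral>\<^sup>+w. f (x + \<tau> *\<^sub>R w) * indicator (ball x \<tau>) (x + \<tau> *\<^sub>R w) \<partial>lborel)"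
    by (rule nn_integral_lborel_affine[OF _ \<tau>0]) measurable
  also have "(\<integral>\<^sup>+w. f (x + \<tau> *\<^sub>R w) * indicator (ball x \<tau>) (x + \<tau> *\<^sub>R w) \<partial>lborel) = (\<integral>\<^sup>+w\<in>ball 0 1. f (x + \<tau> *\<^sub>R w) \<partial>lborel)"
    using \<tau> by (intro nn_integral_cong) (auto simp: indicator_def dist_norm)
  finally have *: "(\<integral>\<^sup>+z\<in>ball x \<tau>. f z \<partial>lborel) = ennreal (\<tau> ^ DIM('a)) * (\<integral>\<^sup>+w\<in>ball 0 1. f (x + \<tau> *\<^sub>R w) \<partial>lborel)"
    using \<tau> by simp
  have "ennreal (\<tau> powr - real DIM('a)) * ennreal (\<tau> ^ DIM('a)) = 1"
    using \<tau> by (simp add: ennreal_mult[symmetric] powr_minus powr_realpow)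
  then show ?thesis unfolding * by (simp add: mult.assoc[symmetric])
qed

text \<open>Exchange the integrals and substitute \<open>z = x + \<tau> *\<^sub>R w\<close>: the
  average at time \<open>\<tau>\<close> is \<open>\<tau> powr - n\<close> times the integral of
  \<open>f\<close> over \<open>ball x \<tau>\<close>, and this ball lies in the region
  \<open>dist x y < 2 * \<tau>\<close> of the kernel.\<close>

lemma ray_average_le_riesz:
  fixes f :: "'a::euclidean_space \<Rightarrow> ennreal"
  assumes [measurable]: "f \<in> borel_measurable borel"
  shows "(\<integral>\<^sup>+w\<in>ball 0 1. (\<integral>\<^sup>+\<tau>\<in>{0<..}. f (x + \<tau> *\<^sub>R w) \<partial>lborel) \<partial>lborel) \<le> riesz f x"
proof -
  have "(\<integral>\<^sup>+w\<in>ball 0 1. (\<integral>\<^sup>+\<tau>\<in>{0<..}. f (x + \<tau> *\<^sub>R w) \<partial>lborel) \<partial>lborel)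
    = (\<integral>\<^sup>+w. (\<integral>\<^sup>+\<tau>. f (x + \<tau> *\<^sub>R w) * indicator {0<..} \<tau> * indicator (ball 0 1) w \<partial>lborel) \<partial>lborel)"
    by (intro nn_integral_cong nn_integral_multc[symmetric]) measurable
  also have "\<dots> = (\<integral>\<^sup>+\<tau>. (\<integral>\<^sup>+w. f (x + \<tau> *\<^sub>R w) * indicator {0<..} \<tau> * indicator (ball 0 1) w \<partial>lborel) \<partial>lborel)"
    by (rule lborel_pair.Fubini') measurable
  also have "\<dots> \<le> (\<integral>\<^sup>+\<tau>. (\<integral>\<^sup>+y. (if dist x y < 2 * \<tau> then ennreal (\<tau> powr - real DIM('a)) else 0) * f y \<partial>lborel) \<partial>lborel)"
  proof (rule nn_integral_mono)
    fix \<tau> :: real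
    show "(\<integral>\<^sup>+w. f (x + \<tau> *\<^sub>R w) * indicator {0<..} \<tau> * indicator (ball 0 1) w \<partial>lborel)
      \<le> (\<integral>\<^sup>+y. (if dist x y < 2 * \<tau> then ennreal (\<tau> powr - real DIM('a)) else 0) * f y \<partial>lborel)"
    proof (cases "\<tau> > 0")
      case True
      then have "(\<integral>\<^sup>+w. f (x + \<tau> *\<^sub>R w) * indicator {0<..} \<tau> * indicator (ball 0 1) w \<partial>lborel)
        = ennreal (\<tau> powr - real DIM('a)) * (\<integral>\<^sup>+z\<in>ball x \<tau>. f z \<partial>lborel)"
        by (simp add: nn_integral_unit_ball_ray)
      also have "\<dots> = (\<integral>\<^sup>+z. ennreal (\<tau> powr - real DIM('a)) * (f z * indicator (ball x \<tau>) z) \<partial>lborel)"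
        by (rule nn_integral_cmult[symmetric]) simp
      also have "\<dots> \<le> (\<integral>\<^sup>+y. (if dist x y < 2 * \<tau> then ennreal (\<tau> powr - real DIM('a)) else 0) * f y \<partial>lborel)"
        using True by (intro nn_integral_mono) (auto simp: indicator_def)
      finally show ?thesis .
    qed simp
  qed
  also have "\<dots> = (\<integral>\<^sup>+y. (\<integral>\<^sup>+\<tau>. (if dist x y < 2 * \<tau> then ennreal (\<tau> powr - real DIM('a)) else 0) * f y \<partial>lborel) \<partial>lborel)"
    by (rule lborel_pair.Fubini') measurable
  also have "\<dots> = riesz f x"
    unfolding riesz_def riesz_kernel_def by (intro nn_integral_cong nn_integral_multc) simp
  finally show ?thesis .
qed

text \<open>If \<open>z\<close> lies in \<open>ball x \<tau>\<close> and \<open>y\<close> within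
  \<open>\<delta> \<le> \<tau>\<close> of \<open>z\<close>, then
  \<open>dist x y < 2 * \<tau>\<close>. So the mollified average has the same bound as the plain
  one, provided that the rays start at time \<open>\<delta>\<close>.\<close>

lemma mollified_ray_average_le_riesz:
  fixes g :: "'a::euclidean_space \<Rightarrow> ennreal"
  assumes [measurable]: "g \<in> borel_measurable borel" "\<psi> \<in> borel_measurable borel"
    and supp: "\<And>x. \<psi> x \<noteq> 0 \<Longrightarrow> norm x \<le> \<delta>"
    and one: "(\<integral>\<^sup>+x. ennreal (\<psi> x) \<partial>lborel) = 1" and \<delta>: "\<delta> > 0"
  shows "(\<integral>\<^sup>+w\<in>ball 0 1. (\<integral>\<^sup>+\<tau>\<in>{\<delta>..}. (\<integral>\<^sup>+y. g y * ennreal (\<psi> (x + \<tau> *\<^sub>R w - y)) \<partial>lborel) \<partial>lborel) \<partial>lborel) \<le> riesz g x"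
proof -
  define h where "h z = (\<integral>\<^sup>+y. g y * ennreal (\<psi> (z - y)) \<partial>lborel)" for z
  have [measurable]: "h \<in> borel_measurable borel" unfolding h_def[abs_def] by measurable
  have hb: "(\<integral>\<^sup>+z\<in>ball x \<tau>. h z \<partial>lborel) \<le> (\<integral>\<^sup>+y. (if dist x y < 2 * \<tau> then 1 else 0) * g y \<partial>lborel)" if "\<tau> \<ge> \<delta>" for \<tau>
  proof -
    have "(\<integral>\<^sup>+z\<in>ball x \<tau>. h z \<partial>lborel) = (\<integral>\<^sup>+z. (\<integral>\<^sup>+y. g y * ennreal (\<psi> (z - y)) * indicator (ball x \<tau>) z \<partial>lborel) \<partial>lborel)"
      unfolding h_def by (intro nn_integral_cong nn_integral_multc[symmetric]) measurable
    also have "\<dots> = (\<integral>\<^sup>+y. (\<integral>\<^sup>+z. g y * ennreal (\<psi> (z - y)) * indicator (ball x \<tau>) z \<partial>lborel) \<partial>lborel)"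
      by (rule lborel_pair.Fubini') measurable
    also have "\<dots> \<le> (\<integral>\<^sup>+y. (if dist x y < 2 * \<tau> then 1 else 0) * g y \<partial>lborel)"
    proof (rule nn_integral_mono)
      fix y
      show "(\<integral>\<^sup>+z. g y * ennreal (\<psi> (z - y)) * indicator (ball x \<tau>) z \<partial>lborel) \<le> (if dist x y < 2 * \<tau> then 1 else 0) * g y"
      proof (cases "dist x y < 2 * \<tau>")
        case True
        have "(\<integral>\<^sup>+z. g y * ennreal (\<psi> (z - y)) * indicator (ball x \<tau>) z \<partial>lborel) \<le> (\<integral>\<^sup>+z. g y * ennreal (\<psi> (z - y)) \<partial>lborel)"
          by (intro nn_integral_mono) (auto simp: indicator_def)
        also have "\<dots> = g y * (\<integral>\<^sup>+z. ennreal (\<psi> (z - y)) \<partial>lborel)" by (rule nn_integral_cmult) simp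
        also have "(\<integral>\<^sup>+z. ennreal (\<psi> (z - y)) \<partial>lborel) = 1"
          using nn_integral_lborel_affine[of "\<lambda>z. ennreal (\<psi> z)" 1 "- y"] one by simp
        finally show ?thesis using True by simp
      next
        case False
        have "ennreal (\<psi> (z - y)) * indicator (ball x \<tau>) z = 0" for z
        proof (rule ccontr)
          assume "ennreal (\<psi> (z - y)) * indicator (ball x \<tau>) z \<noteq> 0"
          then have "\<psi> (z - y) \<noteq> 0" "dist x z < \<tau>" by (auto simp: indicator_def split: if_splits)
          then have "dist z y \<le> \<tau>" "dist x z < \<tau>" using supp[of "z - y"] that by (auto simp: dist_norm)
          with dist_triangle[of x y z] False show False by simp
        qed
        then have "g y * ennreal (\<psi> (z - y)) * indicator (ball x \<tau>) z = 0" for z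
          by (simp only: mult.assoc mult_zero_right)
        then show ?thesis by (simp only: nn_integral_const mult_zero_left zero_le)
      qed
    qed
    finally show ?thesis .
  qed
  have "(\<integral>\<^sup>+w\<in>ball 0 1. (\<integral>\<^sup>+\<tau>\<in>{\<delta>..}. h (x + \<tau> *\<^sub>R w) \<partial>lborel) \<partial>lborel)
    = (\<integral>\<^sup>+w. (\<integral>\<^sup>+\<tau>. h (x + \<tau> *\<^sub>R w) * indicator {\<delta>..} \<tau> * indicator (ball 0 1) w \<partial>lborel) \<partial>lborel)"
    by (intro nn_integral_cong nn_integral_multc[symmetric]) measurable
  also have "\<dots> = (\<integral>\<^sup>+\<tau>. (\<integral>\<^sup>+w. h (x + \<tau> *\<^sub>R w) * indicator {\<delta>..} \<tau> * indicator (ball 0 1) w \<partial>lborel) \<partial>lborel)"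
    by (rule lborel_pair.Fubini') measurable
  also have "\<dots> \<le> (\<integral>\<^sup>+\<tau>. (\<integral>\<^sup>+y. (if dist x y < 2 * \<tau> then ennreal (\<tau> powr - real DIM('a)) else 0) * g y \<partial>lborel) \<partial>lborel)"
  proof (rule nn_integral_mono)
    fix \<tau> :: real
    show "(\<integral>\<^sup>+w. h (x + \<tau> *\<^sub>R w) * indicator {\<delta>..} \<tau> * indicator (ball 0 1) w \<partial>lborel)
      \<le> (\<integral>\<^sup>+y. (if dist x y < 2 * \<tau> then ennreal (\<tau> powr - real DIM('a)) else 0) * g y \<partial>lborel)"
    proof (cases "\<tau> \<ge> \<delta>")
      case True
      then have "(\<integral>\<^sup>+w. h (x + \<tau> *\<^sub>R w) * indicator {\<delta>..} \<tau> * indicator (ball 0 1) w \<partial>lborel)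
        = ennreal (\<tau> powr - real DIM('a)) * (\<integral>\<^sup>+z\<in>ball x \<tau>. h z \<partial>lborel)"
        using \<delta> by (simp add: nn_integral_unit_ball_ray)
      also have "\<dots> \<le> ennreal (\<tau> powr - real DIM('a)) * (\<integral>\<^sup>+y. (if dist x y < 2 * \<tau> then 1 else 0) * g y \<partial>lborel)"
        by (intro mult_left_mono hb True) simp
      also have "\<dots> = (\<integral>\<^sup>+y. ennreal (\<tau> powr - real DIM('a)) * ((if dist x y < 2 * \<tau> then 1 else 0) * g y) \<partial>lborel)"
        by (rule nn_integral_cmult[symmetric]) simp
      also have "\<dots> = (\<integral>\<^sup>+y. (if dist x y < 2 * \<tau> then ennreal (\<tau> powr - real DIM('a)) else 0) * g y \<partial>lborel)"
        by (intro nn_integral_cong) auto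
      finally show ?thesis .
    qed simp
  qed
  also have "\<dots> = (\<integral>\<^sup>+y. (\<integral>\<^sup>+\<tau>. (if dist x y < 2 * \<tau> then ennreal (\<tau> powr - real DIM('a)) else 0) * g y \<partial>lborel) \<partial>lborel)"
    by (rule lborel_pair.Fubini') measurable
  also have "\<dots> = riesz g x"
    unfolding riesz_def riesz_kernel_def by (intro nn_integral_cong nn_integral_multc) simp
  finally show ?thesis unfolding h_def .
qed

section \<open>End points of rays and the pointwise estimate\<close>

lemma mollified_value_close:
  fixes v \<psi> :: "'a::euclidean_space \<Rightarrow> real"
  assumes [measurable]: "v \<in> borel_measurable borel" "\<psi> \<in> borel_measurable borel"
    and \<psi>0: "\<And>x. \<psi> x \<ge> 0" and supp: "\<And>x. \<psi> x \<noteq> 0 \<Longrightarrow> norm x \<le> \<delta>"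
    and one: "(\<integral>\<^sup>+x. ennreal (\<psi> x) \<partial>lborel) = 1"
    and close: "\<And>y. y \<in> cball z \<delta> \<Longrightarrow> \<bar>v y - c\<bar> \<le> e" and e: "e \<ge> 0"
  shows "\<bar>(LINT y|lborel. v y * \<psi> (z - y)) - c\<bar> \<le> e"
proof -
  have n1: "(\<integral>\<^sup>+y. ennreal (\<psi> (z - y)) \<partial>lborel) = 1"
    using nn_integral_lborel_affine[of "\<lambda>z. ennreal (\<psi> z)" "-1" z] one by simp
  have i1: "integrable lborel (\<lambda>y. \<psi> (z - y))"
    using n1 \<psi>0 by (intro integrableI_nonneg) auto
  have l1: "(LINT y|lborel. \<psi> (z - y)) = 1"
    using n1 \<psi>0 by (subst integral_eq_nn_integral) auto
  have cl: "\<bar>(v y - c) * \<psi> (z - y)\<bar> \<le> e * \<psi> (z - y)" for y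
  proof (cases "\<psi> (z - y) = 0")
    case False
    then have "y \<in> cball z \<delta>" using supp[of "z - y"] by (simp add: dist_norm)
    then show ?thesis using close \<psi>0 by (simp add: abs_mult mult_right_mono)
  qed simp
  have i2: "integrable lborel (\<lambda>y. (v y - c) * \<psi> (z - y))"
    by (rule Bochner_Integration.integrable_bound[OF integrable_mult_right[OF i1, of e]])
       (use cl \<psi>0 e in \<open>auto simp: abs_mult\<close>)
  have "(LINT y|lborel. v y * \<psi> (z - y)) = (LINT y|lborel. (v y - c) * \<psi> (z - y) + c * \<psi> (z - y))"
    by (simp add: algebra_simps)
  also have "\<dots> = (LINT y|lborel. (v y - c) * \<psi> (z - y)) + c"
    using i1 i2 l1 by simp
  finally have "\<bar>(LINT y|lborel. v y * \<psi> (z - y)) - c\<bar> = \<bar>LINT y|lborel. (v y - c) * \<psi> (z - y)\<bar>" by simp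
  also have "\<dots> \<le> (LINT y|lborel. \<bar>(v y - c) * \<psi> (z - y)\<bar>)" by (rule integral_abs_bound)
  also have "\<dots> \<le> (LINT y|lborel. e * \<psi> (z - y))"
    using i1 i2 cl by (intro integral_mono integrable_abs) auto
  also have "\<dots> = e" using l1 by simp
  finally show ?thesis .
qed

text \<open>Either the ray stays in \<open>\<Omega>\<close> and eventually leaves the bounded
  support of \<open>u\<close>, or it has a first exit time, at which it meets the frontier and
  \<open>hit\<close> applies. In the second case the ray is stopped just before the exit and
  continuity on the closure costs \<open>\<kappa>\<close>: the closed segment must lie in the open
  set, where the symmetric gradient is known.\<close>

lemma ray_reaches_small_value:
  fixes u :: "'a::euclidean_space \<Rightarrow> 'b::real_normed_vector"
  assumes op: "open \<Omega>" and u: "continuous_on (closure \<Omega>) u" and bd: "bounded {x \<in> closure \<Omega>. u x \<noteq> 0}"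
    and x: "x \<in> \<Omega>" and \<omega>: "\<omega> \<noteq> 0" and t: "t \<ge> 0" and \<kappa>: "\<kappa> > 0"
    and hit: "\<And>\<tau>. \<tau> > 0 \<Longrightarrow> x + \<tau> *\<^sub>R \<omega> \<in> frontier \<Omega> \<Longrightarrow> norm (u (x + \<tau> *\<^sub>R \<omega>)) \<le> t"
  obtains s where "s > 0" "\<And>\<tau>. 0 \<le> \<tau> \<Longrightarrow> \<tau> \<le> s \<Longrightarrow> x + \<tau> *\<^sub>R \<omega> \<in> \<Omega>" "norm (u (x + s *\<^sub>R \<omega>)) \<le> t + \<kappa>"
proof (cases "\<forall>\<tau>\<ge>0. x + \<tau> *\<^sub>R \<omega> \<in> \<Omega>")
  case True
  obtain R where R: "\<And>y. y \<in> closure \<Omega> \<Longrightarrow> u y \<noteq> 0 \<Longrightarrow> norm y \<le> R"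
    using bd unfolding bounded_iff by auto
  define s where "s = (\<bar>R\<bar> + norm x + 1) / norm \<omega>"
  have s: "s > 0" using \<omega> by (auto simp: s_def intro!: divide_pos_pos add_nonneg_pos)
  have "norm (s *\<^sub>R \<omega>) = \<bar>R\<bar> + norm x + 1" using \<omega> s by (simp add: s_def)
  moreover have "norm (s *\<^sub>R \<omega>) \<le> norm (x + s *\<^sub>R \<omega>) + norm x"
    using norm_triangle_ineq4[of "x + s *\<^sub>R \<omega>" x] by simp
  ultimately have "norm (x + s *\<^sub>R \<omega>) > R" by linarith
  moreover have "x + s *\<^sub>R \<omega> \<in> closure \<Omega>" using True s closure_subset by force
  ultimately have "u (x + s *\<^sub>R \<omega>) = 0" using R by force
  with True s t \<kappa> show ?thesis by (intro that[of s]) auto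
next
  case False
  define S where "S = {\<tau>. 0 \<le> \<tau> \<and> x + \<tau> *\<^sub>R \<omega> \<notin> \<Omega>}"
  define \<zeta> where "\<zeta> = Inf S"
  have "closed ({0..} \<inter> (\<lambda>\<tau>. x + \<tau> *\<^sub>R \<omega>) -` (- \<Omega>))"
    using op by (intro continuous_closed_preimage continuous_intros) auto
  moreover have "{0..} \<inter> (\<lambda>\<tau>. x + \<tau> *\<^sub>R \<omega>) -` (- \<Omega>) = S" by (auto simp: S_def)
  ultimately have cS: "closed S" by simp
  have neS: "S \<noteq> {}" using False by (auto simp: S_def)
  have bS: "bdd_below S" by (auto simp: S_def bdd_below_def)
  have \<zeta>S: "\<zeta> \<in> S" unfolding \<zeta>_def by (rule closed_contains_Inf[OF neS bS cS])
  have "\<zeta> \<noteq> 0" using \<zeta>S x by (auto simp: S_def)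
  then have \<zeta>0: "\<zeta> > 0" using \<zeta>S by (simp add: S_def)
  have in\<Omega>: "x + \<tau> *\<^sub>R \<omega> \<in> \<Omega>" if "0 \<le> \<tau>" "\<tau> < \<zeta>" for \<tau>
  proof (rule ccontr)
    assume "x + \<tau> *\<^sub>R \<omega> \<notin> \<Omega>"
    then have "\<tau> \<in> S" using that by (simp add: S_def)
    then have "\<zeta> \<le> \<tau>" unfolding \<zeta>_def by (rule cInf_lower[OF _ bS])
    with that show False by simp
  qed
  define z where "z = x + \<zeta> *\<^sub>R \<omega>"
  have near: "dist (x + s *\<^sub>R \<omega>) z = (\<zeta> - s) * norm \<omega>" if "s \<le> \<zeta>" for s
  proof -
    have "x + s *\<^sub>R \<omega> - z = (s - \<zeta>) *\<^sub>R \<omega>" by (simp add: z_def algebra_simps)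
    then show ?thesis using that by (simp add: dist_norm)
  qed
  have pick: "\<exists>s. 0 < s \<and> s < \<zeta> \<and> (\<zeta> - s) * norm \<omega> < e" if "e > 0" for e
  proof -
    \<comment> \<open>The first entry keeps \<open>s\<close> positive, the second keeps the
      remaining distance at most \<open>e / 2\<close>.\<close>
    define s where "s = max (\<zeta> / 2) (\<zeta> - e / (2 * norm \<omega>))"
    have "\<zeta> - s \<le> e / (2 * norm \<omega>)" by (simp add: s_def)
    then have "(\<zeta> - s) * norm \<omega> \<le> e / (2 * norm \<omega>) * norm \<omega>" by (rule mult_right_mono) simp
    also have "\<dots> = e / 2" using \<omega> by simp
    finally show ?thesis using \<zeta>0 \<omega> that by (intro exI[of _ s]) (auto simp: s_def less_max_iff_disj)
  qed
  have zc: "z \<in> closure \<Omega>"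
  proof (subst closure_approachable, intro allI impI)
    fix e :: real assume "e > 0"
    from pick[OF this] obtain s where "0 < s" "s < \<zeta>" "(\<zeta> - s) * norm \<omega> < e" by blast
    then show "\<exists>y\<in>\<Omega>. dist y z < e" using in\<Omega>[of s] near[of s] by (intro bexI[of _ "x + s *\<^sub>R \<omega>"]) auto
  qed
  moreover have "z \<notin> \<Omega>" using \<zeta>S by (simp add: S_def z_def)
  ultimately have "z \<in> frontier \<Omega>" using op by (simp add: frontier_def interior_open)
  then have uz: "norm (u z) \<le> t" using hit[OF \<zeta>0] by (simp add: z_def)
  obtain d where d: "d > 0" "\<And>y. y \<in> closure \<Omega> \<Longrightarrow> dist y z < d \<Longrightarrow> dist (u y) (u z) < \<kappa>"
    using u zc \<kappa> unfolding continuous_on_iff by metis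
  from pick[OF d(1)] obtain s where s: "0 < s" "s < \<zeta>" "(\<zeta> - s) * norm \<omega> < d" by blast
  have "x + s *\<^sub>R \<omega> \<in> closure \<Omega>" using in\<Omega>[of s] s closure_subset by force
  then have "dist (u (x + s *\<^sub>R \<omega>)) (u z) < \<kappa>" using d(2) near[of s] s by simp
  then have "norm (u (x + s *\<^sub>R \<omega>)) \<le> t + \<kappa>"
    using uz norm_triangle_ineq2[of "u (x + s *\<^sub>R \<omega>)" "u z"] by (simp add: dist_norm)
  with s in\<Omega> show ?thesis by (intro that[of s]) auto
qed

text \<open>For large \<open>k\<close> the mollified values at times \<open>\<delta> k\<close> and
  \<open>s\<close> are close to \<open>u x \<bullet> \<omega>\<close> and to the end value, so
  \<open>ray_difference\<close> gives the bound for each such \<open>k\<close>. The start is at time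
  \<open>\<delta> k\<close> instead of 0 because only from there on does
  \<open>mollified_ray_average_le_riesz\<close> apply. The lower limit is a liminf, the form in
  which Fatou's lemma can be used over the directions.\<close>

lemma ray_bound:
  fixes u :: "real^'n::finite \<Rightarrow> real^'n"
  assumes op: "open \<Omega>" and E: "is_sym_gradient \<Omega> u E" and u: "continuous_on \<Omega> u"
    and C: "\<And>k j. Ck j (\<psi> k)" and \<psi>0: "\<And>k x. \<psi> k x \<ge> 0"
    and supp: "\<And>k x. \<psi> k x \<noteq> 0 \<Longrightarrow> norm x \<le> \<delta> k" and one: "\<And>k. (\<integral>\<^sup>+x. ennreal (\<psi> k x) \<partial>lborel) = 1"
    and \<delta>: "\<And>k. \<delta> k > 0" "\<delta> \<longlonglongrightarrow> 0"
    and gm [measurable]: "g \<in> borel_measurable borel"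
    and g: "AE y in lebesgue. y \<in> \<Omega> \<longrightarrow> ennreal (norm (E y)) \<le> g y"
    and \<omega>: "norm \<omega> \<le> 1" and s: "s > 0" and seg: "\<And>\<tau>. 0 \<le> \<tau> \<Longrightarrow> \<tau> \<le> s \<Longrightarrow> x + \<tau> *\<^sub>R \<omega> \<in> \<Omega>"
    and T: "norm (u (x + s *\<^sub>R \<omega>)) \<le> T" and L: "T + L < \<bar>u x \<bullet> \<omega>\<bar>"
  shows "ennreal L \<le> liminf (\<lambda>k. \<integral>\<^sup>+\<tau>\<in>{\<delta> k..}. (\<integral>\<^sup>+y. g y * ennreal (\<psi> k (x + \<tau> *\<^sub>R \<omega> - y)) \<partial>lborel) \<partial>lborel)"
proof (rule Liminf_bounded)
  define K0 where "K0 = (\<lambda>\<tau>. x + \<tau> *\<^sub>R \<omega>) ` {0..s}"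
  have cK0: "compact K0" unfolding K0_def by (intro compact_continuous_image continuous_intros) auto
  have "K0 \<subseteq> \<Omega>" using seg by (auto simp: K0_def)
  then obtain e where e: "e > 0" "(\<Union>a\<in>K0. cball a e) \<subseteq> \<Omega>"
    using compact_subset_open_imp_cball_epsilon_subset[OF cK0 op] by blast
  \<comment> \<open>The closed neighbourhood is written as a Minkowski sum because sums of compact
    sets are known to be compact.\<close>
  define K where "K = (\<Union>a\<in>K0. \<Union>b\<in>cball 0 e. {a + b})"
  have KK: "K = (\<Union>a\<in>K0. cball a e)"
  proof -
    have "y \<in> K" if "a \<in> K0" "y \<in> cball a e" for a y
      unfolding K_def using that by (intro UN_I[of a] UN_I[of "y - a"]) (auto simp: dist_norm norm_minus_commute)
    moreover have "(\<Union>b\<in>cball 0 e. {a + b}) \<subseteq> cball a e" for a :: "real^'n" by (auto simp: dist_norm)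
    ultimately show ?thesis unfolding K_def by blast
  qed
  have cK: "compact K" unfolding K_def by (intro compact_sums' cK0 compact_cball)
  have K\<Omega>: "K \<subseteq> \<Omega>" using e KK by simp
  have Ks: "cball (x + \<tau> *\<^sub>R \<omega>) d \<subseteq> K" if "0 \<le> \<tau>" "\<tau> \<le> s" "d \<le> e" for \<tau> d
    unfolding KK using that subset_cball[of d e] by (force simp: K0_def)
  \<comment> \<open>Half of the slack: one \<open>\<epsilon>\<close> is lost at each end of the
    segment, and \<open>T + L + 2 * \<epsilon>\<close> is exactly the absolute value of
    \<open>u x \<bullet> \<omega>\<close>.\<close>
  define \<epsilon> where "\<epsilon> = (\<bar>u x \<bullet> \<omega>\<bar> - (T + L)) / 2"
  have \<epsilon>: "\<epsilon> > 0" using L by (simp add: \<epsilon>_def)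
  have "x \<in> \<Omega>" "x + s *\<^sub>R \<omega> \<in> \<Omega>" using seg[of 0] seg[of s] s by auto
  then obtain d0 d1 where d0: "d0 > 0" "\<And>y. y \<in> \<Omega> \<Longrightarrow> dist y x < d0 \<Longrightarrow> dist (u y) (u x) < \<epsilon>"
    and d1: "d1 > 0" "\<And>y. y \<in> \<Omega> \<Longrightarrow> dist y (x + s *\<^sub>R \<omega>) < d1 \<Longrightarrow> dist (u y) (u (x + s *\<^sub>R \<omega>)) < \<epsilon>"
    using u \<epsilon> unfolding continuous_on_iff by metis
  \<comment> \<open>The bound by \<open>e\<close> keeps the tube in \<open>K\<close> and the bound
    by \<open>s\<close> orders the limits of integration. A quarter of \<open>d0\<close> is enough
    at the start because the mollifier centred at time \<open>\<delta> k\<close> sees points up to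
    distance \<open>2 * \<delta> k\<close> from \<open>x\<close>.\<close>
  define d where "d = min (min e s) (min (d0 / 4) (d1 / 4))"
  have d: "d > 0" using e s d0 d1 by (simp add: d_def)
  have "eventually (\<lambda>k. \<delta> k < d) sequentially" using \<delta>(2) d by (rule order_tendstoD)
  then show "\<forall>\<^sub>F k in sequentially. ennreal L \<le> (\<integral>\<^sup>+\<tau>\<in>{\<delta> k..}. (\<integral>\<^sup>+y. g y * ennreal (\<psi> k (x + \<tau> *\<^sub>R \<omega> - y)) \<partial>lborel) \<partial>lborel)"
  proof eventually_elim
    fix k assume k: "\<delta> k < d"
    then have ke: "\<delta> k \<le> e" "\<delta> k \<le> s" "2 * \<delta> k < d0" "\<delta> k < d1" using d0 d1 \<delta>(1)[of k] by (auto simp: d_def)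
    define v where "v y = indicator K y * (u y \<bullet> \<omega>)" for y
    define U where "U \<tau> = (LINT y|lborel. v y * \<psi> k (x + \<tau> *\<^sub>R \<omega> - y))" for \<tau>
    have [measurable]: "\<psi> k \<in> borel_measurable borel"
      using C[of 0 k] by (intro borel_measurable_continuous_onI) simp
    have [measurable]: "v \<in> borel_measurable borel"
    proof -
      have "continuous_on K (\<lambda>y. u y \<bullet> \<omega>)" using continuous_on_subset[OF u K\<Omega>] by (intro continuous_intros)
      then have "(\<lambda>y. indicator K y *\<^sub>R (u y \<bullet> \<omega>)) \<in> borel_measurable borel"
        using cK by (intro borel_measurable_continuous_on_indicator) (auto simp: borel_compact)
      then show ?thesis by (simp add: v_def[abs_def])
    qed
    have vc: "\<bar>v y - c \<bullet> \<omega>\<bar> \<le> \<epsilon>" if "y \<in> K" "dist (u y) c < \<epsilon>" for y c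
    proof -
      have "\<bar>v y - c \<bullet> \<omega>\<bar> = \<bar>(u y - c) \<bullet> \<omega>\<bar>" using that by (simp add: v_def inner_diff_left)
      also have "\<dots> \<le> norm (u y - c) * norm \<omega>" by (rule Cauchy_Schwarz_ineq2)
      also have "\<dots> \<le> norm (u y - c) * 1" using \<omega> by (intro mult_left_mono) auto
      finally show ?thesis using that by (simp add: dist_norm)
    qed
    have U0: "\<bar>U (\<delta> k) - u x \<bullet> \<omega>\<bar> \<le> \<epsilon>"
      unfolding U_def
    proof (rule mollified_value_close[OF _ _ \<psi>0 supp one _ less_imp_le[OF \<epsilon>]])
      fix y assume y: "y \<in> cball (x + \<delta> k *\<^sub>R \<omega>) (\<delta> k)"
      then have yK: "y \<in> K" using Ks[of "\<delta> k" "\<delta> k"] \<delta>(1)[of k] ke by auto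
      have "dist y x \<le> dist y (x + \<delta> k *\<^sub>R \<omega>) + dist (x + \<delta> k *\<^sub>R \<omega>) x" by (rule dist_triangle)
      also have "\<dots> \<le> \<delta> k + \<delta> k * 1"
        using y \<omega> \<delta>(1)[of k] by (intro add_mono) (auto simp: dist_commute dist_norm mult_left_le)
      finally have "dist (u y) (u x) < \<epsilon>" using d0(2) yK K\<Omega> ke by auto
      then show "\<bar>v y - u x \<bullet> \<omega>\<bar> \<le> \<epsilon>" by (rule vc[OF yK])
    qed measurable
    have Us: "\<bar>U s - u (x + s *\<^sub>R \<omega>) \<bullet> \<omega>\<bar> \<le> \<epsilon>"
      unfolding U_def
    proof (rule mollified_value_close[OF _ _ \<psi>0 supp one _ less_imp_le[OF \<epsilon>]])
      fix y assume y: "y \<in> cball (x + s *\<^sub>R \<omega>) (\<delta> k)"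
      then have yK: "y \<in> K" using Ks[of s "\<delta> k"] s ke by auto
      have "dist y (x + s *\<^sub>R \<omega>) < d1" using y ke by (simp add: dist_commute)
      then have "dist (u y) (u (x + s *\<^sub>R \<omega>)) < \<epsilon>" using d1(2) yK K\<Omega> by auto
      then show "\<bar>v y - u (x + s *\<^sub>R \<omega>) \<bullet> \<omega>\<bar> \<le> \<epsilon>" by (rule vc[OF yK])
    qed measurable
    have "\<bar>u (x + s *\<^sub>R \<omega>) \<bullet> \<omega>\<bar> \<le> norm (u (x + s *\<^sub>R \<omega>)) * norm \<omega>" by (rule Cauchy_Schwarz_ineq2)
    also have "\<dots> \<le> norm (u (x + s *\<^sub>R \<omega>)) * 1" using \<omega> by (intro mult_left_mono) auto
    finally have "\<bar>u (x + s *\<^sub>R \<omega>) \<bullet> \<omega>\<bar> \<le> T" using T by simp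
    with U0 Us have "L \<le> \<bar>U s - U (\<delta> k)\<bar>" unfolding \<epsilon>_def by (simp add: field_simps abs_if split: if_splits)
    then have "ennreal L \<le> ennreal \<bar>U s - U (\<delta> k)\<bar>" by (rule ennreal_leI)
    also have "\<dots> \<le> ennreal ((norm \<omega>)\<^sup>2) * (\<integral>\<^sup>+\<tau>\<in>{\<delta> k..s}. (\<integral>\<^sup>+y. g y * ennreal (\<psi> k (x + \<tau> *\<^sub>R \<omega> - y)) \<partial>lborel) \<partial>lborel)"
      unfolding U_def v_def
    proof (rule ray_difference[OF op E u C \<psi>0 supp gm g])
      show "\<delta> k \<le> s" by (rule ke)
      show "cball (x + \<tau> *\<^sub>R \<omega>) (\<delta> k) \<subseteq> K" if "\<delta> k \<le> \<tau>" "\<tau> \<le> s" for \<tau>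
        using Ks[of \<tau> "\<delta> k"] that \<delta>(1)[of k] ke by auto
    qed (use cK K\<Omega> in auto)
    also have "\<dots> \<le> 1 * (\<integral>\<^sup>+\<tau>\<in>{\<delta> k..s}. (\<integral>\<^sup>+y. g y * ennreal (\<psi> k (x + \<tau> *\<^sub>R \<omega> - y)) \<partial>lborel) \<partial>lborel)"
    proof (rule mult_right_mono)
      have "(norm \<omega>)\<^sup>2 \<le> 1" using \<omega> by (simp add: power_le_one)
      then show "ennreal ((norm \<omega>)\<^sup>2) \<le> 1" by simp
    qed simp
    also have "\<dots> \<le> (\<integral>\<^sup>+\<tau>\<in>{\<delta> k..}. (\<integral>\<^sup>+y. g y * ennreal (\<psi> k (x + \<tau> *\<^sub>R \<omega> - y)) \<partial>lborel) \<partial>lborel)"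
      unfolding mult_1 by (intro nn_integral_mono) (auto simp: indicator_def)
    finally show "ennreal L \<le> (\<integral>\<^sup>+\<tau>\<in>{\<delta> k..}. (\<integral>\<^sup>+y. g y * ennreal (\<psi> k (x + \<tau> *\<^sub>R \<omega> - y)) \<partial>lborel) \<partial>lborel)" .
  qed
qed

text \<open>The hypothesis \<open>hit\<close> says that the ray transform of \<open>f\<close> is at least 1 along every ray meeting the set where
  the boundary values exceed \<open>t\<close>. On the ball \<open>P\<close> of directions below, one has \<open>u x \<bullet> \<omega> \<ge> norm (u x) / 2\<close>.\<close>

lemma pointwise_riesz_estimate:
  fixes u :: "real^'n::finite \<Rightarrow> real^'n"
  assumes op: "open \<Omega>" and E: "is_sym_gradient \<Omega> u E" and u: "continuous_on (closure \<Omega>) u"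
    and bd: "bounded {x \<in> closure \<Omega>. u x \<noteq> 0}"
    and gm [measurable]: "g \<in> borel_measurable borel"
    and g: "AE y in lebesgue. y \<in> \<Omega> \<longrightarrow> ennreal (norm (E y)) \<le> g y"
    and fm [measurable]: "f \<in> borel_measurable borel"
    and hit: "\<And>\<omega> \<tau>. norm \<omega> < 1 \<Longrightarrow> \<tau> > 0 \<Longrightarrow> x + \<tau> *\<^sub>R \<omega> \<in> frontier \<Omega> \<Longrightarrow> norm (u (x + \<tau> *\<^sub>R \<omega>)) > t
        \<Longrightarrow> 1 \<le> (\<integral>\<^sup>+\<tau>\<in>{0<..}. f (x + \<tau> *\<^sub>R \<omega>) \<partial>lborel)"
    and x: "x \<in> \<Omega>" and t: "t \<ge> 0" and lam: "l > 0" and big: "norm (u x) > 2 * (t + l)"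
  shows "emeasure lborel (ball (0::real^'n) (1/4)) \<le> riesz f x + ennreal (1 / l) * riesz g x"
proof -
  define \<delta> where "\<delta> k = 1 / real (Suc k)" for k
  have \<delta>: "\<delta> k > 0" "\<delta> \<longlonglongrightarrow> 0" for k
    unfolding \<delta>_def[abs_def] using LIMSEQ_inverse_real_of_nat by (auto simp: inverse_eq_divide)
  have "\<exists>p :: real^'n \<Rightarrow> real. (\<forall>j. Ck j p) \<and> (\<forall>x. p x \<ge> 0) \<and> (\<forall>x. p x \<noteq> 0 \<longrightarrow> norm x \<le> \<delta> k)
      \<and> (\<integral>\<^sup>+x. ennreal (p x) \<partial>lborel) = 1" for k
    using mollifier_exists[OF \<delta>(1)[of k]] by (metis (full_types))
  then obtain \<psi> :: "nat \<Rightarrow> real^'n \<Rightarrow> real" where C: "\<And>k j. Ck j (\<psi> k)" and \<psi>0: "\<And>k x. \<psi> k x \<ge> 0"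
    and supp: "\<And>k x. \<psi> k x \<noteq> 0 \<Longrightarrow> norm x \<le> \<delta> k" and one: "\<And>k. (\<integral>\<^sup>+x. ennreal (\<psi> k x) \<partial>lborel) = 1"
    by metis
  have [measurable]: "\<psi> k \<in> borel_measurable borel" for k
    using C[of 0 k] by (intro borel_measurable_continuous_onI) simp
  define J where "J k \<omega> = (\<integral>\<^sup>+\<tau>\<in>{\<delta> k..}. (\<integral>\<^sup>+y. g y * ennreal (\<psi> k (x + \<tau> *\<^sub>R \<omega> - y)) \<partial>lborel) \<partial>lborel)" for k \<omega>
  define X where "X \<omega> = (\<integral>\<^sup>+\<tau>\<in>{0<..}. f (x + \<tau> *\<^sub>R \<omega>) \<partial>lborel)" for \<omega>
  have [measurable]: "J k \<in> borel_measurable borel" for k unfolding J_def by measurable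
  have [measurable]: "X \<in> borel_measurable borel" unfolding X_def by measurable
  define v where "v = u x"
  have "0 < 2 * (t + l)" using t lam by simp
  then have v0: "norm v > 0" using big unfolding v_def by (rule less_trans)
  \<comment> \<open>With centre of norm 3/4 and radius 1/4 the ball \<open>P\<close> stays inside
    the unit ball, and Cauchy-Schwarz gives
    \<open>v \<bullet> \<omega> \<ge> (3/4 - 1/4) * norm v\<close> on it.\<close>
  define p where "p = (3 / (4 * norm v)) *\<^sub>R v"
  define P where "P = ball p (1/4)"
  have np: "norm p = 3 / 4" using v0 by (simp add: p_def)
  have pv: "v \<bullet> p = 3 / 4 * norm v" using v0 by (simp add: p_def power2_norm_eq_inner[symmetric] power2_eq_square)
  have P: "norm \<omega> < 1" "\<omega> \<noteq> 0" "t + l < \<bar>v \<bullet> \<omega>\<bar>" if "\<omega> \<in> P" for \<omega>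
  proof -
    have d: "norm (\<omega> - p) < 1 / 4" using that by (simp add: P_def dist_norm norm_minus_commute)
    show "norm \<omega> < 1" using norm_triangle_ineq[of "\<omega> - p" p] d np by simp
    show "\<omega> \<noteq> 0" using d np by auto
    have "\<bar>v \<bullet> (\<omega> - p)\<bar> \<le> norm v * norm (\<omega> - p)" by (rule Cauchy_Schwarz_ineq2)
    also have "\<dots> \<le> norm v * (1 / 4)" using d by (intro mult_left_mono) auto
    finally have "\<bar>v \<bullet> \<omega> - 3 / 4 * norm v\<bar> \<le> norm v * (1 / 4)" by (simp only: inner_diff_right pv)
    then have "v \<bullet> \<omega> \<ge> norm v / 2" unfolding abs_le_iff by linarith
    then show "t + l < \<bar>v \<bullet> \<omega>\<bar>" using big by (simp add: v_def)
  qed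
  have u': "continuous_on \<Omega> u" using u closure_subset by (rule continuous_on_subset)
  \<comment> \<open>A dichotomy for each direction: if the ray transform of \<open>f\<close> is
    below 1, then by \<open>hit\<close> the ray meets no boundary point with value above
    \<open>t\<close>, so the whole drop has to be paid for by the symmetric gradient.\<close>
  have key: "1 \<le> X \<omega> + ennreal (1 / l) * liminf (\<lambda>k. J k \<omega>)" if wP: "\<omega> \<in> P" for \<omega>
  proof (cases "1 \<le> X \<omega>")
    case True
    then show ?thesis by (simp add: add_increasing2)
  next
    case False
    \<comment> \<open>Half of the gap is spent on stopping before the boundary; the other half keeps
      the strict inequality that \<open>ray_bound\<close> asks for.\<close>
    define \<kappa> where "\<kappa> = (\<bar>v \<bullet> \<omega>\<bar> - (t + l)) / 2"
    have \<kappa>: "\<kappa> > 0" using P(3)[OF wP] by (simp add: \<kappa>_def)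
    have h: "norm (u (x + \<tau> *\<^sub>R \<omega>)) \<le> t" if "\<tau> > 0" "x + \<tau> *\<^sub>R \<omega> \<in> frontier \<Omega>" for \<tau>
      using hit[OF P(1)[OF wP] that] False unfolding X_def by force
    obtain s where s: "s > 0" "\<And>\<tau>. 0 \<le> \<tau> \<Longrightarrow> \<tau> \<le> s \<Longrightarrow> x + \<tau> *\<^sub>R \<omega> \<in> \<Omega>" "norm (u (x + s *\<^sub>R \<omega>)) \<le> t + \<kappa>"
      using ray_reaches_small_value[OF op u bd x P(2)[OF wP] t \<kappa> h] by blast
    have "t + \<kappa> + l < \<bar>u x \<bullet> \<omega>\<bar>" using P(3)[OF wP] by (simp add: \<kappa>_def v_def[symmetric] field_simps)
    from ray_bound[OF op E u' C \<psi>0 supp one \<delta> gm g less_imp_le[OF P(1)[OF wP]] s this]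
    have l: "ennreal l \<le> liminf (\<lambda>k. J k \<omega>)" unfolding J_def .
    have "1 = ennreal (1 / l) * ennreal l" using lam by (simp add: ennreal_mult[symmetric])
    also have "\<dots> \<le> ennreal (1 / l) * liminf (\<lambda>k. J k \<omega>)" by (intro mult_left_mono l) simp
    finally show ?thesis by (simp add: add_increasing)
  qed
  have P1: "P \<subseteq> ball 0 1" using P(1) by auto
  have "emeasure lborel (ball (0::real^'n) (1/4)) = emeasure lborel P" by (simp add: P_def emeasure_ball)
  also have "\<dots> = (\<integral>\<^sup>+\<omega>. indicator P \<omega> \<partial>lborel)" by (simp add: P_def)
  also have "\<dots> \<le> (\<integral>\<^sup>+\<omega>. X \<omega> * indicator (ball 0 1) \<omega> + ennreal (1 / l) * liminf (\<lambda>k. J k \<omega> * indicator (ball 0 1) \<omega>) \<partial>lborel)"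
  proof (rule nn_integral_mono)
    fix \<omega> :: "real^'n"
    show "indicator P \<omega> \<le> X \<omega> * indicator (ball 0 1) \<omega> + ennreal (1 / l) * liminf (\<lambda>k. J k \<omega> * indicator (ball 0 1) \<omega>)"
      using key[of \<omega>] P1 by (cases "\<omega> \<in> P") auto
  qed
  also have "\<dots> = (\<integral>\<^sup>+\<omega>\<in>ball 0 1. X \<omega> \<partial>lborel) + ennreal (1 / l) * (\<integral>\<^sup>+\<omega>. liminf (\<lambda>k. J k \<omega> * indicator (ball 0 1) \<omega>) \<partial>lborel)"
    by (subst nn_integral_add) (auto simp: nn_integral_cmult)
  also have "\<dots> \<le> riesz f x + ennreal (1 / l) * riesz g x"
  \<comment> \<open>Fatou's lemma moves the liminf outside the average over directions, where the
    bound by \<open>riesz g x\<close> holds for every \<open>k\<close>.\<close>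
  proof (intro add_mono mult_left_mono)
    show "(\<integral>\<^sup>+\<omega>\<in>ball 0 1. X \<omega> \<partial>lborel) \<le> riesz f x" unfolding X_def by (rule ray_average_le_riesz[OF fm])
    have "(\<integral>\<^sup>+\<omega>. liminf (\<lambda>k. J k \<omega> * indicator (ball 0 1) \<omega>) \<partial>lborel)
      \<le> liminf (\<lambda>k. (\<integral>\<^sup>+\<omega>\<in>ball 0 1. J k \<omega> \<partial>lborel))"
      by (rule nn_integral_liminf) measurable
    also have "\<dots> \<le> liminf (\<lambda>k. riesz g x)"
      unfolding J_def by (intro Liminf_mono always_eventually allI mollified_ray_average_le_riesz supp one \<delta>) measurable
    also have "\<dots> = riesz g x" by (simp add: Liminf_const)
    finally show "(\<integral>\<^sup>+\<omega>. liminf (\<lambda>k. J k \<omega> * indicator (ball 0 1) \<omega>) \<partial>lborel) \<le> riesz g x" .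
  qed simp
  finally show ?thesis .
qed

section \<open>Level sets and Hausdorff content\<close>

text \<open>Only the content at scale 1 is used, which the outer measure dominates. The factor
  \<open>2 ^ d / unit_ball_vol d\<close> undoes the normalisation of the weight; the cover found has
  weight below \<open>2 * c\<close>, and the extra \<open>c\<close> pays for enlarging the sets to
  open balls.\<close>

lemma hausdorff_outer_ball_cover:
  fixes A :: "'a::euclidean_space set"
  assumes d: "d \<ge> 1" and A: "hausdorff_outer d A \<le> ennreal c" and c: "c > 0"
  obtains y r where "\<And>i::nat. r i > 0" "A \<subseteq> (\<Union>i. ball (y i) (r i))"
    "(\<Sum>i. ennreal (r i ^ d)) \<le> ennreal ((2 ^ (d + 1) / unit_ball_vol (real d) + 1) * c)"
proof -
  let ?V = "unit_ball_vol (real d)"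
  have V: "?V > 0" by simp
  have "hausdorff_pre d 1 A \<le> hausdorff_outer d A" unfolding hausdorff_outer_def by (rule SUP_upper) simp
  also have "\<dots> < ennreal (2 * c)" by (rule le_less_trans[OF A]) (use c in \<open>simp add: ennreal_less_iff\<close>)
  finally obtain U where U: "U \<in> hausdorff_covers 1 A" and Us: "(\<Sum>i. hausdorff_weight d (U i)) < ennreal (2 * c)"
    unfolding hausdorff_pre_def INF_less_iff by blast
  define D where "D i = diameter (U i)" for i
  have bU: "bounded (U i)" for i using U by (auto simp: hausdorff_covers_def)
  have D0: "D i \<ge> 0" for i unfolding D_def by (rule diameter_ge_0[OF bU])
  \<comment> \<open>Covering sets may have diameter 0, and a set need not lie in an open ball of
    radius equal to its diameter. Adding the summable \<open>e i\<close> to the \<open>d\<close>-th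
    powers makes every radius positive and strictly larger than the diameter.\<close>
  define e where "e i = c * (1/2) ^ Suc i" for i :: nat
  have e0: "e i > 0" for i using c by (simp add: e_def)
  define r where "r i = root d (D i ^ d + e i)" for i
  have rd: "r i ^ d = D i ^ d + e i" for i
    unfolding r_def using d D0[of i] e0[of i] by (intro real_root_pow_pos2) auto
  have r0: "r i > 0" for i unfolding r_def using d D0[of i] e0[of i] by (intro real_root_gt_zero) (auto intro: add_nonneg_pos)
  have Dr: "D i < r i" for i
  proof (rule power_less_imp_less_base)
    show "D i ^ d < r i ^ d" using rd e0 by simp
    show "0 \<le> r i" using r0[of i] by simp
  qed
  define y where "y i = (SOME z. z \<in> U i)" for i
  have Ub: "U i \<subseteq> ball (y i) (r i)" for i
  proof
    fix z assume z: "z \<in> U i"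
    then have "y i \<in> U i" unfolding y_def by (rule someI)
    then have "dist (y i) z \<le> D i" unfolding D_def using z by (intro diameter_bounded_bound bU)
    then show "z \<in> ball (y i) (r i)" using Dr[of i] by simp
  qed
  have "A \<subseteq> (\<Union>i. U i)" using U by (simp add: hausdorff_covers_def)
  also have "\<dots> \<subseteq> (\<Union>i. ball (y i) (r i))" by (intro UN_mono Ub) auto
  finally have cov: "A \<subseteq> (\<Union>i. ball (y i) (r i))" .
  have w: "hausdorff_weight d (U i) = ennreal (?V / 2 ^ d) * ennreal (D i ^ d)" for i
  proof (cases "U i = {}")
    case True
    then show ?thesis using d by (simp add: hausdorff_weight_def D_def diameter_def)
  next
    case False
    then show ?thesis using V D0[of i]
      by (simp add: hausdorff_weight_def D_def[symmetric] power_divide ennreal_mult[symmetric])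
  qed
  have "ennreal (2 ^ d / ?V) * (\<Sum>i. hausdorff_weight d (U i)) = (\<Sum>i. ennreal (2 ^ d / ?V) * (ennreal (?V / 2 ^ d) * ennreal (D i ^ d)))"
    unfolding w by simp
  also have "\<dots> = (\<Sum>i. ennreal (D i ^ d))"
  proof (rule arg_cong[where f = suminf], rule ext)
    fix i show "ennreal (2 ^ d / ?V) * (ennreal (?V / 2 ^ d) * ennreal (D i ^ d)) = ennreal (D i ^ d)"
      using less_imp_neq[OF V] D0[of i] by (simp add: ennreal_mult[symmetric] del: unit_ball_vol_pos)
  qed
  finally have sD: "(\<Sum>i. ennreal (D i ^ d)) = ennreal (2 ^ d / ?V) * (\<Sum>i. hausdorff_weight d (U i))" ..
  have "e sums (c * 1)" unfolding e_def by (intro sums_mult power_half_series)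
  then have se: "(\<Sum>i. ennreal (e i)) = ennreal c" using e0 c by (subst suminf_ennreal_eq[where x = c]) (auto intro: less_imp_le)
  have "(\<Sum>i. ennreal (r i ^ d)) = (\<Sum>i. ennreal (D i ^ d) + ennreal (e i))"
    unfolding rd using D0 e0 by (simp add: less_imp_le)
  also have "\<dots> = (\<Sum>i. ennreal (D i ^ d)) + (\<Sum>i. ennreal (e i))" by (rule suminf_add[symmetric]) auto
  also have "\<dots> \<le> ennreal (2 ^ d / ?V) * ennreal (2 * c) + ennreal c"
    unfolding sD se using Us by (intro add_right_mono mult_left_mono) auto
  also have "\<dots> = ennreal ((2 ^ (d + 1) / ?V + 1) * c)"
    using V c by (simp add: ennreal_mult[symmetric] ennreal_plus[symmetric] distrib_left distrib_right mult_ac del: ennreal_plus)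
  finally show thesis using that[of r y] r0 cov by blast
qed

text \<open>A ray meeting \<open>ball (y i) (r i)\<close> spends at least time \<open>r i\<close> in the doubled ball, while the \<open>L\<^sup>1\<close> norm of
  this function is of the order of the sum of the \<open>r i ^ (n - 1)\<close>, i.e. of the Hausdorff content of the covered set.\<close>

definition cover_density :: "(nat \<Rightarrow> 'a::euclidean_space) \<Rightarrow> (nat \<Rightarrow> real) \<Rightarrow> 'a \<Rightarrow> ennreal" where
  "cover_density y r z = (\<Sum>i. ennreal (1 / r i) * indicator (ball (y i) (2 * r i)) z)"

lemma cover_density_measurable [measurable]: "cover_density y r \<in> borel_measurable borel"
  unfolding cover_density_def[abs_def] by measurable

lemma nn_integral_cover_density:
  fixes y :: "nat \<Rightarrow> 'a::euclidean_space"
  assumes r: "\<And>i. r i > 0"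
  shows "(\<integral>\<^sup>+z. cover_density y r z \<partial>lborel)
    = ennreal (unit_ball_vol (real DIM('a)) * 2 ^ DIM('a)) * (\<Sum>i. ennreal (r i ^ (DIM('a) - 1)))"
proof -
  have "(\<integral>\<^sup>+z. cover_density y r z \<partial>lborel) = (\<Sum>i. ennreal (1 / r i) * emeasure lborel (ball (y i) (2 * r i)))"
    unfolding cover_density_def by (subst nn_integral_suminf) (auto simp: nn_integral_cmult_indicator)
  also have "\<dots> = (\<Sum>i. ennreal (unit_ball_vol (real DIM('a)) * 2 ^ DIM('a)) * ennreal (r i ^ (DIM('a) - 1)))"
  proof (rule arg_cong[where f = suminf], rule ext)
    fix i
    have "r i ^ DIM('a) = r i * r i ^ (DIM('a) - 1)" by (simp add: power_eq_if)
    then show "ennreal (1 / r i) * emeasure lborel (ball (y i) (2 * r i))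
      = ennreal (unit_ball_vol (real DIM('a)) * 2 ^ DIM('a)) * ennreal (r i ^ (DIM('a) - 1))"
      using r[of i] by (simp add: emeasure_ball ennreal_mult[symmetric] power_mult_distrib)
  qed
  also have "\<dots> = ennreal (unit_ball_vol (real DIM('a)) * 2 ^ DIM('a)) * (\<Sum>i. ennreal (r i ^ (DIM('a) - 1)))"
    by (rule ennreal_suminf_cmult)
  finally show ?thesis .
qed

text \<open>The direction has norm below 1, so within time \<open>r i\<close> after the hit the ray
  moves by less than \<open>r i\<close> and remains in the doubled ball, where the density is at
  least \<open>1 / r i\<close>.\<close>

lemma cover_density_ray:
  fixes y :: "nat \<Rightarrow> 'a::euclidean_space"
  assumes r: "r i > 0" and \<omega>: "norm \<omega> < 1" and \<tau>: "\<tau> > 0" and hit: "x + \<tau> *\<^sub>R \<omega> \<in> ball (y i) (r i)"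
  shows "1 \<le> (\<integral>\<^sup>+\<tau>\<in>{0<..}. cover_density y r (x + \<tau> *\<^sub>R \<omega>) \<partial>lborel)"
proof -
  have "1 = ennreal (1 / r i) * ennreal (r i)" using r by (simp add: ennreal_mult[symmetric])
  also have "\<dots> = (\<integral>\<^sup>+t. ennreal (1 / r i) * indicator {\<tau><..<\<tau> + r i} t \<partial>lborel)"
    using r by (simp add: nn_integral_cmult_indicator)
  also have "\<dots> \<le> (\<integral>\<^sup>+\<tau>\<in>{0<..}. cover_density y r (x + \<tau> *\<^sub>R \<omega>) \<partial>lborel)"
  proof (rule nn_integral_mono)
    fix t :: real
    show "ennreal (1 / r i) * indicator {\<tau><..<\<tau> + r i} t \<le> cover_density y r (x + t *\<^sub>R \<omega>) * indicator {0<..} t"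
    proof (cases "t \<in> {\<tau><..<\<tau> + r i}")
      case True
      have "dist (x + \<tau> *\<^sub>R \<omega>) (x + t *\<^sub>R \<omega>) = \<bar>\<tau> - t\<bar> * norm \<omega>"
        by (simp add: dist_norm scaleR_diff_left[symmetric])
      also have "\<dots> \<le> \<bar>\<tau> - t\<bar> * 1" using \<omega> by (intro mult_left_mono) auto
      also have "\<dots> < r i" using True by simp
      moreover have "dist (y i) (x + \<tau> *\<^sub>R \<omega>) < r i" using hit by simp
      ultimately have "dist (y i) (x + t *\<^sub>R \<omega>) < 2 * r i"
        using dist_triangle[of "y i" "x + t *\<^sub>R \<omega>" "x + \<tau> *\<^sub>R \<omega>"] by linarith
      then have "ennreal (1 / r i) = ennreal (1 / r i) * indicator (ball (y i) (2 * r i)) (x + t *\<^sub>R \<omega>)" by simp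
      also have "\<dots> \<le> cover_density y r (x + t *\<^sub>R \<omega>)"
      proof -
        define F where "F j = ennreal (1 / r j) * indicator (ball (y j) (2 * r j)) (x + t *\<^sub>R \<omega>)" for j
        have "sum F {i} \<le> suminf F" by (intro sum_le_suminf) auto
        then have "F i \<le> suminf F" by simp
        then show ?thesis unfolding F_def[abs_def] cover_density_def .
      qed
      finally show ?thesis using True \<tau> by simp
    qed simp
  qed
  finally show ?thesis .
qed

text \<open>If \<open>norm (u x) > 2 * (t + l)\<close>, then by
  \<open>pointwise_riesz_estimate\<close> one of the two potentials is large. The allowed measure
  \<open>s\<close> is shared equally: \<open>riesz_weak_L1\<close> controls the potential of the
  cover density and \<open>riesz_weak_rearrangement\<close> that of \<open>g\<close>. The functions
  \<open>fs\<close> and \<open>gs\<close> are arbitrary bounds for the two distribution functions,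
  so the same statement serves any choice of boundary and interior rearrangement.\<close>

lemma level_set_estimate:
  fixes b C :: real
  assumes n: "CARD('n::finite) \<ge> 2" and b: "b > real CARD('n) - 1" and C: "C > 0"
  obtains a K where "a > 0" "K > 0"
    "\<And>\<Omega> (\<nu>::(real^'n) measure) u E g fs gs s T. open \<Omega> \<Longrightarrow> ball_growth \<nu> b C \<Longrightarrow> is_sym_gradient \<Omega> u E
      \<Longrightarrow> continuous_on (closure \<Omega>) u \<Longrightarrow> bounded {x \<in> closure \<Omega>. u x \<noteq> 0}
      \<Longrightarrow> g \<in> borel_measurable borel \<Longrightarrow> (AE y in lebesgue. y \<in> \<Omega> \<longrightarrow> ennreal (norm (E y)) \<le> g y)
      \<Longrightarrow> (\<And>r t. r > 0 \<Longrightarrow> t > 0 \<Longrightarrow> fs r < ennreal t \<Longrightarrow> emeasure lborel {y. ennreal t < g y} \<le> ennreal r)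
      \<Longrightarrow> (\<And>r t. r > 0 \<Longrightarrow> t > 0 \<Longrightarrow> gs r < ennreal t
            \<Longrightarrow> hausdorff_outer (CARD('n) - 1) {y \<in> frontier \<Omega>. t < norm (u y)} \<le> ennreal r)
      \<Longrightarrow> s > 0 \<Longrightarrow> 2 * gs (a * s powr ((real CARD('n) - 1) / b))
          + ennreal K * hardy_op (real CARD('n)) fs ((1/2) powr (real CARD('n) / b) * s powr (real CARD('n) / b)) < ennreal T
      \<Longrightarrow> \<exists>M\<in>sets borel. {x \<in> \<Omega>. T \<le> norm (u x)} \<subseteq> M \<and> emeasure \<nu> M \<le> ennreal s"
proof -
  let ?n = "real CARD('n)"
  let ?V = "unit_ball_vol ?n"
  have n1: "?n > 1" using n by simp
  have b0: "b > 0" using b n1 by simp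
  have dim: "DIM(real^'n) = CARD('n)" by simp
  have nD: "DIM(real^'n) \<ge> 2" using n by simp
  have bD: "b > real DIM(real^'n) - 1" using b by simp
  define K1 where "K1 = riesz_const ?n b C"
  define K2 where "K2 = max K1 (riesz_const ?n ?n ?V)"
  have K1: "K1 > 0" using riesz_const_pos[OF n1 b] C by (simp add: K1_def)
  then have K2: "K2 > 0" by (simp add: K2_def)
  define c0 where "c0 = ?V * (1/4) ^ CARD('n)"
  have c0: "c0 > 0" by (simp add: c0_def)
  have vol: "emeasure lborel (ball (0::real^'n) (1/4)) = ennreal c0" by (simp add: emeasure_ball c0_def)
  define Kh where "Kh = 2 ^ CARD('n) / unit_ball_vol (real (CARD('n) - 1)) + 1"
  have Kh: "Kh > 0" unfolding Kh_def by (intro add_nonneg_pos divide_nonneg_nonneg) auto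
  \<comment> \<open>\<open>W * c\<close> is the base of the power in \<open>riesz_weak_L1\<close> at
    level \<open>c0 / 2\<close>, when the boundary content is at most \<open>c\<close> and the
    density therefore has integral at most \<open>?V * 2 ^ CARD('n) * Kh * c\<close>.\<close>
  define W where "W = 2 * K1 * ?V * 2 ^ CARD('n) * Kh / c0"
  have W: "W > 0" using K1 Kh c0 by (simp add: W_def)
  \<comment> \<open>Solves \<open>W * (a * s powr ((?n - 1) / b)) = (s / 2) powr ((?n - 1) /
    b)\<close>, so that the set coming from the boundary has measure at most
    \<open>s / 2\<close>.\<close>
  define a where "a = (1/2) powr ((?n - 1) / b) / W"
  have a: "a > 0" using W by (simp add: a_def)
  \<comment> \<open>With \<open>l\<close> slightly above \<open>K * h / 2\<close>, the level
    \<open>l * c0 / 2\<close> for the second potential is slightly above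
    \<open>K2 * h\<close>.\<close>
  define K where "K = 4 * K2 / c0"
  have K: "K > 0" using K2 c0 by (simp add: K_def)
  show thesis
  proof (rule that[OF a K])
    fix \<Omega> :: "(real^'n) set" and \<nu> :: "(real^'n) measure" and u E g fs gs and s T :: real
    assume op: "open \<Omega>" and gr: "ball_growth \<nu> b C" and E: "is_sym_gradient \<Omega> u E"
      and u: "continuous_on (closure \<Omega>) u" and bd: "bounded {x \<in> closure \<Omega>. u x \<noteq> 0}"
      and gm: "g \<in> borel_measurable borel" and g: "AE y in lebesgue. y \<in> \<Omega> \<longrightarrow> ennreal (norm (E y)) \<le> g y"
      and fs: "\<And>r t. r > 0 \<Longrightarrow> t > 0 \<Longrightarrow> fs r < ennreal t \<Longrightarrow> emeasure lborel {y. ennreal t < g y} \<le> ennreal r"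
      and gs: "\<And>r t. r > 0 \<Longrightarrow> t > 0 \<Longrightarrow> gs r < ennreal t
            \<Longrightarrow> hausdorff_outer (CARD('n) - 1) {y \<in> frontier \<Omega>. t < norm (u y)} \<le> ennreal r"
      and s: "s > 0" and lt: "2 * gs (a * s powr ((?n - 1) / b))
          + ennreal K * hardy_op ?n fs ((1/2) powr (?n / b) * s powr (?n / b)) < ennreal T"
    define c where "c = a * s powr ((?n - 1) / b)"
    have c: "c > 0" using a s by (simp add: c_def)
    define H where "H = hardy_op ?n fs ((s / 2) powr (?n / b))"
    have sH: "(1/2) powr (?n / b) * s powr (?n / b) = (s / 2) powr (?n / b)"
      using s by (simp add: powr_mult[symmetric])
    have lt': "2 * gs c + ennreal K * H < ennreal T" using lt unfolding sH H_def c_def .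
    have "gs c \<noteq> \<infinity>" using lt' by (auto simp: ennreal_mult_top)
    then obtain G where G: "gs c = ennreal G" "G \<ge> 0" by (cases "gs c") auto
    have "H \<noteq> \<infinity>" using lt' K by (auto simp: ennreal_mult_top)
    then obtain h where h: "H = ennreal h" "h \<ge> 0" by (cases H) auto
    have "ennreal (2 * G + K * h) < ennreal T"
      using lt' G h K by (simp add: ennreal_mult ennreal_plus)
    then have ltT: "2 * G + K * h < T" using G h K by (subst (asm) ennreal_less_iff) auto
    \<comment> \<open>Then \<open>2 * (t + l) = 2 * G + K * h + 4 * \<gamma>\<close> uses half of
      the slack below \<open>T\<close>, while \<open>t\<close> and \<open>l\<close> strictly exceed
      \<open>G\<close> and \<open>K * h / 2\<close>.\<close>
    define \<gamma> where "\<gamma> = (T - (2 * G + K * h)) / 8"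
    have \<gamma>: "\<gamma> > 0" using ltT by (simp add: \<gamma>_def)
    define t where "t = G + \<gamma>"
    define l where "l = K * h / 2 + \<gamma>"
    have t: "t > 0" and l: "l > 0" using G h K \<gamma> by (auto simp: t_def l_def intro!: add_nonneg_pos)
    have tl: "2 * (t + l) < T" using \<gamma> by (simp add: t_def l_def \<gamma>_def field_simps)
    have gt: "gs c < ennreal t" using G \<gamma> by (simp add: t_def ennreal_less_iff)
    have n': "CARD('n) - 1 \<ge> 1" using n by simp
    obtain y r where r: "\<And>i. r i > 0"
      and cov: "{y \<in> frontier \<Omega>. t < norm (u y)} \<subseteq> (\<Union>i. ball (y i) (r i))"
      and sr: "(\<Sum>i. ennreal (r i ^ (CARD('n) - 1))) \<le> ennreal ((2 ^ (CARD('n) - 1 + 1) / unit_ball_vol (real (CARD('n) - 1)) + 1) * c)"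
      by (rule hausdorff_outer_ball_cover[OF n' gs[OF c t gt] c]) blast
    define f where "f = cover_density y r"
    have fm: "f \<in> borel_measurable borel" unfolding f_def by measurable
    have "(\<integral>\<^sup>+z. f z \<partial>lborel) = ennreal (?V * 2 ^ CARD('n)) * (\<Sum>i. ennreal (r i ^ (CARD('n) - 1)))"
      unfolding f_def using nn_integral_cover_density[of r y, OF r] by simp
    also have "\<dots> \<le> ennreal (?V * 2 ^ CARD('n)) * ennreal (Kh * c)"
      using sr n by (intro mult_left_mono) (auto simp: Kh_def)
    also have "\<dots> = ennreal (?V * 2 ^ CARD('n) * Kh * c)" using Kh c by (simp add: ennreal_mult[symmetric] mult_ac)
    finally have fF: "(\<integral>\<^sup>+z. f z \<partial>lborel) \<le> ennreal (?V * 2 ^ CARD('n) * Kh * c)" .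
    \<comment> \<open>The total \<open>c0\<close> of the pointwise estimate is split in half between
      the two potentials; the second carries the factor \<open>1 / l\<close>.\<close>
    define M1 where "M1 = {x. ennreal (c0 / 2) \<le> riesz f x}"
    define M2 where "M2 = {x. ennreal (l * c0 / 2) \<le> riesz g x}"
    have [measurable]: "M1 \<in> sets borel" "M2 \<in> sets borel"
      unfolding M1_def M2_def using fm gm by measurable
    have "{x \<in> \<Omega>. T \<le> norm (u x)} \<subseteq> M1 \<union> M2"
    proof (rule subsetI, rule ccontr)
      fix x assume x: "x \<in> {x \<in> \<Omega>. T \<le> norm (u x)}" and no: "x \<notin> M1 \<union> M2"
      have hit: "1 \<le> (\<integral>\<^sup>+\<tau>\<in>{0<..}. f (x + \<tau> *\<^sub>R \<omega>) \<partial>lborel)"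
        if "norm \<omega> < 1" "\<tau> > 0" "x + \<tau> *\<^sub>R \<omega> \<in> frontier \<Omega>" "norm (u (x + \<tau> *\<^sub>R \<omega>)) > t" for \<omega> \<tau>
      proof -
        from that cov obtain i where "x + \<tau> *\<^sub>R \<omega> \<in> ball (y i) (r i)" by blast
        then show ?thesis unfolding f_def using r that by (intro cover_density_ray) auto
      qed
      have "norm (u x) > 2 * (t + l)" using tl x by simp
      from pointwise_riesz_estimate[OF op E u bd gm g fm hit _ less_imp_le[OF t] l this] x
      have le: "ennreal c0 \<le> riesz f x + ennreal (1 / l) * riesz g x" unfolding vol by auto
      from no have 1: "riesz f x < ennreal (c0 / 2)" and 2: "riesz g x < ennreal (l * c0 / 2)"
        by (auto simp: M1_def M2_def)
      have "ennreal (1 / l) * riesz g x < ennreal (1 / l) * ennreal (l * c0 / 2)"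
        using l by (intro ennreal_mult_strict_left_mono 2) auto
      also have "\<dots> = ennreal (c0 / 2)" using l c0 by (simp add: ennreal_mult[symmetric])
      finally have "riesz f x + ennreal (1 / l) * riesz g x < ennreal (c0 / 2) + ennreal (c0 / 2)"
        using 1 by (intro add_strict_mono)
      also have "\<dots> = ennreal c0" using c0 by (simp add: ennreal_plus[symmetric] del: ennreal_plus)
      finally show False using le by simp
    qed
    moreover have "emeasure \<nu> (M1 \<union> M2) \<le> ennreal s"
    proof -
      have "emeasure \<nu> (M1 \<union> M2) \<le> emeasure \<nu> M1 + emeasure \<nu> M2"
        using ball_growthD(1)[OF gr] by (intro emeasure_subadditive) auto
      moreover have "emeasure \<nu> M1 \<le> ennreal (s / 2)"
      proof -
        have "emeasure \<nu> M1 \<le> ennreal ((riesz_const (real DIM(real^'n)) b C * (?V * 2 ^ CARD('n) * Kh * c) / (c0 / 2)) powr (b / (real DIM(real^'n) - 1)))"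
          unfolding M1_def using c0 Kh c C by (intro riesz_weak_L1[OF gr nD bD _ fm fF]) auto
        also have "riesz_const (real DIM(real^'n)) b C * (?V * 2 ^ CARD('n) * Kh * c) / (c0 / 2) = W * c"
          using c0 by (simp add: W_def K1_def field_simps)
        also have "W * c = ((s / 2) powr ((?n - 1) / b))"
          using W s by (simp add: c_def a_def powr_mult[symmetric])
        also have "(\<dots>) powr (b / (real DIM(real^'n) - 1)) = s / 2"
          using n1 b0 s by (simp add: powr_powr)
        finally show ?thesis .
      qed
      moreover have "emeasure \<nu> M2 \<le> ennreal (s / 2)"
        unfolding M2_def
      proof (rule riesz_weak_rearrangement[OF gr nD bD _ gm])
        show "riesz_const (real DIM(real^'n)) b C \<le> K2"
          "riesz_const (real DIM(real^'n)) (real DIM(real^'n)) (unit_ball_vol (real DIM(real^'n))) \<le> K2"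
          by (simp_all add: K2_def K1_def)
        have "K2 * h < l * c0 / 2" using c0 \<gamma> by (simp add: l_def K_def field_simps)
        then show "ennreal K2 * hardy_op (real DIM(real^'n)) fs ((s / 2) powr (real DIM(real^'n) / b)) < ennreal (l * c0 / 2)"
          using h K2 by (simp add: H_def[symmetric] ennreal_mult[symmetric] ennreal_less_iff)
      qed (use C s fs in auto)
      ultimately have "emeasure \<nu> (M1 \<union> M2) \<le> ennreal (s / 2) + ennreal (s / 2)"
        by (meson add_mono order_trans)
      then show ?thesis using s by (simp add: ennreal_plus[symmetric] del: ennreal_plus)
    qed
    ultimately show "\<exists>M\<in>sets borel. {x \<in> \<Omega>. T \<le> norm (u x)} \<subseteq> M \<and> emeasure \<nu> M \<le> ennreal s"
      by (intro bexI[of _ "M1 \<union> M2"]) auto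
  qed
qed

section \<open>Rearrangements, extension of measures and Borel majorants\<close>

lemma rearrangement_leI:
  "emeasure M {x \<in> space M. t < ennreal (norm (\<phi> x))} \<le> ennreal s \<Longrightarrow> rearrangement M \<phi> s \<le> t"
  unfolding rearrangement_def by (rule Inf_lower) simp

lemma rearrangement_lessD:
  assumes [measurable]: "(\<lambda>x. norm (\<phi> x)) \<in> borel_measurable M" and "rearrangement M \<phi> s < t"
  shows "emeasure M {x \<in> space M. t < ennreal (norm (\<phi> x))} \<le> ennreal s"
proof -
  from assms(2) obtain t' where t': "t' < t" "emeasure M {x \<in> space M. t' < ennreal (norm (\<phi> x))} \<le> ennreal s"
    unfolding rearrangement_def Inf_less_iff by blast
  have "emeasure M {x \<in> space M. t < ennreal (norm (\<phi> x))} \<le> emeasure M {x \<in> space M. t' < ennreal (norm (\<phi> x))}"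
    using t'(1) by (intro emeasure_mono) (auto intro: order.strict_trans)
  then show ?thesis using t'(2) by (rule order_trans)
qed

lemma rearrangement_antimono: "s \<le> s' \<Longrightarrow> rearrangement M \<phi> s' \<le> rearrangement M \<phi> s"
  unfolding rearrangement_def by (rule Inf_superset_mono) (auto intro: order_trans ennreal_leI)

text \<open>Super-level sets of a nonincreasing function are closed downwards, hence empty,
  everything, or a half-line up to their supremum.\<close>

lemma antimono_ennreal_borel_measurable:
  fixes f :: "real \<Rightarrow> ennreal"
  assumes "\<And>s s'. s \<le> s' \<Longrightarrow> f s' \<le> f s"
  shows "f \<in> borel_measurable borel"
proof (rule borel_measurableI_greater)
  fix c
  define S where "S = {x. c < f x}"
  have dc: "x \<in> S" if "y \<in> S" "x \<le> y" for x y
    using assms[OF that(2)] that(1) by (auto simp: S_def)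
  have "S \<in> sets borel"
  proof (cases "bdd_above S \<and> S \<noteq> {}")
    case True
    have "{..<Sup S} \<subseteq> S"
    proof
      fix x assume "x \<in> {..<Sup S}"
      then obtain y where "y \<in> S" "x < y" using True by (auto simp: less_cSup_iff)
      then show "x \<in> S" using dc by (meson less_imp_le)
    qed
    moreover have le: "x \<le> Sup S" if "x \<in> S" for x using that True by (simp add: cSup_upper)
    ultimately have "S = (if Sup S \<in> S then {..Sup S} else {..<Sup S})"
      using dc[of "Sup S"] by (auto simp: order.strict_iff_order)
    moreover have "(if Sup S \<in> S then {..Sup S} else {..<Sup S}) \<in> sets borel" by simp
    ultimately show ?thesis by (rule ssubst)
  next
    case False
    have "S = {} \<or> S = UNIV"
    proof (cases "S = {}")
      case False
      with \<open>\<not> (bdd_above S \<and> S \<noteq> {})\<close> have "\<exists>y\<in>S. x \<le> y" for x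
        by (meson bdd_above.I2 linear bdd_aboveI)
      then show ?thesis using dc by blast
    qed simp
    then show ?thesis by auto
  qed
  then show "{x \<in> space borel. c < f x} \<in> sets borel"
    by (simp add: S_def)
qed

lemma rearrangement_measurable [measurable]: "rearrangement M \<phi> \<in> borel_measurable borel"
  by (rule antimono_ennreal_borel_measurable) (rule rearrangement_antimono)

text \<open>The identity map pushes \<open>\<mu>\<close> to a measure on the whole space that
  vanishes outside \<open>\<Omega>\<close>. A ball with arbitrary centre either misses
  \<open>\<Omega>\<close> or lies in a ball of twice the radius around one of its points in
  \<open>\<Omega>\<close>; this explains the factor \<open>2 powr \<alpha>\<close>.\<close>

lemma growth_measure_distr:
  fixes \<Omega> :: "(real^'n::finite) set"
  assumes gr: "growth_measure \<Omega> \<alpha> C \<mu>" and op: "open \<Omega>" and C: "C > 0"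
  shows "ball_growth (distr \<mu> borel (\<lambda>x. x)) \<alpha> (C * 2 powr \<alpha>)"
    "A \<in> sets borel \<Longrightarrow> emeasure (distr \<mu> borel (\<lambda>x. x)) A = emeasure \<mu> (A \<inter> \<Omega>)"
    "space \<mu> = \<Omega>" "A \<in> sets borel \<Longrightarrow> A \<inter> \<Omega> \<in> sets \<mu>"
proof -
  have s: "sets \<mu> = sets (restrict_space borel \<Omega>)" using gr by (simp add: growth_measure_def)
  have "space \<mu> = space (restrict_space borel \<Omega>)" by (rule sets_eq_imp_space_eq[OF s])
  then show sp: "space \<mu> = \<Omega>" by (simp add: space_restrict_space)
  have m: "(\<lambda>x. x) \<in> measurable \<mu> borel"
    unfolding measurable_cong_sets[OF s refl] by (rule measurable_restrict_space1) simp
  show e: "emeasure (distr \<mu> borel (\<lambda>x. x)) A = emeasure \<mu> (A \<inter> \<Omega>)" if "A \<in> sets borel" for A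
    using that by (simp add: emeasure_distr[OF m] sp)
  show "A \<inter> \<Omega> \<in> sets \<mu>" if "A \<in> sets borel"
    unfolding s using that op by (simp add: sets_restrict_space_iff)
  show "ball_growth (distr \<mu> borel (\<lambda>x. x)) \<alpha> (C * 2 powr \<alpha>)"
    unfolding ball_growth_def
  proof (intro conjI allI impI)
    fix y :: "real^'n" and r :: real assume r: "r > 0"
    show "emeasure (distr \<mu> borel (\<lambda>x. x)) (ball y r) \<le> ennreal (C * 2 powr \<alpha> * r powr \<alpha>)"
    proof (cases "ball y r \<inter> \<Omega> = {}")
      case False
      then obtain x where x: "x \<in> \<Omega>" "dist y x < r" by auto
      have "ball y r \<inter> \<Omega> \<subseteq> ball x (2 * r) \<inter> \<Omega>"
      proof -
        have "dist x z < 2 * r" if "dist y z < r" for z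
          using that x dist_triangle[of x z y] by (simp add: dist_commute)
        then show ?thesis by auto
      qed
      then have "emeasure \<mu> (ball y r \<inter> \<Omega>) \<le> emeasure \<mu> (ball x (2 * r) \<inter> \<Omega>)"
        by (rule emeasure_mono) (simp add: s sets_restrict_space_iff op)
      also have "\<dots> \<le> ennreal (C * (2 * r) powr \<alpha>)" using gr x r by (simp add: growth_measure_def)
      finally show ?thesis using r by (simp add: e powr_mult mult_ac)
    qed (simp add: e)
  qed simp
qed

text \<open>The norm of \<open>F\<close>, extended by 0, is measurable for the completed measure and
  therefore equals a Borel function almost everywhere. Equality almost everywhere, rather than a
  mere upper bound, preserves the distribution function and thus the rearrangement.\<close>

lemma borel_majorant_on:
  fixes F :: "'a::euclidean_space \<Rightarrow> 'b::real_normed_vector"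
  assumes \<Omega>: "\<Omega> \<in> sets borel" and F: "(\<lambda>x. norm (F x)) \<in> borel_measurable (lebesgue_on \<Omega>)"
  obtains g :: "'a \<Rightarrow> ennreal" where "g \<in> borel_measurable borel"
    "AE y in lebesgue. y \<in> \<Omega> \<longrightarrow> ennreal (norm (F y)) \<le> g y"
    "\<And>t. emeasure lborel {y. t < g y} = emeasure (lebesgue_on \<Omega>) {x \<in> space (lebesgue_on \<Omega>). t < ennreal (norm (F x))}"
proof -
  have \<Omega>l: "\<Omega> \<in> sets lebesgue" using \<Omega> by simp
  define h where "h x = ennreal (norm (F x)) * indicator \<Omega> x" for x
  have "(\<lambda>x. ennreal (norm (F x))) \<in> borel_measurable (lebesgue_on \<Omega>)" using F by simp
  then have hm [measurable]: "h \<in> borel_measurable (completion lborel)"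
    unfolding h_def[abs_def] using \<Omega>l
    by (subst (asm) borel_measurable_restrict_space_iff_ennreal) auto
  from completion_ex_borel_measurable[OF hm] obtain g where g [measurable]: "g \<in> borel_measurable lborel"
    and ae: "AE x in lborel. h x = g x" by blast
  have ae': "AE x in lebesgue. h x = g x" using ae by (rule AE_completion)
  have [measurable]: "g \<in> borel_measurable lebesgue" using g by (simp add: measurable_completion)
  show thesis
  proof (rule that[of g])
    show "g \<in> borel_measurable borel" using g by simp
    show "AE y in lebesgue. y \<in> \<Omega> \<longrightarrow> ennreal (norm (F y)) \<le> g y"
      using ae' by eventually_elim (auto simp: h_def)
    fix t
    have "emeasure lborel {y. t < g y} = emeasure lebesgue {y. t < g y}"
      using g by simp
    also have "\<dots> = emeasure lebesgue {y. t < h y}"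
    proof (rule emeasure_eq_AE)
      show "AE x in lebesgue. x \<in> {y. t < g y} \<longleftrightarrow> x \<in> {y. t < h y}" using ae' by eventually_elim auto
      have "{y \<in> space lebesgue. t < g y} \<in> sets lebesgue" "{y \<in> space lebesgue. t < h y} \<in> sets lebesgue" by measurable
      then show "{y. t < g y} \<in> sets lebesgue" "{y. t < h y} \<in> sets lebesgue" by simp_all
    qed
    also have "{y. t < h y} = {x \<in> space (lebesgue_on \<Omega>). t < ennreal (norm (F x))}"
      by (auto simp: h_def indicator_def)
    also have "emeasure lebesgue \<dots> = emeasure (lebesgue_on \<Omega>) \<dots>"
      using \<Omega>l by (intro emeasure_restrict_space[symmetric]) auto
    finally show "emeasure lborel {y. t < g y} = emeasure (lebesgue_on \<Omega>) {x \<in> space (lebesgue_on \<Omega>). t < ennreal (norm (F x))}" .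
  qed
qed

lemma boundary_measure_simps:
  fixes \<Omega> :: "(real^'n::finite) set"
  shows "space (boundary_measure \<Omega>) = frontier \<Omega>"
    and "continuous_on (closure \<Omega>) u \<Longrightarrow> u \<in> borel_measurable (boundary_measure \<Omega>)"
    and "A \<subseteq> frontier \<Omega> \<Longrightarrow> A \<in> sets borel \<Longrightarrow> emeasure (boundary_measure \<Omega>) A = hausdorff_outer (CARD('n) - 1) A"
proof -
  have f: "frontier \<Omega> \<in> sets borel" by simp
  show "space (boundary_measure \<Omega>) = frontier \<Omega>" by (simp add: boundary_measure_def space_restrict_space)
  show "u \<in> borel_measurable (boundary_measure \<Omega>)" if "continuous_on (closure \<Omega>) u"
  proof -
    have "continuous_on (frontier \<Omega>) u" using that by (rule continuous_on_subset) (auto simp: frontier_def)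
    then have "u \<in> borel_measurable (restrict_space borel (frontier \<Omega>))"
      by (rule borel_measurable_continuous_on_restrict)
    moreover have "sets (boundary_measure \<Omega>) = sets (restrict_space borel (frontier \<Omega>))"
      unfolding boundary_measure_def by (rule sets_restrict_space_cong) simp
    ultimately show ?thesis by (simp cong: measurable_cong_sets)
  qed
  show "emeasure (boundary_measure \<Omega>) A = hausdorff_outer (CARD('n) - 1) A" if "A \<subseteq> frontier \<Omega>" "A \<in> sets borel"
    unfolding boundary_measure_def using that f
    by (subst emeasure_restrict_space) (auto simp: emeasure_hausdorff_measure)
qed

text \<open>Every level \<open>T\<close> strictly above the right side satisfies the premise of
  \<open>level_set_estimate\<close>, whose conclusion says that the rearrangement at
  \<open>s\<close> is at most \<open>T\<close>; density of the order gives the claim. The constants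
  come from exponent \<open>\<alpha>\<close> and growth constant \<open>C * 2 powr \<alpha>\<close>,
  the one of the extended measure.\<close>

lemma rearrangement_riesz_bound:
  fixes \<alpha> C :: real
  assumes n: "CARD('n::finite) \<ge> 2" and \<alpha>: "\<alpha> > real CARD('n) - 1" and C: "C > 0"
  obtains a K where "a > 0" "K > 0"
    "\<And>(\<Omega>::(real^'n) set) \<mu> u s. open \<Omega> \<Longrightarrow> growth_measure \<Omega> \<alpha> C \<mu> \<Longrightarrow> u \<in> Cb (closure \<Omega>)
      \<Longrightarrow> \<exists>E. is_sym_gradient \<Omega> u E \<Longrightarrow> (\<lambda>x. norm (sym_gradient \<Omega> u x)) \<in> borel_measurable (lebesgue_on \<Omega>) \<Longrightarrow> s > 0
      \<Longrightarrow> rearrangement \<mu> u s \<le> 2 * rearrangement (boundary_measure \<Omega>) u (a * s powr ((real CARD('n) - 1) / \<alpha>))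
        + ennreal K * hardy_op (real CARD('n)) (rearrangement (lebesgue_on \<Omega>) (sym_gradient \<Omega> u))
              ((1/2) powr (real CARD('n) / \<alpha>) * s powr (real CARD('n) / \<alpha>))"
proof -
  let ?n = "real CARD('n)"
  have C': "C * 2 powr \<alpha> > 0" using C by simp
  obtain a K where a: "a > 0" and K: "K > 0" and est:
    "\<And>\<Omega> (\<nu>::(real^'n) measure) u E g fs gs s T. open \<Omega> \<Longrightarrow> ball_growth \<nu> \<alpha> (C * 2 powr \<alpha>) \<Longrightarrow> is_sym_gradient \<Omega> u E
      \<Longrightarrow> continuous_on (closure \<Omega>) u \<Longrightarrow> bounded {x \<in> closure \<Omega>. u x \<noteq> 0}
      \<Longrightarrow> g \<in> borel_measurable borel \<Longrightarrow> (AE y in lebesgue. y \<in> \<Omega> \<longrightarrow> ennreal (norm (E y)) \<le> g y)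
      \<Longrightarrow> (\<And>r t. r > 0 \<Longrightarrow> t > 0 \<Longrightarrow> fs r < ennreal t \<Longrightarrow> emeasure lborel {y. ennreal t < g y} \<le> ennreal r)
      \<Longrightarrow> (\<And>r t. r > 0 \<Longrightarrow> t > 0 \<Longrightarrow> gs r < ennreal t
            \<Longrightarrow> hausdorff_outer (CARD('n) - 1) {y \<in> frontier \<Omega>. t < norm (u y)} \<le> ennreal r)
      \<Longrightarrow> s > 0 \<Longrightarrow> 2 * gs (a * s powr ((?n - 1) / \<alpha>))
          + ennreal K * hardy_op ?n fs ((1/2) powr (?n / \<alpha>) * s powr (?n / \<alpha>)) < ennreal T
      \<Longrightarrow> \<exists>M\<in>sets borel. {x \<in> \<Omega>. T \<le> norm (u x)} \<subseteq> M \<and> emeasure \<nu> M \<le> ennreal s"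
    using level_set_estimate[OF n \<alpha> C'] by blast
  show thesis
  proof (rule that[OF a K])
    fix \<Omega> :: "(real^'n) set" and \<mu> u s
    assume op: "open \<Omega>" and gr: "growth_measure \<Omega> \<alpha> C \<mu>" and uC: "u \<in> Cb (closure \<Omega>)"
      and ex: "\<exists>E. is_sym_gradient \<Omega> u E" and Em: "(\<lambda>x. norm (sym_gradient \<Omega> u x)) \<in> borel_measurable (lebesgue_on \<Omega>)"
      and s: "(s::real) > 0"
    let ?E = "sym_gradient \<Omega> u" let ?B = "boundary_measure \<Omega>"
    let ?fs = "rearrangement (lebesgue_on \<Omega>) ?E" let ?gs = "rearrangement ?B u"
    let ?R = "2 * ?gs (a * s powr ((?n - 1) / \<alpha>)) + ennreal K * hardy_op ?n ?fs ((1/2) powr (?n / \<alpha>) * s powr (?n / \<alpha>))"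
    have E: "is_sym_gradient \<Omega> u ?E" unfolding sym_gradient_def using ex by (rule someI_ex)
    have u: "continuous_on (closure \<Omega>) u" and bd: "bounded {x \<in> closure \<Omega>. u x \<noteq> 0}" using uC by (auto simp: Cb_def)
    have \<Omega>b: "\<Omega> \<in> sets borel" using op by simp
    obtain g where gm: "g \<in> borel_measurable borel" and g: "AE y in lebesgue. y \<in> \<Omega> \<longrightarrow> ennreal (norm (?E y)) \<le> g y"
      and gd: "\<And>t. emeasure lborel {y. t < g y} = emeasure (lebesgue_on \<Omega>) {x \<in> space (lebesgue_on \<Omega>). t < ennreal (norm (?E x))}"
      using borel_majorant_on[OF \<Omega>b Em] by blast
    have um: "u \<in> borel_measurable ?B" by (rule boundary_measure_simps(2)[OF u])
    then have [measurable]: "(\<lambda>x. norm (u x)) \<in> borel_measurable ?B" by measurable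
    show "rearrangement \<mu> u s \<le> ?R"
    proof (rule dense_ge)
      fix T' assume T': "?R < T'"
      show "rearrangement \<mu> u s \<le> T'"
      proof (cases T')
        case (real T)
        have "\<exists>M\<in>sets borel. {x \<in> \<Omega>. T \<le> norm (u x)} \<subseteq> M \<and> emeasure (distr \<mu> borel (\<lambda>x. x)) M \<le> ennreal s"
        proof (rule est[OF op growth_measure_distr(1)[OF gr op C] E u bd gm g _ _ s])
          fix r t :: real assume "r > 0" "t > 0" "?fs r < ennreal t"
          from rearrangement_lessD[OF Em this(3)] show "emeasure lborel {y. ennreal t < g y} \<le> ennreal r"
            unfolding gd .
        next
          fix r t :: real assume t: "r > 0" "t > 0" "?gs r < ennreal t"
          have "emeasure ?B {x \<in> space ?B. ennreal t < ennreal (norm (u x))} \<le> ennreal r"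
            using t(3) by (intro rearrangement_lessD) measurable
          also have "{x \<in> space ?B. ennreal t < ennreal (norm (u x))} = {y \<in> frontier \<Omega>. t < norm (u y)}"
            using t by (auto simp: boundary_measure_simps(1) ennreal_less_iff)
          finally have le: "emeasure ?B {y \<in> frontier \<Omega>. t < norm (u y)} \<le> ennreal r" .
          have "{x \<in> space ?B. t < norm (u x)} \<in> sets ?B" by measurable
          then have "{y \<in> frontier \<Omega>. t < norm (u y)} \<in> sets borel"
            unfolding boundary_measure_simps(1)
            by (simp add: boundary_measure_def sets_restrict_space_iff)
          from boundary_measure_simps(3)[OF _ this] le
          show "hausdorff_outer (CARD('n) - 1) {y \<in> frontier \<Omega>. t < norm (u y)} \<le> ennreal r" by auto
        next
          show "?R < ennreal T" using T' real by simp
        qed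
        then obtain M where M: "M \<in> sets borel" "{x \<in> \<Omega>. T \<le> norm (u x)} \<subseteq> M" "emeasure \<mu> (M \<inter> \<Omega>) \<le> ennreal s"
          by (auto simp: growth_measure_distr(2)[OF gr op C])
        show ?thesis unfolding real
        proof (rule rearrangement_leI)
          have "emeasure \<mu> {x \<in> space \<mu>. ennreal T < ennreal (norm (u x))} \<le> emeasure \<mu> (M \<inter> \<Omega>)"
            using M real growth_measure_distr(3,4)[OF gr op C]
            by (intro emeasure_mono) (auto simp: ennreal_less_iff)
          then show "emeasure \<mu> {x \<in> space \<mu>. ennreal T < ennreal (norm (u x))} \<le> ennreal s" using M(3) by (rule order_trans)
        qed
      qed simp
    qed
  qed
qed

section \<open>Hardy inequalities\<close>

lemma epowr_ennreal: "r \<ge> 0 \<Longrightarrow> epowr (ennreal r) a = ennreal (r powr a)"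
  by (simp add: epowr_def)

lemma epowr_top [simp]: "epowr top a = top"
  by (simp add: epowr_def)

lemma epowr_0 [simp]: "epowr 0 a = 0"
  by (simp add: epowr_def)

lemma epowr_mono: "0 \<le> a \<Longrightarrow> x \<le> y \<Longrightarrow> epowr x a \<le> epowr y a"
  by (cases x; cases y) (auto simp: epowr_ennreal top_unique intro!: ennreal_leI powr_mono2)

text \<open>The degenerate products agree because \<open>epowr\<close> fixes 0 and infinity for
  every exponent, and the product of 0 and infinity is 0.\<close>

lemma epowr_mult: "epowr (x * y) a = epowr x a * epowr y a"
proof (cases "x = 0 \<or> y = 0")
  case False
  show ?thesis
  proof (cases x; cases y)
    fix r s assume "x = ennreal r" "0 \<le> r" "y = ennreal s" "0 \<le> s"
    then show ?thesis by (simp add: ennreal_mult[symmetric] epowr_ennreal powr_mult)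
  qed (use False in \<open>auto simp: epowr_ennreal ennreal_mult_eq_top_iff ennreal_mult_top ennreal_top_mult\<close>)
qed auto

lemma epowr_epowr: "epowr (epowr x a) b = epowr x (a * b)"
  by (cases x) (auto simp: epowr_ennreal powr_powr)

lemma epowr_1 [simp]: "epowr x 1 = x"
  by (cases x) (auto simp: epowr_ennreal)

lemma epowr_measurable [measurable]: "(\<lambda>x. epowr x a) \<in> borel_measurable borel"
  unfolding epowr_def[abs_def] by measurable

lemma epowr_max: "0 \<le> a \<Longrightarrow> epowr (max x y) a \<le> epowr x a + epowr y a"
  by (auto simp: max_def add_increasing add_increasing2)

lemma epowr_add_le: assumes "0 \<le> a" shows "epowr (x + y) a \<le> ennreal (2 powr a) * (epowr x a + epowr y a)"
proof -
  have "x + y \<le> ennreal 2 * max x y"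
    using add_mono[of x "max x y" y "max x y"] by (simp add: mult_2)
  then have "epowr (x + y) a \<le> epowr (ennreal 2 * max x y) a" by (rule epowr_mono[OF assms])
  also have "\<dots> = ennreal (2 powr a) * epowr (max x y) a"
    unfolding epowr_mult by (simp only: epowr_ennreal zero_le_numeral)
  also have "\<dots> \<le> ennreal (2 powr a) * (epowr x a + epowr y a)"
    by (intro mult_left_mono epowr_max assms) simp
  finally show ?thesis .
qed

text \<open>The convex function h^q lies above its tangent at \<open>m\<close>; here this is read
  off from the weighted inequality of arithmetic and geometric means.\<close>

lemma young_powr:
  fixes h m q :: real
  assumes "h \<ge> 0" "m > 0" "q \<ge> 1"
  shows "q * m powr (q - 1) * h \<le> h powr q + (q - 1) * m powr q"
proof (cases "h = 0")
  case False
  have "(h powr q) powr (1 / q) * (m powr q) powr (1 - 1 / q) \<le> 1 / q * h powr q + (1 - 1 / q) * m powr q"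
    using assms False by (intro Youngs_inequality_0) (auto simp: field_simps)
  moreover have "(h powr q) powr (1 / q) = h" "(m powr q) powr (1 - 1 / q) = m powr (q - 1)"
    using assms by (auto simp: powr_powr right_diff_distrib)
  ultimately have "h * m powr (q - 1) \<le> 1 / q * h powr q + (1 - 1 / q) * m powr q" by simp
  then have "q * (h * m powr (q - 1)) \<le> q * (1 / q * h powr q + (1 - 1 / q) * m powr q)"
    using assms by (intro mult_left_mono) auto
  also have "\<dots> = h powr q + (q - 1) * m powr q" using assms by (simp add: field_simps)
  finally show ?thesis by (simp add: mult_ac)
qed (use assms in auto)

text \<open>Jensen's inequality for a kernel of mass at most \<open>A\<close>, by integrating the
  tangent inequality \<open>young_powr\<close> at the mean value. In this form it holds for extended
  real integrands.\<close>

lemma jensen_epowr: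
  assumes [measurable]: "k \<in> borel_measurable M" "h \<in> borel_measurable M"
    and q: "q \<ge> 1" and A: "A > 0" "(\<integral>\<^sup>+x. k x \<partial>M) \<le> ennreal A"
  shows "epowr (\<integral>\<^sup>+x. k x * h x \<partial>M) q \<le> ennreal (A powr (q - 1)) * (\<integral>\<^sup>+x. k x * epowr (h x) q \<partial>M)"
    (is "epowr ?S q \<le> _ * ?X")
proof (cases "?X = top")
  case True
  then show ?thesis using A by (simp add: ennreal_mult_top)
next
  case False
  then obtain X where X: "?X = ennreal X" "X \<ge> 0" by (cases ?X) auto
  \<comment> \<open>Used to see that the left integral is finite; otherwise the mean below would
    make no sense.\<close>
  have le1: "y \<le> 1 + epowr y q" for y :: ennreal
  proof (cases y)
    case (real r)
    have "r \<le> 1 + r powr q"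
    proof (cases "r \<le> 1")
      case False
      then have "r powr 1 \<le> r powr q" using q by (intro powr_mono) auto
      then show ?thesis using False by simp
    qed (simp add: add_increasing2)
    then have "ennreal r \<le> ennreal (1 + r powr q)" by (rule ennreal_leI)
    then show ?thesis using real by (simp add: epowr_ennreal ennreal_plus)
  qed simp
  have "?S \<le> (\<integral>\<^sup>+x. k x + k x * epowr (h x) q \<partial>M)"
    using mult_left_mono[OF le1] by (intro nn_integral_mono) (simp add: distrib_left)
  also have "\<dots> = (\<integral>\<^sup>+x. k x \<partial>M) + ?X" by (rule nn_integral_add) auto
  also have "\<dots> < top" using A(2) X by (auto simp: ennreal_add_less_top less_top[symmetric] top_unique)
  finally obtain \<sigma> where S: "?S = ennreal \<sigma>" "\<sigma> \<ge> 0" by (cases ?S) auto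
  show ?thesis
  proof (cases "\<sigma> = 0")
    case False
    with S have \<sigma>: "\<sigma> > 0" by simp
    \<comment> \<open>The point of tangency is the mean, for which
      \<open>m powr (q - 1) * \<sigma>\<close> and \<open>m powr q * A\<close> coincide; all but one
      multiple of this quantity then cancel.\<close>
    define m where "m = \<sigma> / A"
    have m: "m > 0" using \<sigma> A by (simp add: m_def)
    have y: "ennreal (q * m powr (q - 1)) * y \<le> epowr y q + ennreal ((q - 1) * m powr q)" for y :: ennreal
    proof (cases y)
      case (real r)
      have "ennreal (q * m powr (q - 1) * r) \<le> ennreal (r powr q + (q - 1) * m powr q)"
        using real by (intro ennreal_leI young_powr m q) auto
      then show ?thesis using real q by (simp add: epowr_ennreal ennreal_plus ennreal_mult'')
    qed simp
    have "ennreal (q * m powr (q - 1)) * ?S = (\<integral>\<^sup>+x. k x * (ennreal (q * m powr (q - 1)) * h x) \<partial>M)"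
      by (subst nn_integral_cmult[symmetric]) (auto simp: mult_ac)
    also have "\<dots> \<le> (\<integral>\<^sup>+x. k x * epowr (h x) q + ennreal ((q - 1) * m powr q) * k x \<partial>M)"
      using mult_left_mono[OF y] by (intro nn_integral_mono) (simp add: distrib_left mult.commute)
    also have "\<dots> = ?X + ennreal ((q - 1) * m powr q) * (\<integral>\<^sup>+x. k x \<partial>M)"
      by (simp add: nn_integral_add nn_integral_cmult)
    also have "\<dots> \<le> ?X + ennreal ((q - 1) * m powr q) * ennreal A"
      by (intro add_left_mono mult_left_mono A) simp
    also have "\<dots> = ennreal (X + (q - 1) * m powr q * A)"
      using X q A by (simp add: ennreal_plus ennreal_mult)
    finally have "ennreal (q * m powr (q - 1) * \<sigma>) \<le> ennreal (X + (q - 1) * m powr q * A)"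
      using S q by (simp add: ennreal_mult)
    then have "q * m powr (q - 1) * \<sigma> \<le> X + (q - 1) * m powr q * A"
      using X q A by (subst (asm) ennreal_le_iff) auto
    then have "q * (m powr (q - 1) * \<sigma>) \<le> X + (q - 1) * m powr q * A" by (simp add: mult.assoc)
    moreover have eq: "m powr (q - 1) * \<sigma> = m powr q * A"
      using \<sigma> A by (simp add: powr_diff m_def)
    ultimately have "q * (m powr q * A) \<le> X + (q - 1) * m powr q * A" by (simp only:)
    then have "m powr q * A \<le> X" by (simp add: algebra_simps)
    then have "A powr (q - 1) * (m powr q * A) \<le> A powr (q - 1) * X" by (intro mult_left_mono) auto
    moreover have "A powr (q - 1) * (m powr q * A) = \<sigma> powr q"
      using A \<sigma> by (simp add: m_def powr_divide powr_diff)
    ultimately show ?thesis using S X by (simp add: epowr_ennreal ennreal_mult[symmetric] ennreal_leI)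
  qed (use S in simp)
qed

text \<open>The inner integral is that of \<open>f / w\<close> against \<open>k * w\<close>, a
  kernel of mass at most \<open>A * v \<sigma>\<close>. Jensen's inequality, an exchange of the
  integrals and the second condition give the bound; the powers of \<open>w\<close> cancel in the
  end.\<close>

lemma schur_test:
  fixes k :: "real \<Rightarrow> real \<Rightarrow> real" and f :: "real \<Rightarrow> ennreal"
  assumes [measurable]: "case_prod k \<in> borel_measurable (borel \<Otimes>\<^sub>M borel)" "f \<in> borel_measurable borel"
    "w \<in> borel_measurable borel" "v \<in> borel_measurable borel" "\<rho> \<in> borel_measurable borel" "om \<in> borel_measurable borel"
    "S \<in> sets borel" "R \<in> sets borel"
    and k0: "\<And>\<sigma> r. k \<sigma> r \<ge> 0" and w0: "\<And>r. r \<in> R \<Longrightarrow> w r > 0" and v0: "\<And>\<sigma>. \<sigma> \<in> S \<Longrightarrow> v \<sigma> > 0"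
    and \<rho>0: "\<And>\<sigma>. \<rho> \<sigma> \<ge> 0" and om0: "\<And>r. om r \<ge> 0" and q: "q \<ge> 1" and A: "A > 0" and B: "B \<ge> 0"
    and c1: "\<And>\<sigma>. \<sigma> \<in> S \<Longrightarrow> (\<integral>\<^sup>+r\<in>R. ennreal (k \<sigma> r * w r) \<partial>lborel) \<le> ennreal (A * v \<sigma>)"
    and c2: "\<And>r. r \<in> R \<Longrightarrow> (\<integral>\<^sup>+\<sigma>\<in>S. ennreal (\<rho> \<sigma> * v \<sigma> powr (q - 1) * k \<sigma> r) \<partial>lborel) \<le> ennreal (B * w r powr (q - 1) * om r)"
  shows "(\<integral>\<^sup>+\<sigma>\<in>S. ennreal (\<rho> \<sigma>) * epowr (\<integral>\<^sup>+r\<in>R. f r * ennreal (k \<sigma> r) \<partial>lborel) q \<partial>lborel)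
     \<le> ennreal (A powr (q - 1) * B) * (\<integral>\<^sup>+r\<in>R. ennreal (om r) * epowr (f r) q \<partial>lborel)"
proof -
  have p1: "epowr (\<integral>\<^sup>+r\<in>R. f r * ennreal (k \<sigma> r) \<partial>lborel) q
     \<le> ennreal ((A * v \<sigma>) powr (q - 1)) * (\<integral>\<^sup>+r. ennreal (k \<sigma> r * w r powr (1 - q)) * epowr (f r) q * indicator R r \<partial>lborel)"
    if \<sigma>: "\<sigma> \<in> S" for \<sigma>
  proof -
    have "(\<integral>\<^sup>+r\<in>R. f r * ennreal (k \<sigma> r) \<partial>lborel)
      = (\<integral>\<^sup>+r. (ennreal (k \<sigma> r * w r) * indicator R r) * (f r * ennreal (1 / w r)) \<partial>lborel)"
    proof (rule nn_integral_cong)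
      fix r show "f r * ennreal (k \<sigma> r) * indicator R r = (ennreal (k \<sigma> r * w r) * indicator R r) * (f r * ennreal (1 / w r))"
      proof (cases "r \<in> R")
        case True
        then have "ennreal (k \<sigma> r) = ennreal (k \<sigma> r * w r) * ennreal (1 / w r)"
          using w0[of r] k0[of \<sigma> r] by (simp add: ennreal_mult[symmetric])
        then show ?thesis using True by (simp add: mult_ac)
      qed simp
    qed
    then have "epowr (\<integral>\<^sup>+r\<in>R. f r * ennreal (k \<sigma> r) \<partial>lborel) q
      = epowr (\<integral>\<^sup>+r. (ennreal (k \<sigma> r * w r) * indicator R r) * (f r * ennreal (1 / w r)) \<partial>lborel) q" by simp
    also have "\<dots> \<le> ennreal ((A * v \<sigma>) powr (q - 1)) * (\<integral>\<^sup>+r. (ennreal (k \<sigma> r * w r) * indicator R r) * epowr (f r * ennreal (1 / w r)) q \<partial>lborel)"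
      using A v0[OF \<sigma>] by (intro jensen_epowr q c1[OF \<sigma>]) auto
    also have "(\<integral>\<^sup>+r. (ennreal (k \<sigma> r * w r) * indicator R r) * epowr (f r * ennreal (1 / w r)) q \<partial>lborel)
      = (\<integral>\<^sup>+r. ennreal (k \<sigma> r * w r powr (1 - q)) * epowr (f r) q * indicator R r \<partial>lborel)"
    proof (rule nn_integral_cong)
      fix r show "(ennreal (k \<sigma> r * w r) * indicator R r) * epowr (f r * ennreal (1 / w r)) q
        = ennreal (k \<sigma> r * w r powr (1 - q)) * epowr (f r) q * indicator R r"
      proof (cases "r \<in> R")
        case True
        then have w: "w r > 0" by (rule w0)
        have eq: "k \<sigma> r * w r powr (1 - q) = k \<sigma> r * w r * (1 / w r) powr q"
          using w by (simp add: powr_diff powr_divide)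
        have kw: "0 \<le> k \<sigma> r * w r" using w k0[of \<sigma> r] by simp
        have e: "ennreal (k \<sigma> r * w r powr (1 - q)) = ennreal (k \<sigma> r * w r) * ennreal ((1 / w r) powr q)"
          by (simp only: eq ennreal_mult[OF kw powr_ge_zero])
        have "epowr (f r * ennreal (1 / w r)) q = epowr (f r) q * ennreal ((1 / w r) powr q)"
          using w by (simp add: epowr_mult epowr_ennreal)
        then show ?thesis unfolding e by (simp only: mult_ac)
      qed simp
    qed
    finally show ?thesis .
  qed
  have "(\<integral>\<^sup>+\<sigma>\<in>S. ennreal (\<rho> \<sigma>) * epowr (\<integral>\<^sup>+r\<in>R. f r * ennreal (k \<sigma> r) \<partial>lborel) q \<partial>lborel)
    \<le> (\<integral>\<^sup>+\<sigma>. (\<integral>\<^sup>+r. ennreal (\<rho> \<sigma> * (A * v \<sigma>) powr (q - 1)) * indicator S \<sigma> *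
         (ennreal (k \<sigma> r * w r powr (1 - q)) * epowr (f r) q * indicator R r) \<partial>lborel) \<partial>lborel)"
  proof (rule nn_integral_mono)
    fix \<sigma>
    have "ennreal (\<rho> \<sigma>) * epowr (\<integral>\<^sup>+r\<in>R. f r * ennreal (k \<sigma> r) \<partial>lborel) q * indicator S \<sigma>
      \<le> ennreal (\<rho> \<sigma>) * (ennreal ((A * v \<sigma>) powr (q - 1)) * (\<integral>\<^sup>+r. ennreal (k \<sigma> r * w r powr (1 - q)) * epowr (f r) q * indicator R r \<partial>lborel)) * indicator S \<sigma>"
      using p1[of \<sigma>] by (cases "\<sigma> \<in> S") (auto intro: mult_left_mono)
    also have "\<dots> = ennreal (\<rho> \<sigma> * (A * v \<sigma>) powr (q - 1)) * indicator S \<sigma> * (\<integral>\<^sup>+r. ennreal (k \<sigma> r * w r powr (1 - q)) * epowr (f r) q * indicator R r \<partial>lborel)"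
      using \<rho>0[of \<sigma>] by (simp add: ennreal_mult mult_ac)
    also have "\<dots> = (\<integral>\<^sup>+r. ennreal (\<rho> \<sigma> * (A * v \<sigma>) powr (q - 1)) * indicator S \<sigma> *
         (ennreal (k \<sigma> r * w r powr (1 - q)) * epowr (f r) q * indicator R r) \<partial>lborel)"
      by (rule nn_integral_cmult[symmetric]) measurable
    finally show "ennreal (\<rho> \<sigma>) * epowr (\<integral>\<^sup>+r\<in>R. f r * ennreal (k \<sigma> r) \<partial>lborel) q * indicator S \<sigma> \<le> \<dots>" .
  qed
  also have "\<dots> = (\<integral>\<^sup>+r. (\<integral>\<^sup>+\<sigma>. ennreal (\<rho> \<sigma> * (A * v \<sigma>) powr (q - 1)) * indicator S \<sigma> *
         (ennreal (k \<sigma> r * w r powr (1 - q)) * epowr (f r) q * indicator R r) \<partial>lborel) \<partial>lborel)"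
    by (rule lborel_pair.Fubini') measurable
  also have "\<dots> \<le> (\<integral>\<^sup>+r. ennreal (A powr (q - 1) * B) * (ennreal (om r) * epowr (f r) q * indicator R r) \<partial>lborel)"
  proof (rule nn_integral_mono)
    fix r
    show "(\<integral>\<^sup>+\<sigma>. ennreal (\<rho> \<sigma> * (A * v \<sigma>) powr (q - 1)) * indicator S \<sigma> *
         (ennreal (k \<sigma> r * w r powr (1 - q)) * epowr (f r) q * indicator R r) \<partial>lborel)
      \<le> ennreal (A powr (q - 1) * B) * (ennreal (om r) * epowr (f r) q * indicator R r)"
    proof (cases "r \<in> R")
      case True
      have w: "w r > 0" using True by (rule w0)
      have "(\<integral>\<^sup>+\<sigma>. ennreal (\<rho> \<sigma> * (A * v \<sigma>) powr (q - 1)) * indicator S \<sigma> *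
         (ennreal (k \<sigma> r * w r powr (1 - q)) * epowr (f r) q * indicator R r) \<partial>lborel)
        = (\<integral>\<^sup>+\<sigma>. (ennreal (A powr (q - 1) * w r powr (1 - q)) * epowr (f r) q) * (ennreal (\<rho> \<sigma> * v \<sigma> powr (q - 1) * k \<sigma> r) * indicator S \<sigma>) \<partial>lborel)"
      proof (rule nn_integral_cong)
        fix \<sigma>
        show "ennreal (\<rho> \<sigma> * (A * v \<sigma>) powr (q - 1)) * indicator S \<sigma> * (ennreal (k \<sigma> r * w r powr (1 - q)) * epowr (f r) q * indicator R r)
          = (ennreal (A powr (q - 1) * w r powr (1 - q)) * epowr (f r) q) * (ennreal (\<rho> \<sigma> * v \<sigma> powr (q - 1) * k \<sigma> r) * indicator S \<sigma>)"
        proof (cases "\<sigma> \<in> S")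
          case S: True
          have "(A * v \<sigma>) powr (q - 1) = A powr (q - 1) * v \<sigma> powr (q - 1)"
            using A v0[OF S] by (simp add: powr_mult)
          then show ?thesis using True S \<rho>0[of \<sigma>] k0[of \<sigma> r] by (simp add: ennreal_mult mult_ac)
        qed simp
      qed
      also have "\<dots> = (ennreal (A powr (q - 1) * w r powr (1 - q)) * epowr (f r) q) * (\<integral>\<^sup>+\<sigma>\<in>S. ennreal (\<rho> \<sigma> * v \<sigma> powr (q - 1) * k \<sigma> r) \<partial>lborel)"
        by (rule nn_integral_cmult) measurable
      also have "\<dots> \<le> (ennreal (A powr (q - 1) * w r powr (1 - q)) * epowr (f r) q) * ennreal (B * w r powr (q - 1) * om r)"
        by (intro mult_left_mono c2 True) simp
      also have "\<dots> = ennreal (A powr (q - 1) * w r powr (1 - q)) * ennreal (B * w r powr (q - 1) * om r) * epowr (f r) q"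
        by (simp add: mult_ac)
      also have "ennreal (A powr (q - 1) * w r powr (1 - q)) * ennreal (B * w r powr (q - 1) * om r) = ennreal (A powr (q - 1) * B * om r)"
      proof -
        have "w r powr (1 - q) * w r powr (q - 1) = 1" using w by (simp add: powr_add[symmetric])
        then have "A powr (q - 1) * w r powr (1 - q) * (B * w r powr (q - 1) * om r) = A powr (q - 1) * B * om r"
          by (simp add: mult_ac)
        then show ?thesis using B om0[of r] by (simp add: ennreal_mult[symmetric])
      qed
      finally show ?thesis using True B om0[of r] by (simp add: ennreal_mult mult_ac)
    qed simp
  qed
  also have "\<dots> = ennreal (A powr (q - 1) * B) * (\<integral>\<^sup>+r\<in>R. ennreal (om r) * epowr (f r) q \<partial>lborel)"
    by (rule nn_integral_cmult) measurable
  finally show ?thesis .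
qed

section \<open>Power substitutions and power weights\<close>

lemma nn_integral_Ioi_le:
  fixes F :: "real \<Rightarrow> ennreal"
  assumes [measurable]: "F \<in> borel_measurable borel"
    and le: "\<And>a b. 0 < a \<Longrightarrow> a < b \<Longrightarrow> (\<integral>\<^sup>+x\<in>{a..b}. F x \<partial>lborel) \<le> c"
  shows "(\<integral>\<^sup>+x\<in>{0<..}. F x \<partial>lborel) \<le> c"
proof -
  define I where "I k = {1 / (real k + 2)..real k + 2}" for k :: nat
  have inc: "I i \<subseteq> I j" if "i \<le> j" for i j
  proof -
    have "1 / (real j + 2) \<le> 1 / (real i + 2)" using that by (intro divide_left_mono) auto
    then show ?thesis using that by (auto simp: I_def)
  qed
  have "(SUP k. F x * indicator (I k) x) = F x * indicator {0<..} x" for x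
  proof (cases "x > 0")
    case True
    obtain k where k: "max x (1 / x) < real k" using reals_Archimedean2 by blast
    then have "x \<le> real k + 2" "1 / x \<le> real k + 2" by auto
    then have "x \<in> I k" using True by (simp add: I_def field_simps)
    then have "F x * indicator {0<..} x \<le> F x * indicator (I k) x" using True by simp
    also have "\<dots> \<le> (SUP k. F x * indicator (I k) x)" by (rule SUP_upper) simp
    finally show ?thesis by (intro antisym SUP_least) (auto simp: indicator_def True)
  next
    case False
    have "x \<notin> I k" for k
    proof
      assume "x \<in> I k"
      moreover have "1 / (real k + 2) > 0" by simp
      ultimately show False using False unfolding I_def by (meson atLeastAtMost_iff less_le_trans)
    qed
    then show ?thesis using False by simp
  qed
  then have "(\<integral>\<^sup>+x\<in>{0<..}. F x \<partial>lborel) = (\<integral>\<^sup>+x. (SUP k. F x * indicator (I k) x) \<partial>lborel)" by simp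
  also have "\<dots> = (SUP k. (\<integral>\<^sup>+x. F x * indicator (I k) x \<partial>lborel))"
  proof (rule nn_integral_monotone_convergence_SUP)
    show "incseq (\<lambda>k x. F x * indicator (I k) x)"
      using inc by (auto simp: incseq_def le_fun_def indicator_def)
    show "(\<lambda>x. F x * indicator (I k) x) \<in> borel_measurable lborel" for k unfolding I_def by measurable
  qed
  also have "\<dots> \<le> c"
  proof (rule SUP_least)
    fix k :: nat
    have "1 / (real k + 2) \<le> 1" by simp
    then have "1 / (real k + 2) < real k + 2" by linarith
    then show "(\<integral>\<^sup>+x. F x * indicator (I k) x \<partial>lborel) \<le> c" unfolding I_def by (intro le) auto
  qed
  finally show ?thesis .
qed

text \<open>The substitution is \<open>r = a * s powr \<beta>\<close>, carried out on compact
  intervals away from 0, where it is continuously differentiable. An inequality is enough for the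
  estimates, so the image interval is simply enlarged to the half-line.\<close>

lemma nn_integral_powr_substitution_le:
  fixes F :: "real \<Rightarrow> ennreal"
  assumes [measurable]: "F \<in> borel_measurable borel" and a: "a > 0" and \<beta>: "\<beta> > 0"
  shows "(\<integral>\<^sup>+s\<in>{0<..}. ennreal (s powr \<gamma>) * F (a * s powr \<beta>) \<partial>lborel)
    \<le> ennreal (a powr (- ((\<gamma> + 1) / \<beta>)) / \<beta>) * (\<integral>\<^sup>+r\<in>{0<..}. ennreal (r powr ((\<gamma> + 1) / \<beta> - 1)) * F r \<partial>lborel)"
proof (rule nn_integral_Ioi_le)
  fix l u :: real assume lu: "0 < l" "l < u"
  let ?e = "(\<gamma> + 1) / \<beta>"
  define f where "f r = ennreal (a powr (- ?e) / \<beta> * r powr (?e - 1)) * F r" for r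
  have "(\<integral>\<^sup>+s\<in>{l..u}. ennreal (s powr \<gamma>) * F (a * s powr \<beta>) \<partial>lborel)
    = (\<integral>\<^sup>+s. f (a * s powr \<beta>) * ennreal (a * (\<beta> * s powr (\<beta> - 1))) * indicator {l..u} s \<partial>lborel)"
  proof (rule nn_integral_cong)
    fix s
    show "ennreal (s powr \<gamma>) * F (a * s powr \<beta>) * indicator {l..u} s
      = f (a * s powr \<beta>) * ennreal (a * (\<beta> * s powr (\<beta> - 1))) * indicator {l..u} s"
    proof (cases "s \<in> {l..u}")
      case True
      then have s: "s > 0" using lu by simp
      have "a powr (- ?e) / \<beta> * (a * s powr \<beta>) powr (?e - 1) * (a * (\<beta> * s powr (\<beta> - 1)))
        = (a powr (- ?e) * a powr (?e - 1) * a powr 1) * (s powr (\<beta> * (?e - 1)) * s powr (\<beta> - 1))"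
        using s a \<beta> by (simp add: powr_mult powr_powr)
      also have "\<dots> = a powr (- ?e + (?e - 1) + 1) * s powr (\<beta> * (?e - 1) + (\<beta> - 1))"
        by (simp only: powr_add)
      also have "\<beta> * (?e - 1) + (\<beta> - 1) = \<gamma>" using \<beta> by (simp add: right_diff_distrib)
      finally have eq: "s powr \<gamma> = a powr (- ?e) / \<beta> * (a * s powr \<beta>) powr (?e - 1) * (a * (\<beta> * s powr (\<beta> - 1)))"
        using a by simp
      have n1: "0 \<le> a powr (- ?e) / \<beta> * (a * s powr \<beta>) powr (?e - 1)" "0 \<le> a * (\<beta> * s powr (\<beta> - 1))"
        using a \<beta> by simp_all
      have "ennreal (s powr \<gamma>) = ennreal (a powr (- ?e) / \<beta> * (a * s powr \<beta>) powr (?e - 1)) * ennreal (a * (\<beta> * s powr (\<beta> - 1)))"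
        by (simp only: eq ennreal_mult[OF n1])
      then show ?thesis by (simp add: f_def mult_ac)
    qed simp
  qed
  also have "\<dots> = (\<integral>\<^sup>+r. f r * indicator {a * l powr \<beta>..a * u powr \<beta>} r \<partial>lborel)"
  proof (rule nn_integral_substitution_aux[symmetric])
    show "f \<in> borel_measurable borel" unfolding f_def[abs_def] by measurable
    show "((\<lambda>s. a * s powr \<beta>) has_real_derivative a * (\<beta> * s powr (\<beta> - 1))) (at s)" if "s \<in> {l..u}" for s
      using that lu by (auto intro!: derivative_eq_intros)
    show "continuous_on {l..u} (\<lambda>s. a * (\<beta> * s powr (\<beta> - 1)))"
      using lu by (intro continuous_intros) auto
  qed (use a \<beta> lu in auto)
  also have "\<dots> \<le> (\<integral>\<^sup>+r. ennreal (a powr (- ?e) / \<beta>) * (ennreal (r powr (?e - 1)) * F r * indicator {0<..} r) \<partial>lborel)"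
  proof (rule nn_integral_mono)
    fix r
    have "a * l powr \<beta> > 0" using a lu by simp
    moreover have "ennreal (a powr (- ?e) / \<beta> * r powr (?e - 1)) = ennreal (a powr (- ?e) / \<beta>) * ennreal (r powr (?e - 1))"
      using \<beta> by (intro ennreal_mult) auto
    ultimately show "f r * indicator {a * l powr \<beta>..a * u powr \<beta>} r \<le> ennreal (a powr (- ?e) / \<beta>) * (ennreal (r powr (?e - 1)) * F r * indicator {0<..} r)"
      unfolding f_def by (auto simp: indicator_def mult.assoc simp del: times_divide_eq_left)
  qed
  also have "\<dots> = ennreal (a powr (- ?e) / \<beta>) * (\<integral>\<^sup>+r\<in>{0<..}. ennreal (r powr (?e - 1)) * F r \<partial>lborel)"
    by (rule nn_integral_cmult) measurable
  finally show "(\<integral>\<^sup>+s\<in>{l..u}. ennreal (s powr \<gamma>) * F (a * s powr \<beta>) \<partial>lborel)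
    \<le> ennreal (a powr (- ((\<gamma> + 1) / \<beta>)) / \<beta>) * (\<integral>\<^sup>+r\<in>{0<..}. ennreal (r powr ((\<gamma> + 1) / \<beta> - 1)) * F r \<partial>lborel)" .
qed measurable

lemma hardy_op_measurable [measurable]:
  assumes [measurable]: "f \<in> borel_measurable borel"
  shows "hardy_op n f \<in> borel_measurable borel"
  unfolding hardy_op_def[abs_def] by measurable

lemma nn_integral_max_powr_le:
  fixes a c \<sigma> :: real
  assumes a: "a > -1" and ac: "a + c < -1" and \<sigma>: "\<sigma> > 0"
  shows "(\<integral>\<^sup>+r\<in>{0<..}. ennreal (max \<sigma> r powr c * r powr a) \<partial>lborel)
    \<le> ennreal ((1 / (a + 1) + 1 / (- (a + c + 1))) * \<sigma> powr (a + c + 1))"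
proof -
  have "(\<integral>\<^sup>+r\<in>{0<..}. ennreal (max \<sigma> r powr c * r powr a) \<partial>lborel)
    \<le> (\<integral>\<^sup>+r. ennreal (\<sigma> powr c) * (ennreal (r powr a) * indicator {0..\<sigma>} r) + ennreal (r powr (a + c)) * indicator {\<sigma>..} r \<partial>lborel)"
  proof (rule nn_integral_mono)
    fix r :: real
    show "ennreal (max \<sigma> r powr c * r powr a) * indicator {0<..} r
      \<le> ennreal (\<sigma> powr c) * (ennreal (r powr a) * indicator {0..\<sigma>} r) + ennreal (r powr (a + c)) * indicator {\<sigma>..} r"
    proof (cases "r \<le> \<sigma>")
      case True
      then show ?thesis by (auto simp: indicator_def max_absorb1 ennreal_mult add_increasing2)
    next
      case False
      then show ?thesis using \<sigma> by (auto simp: indicator_def max_absorb2 powr_add mult.commute)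
    qed
  qed
  also have "\<dots> = ennreal (\<sigma> powr c) * ennreal (\<sigma> powr (a + 1) / (a + 1)) + ennreal (\<sigma> powr (a + c + 1) / (- (a + c + 1)))"
    using assms by (simp add: nn_integral_add nn_integral_cmult nn_integral_powr_below nn_integral_powr_above)
  also have "\<dots> = ennreal (\<sigma> powr c * (\<sigma> powr (a + 1) / (a + 1)) + \<sigma> powr (a + c + 1) / (- (a + c + 1)))"
  proof -
    have "0 \<le> \<sigma> powr (a + 1) / (a + 1)" "0 \<le> \<sigma> powr (a + c + 1) / (- (a + c + 1))"
      using a ac by (intro divide_nonneg_pos; simp)+
    then show ?thesis by (simp only: ennreal_mult[symmetric] ennreal_plus[symmetric] powr_ge_zero mult_nonneg_nonneg)
  qed
  also have "\<sigma> powr c * (\<sigma> powr (a + 1) / (a + 1)) = \<sigma> powr (a + c + 1) / (a + 1)"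
    by (simp add: powr_add[symmetric] add_ac)
  also have "\<sigma> powr (a + c + 1) / (a + 1) + \<sigma> powr (a + c + 1) / (- (a + c + 1))
      = (1 / (a + 1) + 1 / (- (a + c + 1))) * \<sigma> powr (a + c + 1)"
    by (simp only: distrib_right times_divide_eq_left mult_1)
  finally show ?thesis .
qed

text \<open>The two pieces of the integral of the kernel against \<open>r powr - \<pi>\<close>,
  below and above \<open>\<sigma>\<close>. With \<open>\<pi> = 1 / p\<close> they converge exactly
  for 1 < p < n.\<close>

definition hardy_const :: "real \<Rightarrow> real \<Rightarrow> real" where
  "hardy_const n \<pi> = 1 / (1 - \<pi>) + 1 / (\<pi> - 1 / n)"

lemma hardy_const_pos: "1 / n < \<pi> \<Longrightarrow> \<pi> < 1 \<Longrightarrow> hardy_const n \<pi> > 0"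
  by (simp add: hardy_const_def add_pos_pos)

lemma hardy_op_powr_weight:
  assumes n: "n > 1" and p: "1 / n < \<pi>" "\<pi> < 1" and \<sigma>: "\<sigma> > 0"
  shows "(\<integral>\<^sup>+r\<in>{0<..}. ennreal (max \<sigma> r powr (1 / n - 1) * r powr - \<pi>) \<partial>lborel) \<le> ennreal (hardy_const n \<pi> * \<sigma> powr (1 / n - \<pi>))"
proof -
  have 1: "- \<pi> > -1" "- \<pi> + (1 / n - 1) < -1" using p by auto
  have 2: "- \<pi> + (1 / n - 1) + 1 = 1 / n - \<pi>" "- \<pi> + 1 = 1 - \<pi>" "- (1 / n - \<pi>) = \<pi> - 1 / n" by auto
  show ?thesis using nn_integral_max_powr_le[OF 1 \<sigma>] unfolding 2 hardy_const_def .
qed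

text \<open>The case of second Lorentz index infinity: a pointwise power bound on \<open>f\<close>
  is integrated against the kernel.\<close>

lemma hardy_op_weak_bound:
  assumes n: "n > 1" and p: "1 / n < \<pi>" "\<pi> < 1" and \<sigma>: "\<sigma> > 0" and c: "c \<ge> 0"
    and f: "\<And>r. r > 0 \<Longrightarrow> f r \<le> ennreal (c * r powr - \<pi>) * N"
  shows "hardy_op n f \<sigma> \<le> ennreal (c * hardy_const n \<pi> * \<sigma> powr (1 / n - \<pi>)) * N"
proof -
  have "hardy_op n f \<sigma> \<le> (\<integral>\<^sup>+r. (ennreal c * N) * (ennreal (max \<sigma> r powr (1 / n - 1) * r powr - \<pi>) * indicator {0<..} r) \<partial>lborel)"
    unfolding hardy_op_def
  proof (rule nn_integral_mono)
    fix r :: real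
    show "f r * ennreal (max \<sigma> r powr (1 / n - 1)) * indicator {0<..} r
      \<le> (ennreal c * N) * (ennreal (max \<sigma> r powr (1 / n - 1) * r powr - \<pi>) * indicator {0<..} r)"
    proof (cases "r > 0")
      case True
      have "f r * ennreal (max \<sigma> r powr (1 / n - 1)) \<le> ennreal (c * r powr - \<pi>) * N * ennreal (max \<sigma> r powr (1 / n - 1))"
        by (intro mult_right_mono f True) simp
      also have "\<dots> = (ennreal c * N) * ennreal (max \<sigma> r powr (1 / n - 1) * r powr - \<pi>)"
        using c by (simp add: ennreal_mult mult_ac)
      finally show ?thesis using True by simp
    qed simp
  qed
  also have "\<dots> = (ennreal c * N) * (\<integral>\<^sup>+r\<in>{0<..}. ennreal (max \<sigma> r powr (1 / n - 1) * r powr - \<pi>) \<partial>lborel)"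
    by (rule nn_integral_cmult) measurable
  also have "\<dots> \<le> (ennreal c * N) * ennreal (hardy_const n \<pi> * \<sigma> powr (1 / n - \<pi>))"
    by (intro mult_left_mono hardy_op_powr_weight assms) simp
  also have "\<dots> = ennreal (c * hardy_const n \<pi> * \<sigma> powr (1 / n - \<pi>)) * N"
    using c hardy_const_pos[OF p] by (simp add: ennreal_mult mult_ac)
  finally show ?thesis .
qed

text \<open>Schur's test with power weights. The kernel is homogeneous, so the weight exponent
  \<open>- \<pi>\<close> determines \<open>v\<close>, and the second condition leads to the same two
  fractions in the opposite order; hence both constants are
  \<open>hardy_const n \<pi>\<close>.\<close>

lemma hardy_op_Lq:
  fixes n \<pi> q :: real and f :: "real \<Rightarrow> ennreal"
  assumes n: "n > 1" and p: "1 / n < \<pi>" "\<pi> < 1" and q: "q \<ge> 1" and f [measurable]: "f \<in> borel_measurable borel"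
  shows "(\<integral>\<^sup>+\<sigma>\<in>{0<..}. ennreal (\<sigma> powr (q * (\<pi> - 1 / n) - 1)) * epowr (hardy_op n f \<sigma>) q \<partial>lborel)
    \<le> ennreal (hardy_const n \<pi> powr (q - 1) * hardy_const n \<pi>) * (\<integral>\<^sup>+r\<in>{0<..}. ennreal (r powr (q * \<pi> - 1)) * epowr (f r) q \<partial>lborel)"
proof -
  have reorder: "hardy_op n f \<sigma> = (\<integral>\<^sup>+r\<in>{0<..}. f r * ennreal (max \<sigma> r powr (1 / n - 1)) \<partial>lborel)" for \<sigma>
    unfolding hardy_op_def ..
  show ?thesis
    unfolding reorder
  proof (rule schur_test[where w = "\<lambda>r. r powr - \<pi>" and v = "\<lambda>\<sigma>. \<sigma> powr (1 / n - \<pi>)"])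
    show "hardy_const n \<pi> > 0" "hardy_const n \<pi> \<ge> 0" using hardy_const_pos[OF p] by auto
    fix \<sigma> :: real assume "\<sigma> \<in> {0<..}"
    then show "(\<integral>\<^sup>+r\<in>{0<..}. ennreal (max \<sigma> r powr (1 / n - 1) * r powr - \<pi>) \<partial>lborel)
        \<le> ennreal (hardy_const n \<pi> * \<sigma> powr (1 / n - \<pi>))"
      using hardy_op_powr_weight[OF n p] by simp
  next
    fix r :: real assume r: "r \<in> {0<..}"
    have 1: "\<pi> - 1 / n - 1 > -1" "\<pi> - 1 / n - 1 + (1 / n - 1) < -1" using p by auto
    have "(\<integral>\<^sup>+\<sigma>\<in>{0<..}. ennreal (\<sigma> powr (q * (\<pi> - 1 / n) - 1) * (\<sigma> powr (1 / n - \<pi>)) powr (q - 1) * max \<sigma> r powr (1 / n - 1)) \<partial>lborel)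
      = (\<integral>\<^sup>+\<sigma>\<in>{0<..}. ennreal (max r \<sigma> powr (1 / n - 1) * \<sigma> powr (\<pi> - 1 / n - 1)) \<partial>lborel)"
    proof (intro nn_integral_cong)
      fix \<sigma> :: real
      have "\<sigma> powr (q * (\<pi> - 1 / n) - 1) * (\<sigma> powr (1 / n - \<pi>)) powr (q - 1) = \<sigma> powr (\<pi> - 1 / n - 1)"
        unfolding powr_powr powr_add[symmetric] by (simp add: algebra_simps diff_divide_distrib)
      then show "ennreal (\<sigma> powr (q * (\<pi> - 1 / n) - 1) * (\<sigma> powr (1 / n - \<pi>)) powr (q - 1) * max \<sigma> r powr (1 / n - 1)) * indicator {0<..} \<sigma>
         = ennreal (max r \<sigma> powr (1 / n - 1) * \<sigma> powr (\<pi> - 1 / n - 1)) * indicator {0<..} \<sigma>"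
        by (simp add: max.commute mult.commute)
    qed
    also have "\<dots> \<le> ennreal ((1 / (\<pi> - 1 / n - 1 + 1) + 1 / (- (\<pi> - 1 / n - 1 + (1 / n - 1) + 1))) * r powr (\<pi> - 1 / n - 1 + (1 / n - 1) + 1))"
      using r by (intro nn_integral_max_powr_le 1) simp
    also have "1 / (\<pi> - 1 / n - 1 + 1) + 1 / (- (\<pi> - 1 / n - 1 + (1 / n - 1) + 1)) = hardy_const n \<pi>"
      by (simp add: hardy_const_def)
    also have "r powr (\<pi> - 1 / n - 1 + (1 / n - 1) + 1) = (r powr - \<pi>) powr (q - 1) * r powr (q * \<pi> - 1)"
      unfolding powr_powr powr_add[symmetric] by (simp add: algebra_simps diff_divide_distrib)
    finally show "(\<integral>\<^sup>+\<sigma>\<in>{0<..}. ennreal (\<sigma> powr (q * (\<pi> - 1 / n) - 1) * (\<sigma> powr (1 / n - \<pi>)) powr (q - 1) * max \<sigma> r powr (1 / n - 1)) \<partial>lborel)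
      \<le> ennreal (hardy_const n \<pi> * (r powr - \<pi>) powr (q - 1) * r powr (q * \<pi> - 1))"
      by (simp add: mult.assoc)
  qed (use q in \<open>auto\<close>)
qed

section \<open>Logarithmic weights\<close>

lemma ln_shift_le:
  fixes a \<beta> h m :: real
  assumes "a > 0" "\<beta> > 0" "h > 0" "m > 0"
  obtains C where "C > 0" "\<And>s. 0 < s \<Longrightarrow> s < m \<Longrightarrow> ln (1 + h / (a * s powr \<beta>)) \<le> C * ln (1 + m / s)"
proof -
  define D where "D = h / (a * m powr \<beta>)"
  have D: "D > 0" using assms by (simp add: D_def)
  define C where "C = ln (1 + D) / ln 2 + \<beta>"
  have C: "C > 0" using D assms unfolding C_def by (intro add_nonneg_pos) auto
  show thesis
  proof (rule that[OF C])
    fix s assume s: "0 < s" "s < m"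
    define x where "x = m / s"
    have x: "x > 1" using s by (simp add: x_def)
    have "h / (a * s powr \<beta>) = D * x powr \<beta>" using s assms by (simp add: D_def x_def powr_divide)
    \<comment> \<open>The logarithm turns this product into a constant plus
      \<open>\<beta> * ln (1 + x)\<close>, and the constant is absorbed because \<open>x > 1\<close>
      gives \<open>ln (1 + x) \<ge> ln 2\<close>.\<close>
    also have "1 + D * x powr \<beta> \<le> (1 + D) * (1 + x) powr \<beta>"
    proof -
      have "x powr \<beta> \<le> (1 + x) powr \<beta>" using x assms by (intro powr_mono2) auto
      then have "D * x powr \<beta> \<le> D * (1 + x) powr \<beta>" using D by simp
      moreover have "1 \<le> (1 + x) powr \<beta>" using x assms by (intro ge_one_powr_ge_zero) auto
      ultimately show ?thesis by (simp add: distrib_right)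
    qed
    finally have "ln (1 + h / (a * s powr \<beta>)) \<le> ln ((1 + D) * (1 + x) powr \<beta>)"
      using D x assms s by (intro ln_mono add_pos_pos) auto
    also have "\<dots> = ln (1 + D) + \<beta> * ln (1 + x)" using D x by (simp add: ln_mult ln_powr)
    also have "ln (1 + D) \<le> ln (1 + D) / ln 2 * ln (1 + x)"
    proof -
      have "ln 2 \<le> ln (1 + x)" using x by (intro ln_mono) auto
      then have "ln (1 + D) * ln 2 \<le> ln (1 + D) * ln (1 + x)" using D by (intro mult_left_mono) auto
      then show ?thesis by (simp add: field_simps)
    qed
    finally show "ln (1 + h / (a * s powr \<beta>)) \<le> C * ln (1 + m / s)" by (simp add: C_def x_def distrib_right)
  qed
qed

text \<open>Exponent 1/2 gives the antiderivative for the outer integral and exponent 1 - e the one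
  for the inner integral in the two lemmas that follow.\<close>

lemma log_weight_deriv:
  fixes \<Lambda> x s :: real
  assumes "0 < x" "x \<le> \<Lambda>"
  shows "((\<lambda>x. (1 + ln (\<Lambda> / x)) powr s) has_real_derivative - (s * (x powr -1 * (1 + ln (\<Lambda> / x)) powr (s - 1)))) (at x)"
proof -
  have l: "1 + ln (\<Lambda> / x) > 0" using assms by (intro add_pos_nonneg) auto
  have "((\<lambda>x. 1 + ln (\<Lambda> / x)) has_real_derivative - (1 / x)) (at x)"
    using assms by (auto intro!: derivative_eq_intros simp: field_simps power2_eq_square)
  from DERIV_powr[OF this l DERIV_const[of s]]
  have "((\<lambda>x. (1 + ln (\<Lambda> / x)) powr s) has_real_derivative
     (1 + ln (\<Lambda> / x)) powr s * (0 * ln (1 + ln (\<Lambda> / x)) + - (1 / x) * s / (1 + ln (\<Lambda> / x)))) (at x)" .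
  moreover have "(1 + ln (\<Lambda> / x)) powr s * (0 * ln (1 + ln (\<Lambda> / x)) + - (1 / x) * s / (1 + ln (\<Lambda> / x)))
     = - (s * (x powr -1 * (1 + ln (\<Lambda> / x)) powr (s - 1)))"
    using l assms by (simp add: powr_diff powr_minus field_simps)
  ultimately show ?thesis by simp
qed

lemma nn_integral_log_weight_above:
  fixes \<Lambda> \<sigma> :: real
  assumes "0 < \<sigma>" "\<sigma> \<le> \<Lambda>"
  shows "(\<integral>\<^sup>+r\<in>{\<sigma>..\<Lambda>}. ennreal (r powr -1 * (1 + ln (\<Lambda> / r)) powr (-1/2)) \<partial>lborel) \<le> ennreal (2 * (1 + ln (\<Lambda> / \<sigma>)) powr (1/2))"
proof -
  have "(\<integral>\<^sup>+r\<in>{\<sigma>..\<Lambda>}. ennreal (r powr -1 * (1 + ln (\<Lambda> / r)) powr (-1/2)) \<partial>lborel)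
    = ennreal ((- 2 * (1 + ln (\<Lambda> / \<Lambda>)) powr (1/2)) - (- 2 * (1 + ln (\<Lambda> / \<sigma>)) powr (1/2)))"
  proof (rule nn_integral_FTC_Icc)
    fix x assume "x \<in> {\<sigma>..\<Lambda>}"
    then have x: "0 < x" "x \<le> \<Lambda>" using assms by auto
    show "((\<lambda>x. - 2 * (1 + ln (\<Lambda> / x)) powr (1/2)) has_real_derivative x powr -1 * (1 + ln (\<Lambda> / x)) powr (-1/2)) (at x)"
      using DERIV_cmult[OF log_weight_deriv[OF x, of "1/2"], of "-2"] by simp
  qed (use assms in auto)
  also have "\<dots> \<le> ennreal (2 * (1 + ln (\<Lambda> / \<sigma>)) powr (1/2))" by (intro ennreal_leI) simp
  finally show ?thesis .
qed

lemma nn_integral_log_weight_below: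
  fixes \<Lambda> r e :: real
  assumes r: "0 < r" "r \<le> \<Lambda>" and e: "e > 1"
  shows "(\<integral>\<^sup>+\<sigma>\<in>{0<..}. ennreal (\<sigma> powr -1 * (1 + ln (\<Lambda> / \<sigma>)) powr (- e)) * indicator {..r} \<sigma> \<partial>lborel)
     \<le> ennreal ((1 + ln (\<Lambda> / r)) powr (1 - e) / (e - 1))"
proof (rule nn_integral_Ioi_le)
  fix a b :: real assume ab: "0 < a" "a < b"
  show "(\<integral>\<^sup>+\<sigma>\<in>{a..b}. ennreal (\<sigma> powr -1 * (1 + ln (\<Lambda> / \<sigma>)) powr (- e)) * indicator {..r} \<sigma> \<partial>lborel)
     \<le> ennreal ((1 + ln (\<Lambda> / r)) powr (1 - e) / (e - 1))"
  proof (cases "a \<le> r")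
    case True
    have "(\<integral>\<^sup>+\<sigma>\<in>{a..b}. ennreal (\<sigma> powr -1 * (1 + ln (\<Lambda> / \<sigma>)) powr (- e)) * indicator {..r} \<sigma> \<partial>lborel)
      \<le> (\<integral>\<^sup>+\<sigma>\<in>{a..r}. ennreal (\<sigma> powr -1 * (1 + ln (\<Lambda> / \<sigma>)) powr (- e)) \<partial>lborel)"
      by (intro nn_integral_mono) (auto simp: indicator_def)
    also have "\<dots> = ennreal (1 / (e - 1) * (1 + ln (\<Lambda> / r)) powr (1 - e) - 1 / (e - 1) * (1 + ln (\<Lambda> / a)) powr (1 - e))"
    proof (rule nn_integral_FTC_Icc)
      fix x assume "x \<in> {a..r}"
      then have x: "0 < x" "x \<le> \<Lambda>" using ab r by auto
      have Y: "1 / (e - 1) * - ((1 - e) * Y) = Y" for Y using e by (simp add: field_simps)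
      have "1 / (e - 1) * - ((1 - e) * (x powr -1 * (1 + ln (\<Lambda> / x)) powr (1 - e - 1))) = x powr -1 * (1 + ln (\<Lambda> / x)) powr (- e)"
        unfolding Y by simp
      then show "((\<lambda>x. 1 / (e - 1) * (1 + ln (\<Lambda> / x)) powr (1 - e)) has_real_derivative x powr -1 * (1 + ln (\<Lambda> / x)) powr (- e)) (at x)"
        using DERIV_cmult[OF log_weight_deriv[OF x, of "1 - e"], of "1 / (e - 1)"] by simp
    qed (use True in auto)
    also have "\<dots> \<le> ennreal ((1 + ln (\<Lambda> / r)) powr (1 - e) / (e - 1))"
      using e by (intro ennreal_leI) simp
    finally show ?thesis .
  next
    case False
    then have "ennreal (\<sigma> powr -1 * (1 + ln (\<Lambda> / \<sigma>)) powr (- e)) * indicator {..r} \<sigma> * indicator {a..b} \<sigma> = 0" for \<sigma>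
      by (auto simp: indicator_def)
    then show ?thesis by (simp only: nn_integral_const mult_zero_left zero_le)
  qed
qed measurable

text \<open>Schur's test with the weight \<open>r powr (- (1 / n))\<close> for \<open>r < \<sigma>\<close>, multiplied by the square root of the reciprocal logarithm
  for \<open>r \<ge> \<sigma>\<close>; without the latter the outer part diverges logarithmically.\<close>

lemma hardy_op_log_Lq:
  fixes n q \<Lambda> :: real and f :: "real \<Rightarrow> ennreal"
  assumes n: "n > 1" and q: "q > 1" and \<Lambda>: "\<Lambda> > 0" and f [measurable]: "f \<in> borel_measurable borel"
    and f0: "\<And>r. r \<ge> \<Lambda> \<Longrightarrow> f r = 0"
  shows "(\<integral>\<^sup>+\<sigma>\<in>{0<..<\<Lambda>}. ennreal (\<sigma> powr -1 * (1 + ln (\<Lambda> / \<sigma>)) powr (- q)) * epowr (hardy_op n f \<sigma>) q \<partial>lborel)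
    \<le> ennreal (2 powr q * ((1 / (1 - 1 / n)) powr (q - 1) * (1 / (1 - 1 / n)) + 2 powr (q - 1) * (2 / (q - 1))))
       * (\<integral>\<^sup>+r\<in>{0<..}. ennreal (r powr (q / n - 1)) * epowr (f r) q \<partial>lborel)"
proof -
  let ?l = "\<lambda>x. 1 + ln (\<Lambda> / x)"
  let ?I = "\<integral>\<^sup>+r\<in>{0<..}. ennreal (r powr (q / n - 1)) * epowr (f r) q \<partial>lborel"
  have l1: "?l x \<ge> 1" if "0 < x" "x \<le> \<Lambda>" for x using that by simp
  have l0: "?l x \<noteq> 0" if "0 < x" "x < \<Lambda>" for x using l1[OF that(1) less_imp_le[OF that(2)]] by linarith
  define c where "c = 1 / n - 1"
  define A where "A = 1 / (1 - 1 / n)"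
  have A: "A > 0" using n by (simp add: A_def)
  define k1 where "k1 \<sigma> r = (if r < \<sigma> then \<sigma> powr c else 0)" for \<sigma> r :: real
  define k2 where "k2 \<sigma> r = (if \<sigma> \<le> r then r powr c else 0)" for \<sigma> r :: real
  define T1 where "T1 \<sigma> = (\<integral>\<^sup>+r\<in>{0<..}. f r * ennreal (k1 \<sigma> r) \<partial>lborel)" for \<sigma>
  \<comment> \<open>As \<open>f\<close> vanishes from \<open>\<Lambda>\<close> on, the outer part
    can be cut off there; on the remaining interval \<open>?l\<close> is at least 1 and may serve as
    a weight in Schur's test.\<close>
  define T2 where "T2 \<sigma> = (\<integral>\<^sup>+r\<in>{0<..<\<Lambda>}. f r * ennreal (k2 \<sigma> r) \<partial>lborel)" for \<sigma>
  have [measurable]: "case_prod k1 \<in> borel_measurable (borel \<Otimes>\<^sub>M borel)" "case_prod k2 \<in> borel_measurable (borel \<Otimes>\<^sub>M borel)"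
    unfolding k1_def k2_def by measurable
  have [measurable]: "T1 \<in> borel_measurable borel" "T2 \<in> borel_measurable borel"
    unfolding T1_def[abs_def] T2_def[abs_def] by measurable
  have hT: "hardy_op n f \<sigma> \<le> T1 \<sigma> + T2 \<sigma>" for \<sigma>
  proof -
    have "hardy_op n f \<sigma> \<le> (\<integral>\<^sup>+r. f r * ennreal (k1 \<sigma> r) * indicator {0<..} r + f r * ennreal (k2 \<sigma> r) * indicator {0<..<\<Lambda>} r \<partial>lborel)"
      unfolding hardy_op_def c_def[symmetric]
    proof (rule nn_integral_mono)
      fix r :: real
      show "f r * ennreal (max \<sigma> r powr c) * indicator {0<..} r
         \<le> f r * ennreal (k1 \<sigma> r) * indicator {0<..} r + f r * ennreal (k2 \<sigma> r) * indicator {0<..<\<Lambda>} r"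
        using f0[of r] by (auto simp: indicator_def k1_def k2_def max_def not_less)
    qed
    also have "\<dots> = T1 \<sigma> + T2 \<sigma>" unfolding T1_def T2_def by (rule nn_integral_add) measurable
    finally show ?thesis .
  qed
  have "(\<integral>\<^sup>+\<sigma>\<in>{0<..<\<Lambda>}. ennreal (\<sigma> powr -1 * ?l \<sigma> powr (- q)) * epowr (hardy_op n f \<sigma>) q \<partial>lborel)
    \<le> (\<integral>\<^sup>+\<sigma>. ennreal (2 powr q) * (ennreal (\<sigma> powr -1) * epowr (T1 \<sigma>) q * indicator {0<..<\<Lambda>} \<sigma>
        + ennreal (\<sigma> powr -1 * ?l \<sigma> powr (- q)) * epowr (T2 \<sigma>) q * indicator {0<..<\<Lambda>} \<sigma>) \<partial>lborel)"
  proof (rule nn_integral_mono)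
    fix \<sigma> :: real
    show "ennreal (\<sigma> powr -1 * ?l \<sigma> powr (- q)) * epowr (hardy_op n f \<sigma>) q * indicator {0<..<\<Lambda>} \<sigma>
      \<le> ennreal (2 powr q) * (ennreal (\<sigma> powr -1) * epowr (T1 \<sigma>) q * indicator {0<..<\<Lambda>} \<sigma>
        + ennreal (\<sigma> powr -1 * ?l \<sigma> powr (- q)) * epowr (T2 \<sigma>) q * indicator {0<..<\<Lambda>} \<sigma>)"
    proof (cases "\<sigma> \<in> {0<..<\<Lambda>}")
      case True
      have "epowr (hardy_op n f \<sigma>) q \<le> epowr (T1 \<sigma> + T2 \<sigma>) q" using q by (intro epowr_mono hT) simp
      also have "\<dots> \<le> ennreal (2 powr q) * (epowr (T1 \<sigma>) q + epowr (T2 \<sigma>) q)" using q by (intro epowr_add_le) simp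
      finally have "ennreal (\<sigma> powr -1 * ?l \<sigma> powr (- q)) * epowr (hardy_op n f \<sigma>) q
        \<le> ennreal (\<sigma> powr -1 * ?l \<sigma> powr (- q)) * (ennreal (2 powr q) * (epowr (T1 \<sigma>) q + epowr (T2 \<sigma>) q))"
        by (rule mult_left_mono) simp
      also have "\<dots> = ennreal (2 powr q) * (ennreal (\<sigma> powr -1 * ?l \<sigma> powr (- q)) * epowr (T1 \<sigma>) q
          + ennreal (\<sigma> powr -1 * ?l \<sigma> powr (- q)) * epowr (T2 \<sigma>) q)"
        by (simp only: distrib_left mult_ac)
      also have "\<dots> \<le> ennreal (2 powr q) * (ennreal (\<sigma> powr -1) * epowr (T1 \<sigma>) q
          + ennreal (\<sigma> powr -1 * ?l \<sigma> powr (- q)) * epowr (T2 \<sigma>) q)"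
      proof (intro mult_left_mono add_right_mono mult_right_mono ennreal_leI)
        \<comment> \<open>For the inner part the logarithm is not worth keeping: it is at most 1 and
          power weights alone give a bounded operator.\<close>
        have "?l \<sigma> powr (- q) \<le> ?l \<sigma> powr 0" using l1[of \<sigma>] True q by (intro powr_mono) auto
        moreover have "?l \<sigma> \<ge> 1" using True by (intro l1) auto
        then have "?l \<sigma> \<noteq> 0" by linarith
        ultimately have "?l \<sigma> powr (- q) \<le> 1" by simp
        from mult_left_mono[OF this powr_ge_zero[of \<sigma> "-1"]]
        show "\<sigma> powr -1 * ?l \<sigma> powr (- q) \<le> \<sigma> powr -1" by (simp only: mult_1_right)
      qed auto
      finally show ?thesis using True by simp
    qed simp
  qed
  also have "\<dots> = ennreal (2 powr q) * ((\<integral>\<^sup>+\<sigma>\<in>{0<..<\<Lambda>}. ennreal (\<sigma> powr -1) * epowr (T1 \<sigma>) q \<partial>lborel)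
        + (\<integral>\<^sup>+\<sigma>\<in>{0<..<\<Lambda>}. ennreal (\<sigma> powr -1 * ?l \<sigma> powr (- q)) * epowr (T2 \<sigma>) q \<partial>lborel))"
    by (simp add: nn_integral_cmult nn_integral_add)
  also have "\<dots> \<le> ennreal (2 powr q) * (ennreal (A powr (q - 1) * A) * ?I + ennreal (2 powr (q - 1) * (2 / (q - 1))) * ?I)"
  proof (intro mult_left_mono add_mono)
    show "(\<integral>\<^sup>+\<sigma>\<in>{0<..<\<Lambda>}. ennreal (\<sigma> powr -1) * epowr (T1 \<sigma>) q \<partial>lborel) \<le> ennreal (A powr (q - 1) * A) * ?I"
      unfolding T1_def
    proof (rule schur_test[where w = "\<lambda>r. r powr (- (1 / n))" and v = "\<lambda>_. 1"])
      fix \<sigma> assume \<sigma>: "\<sigma> \<in> {0<..<\<Lambda>}"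
      have "(\<integral>\<^sup>+r\<in>{0<..}. ennreal (k1 \<sigma> r * r powr (- (1 / n))) \<partial>lborel)
        \<le> (\<integral>\<^sup>+r. ennreal (\<sigma> powr c) * (ennreal (r powr (- (1 / n))) * indicator {0..\<sigma>} r) \<partial>lborel)"
        by (intro nn_integral_mono) (auto simp: indicator_def k1_def ennreal_mult)
      also have "\<dots> = ennreal (\<sigma> powr c) * ennreal (\<sigma> powr (- (1 / n) + 1) / (- (1 / n) + 1))"
        using n \<sigma> by (simp add: nn_integral_cmult nn_integral_powr_below)
      also have "\<dots> = ennreal (\<sigma> powr c * (\<sigma> powr (- (1 / n) + 1) / (- (1 / n) + 1)))"
        using n by (intro ennreal_mult[symmetric]) auto
      also have "\<sigma> powr c * (\<sigma> powr (- (1 / n) + 1) / (- (1 / n) + 1)) = A * 1"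
        using \<sigma> by (simp add: powr_add[symmetric] c_def A_def)
      finally show "(\<integral>\<^sup>+r\<in>{0<..}. ennreal (k1 \<sigma> r * r powr (- (1 / n))) \<partial>lborel) \<le> ennreal (A * 1)" .
    next
      fix r :: real assume r: "r \<in> {0<..}"
      have "(\<integral>\<^sup>+\<sigma>\<in>{0<..<\<Lambda>}. ennreal (\<sigma> powr -1 * 1 powr (q - 1) * k1 \<sigma> r) \<partial>lborel)
        \<le> (\<integral>\<^sup>+\<sigma>\<in>{r..}. ennreal (\<sigma> powr (c - 1)) \<partial>lborel)"
      proof (rule nn_integral_mono)
        fix \<sigma> :: real
        have "\<sigma> powr -1 * \<sigma> powr c = \<sigma> powr (c - 1)" unfolding powr_add[symmetric] by simp
        then show "ennreal (\<sigma> powr -1 * 1 powr (q - 1) * k1 \<sigma> r) * indicator {0<..<\<Lambda>} \<sigma> \<le> ennreal (\<sigma> powr (c - 1)) * indicator {r..} \<sigma>"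
          by (auto simp: indicator_def k1_def)
      qed
      also have "\<dots> = ennreal (r powr (c - 1 + 1) / (- (c - 1 + 1)))"
        using n r by (intro nn_integral_powr_above) (auto simp: c_def)
      also have "r powr (c - 1 + 1) / (- (c - 1 + 1)) = A * r powr (1 / n - 1)"
        by (simp add: A_def c_def)
      also have "r powr (1 / n - 1) = (r powr (- (1 / n))) powr (q - 1) * r powr (q / n - 1)"
        unfolding powr_powr powr_add[symmetric] by (simp add: algebra_simps diff_divide_distrib)
      finally show "(\<integral>\<^sup>+\<sigma>\<in>{0<..<\<Lambda>}. ennreal (\<sigma> powr -1 * 1 powr (q - 1) * k1 \<sigma> r) \<partial>lborel)
        \<le> ennreal (A * (r powr (- (1 / n))) powr (q - 1) * r powr (q / n - 1))" by (simp only: mult.assoc)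
    qed (use q A in \<open>auto simp: k1_def\<close>)
    have "(\<integral>\<^sup>+\<sigma>\<in>{0<..<\<Lambda>}. ennreal (\<sigma> powr -1 * ?l \<sigma> powr (- q)) * epowr (T2 \<sigma>) q \<partial>lborel)
      \<le> ennreal (2 powr (q - 1) * (2 / (q - 1))) * (\<integral>\<^sup>+r\<in>{0<..<\<Lambda>}. ennreal (r powr (q / n - 1)) * epowr (f r) q \<partial>lborel)"
      unfolding T2_def
    proof (rule schur_test[where w = "\<lambda>r. r powr (- (1 / n)) * ?l r powr (-1/2)" and v = "\<lambda>\<sigma>. ?l \<sigma> powr (1/2)"])
      show "0 < r powr (- (1 / n)) * ?l r powr (-1/2)" if "r \<in> {0<..<\<Lambda>}" for r
        using l0[of r] that by (intro mult_pos_pos) auto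
      show "0 < ?l r powr (1/2)" if "r \<in> {0<..<\<Lambda>}" for r
        using l0[of r] that by auto
    next
      fix \<sigma> assume \<sigma>: "\<sigma> \<in> {0<..<\<Lambda>}"
      have "(\<integral>\<^sup>+r\<in>{0<..<\<Lambda>}. ennreal (k2 \<sigma> r * (r powr (- (1 / n)) * ?l r powr (-1/2))) \<partial>lborel)
        \<le> (\<integral>\<^sup>+r\<in>{\<sigma>..\<Lambda>}. ennreal (r powr -1 * ?l r powr (-1/2)) \<partial>lborel)"
      proof (rule nn_integral_mono)
        fix r :: real
        have "r powr c * r powr (- (1 / n)) = r powr -1" unfolding powr_add[symmetric] c_def by simp
        then have "r powr c * (r powr (- (1 / n)) * ?l r powr (-1/2)) = r powr -1 * ?l r powr (-1/2)"
          by (simp only: mult.assoc[symmetric])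
        then show "ennreal (k2 \<sigma> r * (r powr (- (1 / n)) * ?l r powr (-1/2))) * indicator {0<..<\<Lambda>} r
          \<le> ennreal (r powr -1 * ?l r powr (-1/2)) * indicator {\<sigma>..\<Lambda>} r"
          unfolding k2_def by (auto simp: indicator_def simp del: times_divide_eq_right)
      qed
      also have "\<dots> \<le> ennreal (2 * ?l \<sigma> powr (1/2))" using \<sigma> by (intro nn_integral_log_weight_above) auto
      finally show "(\<integral>\<^sup>+r\<in>{0<..<\<Lambda>}. ennreal (k2 \<sigma> r * (r powr (- (1 / n)) * ?l r powr (-1/2))) \<partial>lborel)
        \<le> ennreal (2 * ?l \<sigma> powr (1/2))" .
    next
      fix r assume r: "r \<in> {0<..<\<Lambda>}"
      \<comment> \<open>The weight contributes the power (q - 1) / 2 of the logarithm, so the total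
        exponent is - q + (q - 1) / 2 = - e; the condition \<open>e > 1\<close> for convergence at 0
        is \<open>q > 1\<close>.\<close>
      define e where "e = (q + 1) / 2"
      have e: "e > 1" using q by (simp add: e_def)
      have "(\<integral>\<^sup>+\<sigma>\<in>{0<..<\<Lambda>}. ennreal (\<sigma> powr -1 * ?l \<sigma> powr (- q) * (?l \<sigma> powr (1/2)) powr (q - 1) * k2 \<sigma> r) \<partial>lborel)
        \<le> (\<integral>\<^sup>+\<sigma>. ennreal (r powr c) * (ennreal (\<sigma> powr -1 * ?l \<sigma> powr (- e)) * indicator {..r} \<sigma> * indicator {0<..} \<sigma>) \<partial>lborel)"
      proof (rule nn_integral_mono)
        fix \<sigma> :: real
        have ex: "- q + 1 / 2 * (q - 1) = - e" by (simp add: e_def field_simps)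
        have "?l \<sigma> powr (- q) * (?l \<sigma> powr (1/2)) powr (q - 1) = ?l \<sigma> powr (- e)"
          unfolding powr_powr powr_add[symmetric] ex ..
        then have "\<sigma> powr -1 * ?l \<sigma> powr (- q) * (?l \<sigma> powr (1/2)) powr (q - 1) * r powr c = r powr c * (\<sigma> powr -1 * ?l \<sigma> powr (- e))"
          by (simp only: mult.assoc mult.commute)
        then show "ennreal (\<sigma> powr -1 * ?l \<sigma> powr (- q) * (?l \<sigma> powr (1/2)) powr (q - 1) * k2 \<sigma> r) * indicator {0<..<\<Lambda>} \<sigma>
          \<le> ennreal (r powr c) * (ennreal (\<sigma> powr -1 * ?l \<sigma> powr (- e)) * indicator {..r} \<sigma> * indicator {0<..} \<sigma>)"
          unfolding k2_def by (auto simp: indicator_def ennreal_mult simp del: times_divide_eq_right)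
      qed
      also have "\<dots> = ennreal (r powr c) * (\<integral>\<^sup>+\<sigma>\<in>{0<..}. ennreal (\<sigma> powr -1 * ?l \<sigma> powr (- e)) * indicator {..r} \<sigma> \<partial>lborel)"
        by (rule nn_integral_cmult) measurable
      also have "\<dots> \<le> ennreal (r powr c) * ennreal (?l r powr (1 - e) / (e - 1))"
        using r e by (intro mult_left_mono nn_integral_log_weight_below) auto
      also have "\<dots> = ennreal (r powr c * (?l r powr (1 - e) / (e - 1)))"
        using e by (intro ennreal_mult[symmetric]) auto
      also have "r powr c * (?l r powr (1 - e) / (e - 1)) = 2 / (q - 1) * (r powr (- (1 / n)) * ?l r powr (-1/2)) powr (q - 1) * r powr (q / n - 1)"
      proof -
        have 1: "(r powr (- (1 / n)) * ?l r powr (-1/2)) powr (q - 1) = (r powr (- (1 / n))) powr (q - 1) * (?l r powr (-1/2)) powr (q - 1)"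
          by (rule powr_mult)
        have 2: "(r powr (- (1 / n))) powr (q - 1) * r powr (q / n - 1) = r powr c"
          unfolding powr_powr powr_add[symmetric] c_def by (simp add: algebra_simps diff_divide_distrib)
        have 3: "(?l r powr (-1/2)) powr (q - 1) = ?l r powr (1 - e)"
        proof -
          have ex: "(-1/2) * (q - 1) = 1 - e" by (simp add: e_def field_simps)
          show ?thesis unfolding powr_powr ex ..
        qed
        have "2 / (q - 1) = 1 / (e - 1)" using q by (simp add: e_def field_simps)
        then show ?thesis unfolding 1 3 2[symmetric] by simp
      qed
      finally show "(\<integral>\<^sup>+\<sigma>\<in>{0<..<\<Lambda>}. ennreal (\<sigma> powr -1 * ?l \<sigma> powr (- q) * (?l \<sigma> powr (1/2)) powr (q - 1) * k2 \<sigma> r) \<partial>lborel)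
        \<le> ennreal (2 / (q - 1) * (r powr (- (1 / n)) * ?l r powr (-1/2)) powr (q - 1) * r powr (q / n - 1))" .
    qed (use q in \<open>auto simp: k2_def\<close>)
    also have "\<dots> \<le> ennreal (2 powr (q - 1) * (2 / (q - 1))) * ?I"
      by (intro mult_left_mono nn_integral_mono) (auto simp: indicator_def)
    finally show "(\<integral>\<^sup>+\<sigma>\<in>{0<..<\<Lambda>}. ennreal (\<sigma> powr -1 * ?l \<sigma> powr (- q)) * epowr (T2 \<sigma>) q \<partial>lborel)
      \<le> ennreal (2 powr (q - 1) * (2 / (q - 1))) * ?I" .
  qed simp
  also have "\<dots> = ennreal (2 powr q * (A powr (q - 1) * A + 2 powr (q - 1) * (2 / (q - 1)))) * ?I"
  proof -
    have nn: "0 \<le> A powr (q - 1) * A" "0 \<le> 2 powr (q - 1) * (2 / (q - 1))" using A q by simp_all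
    have "ennreal (2 powr q * (A powr (q - 1) * A + 2 powr (q - 1) * (2 / (q - 1))))
      = ennreal (2 powr q) * (ennreal (A powr (q - 1) * A) + ennreal (2 powr (q - 1) * (2 / (q - 1))))"
      unfolding ennreal_plus[OF nn, symmetric] using nn by (intro ennreal_mult) (simp_all only: powr_ge_zero add_nonneg_nonneg)
    then show ?thesis by (simp only: distrib_right mult.assoc)
  qed
  finally show ?thesis unfolding A_def .
qed

section \<open>Lorentz and Lorentz-Zygmund estimates\<close>

lemma Lq_norm_real:
  assumes "q \<ge> 1"
  shows "Lq_norm (ennreal q) M f = epowr (\<integral>\<^sup>+x. epowr (f x) q \<partial>M) (1 / q)"
  using assms by (simp add: Lq_norm_def)

lemma enn2real_inverse_ennreal: "x > 0 \<Longrightarrow> enn2real (inverse (ennreal x)) = 1 / x"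
  by (simp add: inverse_ennreal inverse_eq_divide)

lemma lorentz_norm_real:
  assumes q: "q \<ge> 1"
  shows "lorentz_norm M p (ennreal q) \<phi>
    = epowr (\<integral>\<^sup>+s\<in>{0<..}. ennreal (s powr (q * enn2real (inverse p) - 1)) * epowr (rearrangement M \<phi> s) q \<partial>lborel) (1 / q)"
proof -
  have e: "epowr (ennreal (s powr (enn2real (inverse p) - 1 / q)) * x) q = ennreal (s powr (q * enn2real (inverse p) - 1)) * epowr x q" for s x
    using q by (simp add: epowr_mult epowr_ennreal powr_powr algebra_simps)
  show ?thesis
    unfolding lorentz_norm_def Lq_norm_real[OF q] using q
    by (simp add: enn2real_inverse_ennreal e nn_integral_restrict_space)
qed

lemma lorentz_norm_top:
  "lorentz_norm M p \<infinity> \<phi>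
    = esssup (restrict_space lborel {0<..}) (\<lambda>s. ennreal (s powr enn2real (inverse p)) * rearrangement M \<phi> s)"
  by (simp add: lorentz_norm_def Lq_norm_def)

lemma lorentz_zygmund_norm_real:
  fixes M :: "'a measure"
  assumes q: "q > 1"
  defines "m \<equiv> measure M (space M)"
  shows "lorentz_zygmund_norm M q \<phi>
    = epowr (\<integral>\<^sup>+s\<in>{0<..<m}. ennreal (s powr -1 * ln (1 + m / s) powr (- q)) * epowr (rearrangement M \<phi> s) q \<partial>lborel) (1 / q)"
proof -
  have q1: "q \<ge> 1" using q by simp
  have e: "epowr (ennreal (s powr (- 1 / q) * inverse (ln (1 + m / s))) * x) q * indicator {0<..<m} s
     = ennreal (s powr -1 * ln (1 + m / s) powr (- q)) * epowr x q * indicator {0<..<m} s" for s x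
  proof (cases "s \<in> {0<..<m}")
    case True
    then have l: "ln (1 + m / s) > 0" by (intro ln_gt_zero) auto
    have "(s powr (- 1 / q) * inverse (ln (1 + m / s))) powr q = (s powr (- 1 / q)) powr q * inverse (ln (1 + m / s)) powr q"
      by (rule powr_mult)
    also have "(s powr (- 1 / q)) powr q = s powr -1" using q by (simp add: powr_powr)
    also have "inverse (ln (1 + m / s)) powr q = ln (1 + m / s) powr (- q)"
      using l by (simp add: powr_minus inverse_powr)
    finally have "(s powr (- 1 / q) * inverse (ln (1 + m / s))) powr q = s powr -1 * ln (1 + m / s) powr (- q)" .
    then show ?thesis using l by (simp add: epowr_mult epowr_ennreal)
  qed simp
  have nr: "nn_integral (restrict_space lborel {0<..<m}) f = (\<integral>\<^sup>+x. f x * indicator {0<..<m} x \<partial>lborel)" for f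
    by (rule nn_integral_restrict_space) simp
  show ?thesis
    unfolding lorentz_zygmund_norm_def Let_def m_def[symmetric] Lq_norm_real[OF q1] nr e ..
qed

lemma rearrangement_weak_bound:
  fixes p q :: ennreal
  assumes q: "1 \<le> q" and \<pi>: "0 < enn2real (inverse p) \<or> q = \<infinity>"
  obtains c where "c > 0" "\<And>(M :: 'x measure) (\<phi> :: 'x \<Rightarrow> 'y::real_normed_vector) s. s > 0 \<Longrightarrow>
     rearrangement M \<phi> s \<le> ennreal (c * s powr - enn2real (inverse p)) * lorentz_norm M p q \<phi>"
proof (cases q)
  case (real q')
  let ?\<pi> = "enn2real (inverse p)"
  have q1: "q' \<ge> 1" using q real by simp
  have \<pi>0: "?\<pi> > 0" using \<pi> real by auto
  have qp: "q' * ?\<pi> > 0" using q1 \<pi>0 by simp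
  define c where "c = (q' * ?\<pi>) powr (1 / q')"
  show thesis
  proof (rule that[of c])
    show "c > 0" using q1 \<pi>0 by (simp add: c_def)
    fix M :: "'x measure" and \<phi> :: "'x \<Rightarrow> 'y::real_normed_vector" and s :: real assume s: "s > 0"
    let ?F = "rearrangement M \<phi>"
    let ?I = "\<integral>\<^sup>+s\<in>{0<..}. ennreal (s powr (q' * ?\<pi> - 1)) * epowr (?F s) q' \<partial>lborel"
    have "ennreal (s powr (q' * ?\<pi>) / (q' * ?\<pi>)) * epowr (?F s) q'
      = (\<integral>\<^sup>+t\<in>{0..s}. ennreal (t powr (q' * ?\<pi> - 1)) \<partial>lborel) * epowr (?F s) q'"
      using qp s by (simp add: nn_integral_powr_below)
    also have "\<dots> = (\<integral>\<^sup>+t. ennreal (t powr (q' * ?\<pi> - 1)) * indicator {0..s} t * epowr (?F s) q' \<partial>lborel)"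
      by (rule nn_integral_multc[symmetric]) measurable
    also have "\<dots> \<le> ?I"
    proof (rule nn_integral_mono)
      fix t :: real
      show "ennreal (t powr (q' * ?\<pi> - 1)) * indicator {0..s} t * epowr (?F s) q'
        \<le> ennreal (t powr (q' * ?\<pi> - 1)) * epowr (?F t) q' * indicator {0<..} t"
      proof (cases "0 < t \<and> t \<le> s")
        case True
        then have "epowr (?F s) q' \<le> epowr (?F t) q'"
          using q1 by (intro epowr_mono rearrangement_antimono) auto
        then show ?thesis using True by (simp add: mult_left_mono)
      qed (auto simp: indicator_def)
    qed
    finally have le: "ennreal (s powr (q' * ?\<pi>) / (q' * ?\<pi>)) * epowr (?F s) q' \<le> ?I" .
    have "epowr (?F s) q' = ennreal (q' * ?\<pi> * s powr - (q' * ?\<pi>)) * (ennreal (s powr (q' * ?\<pi>) / (q' * ?\<pi>)) * epowr (?F s) q')"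
    proof -
      have "q' * ?\<pi> * s powr - (q' * ?\<pi>) * (s powr (q' * ?\<pi>) / (q' * ?\<pi>)) = 1"
        using q1 \<pi>0 s by (simp add: powr_minus)
      then have "ennreal (q' * ?\<pi> * s powr - (q' * ?\<pi>)) * ennreal (s powr (q' * ?\<pi>) / (q' * ?\<pi>)) = 1"
        using q1 \<pi>0 by (subst ennreal_mult[symmetric]) auto
      then show ?thesis by (simp add: mult.assoc[symmetric])
    qed
    also have "\<dots> \<le> ennreal (q' * ?\<pi> * s powr - (q' * ?\<pi>)) * ?I" by (intro mult_left_mono le) simp
    finally have "epowr (epowr (?F s) q') (1 / q') \<le> epowr (ennreal (q' * ?\<pi> * s powr - (q' * ?\<pi>)) * ?I) (1 / q')"
      using q1 by (intro epowr_mono) auto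
    also have "\<dots> = ennreal ((q' * ?\<pi> * s powr - (q' * ?\<pi>)) powr (1 / q')) * epowr ?I (1 / q')"
      using q1 \<pi>0 by (subst epowr_mult, subst epowr_ennreal) auto
    also have "(q' * ?\<pi> * s powr - (q' * ?\<pi>)) powr (1 / q') = c * s powr - ?\<pi>"
      using q1 by (simp add: powr_mult[of "q' * ?\<pi>"] powr_powr c_def)
    also have "epowr ?I (1 / q') = lorentz_norm M p q \<phi>"
      using real by (simp add: lorentz_norm_real[OF q1])
    finally show "?F s \<le> ennreal (c * s powr - ?\<pi>) * lorentz_norm M p q \<phi>"
      using q1 by (simp add: epowr_epowr)
  qed
next
  case top
  let ?\<pi> = "enn2real (inverse p)"
  show thesis
  proof (rule that[of "2 powr ?\<pi>"])
    fix M :: "'x measure" and \<phi> :: "'x \<Rightarrow> 'y::real_normed_vector" and s :: real assume s: "s > 0"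
    let ?F = "rearrangement M \<phi>" let ?N = "lorentz_norm M p q \<phi>"
    have "AE t in restrict_space lborel {0<..}. ennreal (t powr ?\<pi>) * ?F t \<le> ?N"
      unfolding top[folded infinity_ennreal_def] lorentz_norm_top by (rule esssup_AE)
    then have ae: "AE t in lborel. t \<in> {0<..} \<longrightarrow> ennreal (t powr ?\<pi>) * ?F t \<le> ?N"
      by (subst (asm) AE_restrict_space_iff) auto
    \<comment> \<open>The essential supremum bounds only almost every \<open>t\<close>, possibly not
      \<open>s\<close> itself. A good \<open>t\<close> in the upper half of the interval exists by
      positive measure, and monotonicity transfers the bound to \<open>s\<close> at the price of
      \<open>2 powr ?\<pi>\<close>.\<close>
    have "\<exists>t. s / 2 < t \<and> t < s \<and> ennreal (t powr ?\<pi>) * ?F t \<le> ?N"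
    proof (rule ccontr)
      assume no: "\<not> ?thesis"
      have "AE t in lborel. t \<notin> {s / 2<..<s}"
        using ae by eventually_elim (use no s in auto)
      moreover have "{s / 2<..<s} \<in> sets lborel" by simp
      ultimately have "{s / 2<..<s} \<in> null_sets lborel" by (simp only: AE_iff_null_sets)
      then have "emeasure lborel {s / 2<..<s} = 0" by (rule null_setsD1)
      then show False using s by simp
    qed
    then obtain t where t: "s / 2 < t" "t < s" "ennreal (t powr ?\<pi>) * ?F t \<le> ?N" by blast
    have t0: "t > 0" using t s by simp
    have "?F s \<le> ?F t" using t by (intro rearrangement_antimono) simp
    also have "\<dots> = ennreal (t powr - ?\<pi>) * (ennreal (t powr ?\<pi>) * ?F t)"
    proof -
      have "ennreal (t powr - ?\<pi>) * ennreal (t powr ?\<pi>) = 1"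
        using t0 by (simp add: ennreal_mult[symmetric] powr_add[symmetric])
      then show ?thesis by (simp add: mult.assoc[symmetric])
    qed
    also have "\<dots> \<le> ennreal (2 powr ?\<pi> * s powr - ?\<pi>) * ?N"
    proof (intro mult_mono t(3) ennreal_leI)
      have "t powr - ?\<pi> \<le> (s / 2) powr - ?\<pi>" using t s by (intro powr_mono2') auto
      also have "\<dots> = 2 powr ?\<pi> * s powr - ?\<pi>" using s by (simp add: powr_divide powr_minus field_simps)
      finally show "t powr - ?\<pi> \<le> 2 powr ?\<pi> * s powr - ?\<pi>" .
    qed auto
    finally show "?F s \<le> ennreal (2 powr ?\<pi> * s powr - ?\<pi>) * ?N" .
  qed simp
qed

lemma rearrangement_eq_0:
  assumes "emeasure M (space M) \<le> ennreal s"
  shows "rearrangement M \<phi> s = 0"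
proof -
  have "emeasure M {x \<in> space M. 0 < ennreal (norm (\<phi> x))} \<le> emeasure M (space M)"
    by (rule emeasure_mono) auto
  then have "rearrangement M \<phi> s \<le> 0" using assms by (intro rearrangement_leI) (rule order_trans)
  then show ?thesis by simp
qed

lemma epowr_combination_le:
  assumes q: "q \<ge> 1" and K: "K > 0"
  shows "epowr (2 * x + ennreal K * y) q \<le> ennreal (2 powr q * (2 powr q + K powr q)) * (epowr x q + epowr y q)"
proof -
  have "epowr (2 * x + ennreal K * y) q \<le> ennreal (2 powr q) * (epowr (ennreal 2 * x) q + epowr (ennreal K * y) q)"
    using epowr_add_le[of q "ennreal 2 * x" "ennreal K * y"] q by simp
  also have "\<dots> = ennreal (2 powr q) * (ennreal (2 powr q) * epowr x q + ennreal (K powr q) * epowr y q)"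
    using K by (simp only: epowr_mult epowr_ennreal less_imp_le zero_le_numeral)
  also have "\<dots> \<le> ennreal (2 powr q) * (ennreal (2 powr q + K powr q) * epowr x q + ennreal (2 powr q + K powr q) * epowr y q)"
    by (intro mult_left_mono add_mono mult_right_mono ennreal_leI) auto
  also have "\<dots> = ennreal (2 powr q) * ennreal (2 powr q + K powr q) * (epowr x q + epowr y q)"
    by (simp only: distrib_left mult.assoc)
  also have "ennreal (2 powr q) * ennreal (2 powr q + K powr q) = ennreal (2 powr q * (2 powr q + K powr q))"
    by (intro ennreal_mult[symmetric]) auto
  finally show ?thesis .
qed

lemma epowr_root_le:
  assumes q: "q \<ge> 1" and C: "C \<ge> 0" and le: "X \<le> ennreal C * (Y + Z)"
  shows "epowr X (1 / q) \<le> ennreal (2 * C powr (1 / q)) * (epowr Y (1 / q) + epowr Z (1 / q))"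
proof -
  have "epowr X (1 / q) \<le> epowr (ennreal C * (Y + Z)) (1 / q)" using q by (intro epowr_mono le) simp
  also have "\<dots> = ennreal (C powr (1 / q)) * epowr (Y + Z) (1 / q)" using C by (simp only: epowr_mult epowr_ennreal)
  also have "\<dots> \<le> ennreal (C powr (1 / q)) * (ennreal (2 powr (1 / q)) * (epowr Y (1 / q) + epowr Z (1 / q)))"
    using q by (intro mult_left_mono epowr_add_le) auto
  also have "\<dots> \<le> ennreal (C powr (1 / q)) * (ennreal 2 * (epowr Y (1 / q) + epowr Z (1 / q)))"
  proof (intro mult_left_mono mult_right_mono ennreal_leI)
    have "2 powr (1 / q) \<le> 2 powr 1" using q by (intro powr_mono) auto
    then show "2 powr (1 / q) \<le> 2" by simp
  qed auto
  also have "\<dots> = ennreal (2 * C powr (1 / q)) * (epowr Y (1 / q) + epowr Z (1 / q))"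
    by (simp only: ennreal_mult zero_le_numeral powr_ge_zero mult_ac)
  finally show ?thesis .
qed

text \<open>The measure ds/s is invariant under \<open>r = a * s powr \<beta>\<close> up to the
  factor \<open>1 / \<beta>\<close>, so only the logarithms have to be compared. The comparison is
  demanded only where \<open>X\<close> does not vanish, because the logarithm in the new variable
  may degenerate elsewhere.\<close>

lemma nn_integral_log_transfer:
  fixes X :: "real \<Rightarrow> ennreal" and W :: "real \<Rightarrow> real"
  assumes [measurable]: "X \<in> borel_measurable borel" "W \<in> borel_measurable borel"
    and a: "a > 0" and \<beta>: "\<beta> > 0" and D: "D \<ge> 0"
    and le: "\<And>s. 0 < s \<Longrightarrow> s < m \<Longrightarrow> X (a * s powr \<beta>) \<noteq> 0 \<Longrightarrow> ln (1 + m / s) powr (- q) \<le> D * W (a * s powr \<beta>)"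
  shows "(\<integral>\<^sup>+s\<in>{0<..<m}. ennreal (s powr -1 * ln (1 + m / s) powr (- q)) * X (a * s powr \<beta>) \<partial>lborel)
    \<le> ennreal (D / \<beta>) * (\<integral>\<^sup>+r\<in>{0<..}. ennreal (r powr -1) * (ennreal (W r) * X r) \<partial>lborel)"
proof -
  have "(\<integral>\<^sup>+s\<in>{0<..<m}. ennreal (s powr -1 * ln (1 + m / s) powr (- q)) * X (a * s powr \<beta>) \<partial>lborel)
    \<le> (\<integral>\<^sup>+s. ennreal D * (ennreal (s powr -1) * (ennreal (W (a * s powr \<beta>)) * X (a * s powr \<beta>)) * indicator {0<..} s) \<partial>lborel)"
  proof (rule nn_integral_mono)
    fix s :: real
    show "ennreal (s powr -1 * ln (1 + m / s) powr (- q)) * X (a * s powr \<beta>) * indicator {0<..<m} s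
      \<le> ennreal D * (ennreal (s powr -1) * (ennreal (W (a * s powr \<beta>)) * X (a * s powr \<beta>)) * indicator {0<..} s)"
    proof (cases "0 < s \<and> s < m \<and> X (a * s powr \<beta>) \<noteq> 0")
      case True
      then have "ennreal (ln (1 + m / s) powr (- q)) \<le> ennreal (D * W (a * s powr \<beta>))"
        by (intro ennreal_leI le) auto
      also have "\<dots> = ennreal D * ennreal (W (a * s powr \<beta>))" using D by (rule ennreal_mult')
      finally have "ennreal (s powr -1) * ennreal (ln (1 + m / s) powr (- q)) * X (a * s powr \<beta>)
        \<le> ennreal (s powr -1) * (ennreal D * ennreal (W (a * s powr \<beta>))) * X (a * s powr \<beta>)"
        by (intro mult_right_mono mult_left_mono) auto
      moreover have "ennreal (s powr -1 * ln (1 + m / s) powr (- q)) = ennreal (s powr -1) * ennreal (ln (1 + m / s) powr (- q))"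
        by (rule ennreal_mult) auto
      ultimately show ?thesis using True by (simp add: mult_ac)
    qed (auto simp: indicator_def)
  qed
  also have "\<dots> = ennreal D * (\<integral>\<^sup>+s\<in>{0<..}. ennreal (s powr -1) * (ennreal (W (a * s powr \<beta>)) * X (a * s powr \<beta>)) \<partial>lborel)"
    by (rule nn_integral_cmult) measurable
  also have "\<dots> \<le> ennreal D * (ennreal (a powr (- ((-1 + 1) / \<beta>)) / \<beta>) * (\<integral>\<^sup>+r\<in>{0<..}. ennreal (r powr ((-1 + 1) / \<beta> - 1)) * (ennreal (W r) * X r) \<partial>lborel))"
    by (intro mult_left_mono nn_integral_powr_substitution_le[where F = "\<lambda>r. ennreal (W r) * X r"] a \<beta>) measurable
  also have "\<dots> = ennreal D * (ennreal (1 / \<beta>) * (\<integral>\<^sup>+r\<in>{0<..}. ennreal (r powr -1) * (ennreal (W r) * X r) \<partial>lborel))"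
    using a by simp
  also have "\<dots> = ennreal (D / \<beta>) * (\<integral>\<^sup>+r\<in>{0<..}. ennreal (r powr -1) * (ennreal (W r) * X r) \<partial>lborel)"
    using D \<beta> ennreal_mult[of D "1 / \<beta>"] by (simp add: mult.assoc[symmetric])
  finally show ?thesis .
qed

lemma E1_lorentz_spaceD:
  assumes "u \<in> E1 \<Omega> (lorentz_space (lebesgue_on \<Omega>) p q) \<inter> Cb (closure \<Omega>)"
  shows "\<exists>E. is_sym_gradient \<Omega> u E" "(\<lambda>x. norm (sym_gradient \<Omega> u x)) \<in> borel_measurable (lebesgue_on \<Omega>)"
    "u \<in> Cb (closure \<Omega>)"
  using assms by (auto simp: E1_def lorentz_space_def)

lemma nn_integral_epowr_combination_le:
  fixes F G H :: "real \<Rightarrow> ennreal" and w :: "real \<Rightarrow> real"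
  assumes [measurable]: "G \<in> borel_measurable borel" "H \<in> borel_measurable borel" "w \<in> borel_measurable borel" "S \<in> sets borel"
    and q: "q \<ge> 1" and K: "K > 0"
    and le: "\<And>s. s \<in> S \<Longrightarrow> F s \<le> 2 * G s + ennreal K * H s"
  shows "(\<integral>\<^sup>+s\<in>S. ennreal (w s) * epowr (F s) q \<partial>lborel)
    \<le> ennreal (2 powr q * (2 powr q + K powr q))
       * ((\<integral>\<^sup>+s\<in>S. ennreal (w s) * epowr (G s) q \<partial>lborel) + (\<integral>\<^sup>+s\<in>S. ennreal (w s) * epowr (H s) q \<partial>lborel))"
proof -
  let ?D = "ennreal (2 powr q * (2 powr q + K powr q))"
  have gen: "W * (D * (x + y)) = D * (W * x + W * y)" for W D x y :: ennreal
    by (simp only: distrib_left mult_ac)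
  have "(\<integral>\<^sup>+s\<in>S. ennreal (w s) * epowr (F s) q \<partial>lborel)
    \<le> (\<integral>\<^sup>+s. ?D * (ennreal (w s) * epowr (G s) q * indicator S s + ennreal (w s) * epowr (H s) q * indicator S s) \<partial>lborel)"
  proof (rule nn_integral_mono)
    fix s
    show "ennreal (w s) * epowr (F s) q * indicator S s
      \<le> ?D * (ennreal (w s) * epowr (G s) q * indicator S s + ennreal (w s) * epowr (H s) q * indicator S s)"
    proof (cases "s \<in> S")
      case True
      have "epowr (F s) q \<le> epowr (2 * G s + ennreal K * H s) q" using q by (intro epowr_mono le True) simp
      also have "\<dots> \<le> ?D * (epowr (G s) q + epowr (H s) q)" by (rule epowr_combination_le[OF q K])
      finally have "ennreal (w s) * epowr (F s) q \<le> ennreal (w s) * (?D * (epowr (G s) q + epowr (H s) q))"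
        by (rule mult_left_mono) simp
      also have "\<dots> = ?D * (ennreal (w s) * epowr (G s) q + ennreal (w s) * epowr (H s) q)"
        by (rule gen)
      finally show ?thesis using True by simp
    qed simp
  qed
  also have "\<dots> = ?D * (\<integral>\<^sup>+s. (ennreal (w s) * epowr (G s) q * indicator S s + ennreal (w s) * epowr (H s) q * indicator S s) \<partial>lborel)"
    by (rule nn_integral_cmult) measurable
  also have "(\<integral>\<^sup>+s. (ennreal (w s) * epowr (G s) q * indicator S s + ennreal (w s) * epowr (H s) q * indicator S s) \<partial>lborel)
    = (\<integral>\<^sup>+s\<in>S. ennreal (w s) * epowr (G s) q \<partial>lborel) + (\<integral>\<^sup>+s\<in>S. ennreal (w s) * epowr (H s) q \<partial>lborel)"
    by (rule nn_integral_add) measurable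
  finally show ?thesis .
qed

lemma ennreal_combination_le:
  assumes "x \<le> ennreal D * (y + z)" "y \<le> ennreal c * Y" "z \<le> ennreal d * Z" "D \<ge> 0" "c \<ge> 0" "d \<ge> 0"
  shows "x \<le> ennreal (D * (c + d)) * (Z + Y)"
proof -
  have "x \<le> ennreal D * (ennreal c * Y + ennreal d * Z)"
    using assms(1-3) by (meson add_mono mult_left_mono order_trans zero_le)
  also have "\<dots> \<le> ennreal D * (ennreal (c + d) * Y + ennreal (c + d) * Z)"
    using assms by (intro mult_left_mono add_mono mult_right_mono ennreal_leI) auto
  also have "\<dots> = ennreal D * ennreal (c + d) * (Z + Y)"
    by (simp only: distrib_left mult.assoc add.commute)
  also have "ennreal D * ennreal (c + d) = ennreal (D * (c + d))"
    using assms by (intro ennreal_mult[symmetric]) auto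
  finally show ?thesis .
qed

text \<open>The rearrangement inequality is inserted into the norm; the boundary term becomes the
  boundary norm by substitution, the potential term the interior norm by substitution and
  \<open>hardy_op_Lq\<close>. For \<open>q = \<infinity>\<close> the weak-type bounds replace both
  integrals pointwise.\<close>

lemma subcritical_estimate:
  fixes \<alpha> C p :: real and q :: ennreal
  assumes n: "CARD('n::finite) \<ge> 2" and \<alpha>: "\<alpha> > real CARD('n) - 1" and C: "C > 0"
    and p: "1 < p" "p < real CARD('n)" and q: "1 \<le> q"
  shows "\<exists>K>0. \<forall>(\<Omega>::(real^'n) set) \<mu>. open \<Omega> \<and> growth_measure \<Omega> \<alpha> C \<mu> \<longrightarrow>
           (\<forall>u \<in> E1 \<Omega> (lorentz_space (lebesgue_on \<Omega>) (ennreal p) q) \<inter> Cb (closure \<Omega>).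
             lorentz_norm \<mu> (ennreal (\<alpha> * p / (real CARD('n) - p))) q u
               \<le> ennreal K *
                  (lorentz_norm (lebesgue_on \<Omega>) (ennreal p) q (sym_gradient \<Omega> u)
                   + lorentz_norm (boundary_measure \<Omega>)
                       (ennreal (p * (real CARD('n) - 1) / (real CARD('n) - p))) q u))"
proof -
  let ?n = "real CARD('n)"
  have n1: "?n > 1" using n by simp
  have \<alpha>0: "\<alpha> > 0" using \<alpha> n1 by linarith
  define \<pi> where "\<pi> = 1 / p"
  define \<pi>b where "\<pi>b = (?n - p) / (p * (?n - 1))"
  define \<rho> where "\<rho> = (?n - p) / (\<alpha> * p)"
  define \<beta>1 where "\<beta>1 = (?n - 1) / \<alpha>"
  define \<beta>2 where "\<beta>2 = ?n / \<alpha>"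
  have \<beta>: "\<beta>1 > 0" "\<beta>2 > 0" using n1 \<alpha>0 by (auto simp: \<beta>1_def \<beta>2_def)
  have \<pi>: "1 / ?n < \<pi>" "\<pi> < 1" using p n1 by (auto simp: \<pi>_def field_simps)
  have \<pi>b: "\<pi>b > 0" using p n1 by (simp add: \<pi>b_def)
  \<comment> \<open>The scaling identities \<open>i1\<close> and \<open>i2\<close> are what ties the
    three Lorentz exponents together: after the power substitutions the weight \<open>\<rho>\<close>
    turns into the boundary weight \<open>\<pi>b\<close> and into the weight
    \<open>\<pi> - 1 / ?n\<close> on the left of Hardy's inequality.\<close>
  have i1: "\<beta>1 * \<pi>b = \<rho>" using p n1 \<alpha>0 by (simp add: \<beta>1_def \<pi>b_def \<rho>_def)
  have i2: "\<beta>2 * (\<pi> - 1 / ?n) = \<rho>"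
  proof -
    have "k / \<alpha> * (1 / p - 1 / k) = (k - p) / (\<alpha> * p)" if "k > 1" for k
      using that p \<alpha>0 by (simp add: field_simps)
    from this[OF n1] show ?thesis by (simp add: \<beta>2_def \<pi>_def \<rho>_def)
  qed
  have e1: "enn2real (inverse (ennreal p)) = \<pi>" using p by (simp add: enn2real_inverse_ennreal \<pi>_def)
  have e2: "enn2real (inverse (ennreal (\<alpha> * p / (?n - p)))) = \<rho>"
    using p \<alpha>0 by (subst enn2real_inverse_ennreal) (auto simp: \<rho>_def)
  have e3: "enn2real (inverse (ennreal (p * (?n - 1) / (?n - p)))) = \<pi>b"
    using p n1 by (subst enn2real_inverse_ennreal) (auto simp: \<pi>b_def)
  obtain a K where a: "a > 0" and K: "K > 0" and bound:
    "\<And>(\<Omega>::(real^'n) set) \<mu> u s. open \<Omega> \<Longrightarrow> growth_measure \<Omega> \<alpha> C \<mu> \<Longrightarrow> u \<in> Cb (closure \<Omega>)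
      \<Longrightarrow> \<exists>E. is_sym_gradient \<Omega> u E \<Longrightarrow> (\<lambda>x. norm (sym_gradient \<Omega> u x)) \<in> borel_measurable (lebesgue_on \<Omega>) \<Longrightarrow> s > 0
      \<Longrightarrow> rearrangement \<mu> u s \<le> 2 * rearrangement (boundary_measure \<Omega>) u (a * s powr \<beta>1)
        + ennreal K * hardy_op ?n (rearrangement (lebesgue_on \<Omega>) (sym_gradient \<Omega> u)) ((1/2) powr \<beta>2 * s powr \<beta>2)"
    unfolding \<beta>1_def \<beta>2_def using rearrangement_riesz_bound[OF n \<alpha> C] by blast
  define a2 where "a2 = (1/2::real) powr \<beta>2"
  have a2: "a2 > 0" by (simp add: a2_def)
  define A where "A = hardy_const ?n \<pi>"
  have A: "A > 0" using hardy_const_pos[OF \<pi>] by (simp add: A_def)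
  show ?thesis
  proof (cases q)
    case (real q')
    have q1: "q' \<ge> 1" using q real by simp
    have qq: "q = ennreal q'" using real by simp
    define c1 where "c1 = a powr (- (q' * \<rho> / \<beta>1)) / \<beta>1"
    define c2 where "c2 = a2 powr (- (q' * \<rho> / \<beta>2)) / \<beta>2 * (A powr (q' - 1) * A)"
    have c: "c1 > 0" "c2 > 0" using \<beta> a a2 A by (auto simp: c1_def c2_def)
    define D where "D = (2 powr q' * (2 powr q' + K powr q')) * (c1 + c2)"
    have D: "D > 0" unfolding D_def using c K by (intro mult_pos_pos add_pos_pos) auto
    have x1: "q' * \<rho> / \<beta>1 = q' * \<pi>b" "q' * \<rho> / \<beta>2 = q' * (\<pi> - 1 / ?n)"
      using \<beta> unfolding i1[symmetric] by simp (use \<beta> in \<open>simp add: i1 i2[symmetric]\<close>)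
    show ?thesis
    proof (intro exI[of _ "2 * D powr (1 / q')"] conjI allI impI ballI)
      show "0 < 2 * D powr (1 / q')" using D by simp
      fix \<Omega> :: "(real^'n) set" and \<mu> u
      assume "open \<Omega> \<and> growth_measure \<Omega> \<alpha> C \<mu>"
        and u: "u \<in> E1 \<Omega> (lorentz_space (lebesgue_on \<Omega>) (ennreal p) q) \<inter> Cb (closure \<Omega>)"
      then have op: "open \<Omega>" and gr: "growth_measure \<Omega> \<alpha> C \<mu>" by auto
      note uD = E1_lorentz_spaceD[OF u]
      define G where "G = rearrangement (boundary_measure \<Omega>) u"
      define f where "f = rearrangement (lebesgue_on \<Omega>) (sym_gradient \<Omega> u)"
      have [measurable]: "G \<in> borel_measurable borel" "f \<in> borel_measurable borel" by (simp_all add: G_def f_def)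
      have m1: "(\<integral>\<^sup>+s\<in>{0<..}. ennreal (s powr (q' * \<rho> - 1)) * epowr (rearrangement \<mu> u s) q' \<partial>lborel)
        \<le> ennreal (2 powr q' * (2 powr q' + K powr q'))
          * ((\<integral>\<^sup>+s\<in>{0<..}. ennreal (s powr (q' * \<rho> - 1)) * epowr (G (a * s powr \<beta>1)) q' \<partial>lborel)
           + (\<integral>\<^sup>+s\<in>{0<..}. ennreal (s powr (q' * \<rho> - 1)) * epowr (hardy_op ?n f (a2 * s powr \<beta>2)) q' \<partial>lborel))"
      proof (rule nn_integral_epowr_combination_le[OF _ _ _ _ q1 K])
        show "rearrangement \<mu> u s \<le> 2 * G (a * s powr \<beta>1) + ennreal K * hardy_op ?n f (a2 * s powr \<beta>2)" if "s \<in> {0<..}" for s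
          using bound[OF op gr uD(3,1,2), of s] that by (simp add: G_def f_def a2_def)
      qed measurable
      have m2: "(\<integral>\<^sup>+s\<in>{0<..}. ennreal (s powr (q' * \<rho> - 1)) * epowr (G (a * s powr \<beta>1)) q' \<partial>lborel)
        \<le> ennreal c1 * (\<integral>\<^sup>+r\<in>{0<..}. ennreal (r powr (q' * \<pi>b - 1)) * epowr (G r) q' \<partial>lborel)"
        using nn_integral_powr_substitution_le[OF _ a \<beta>(1), of "\<lambda>r. epowr (G r) q'" "q' * \<rho> - 1"]
        by (simp add: c1_def x1)
      have m3: "(\<integral>\<^sup>+s\<in>{0<..}. ennreal (s powr (q' * \<rho> - 1)) * epowr (hardy_op ?n f (a2 * s powr \<beta>2)) q' \<partial>lborel)
        \<le> ennreal c2 * (\<integral>\<^sup>+r\<in>{0<..}. ennreal (r powr (q' * \<pi> - 1)) * epowr (f r) q' \<partial>lborel)"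
      proof -
        have "(\<integral>\<^sup>+s\<in>{0<..}. ennreal (s powr (q' * \<rho> - 1)) * epowr (hardy_op ?n f (a2 * s powr \<beta>2)) q' \<partial>lborel)
          \<le> ennreal (a2 powr (- (q' * \<rho> / \<beta>2)) / \<beta>2) * (\<integral>\<^sup>+r\<in>{0<..}. ennreal (r powr (q' * (\<pi> - 1 / ?n) - 1)) * epowr (hardy_op ?n f r) q' \<partial>lborel)"
          using nn_integral_powr_substitution_le[OF _ a2 \<beta>(2), of "\<lambda>r. epowr (hardy_op ?n f r) q'" "q' * \<rho> - 1"]
          by (simp add: x1)
        also have "\<dots> \<le> ennreal (a2 powr (- (q' * \<rho> / \<beta>2)) / \<beta>2) * (ennreal (A powr (q' - 1) * A) * (\<integral>\<^sup>+r\<in>{0<..}. ennreal (r powr (q' * \<pi> - 1)) * epowr (f r) q' \<partial>lborel))"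
          unfolding A_def by (intro mult_left_mono hardy_op_Lq n1 \<pi> q1) auto
        also have "\<dots> = ennreal c2 * (\<integral>\<^sup>+r\<in>{0<..}. ennreal (r powr (q' * \<pi> - 1)) * epowr (f r) q' \<partial>lborel)"
          unfolding c2_def using \<beta> A by (subst (2) ennreal_mult) (auto simp: mult.assoc)
        finally show ?thesis .
      qed
      have "(\<integral>\<^sup>+s\<in>{0<..}. ennreal (s powr (q' * \<rho> - 1)) * epowr (rearrangement \<mu> u s) q' \<partial>lborel)
        \<le> ennreal D * ((\<integral>\<^sup>+r\<in>{0<..}. ennreal (r powr (q' * \<pi> - 1)) * epowr (f r) q' \<partial>lborel)
           + (\<integral>\<^sup>+r\<in>{0<..}. ennreal (r powr (q' * \<pi>b - 1)) * epowr (G r) q' \<partial>lborel))"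
        unfolding D_def by (rule ennreal_combination_le[OF m1 m2 m3]) (use c in auto)
      from epowr_root_le[OF q1 less_imp_le[OF D] this]
      show "lorentz_norm \<mu> (ennreal (\<alpha> * p / (?n - p))) q u \<le> ennreal (2 * D powr (1 / q')) *
          (lorentz_norm (lebesgue_on \<Omega>) (ennreal p) q (sym_gradient \<Omega> u)
             + lorentz_norm (boundary_measure \<Omega>) (ennreal (p * (?n - 1) / (?n - p))) q u)"
        unfolding qq lorentz_norm_real[OF q1] e1 e2 e3 G_def f_def .
    qed
  next
    case top
    then have qq: "q = \<infinity>" by simp
    have "0 < enn2real (inverse (ennreal p)) \<or> q = \<infinity>" using qq by simp
    from rearrangement_weak_bound[OF q this] obtain cf where cf: "cf > 0"
      "\<And>(M :: (real^'n) measure) (\<phi> :: real^'n \<Rightarrow> real^'n^'n) s. s > 0 \<Longrightarrow>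
         rearrangement M \<phi> s \<le> ennreal (cf * s powr - \<pi>) * lorentz_norm M (ennreal p) q \<phi>"
      unfolding e1 by blast
    have "0 < enn2real (inverse (ennreal (p * (?n - 1) / (?n - p)))) \<or> q = \<infinity>" using qq by simp
    from rearrangement_weak_bound[OF q this] obtain cg where cg: "cg > 0"
      "\<And>(M :: (real^'n) measure) (\<phi> :: real^'n \<Rightarrow> real^'n) s. s > 0 \<Longrightarrow>
         rearrangement M \<phi> s \<le> ennreal (cg * s powr - \<pi>b) * lorentz_norm M (ennreal (p * (?n - 1) / (?n - p))) q \<phi>"
      unfolding e3 by blast
    define k1 where "k1 = 2 * (cg * a powr - \<pi>b)"
    define k2 where "k2 = K * (cf * A * a2 powr (1 / ?n - \<pi>))"
    have k: "k1 > 0" "k2 > 0" using cg cf a a2 A K by (auto simp: k1_def k2_def)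
    show ?thesis
    proof (intro exI[of _ "1 * (k1 + k2)"] conjI allI impI ballI)
      show "0 < 1 * (k1 + k2)" using k by simp
      fix \<Omega> :: "(real^'n) set" and \<mu> u
      assume "open \<Omega> \<and> growth_measure \<Omega> \<alpha> C \<mu>"
        and u: "u \<in> E1 \<Omega> (lorentz_space (lebesgue_on \<Omega>) (ennreal p) q) \<inter> Cb (closure \<Omega>)"
      then have op: "open \<Omega>" and gr: "growth_measure \<Omega> \<alpha> C \<mu>" by auto
      note uD = E1_lorentz_spaceD[OF u]
      define Nf where "Nf = lorentz_norm (lebesgue_on \<Omega>) (ennreal p) q (sym_gradient \<Omega> u)"
      define Ng where "Ng = lorentz_norm (boundary_measure \<Omega>) (ennreal (p * (?n - 1) / (?n - p))) q u"
      have main: "ennreal (s powr \<rho>) * rearrangement \<mu> u s \<le> ennreal (1 * (k1 + k2)) * (Nf + Ng)" if s: "s > 0" for s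
      proof -
        define H where "H = hardy_op ?n (rearrangement (lebesgue_on \<Omega>) (sym_gradient \<Omega> u)) (a2 * s powr \<beta>2)"
        define G where "G = rearrangement (boundary_measure \<Omega>) u (a * s powr \<beta>1)"
        have b: "rearrangement \<mu> u s \<le> 2 * G + ennreal K * H"
          using bound[OF op gr uD(3,1,2) s] by (simp add: G_def H_def a2_def)
        have g: "G \<le> ennreal (cg * (a * s powr \<beta>1) powr - \<pi>b) * Ng"
          unfolding G_def Ng_def using a s by (intro cg(2)) simp
        have h: "H \<le> ennreal (cf * A * (a2 * s powr \<beta>2) powr (1 / ?n - \<pi>)) * Nf"
          unfolding H_def A_def Nf_def using a2 s cf by (intro hardy_op_weak_bound n1 \<pi> cf(2)) auto
        have p1: "(a * s powr \<beta>1) powr - \<pi>b = a powr - \<pi>b * s powr - \<rho>"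
          using i1 by (simp add: powr_mult powr_powr)
        have p2: "(a2 * s powr \<beta>2) powr (1 / ?n - \<pi>) = a2 powr (1 / ?n - \<pi>) * s powr - \<rho>"
        proof -
          have "\<beta>2 * (1 / ?n - \<pi>) = - \<rho>" unfolding i2[symmetric] by (simp add: right_diff_distrib)
          then show ?thesis by (simp add: powr_mult powr_powr)
        qed
        have s1: "s powr \<rho> * s powr - \<rho> = 1" using s by (simp add: powr_add[symmetric])
        have g': "ennreal (2 * s powr \<rho>) * G \<le> ennreal k1 * Ng"
        proof -
          have "ennreal (2 * s powr \<rho>) * G \<le> ennreal (2 * s powr \<rho>) * (ennreal (cg * (a * s powr \<beta>1) powr - \<pi>b) * Ng)"
            by (intro mult_left_mono g) simp
          also have "\<dots> = ennreal (2 * s powr \<rho> * (cg * (a * s powr \<beta>1) powr - \<pi>b)) * Ng"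
            using cg by (subst (3) ennreal_mult) (auto simp: mult.assoc)
          also have "2 * s powr \<rho> * (cg * (a * s powr \<beta>1) powr - \<pi>b) = k1 * (s powr \<rho> * s powr - \<rho>)"
            unfolding p1 k1_def by (simp only: mult_ac)
          finally show ?thesis unfolding s1 by simp
        qed
        have h': "ennreal (K * s powr \<rho>) * H \<le> ennreal k2 * Nf"
        proof -
          have "ennreal (K * s powr \<rho>) * H \<le> ennreal (K * s powr \<rho>) * (ennreal (cf * A * (a2 * s powr \<beta>2) powr (1 / ?n - \<pi>)) * Nf)"
            by (intro mult_left_mono h) simp
          also have "\<dots> = ennreal (K * s powr \<rho> * (cf * A * (a2 * s powr \<beta>2) powr (1 / ?n - \<pi>))) * Nf"
            using cf A K by (subst (3) ennreal_mult) (auto simp: mult.assoc)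
          also have "K * s powr \<rho> * (cf * A * (a2 * s powr \<beta>2) powr (1 / ?n - \<pi>)) = k2 * (s powr \<rho> * s powr - \<rho>)"
            unfolding p2 k2_def by (simp only: mult_ac)
          finally show ?thesis unfolding s1 by simp
        qed
        have "ennreal (s powr \<rho>) * rearrangement \<mu> u s \<le> ennreal (s powr \<rho>) * (ennreal 2 * G + ennreal K * H)"
          using b by (intro mult_left_mono) auto
        also have "\<dots> = ennreal 1 * (ennreal (2 * s powr \<rho>) * G + ennreal (K * s powr \<rho>) * H)"
        proof -
          have "ennreal (2 * s powr \<rho>) = ennreal 2 * ennreal (s powr \<rho>)" "ennreal (K * s powr \<rho>) = ennreal K * ennreal (s powr \<rho>)"
            using K by (intro ennreal_mult; simp)+
          then show ?thesis by (simp only: distrib_left mult_ac ennreal_1 mult_1)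
        qed
        finally show ?thesis by (rule ennreal_combination_le[OF _ g' h']) (use k in auto)
      qed
      show "lorentz_norm \<mu> (ennreal (\<alpha> * p / (?n - p))) q u \<le> ennreal (1 * (k1 + k2)) *
          (lorentz_norm (lebesgue_on \<Omega>) (ennreal p) q (sym_gradient \<Omega> u)
             + lorentz_norm (boundary_measure \<Omega>) (ennreal (p * (?n - 1) / (?n - p))) q u)"
        unfolding Nf_def[symmetric] Ng_def[symmetric]
      proof -
        have "esssup (restrict_space lborel {0<..}) (\<lambda>s. ennreal (s powr \<rho>) * rearrangement \<mu> u s) \<le> ennreal (1 * (k1 + k2)) * (Nf + Ng)"
        proof (rule esssup_I)
          show "(\<lambda>s. ennreal (s powr \<rho>) * rearrangement \<mu> u s) \<in> borel_measurable (restrict_space lborel {0<..})"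
            by (rule measurable_restrict_space1) measurable
          show "AE s in restrict_space lborel {0<..}. ennreal (s powr \<rho>) * rearrangement \<mu> u s \<le> ennreal (1 * (k1 + k2)) * (Nf + Ng)"
            using main by (intro AE_I2) (auto simp: space_restrict_space)
        qed
        then show "lorentz_norm \<mu> (ennreal (\<alpha> * p / (?n - p))) q u \<le> ennreal (1 * (k1 + k2)) * (Nf + Ng)"
          unfolding qq lorentz_norm_top e2 .
      qed
    qed
  qed
qed

lemma powr_neg_le:
  fixes c q x y :: real
  assumes "0 < y" "y \<le> c * x" "c > 0" "q \<ge> 0"
  shows "x powr (- q) \<le> c powr q * y powr (- q)"
proof -
  have "0 < c * x" using assms by linarith
  then have x: "x > 0" using assms(3) by (simp add: zero_less_mult_iff)
  have "(c * x) powr (- q) \<le> y powr (- q)" using assms by (intro powr_mono2') auto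
  then have "c powr q * (c * x) powr (- q) \<le> c powr q * y powr (- q)" by (rule mult_left_mono) simp
  also have "c powr q * (c * x) powr (- q) = (c powr q * c powr (- q)) * x powr (- q)"
    by (simp only: powr_mult mult.assoc)
  also have "c powr q * c powr (- q) = 1" using assms(3) by (simp add: powr_add[symmetric])
  finally show ?thesis by simp
qed

text \<open>At p = n the outer half of the Hardy operator is no longer bounded with power weights,
  and \<open>hardy_op_log_Lq\<close> takes its place. The total masses enter through the comparison
  of logarithms normalised at different end points.\<close>

lemma critical_estimate:
  fixes \<alpha> C q L m h :: real
  assumes n: "CARD('n::finite) \<ge> 2" and \<alpha>: "\<alpha> > real CARD('n) - 1" and C: "C > 0" and q: "1 < q"
  shows "\<exists>K>0. \<forall>(\<Omega>::(real^'n) set) \<mu>. open \<Omega> \<and> growth_measure \<Omega> \<alpha> C \<mu>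
            \<and> emeasure lebesgue \<Omega> = ennreal L \<and> emeasure \<mu> \<Omega> = ennreal m
            \<and> emeasure (hausdorff_measure (CARD('n) - 1)) (frontier \<Omega>) = ennreal h \<longrightarrow>
           (\<forall>u \<in> E1 \<Omega> (lorentz_space (lebesgue_on \<Omega>) (of_nat CARD('n)) (ennreal q)) \<inter> Cb (closure \<Omega>).
             lorentz_zygmund_norm \<mu> q u
               \<le> ennreal K *
                  (lorentz_norm (lebesgue_on \<Omega>) (of_nat CARD('n)) (ennreal q) (sym_gradient \<Omega> u)
                   + lorentz_zygmund_norm (boundary_measure \<Omega>) q u))"
proof -
  let ?n = "real CARD('n)"
  have n1: "?n > 1" using n by simp
  have \<alpha>0: "\<alpha> > 0" using \<alpha> n1 by linarith
  have q1: "q \<ge> 1" using q by simp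
  define \<beta>1 where "\<beta>1 = (?n - 1) / \<alpha>"
  define \<beta>2 where "\<beta>2 = ?n / \<alpha>"
  have \<beta>: "\<beta>1 > 0" "\<beta>2 > 0" using n1 \<alpha>0 by (auto simp: \<beta>1_def \<beta>2_def)
  have en: "enn2real (inverse (of_nat CARD('n) :: ennreal)) = 1 / ?n"
    using n1 enn2real_inverse_ennreal[of ?n] by (simp add: ennreal_of_nat_eq_real_of_nat)
  obtain a K where a: "a > 0" and K: "K > 0" and bound:
    "\<And>(\<Omega>::(real^'n) set) \<mu> u s. open \<Omega> \<Longrightarrow> growth_measure \<Omega> \<alpha> C \<mu> \<Longrightarrow> u \<in> Cb (closure \<Omega>)
      \<Longrightarrow> \<exists>E. is_sym_gradient \<Omega> u E \<Longrightarrow> (\<lambda>x. norm (sym_gradient \<Omega> u x)) \<in> borel_measurable (lebesgue_on \<Omega>) \<Longrightarrow> s > 0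
      \<Longrightarrow> rearrangement \<mu> u s \<le> 2 * rearrangement (boundary_measure \<Omega>) u (a * s powr \<beta>1)
        + ennreal K * hardy_op ?n (rearrangement (lebesgue_on \<Omega>) (sym_gradient \<Omega> u)) ((1/2) powr \<beta>2 * s powr \<beta>2)"
    unfolding \<beta>1_def \<beta>2_def using rearrangement_riesz_bound[OF n \<alpha> C] by blast
  define a2 where "a2 = (1/2::real) powr \<beta>2"
  have a2: "a2 > 0" by (simp add: a2_def)
  \<comment> \<open>The parameters are arbitrary reals and \<open>ennreal\<close> maps negative ones
    to 0; \<open>m0\<close>, \<open>h0\<close> and \<open>L0\<close> are the actual masses.\<close>
  define m0 where "m0 = enn2real (ennreal m)"
  define h0 where "h0 = enn2real (ennreal h)"
  define L0 where "L0 = enn2real (ennreal L)"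
  have 0: "m0 \<ge> 0" "h0 \<ge> 0" "L0 \<ge> 0" by (simp_all add: m0_def h0_def L0_def)
  have measure_\<Omega>: "measure \<mu> (space \<mu>) = m0"
    if "growth_measure \<Omega> \<alpha> C \<mu>" "open \<Omega>" "emeasure \<mu> \<Omega> = ennreal m" for \<Omega> :: "(real^'n) set" and \<mu>
    using growth_measure_distr(3)[OF that(1,2) C] that(3) by (simp add: measure_def m0_def)
  show ?thesis
  \<comment> \<open>A null measure has norm 0, the integral over an empty interval;
    \<open>ln_shift_le\<close> needs a positive mass.\<close>
  proof (cases "m0 = 0")
    case True
    show ?thesis
    proof (intro exI[of _ "1::real"] conjI allI impI ballI)
      fix \<Omega> :: "(real^'n) set" and \<mu> and u :: "real^'n \<Rightarrow> real^'n"
      assume "open \<Omega> \<and> growth_measure \<Omega> \<alpha> C \<mu>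
            \<and> emeasure lebesgue \<Omega> = ennreal L \<and> emeasure \<mu> \<Omega> = ennreal m
            \<and> emeasure (hausdorff_measure (CARD('n) - 1)) (frontier \<Omega>) = ennreal h"
      then have "measure \<mu> (space \<mu>) = 0" using measure_\<Omega>[of \<Omega> \<mu>] True by auto
      then have "lorentz_zygmund_norm \<mu> q u = 0" by (simp add: lorentz_zygmund_norm_real[OF q])
      then show "lorentz_zygmund_norm \<mu> q u \<le> ennreal 1 *
                  (lorentz_norm (lebesgue_on \<Omega>) (of_nat CARD('n)) (ennreal q) (sym_gradient \<Omega> u)
                   + lorentz_zygmund_norm (boundary_measure \<Omega>) q u)" by simp
    qed simp
  next
    case False
    with 0 have m0: "m0 > 0" by simp
    have lm: "ln (1 + m0 / s) > 0" if "0 < s" "s < m0" for s using that by (intro ln_gt_zero) auto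
    \<comment> \<open>Beyond \<open>L0\<close> the rearrangement of the symmetric gradient vanishes,
      as \<open>hardy_op_log_Lq\<close> requires, and all arguments
      \<open>a2 * s powr \<beta>2\<close> with \<open>s < m0\<close> stay below
      \<open>\<Lambda>\<close>. The summand 1 makes both comparisons strict.\<close>
    define \<Lambda> where "\<Lambda> = max L0 (a2 * m0 powr \<beta>2) + 1"
    have \<Lambda>: "\<Lambda> > 0" "\<Lambda> > L0" using 0 by (auto simp: \<Lambda>_def)
    have s\<Lambda>: "a2 * s powr \<beta>2 < \<Lambda>" if "0 < s" "s < m0" for s
    proof -
      have "a2 * s powr \<beta>2 \<le> a2 * m0 powr \<beta>2" using that a2 \<beta> by (intro mult_left_mono powr_mono2) auto
      then show ?thesis by (simp add: \<Lambda>_def)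
    qed
    obtain C0 where C0: "C0 > 0" "\<And>s. 0 < s \<Longrightarrow> s < m0 \<Longrightarrow> ln (1 + \<Lambda> / (a2 * s powr \<beta>2)) \<le> C0 * ln (1 + m0 / s)"
      using ln_shift_le[OF a2 \<beta>(2) \<Lambda>(1) m0] by blast
    \<comment> \<open>For \<open>x > 1\<close> the constant 1 is at most
      \<open>ln (1 + x) / ln 2\<close> and \<open>ln x\<close> at most \<open>ln (1 + x)\<close>;
      this passes from the weight 1 + ln x to the weight of the norm.\<close>
    define C1 where "C1 = 1 / ln 2 + (1::real)"
    have C1: "C1 > 0" by (simp add: C1_def add_pos_pos)
    have w2: "ln (1 + m0 / s) powr (- q) \<le> (C1 * C0) powr q * (1 + ln (\<Lambda> / (a2 * s powr \<beta>2))) powr (- q)" if s: "0 < s" "s < m0" for s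
    proof (rule powr_neg_le)
      define x where "x = \<Lambda> / (a2 * s powr \<beta>2)"
      have x: "x > 1" using s\<Lambda>[OF s] a2 s by (simp add: x_def)
      show "0 < 1 + ln (\<Lambda> / (a2 * s powr \<beta>2))" unfolding x_def[symmetric] using x by (intro add_pos_nonneg) auto
      have "1 + ln x \<le> C1 * ln (1 + x)"
      proof -
        have "ln 2 \<le> ln (1 + x)" "ln x \<le> ln (1 + x)" using x by (auto intro!: ln_mono)
        then have "1 + ln x \<le> ln (1 + x) / ln 2 + ln (1 + x)" by (intro add_mono) (auto simp: field_simps)
        then show ?thesis by (simp add: C1_def distrib_right)
      qed
      also have "\<dots> \<le> C1 * (C0 * ln (1 + m0 / s))"
        using C0(2)[OF s] C1 unfolding x_def by (intro mult_left_mono) auto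
      finally show "1 + ln (\<Lambda> / (a2 * s powr \<beta>2)) \<le> C1 * C0 * ln (1 + m0 / s)" by (simp add: x_def)
    qed (use C0 C1 q in auto)
    \<comment> \<open>If the boundary has measure 0 the comparison is vacuous: its rearrangement
      then vanishes at all positive arguments, and the transfer below asks for nothing
      there.\<close>
    obtain C2 where C2: "C2 > 0" "\<And>s. 0 < s \<Longrightarrow> s < m0 \<Longrightarrow> h0 > 0 \<Longrightarrow> ln (1 + h0 / (a * s powr \<beta>1)) \<le> C2 * ln (1 + m0 / s)"
    proof (cases "h0 > 0")
      case True
      obtain c where "c > 0" "\<And>s. 0 < s \<Longrightarrow> s < m0 \<Longrightarrow> ln (1 + h0 / (a * s powr \<beta>1)) \<le> c * ln (1 + m0 / s)"
        by (rule ln_shift_le[OF a \<beta>(1) True m0]) blast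
      then show thesis by (intro that[of c])
    next
      case False
      then show thesis by (intro that[of 1]) auto
    qed
    define c1 where "c1 = C2 powr q / \<beta>1"
    define k2 where "k2 = 2 powr q * ((1 / (1 - 1 / ?n)) powr (q - 1) * (1 / (1 - 1 / ?n)) + 2 powr (q - 1) * (2 / (q - 1)))"
    define c2 where "c2 = (C1 * C0) powr q / \<beta>2 * k2"
    have k2: "k2 \<ge> 0" unfolding k2_def using q n1 by (intro mult_nonneg_nonneg add_nonneg_nonneg) auto
    have c: "c1 > 0" "c2 \<ge> 0" using C2 \<beta> k2 by (auto simp: c1_def c2_def)
    define D where "D = (2 powr q * (2 powr q + K powr q)) * (c1 + c2)"
    have D: "D > 0" unfolding D_def using c K by (intro mult_pos_pos add_pos_nonneg) auto
    show ?thesis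
    proof (intro exI[of _ "2 * D powr (1 / q)"] conjI allI impI ballI)
      show "0 < 2 * D powr (1 / q)" using D by simp
      fix \<Omega> :: "(real^'n) set" and \<mu> u
      assume *: "open \<Omega> \<and> growth_measure \<Omega> \<alpha> C \<mu>
            \<and> emeasure lebesgue \<Omega> = ennreal L \<and> emeasure \<mu> \<Omega> = ennreal m
            \<and> emeasure (hausdorff_measure (CARD('n) - 1)) (frontier \<Omega>) = ennreal h"
        and u: "u \<in> E1 \<Omega> (lorentz_space (lebesgue_on \<Omega>) (of_nat CARD('n)) (ennreal q)) \<inter> Cb (closure \<Omega>)"
      then have op: "open \<Omega>" and gr: "growth_measure \<Omega> \<alpha> C \<mu>" by auto
      note uD = E1_lorentz_spaceD[OF u]
      have mm: "measure \<mu> (space \<mu>) = m0" using * by (intro measure_\<Omega>) auto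
      have eB: "emeasure (boundary_measure \<Omega>) (space (boundary_measure \<Omega>)) = ennreal h0"
        unfolding boundary_measure_simps(1)
        using * by (subst boundary_measure_simps(3)) (auto simp: emeasure_hausdorff_measure[symmetric] h0_def)
      then have mB: "measure (boundary_measure \<Omega>) (space (boundary_measure \<Omega>)) = h0" using 0 by (simp add: measure_def)
      define G where "G = rearrangement (boundary_measure \<Omega>) u"
      define f where "f = rearrangement (lebesgue_on \<Omega>) (sym_gradient \<Omega> u)"
      have [measurable]: "G \<in> borel_measurable borel" "f \<in> borel_measurable borel" by (simp_all add: G_def f_def)
      have G0: "G r = 0" if "r \<ge> h0" for r
        unfolding G_def using that by (intro rearrangement_eq_0) (simp add: eB ennreal_leI)
      have f0: "f r = 0" if "r \<ge> \<Lambda>" for r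
      proof -
        have "emeasure (lebesgue_on \<Omega>) (space (lebesgue_on \<Omega>)) = ennreal L"
          using * op by (subst emeasure_restrict_space) auto
        also have "\<dots> = ennreal L0" by (simp add: L0_def)
        also have "\<dots> \<le> ennreal r" using that \<Lambda> by (intro ennreal_leI) simp
        finally show ?thesis unfolding f_def by (rule rearrangement_eq_0)
      qed
      let ?w = "\<lambda>s. s powr -1 * ln (1 + m0 / s) powr (- q)"
      let ?IG = "\<integral>\<^sup>+r\<in>{0<..<h0}. ennreal (r powr -1 * ln (1 + h0 / r) powr (- q)) * epowr (G r) q \<partial>lborel"
      let ?If = "\<integral>\<^sup>+r\<in>{0<..}. ennreal (r powr (q / ?n - 1)) * epowr (f r) q \<partial>lborel"
      have m1: "(\<integral>\<^sup>+s\<in>{0<..<m0}. ennreal (?w s) * epowr (rearrangement \<mu> u s) q \<partial>lborel)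
        \<le> ennreal (2 powr q * (2 powr q + K powr q))
          * ((\<integral>\<^sup>+s\<in>{0<..<m0}. ennreal (?w s) * epowr (G (a * s powr \<beta>1)) q \<partial>lborel)
           + (\<integral>\<^sup>+s\<in>{0<..<m0}. ennreal (?w s) * epowr (hardy_op ?n f (a2 * s powr \<beta>2)) q \<partial>lborel))"
      proof (rule nn_integral_epowr_combination_le[OF _ _ _ _ q1 K])
        show "rearrangement \<mu> u s \<le> 2 * G (a * s powr \<beta>1) + ennreal K * hardy_op ?n f (a2 * s powr \<beta>2)" if "s \<in> {0<..<m0}" for s
          using bound[OF op gr uD(3,1,2), of s] that by (simp add: G_def f_def a2_def)
      qed measurable
      have m2: "(\<integral>\<^sup>+s\<in>{0<..<m0}. ennreal (?w s) * epowr (G (a * s powr \<beta>1)) q \<partial>lborel) \<le> ennreal c1 * ?IG"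
      proof -
        have "(\<integral>\<^sup>+s\<in>{0<..<m0}. ennreal (?w s) * epowr (G (a * s powr \<beta>1)) q \<partial>lborel)
          \<le> ennreal (C2 powr q / \<beta>1) * (\<integral>\<^sup>+r\<in>{0<..}. ennreal (r powr -1) * (ennreal (ln (1 + h0 / r) powr (- q)) * epowr (G r) q) \<partial>lborel)"
        proof (rule nn_integral_log_transfer[OF _ _ a \<beta>(1)])
          fix s assume s: "0 < s" "s < m0" and ne: "epowr (G (a * s powr \<beta>1)) q \<noteq> 0"
          define r where "r = a * s powr \<beta>1"
          have r: "r > 0" using a s by (simp add: r_def)
          have rh: "r < h0"
          proof (rule ccontr)
            assume "\<not> r < h0"
            then have "G r = 0" by (intro G0) simp
            with ne show False by (simp add: r_def)
          qed
          show "ln (1 + m0 / s) powr (- q) \<le> C2 powr q * ln (1 + h0 / (a * s powr \<beta>1)) powr (- q)"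
          proof (rule powr_neg_le[OF _ C2(2)[OF s]])
            show "0 < ln (1 + h0 / (a * s powr \<beta>1))" unfolding r_def[symmetric] using r rh by (intro ln_gt_zero) auto
          qed (use C2 q r rh in auto)
        qed measurable
        also have "(\<integral>\<^sup>+r\<in>{0<..}. ennreal (r powr -1) * (ennreal (ln (1 + h0 / r) powr (- q)) * epowr (G r) q) \<partial>lborel) = ?IG"
        proof (rule nn_integral_cong)
          fix r :: real
          have "ennreal (r powr -1 * ln (1 + h0 / r) powr (- q)) = ennreal (r powr -1) * ennreal (ln (1 + h0 / r) powr (- q))"
            by (rule ennreal_mult) auto
          then show "ennreal (r powr -1) * (ennreal (ln (1 + h0 / r) powr (- q)) * epowr (G r) q) * indicator {0<..} r
             = ennreal (r powr -1 * ln (1 + h0 / r) powr (- q)) * epowr (G r) q * indicator {0<..<h0} r"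
            using G0[of r] by (cases "r < h0") (simp_all only: mult.assoc, auto simp: indicator_def)
        qed
        finally show ?thesis unfolding c1_def .
      qed
      have m3: "(\<integral>\<^sup>+s\<in>{0<..<m0}. ennreal (?w s) * epowr (hardy_op ?n f (a2 * s powr \<beta>2)) q \<partial>lborel) \<le> ennreal c2 * ?If"
      proof -
        \<comment> \<open>The transfer lemma ends with an integral over the whole half-line; the
          indicator restricts it to the interval on which the logarithmic Hardy inequality holds and
          changes nothing on the left.\<close>
        define X where "X r = epowr (hardy_op ?n f r) q * indicator {..<\<Lambda>} r" for r
        have [measurable]: "X \<in> borel_measurable borel" unfolding X_def[abs_def] by measurable
        have "(\<integral>\<^sup>+s\<in>{0<..<m0}. ennreal (?w s) * epowr (hardy_op ?n f (a2 * s powr \<beta>2)) q \<partial>lborel)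
          = (\<integral>\<^sup>+s\<in>{0<..<m0}. ennreal (?w s) * X (a2 * s powr \<beta>2) \<partial>lborel)"
          using s\<Lambda> by (intro nn_integral_cong) (auto simp: indicator_def X_def)
        also have "\<dots> \<le> ennreal ((C1 * C0) powr q / \<beta>2) * (\<integral>\<^sup>+r\<in>{0<..}. ennreal (r powr -1) * (ennreal ((1 + ln (\<Lambda> / r)) powr (- q)) * X r) \<partial>lborel)"
          by (rule nn_integral_log_transfer[OF _ _ a2 \<beta>(2)]) (use w2 in auto)
        also have "(\<integral>\<^sup>+r\<in>{0<..}. ennreal (r powr -1) * (ennreal ((1 + ln (\<Lambda> / r)) powr (- q)) * X r) \<partial>lborel)
          = (\<integral>\<^sup>+r\<in>{0<..<\<Lambda>}. ennreal (r powr -1 * (1 + ln (\<Lambda> / r)) powr (- q)) * epowr (hardy_op ?n f r) q \<partial>lborel)"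
        proof (rule nn_integral_cong)
          fix r :: real
          have "ennreal (r powr -1 * (1 + ln (\<Lambda> / r)) powr (- q)) = ennreal (r powr -1) * ennreal ((1 + ln (\<Lambda> / r)) powr (- q))"
            by (rule ennreal_mult) auto
          then show "ennreal (r powr -1) * (ennreal ((1 + ln (\<Lambda> / r)) powr (- q)) * X r) * indicator {0<..} r
             = ennreal (r powr -1 * (1 + ln (\<Lambda> / r)) powr (- q)) * epowr (hardy_op ?n f r) q * indicator {0<..<\<Lambda>} r"
            by (simp only: X_def mult.assoc) (auto simp: indicator_def)
        qed
        also have "ennreal ((C1 * C0) powr q / \<beta>2) * \<dots> \<le> ennreal ((C1 * C0) powr q / \<beta>2) * (ennreal k2 * ?If)"
          unfolding k2_def by (intro mult_left_mono hardy_op_log_Lq n1 q \<Lambda>(1) f0) auto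
        also have "\<dots> = ennreal c2 * ?If"
          unfolding c2_def using ennreal_mult[of "(C1 * C0) powr q / \<beta>2" k2] k2 \<beta> by (simp only: mult.assoc powr_ge_zero divide_nonneg_pos)
        finally show ?thesis .
      qed
      have "(\<integral>\<^sup>+s\<in>{0<..<m0}. ennreal (?w s) * epowr (rearrangement \<mu> u s) q \<partial>lborel) \<le> ennreal D * (?If + ?IG)"
        unfolding D_def by (rule ennreal_combination_le[OF m1 m2 m3]) (use c in auto)
      from epowr_root_le[OF q1 less_imp_le[OF D] this]
      show "lorentz_zygmund_norm \<mu> q u \<le> ennreal (2 * D powr (1 / q)) *
                  (lorentz_norm (lebesgue_on \<Omega>) (of_nat CARD('n)) (ennreal q) (sym_gradient \<Omega> u)
                   + lorentz_zygmund_norm (boundary_measure \<Omega>) q u)"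
        unfolding lorentz_zygmund_norm_real[OF q] lorentz_norm_real[OF q1] mm mB en G_def f_def by simp
    qed
  qed
qed

text \<open>The kernel is at most r^(1/n-1), whatever \<open>\<sigma>\<close> is. For p = n and q =
  1 the resulting integral is the Lorentz norm itself. For larger p the weak-type bound leaves a
  power with exponent above -1, integrable up to \<open>L\<close>, beyond which the rearrangement is
  0.\<close>

lemma hardy_op_le_lorentz_norm:
  fixes p q :: ennreal and n L :: real
  assumes n: "n > 1" and L: "L > 0"
    and pq: "enn2real (inverse p) = 1 / n \<and> q = 1 \<or> enn2real (inverse p) < 1 / n \<and> 1 \<le> q \<and> (0 < enn2real (inverse p) \<or> q = \<infinity>)"
  obtains c where "c > 0" "\<And>(M :: 'x measure) (\<phi> :: 'x \<Rightarrow> 'y::real_normed_vector) \<sigma>. emeasure M (space M) \<le> ennreal L \<Longrightarrow> \<sigma> > 0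
    \<Longrightarrow> hardy_op n (rearrangement M \<phi>) \<sigma> \<le> ennreal c * lorentz_norm M p q \<phi>"
proof -
  have mx: "max \<sigma> r powr (1 / n - 1) \<le> r powr (1 / n - 1)" if "r > 0" for \<sigma> r :: real
    using n that by (intro powr_mono2') auto
  from pq show thesis
  proof
    assume pq: "enn2real (inverse p) = 1 / n \<and> q = 1"
    show thesis
    proof (rule that[of 1])
      fix M :: "'x measure" and \<phi> :: "'x \<Rightarrow> 'y" and \<sigma> :: real
      have q: "q = ennreal 1" using pq by simp
      have "hardy_op n (rearrangement M \<phi>) \<sigma>
        \<le> (\<integral>\<^sup>+r\<in>{0<..}. ennreal (r powr (1 / n - 1)) * rearrangement M \<phi> r \<partial>lborel)"
        unfolding hardy_op_def using mx
        by (intro nn_integral_mono) (auto simp: indicator_def mult.commute intro!: mult_left_mono ennreal_leI)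
      also have "\<dots> = lorentz_norm M p q \<phi>"
        unfolding q by (subst lorentz_norm_real) (use pq in auto)
      finally show "hardy_op n (rearrangement M \<phi>) \<sigma> \<le> ennreal 1 * lorentz_norm M p q \<phi>" by simp
    qed simp
  next
    let ?\<pi> = "enn2real (inverse p)"
    assume pq: "?\<pi> < 1 / n \<and> 1 \<le> q \<and> (0 < ?\<pi> \<or> q = \<infinity>)"
    then have q: "1 \<le> q" and pi: "0 < ?\<pi> \<or> q = \<infinity>" and less: "?\<pi> < 1 / n" by auto
    obtain c where c: "c > 0" "\<And>(M :: 'x measure) (\<phi> :: 'x \<Rightarrow> 'y) s. s > 0 \<Longrightarrow>
        rearrangement M \<phi> s \<le> ennreal (c * s powr - ?\<pi>) * lorentz_norm M p q \<phi>"
      using rearrangement_weak_bound[OF q pi] by blast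
    define e where "e = - ?\<pi> + (1 / n - 1)"
    have e: "e > -1" using less by (simp add: e_def)
    show thesis
    proof (rule that[of "c * (L powr (e + 1) / (e + 1))"])
      show "0 < c * (L powr (e + 1) / (e + 1))" using c L e by simp
      fix M :: "'x measure" and \<phi> :: "'x \<Rightarrow> 'y" and \<sigma> :: real
      assume M: "emeasure M (space M) \<le> ennreal L" and \<sigma>: "\<sigma> > 0"
      let ?N = "lorentz_norm M p q \<phi>"
      have "hardy_op n (rearrangement M \<phi>) \<sigma> \<le> (\<integral>\<^sup>+r. ennreal c * ?N * (ennreal (r powr e) * indicator {0..L} r) \<partial>lborel)"
        unfolding hardy_op_def
      proof (rule nn_integral_mono)
        fix r :: real
        show "rearrangement M \<phi> r * ennreal (max \<sigma> r powr (1 / n - 1)) * indicator {0<..} r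
          \<le> ennreal c * ?N * (ennreal (r powr e) * indicator {0..L} r)"
        proof (cases "0 < r \<and> r \<le> L")
          case True
          then have "rearrangement M \<phi> r * ennreal (max \<sigma> r powr (1 / n - 1))
            \<le> ennreal (c * r powr - ?\<pi>) * ?N * ennreal (r powr (1 / n - 1))"
            by (intro mult_mono c(2) ennreal_leI mx) auto
          also have "\<dots> = ennreal c * ?N * (ennreal (r powr - ?\<pi>) * ennreal (r powr (1 / n - 1)))"
            using c by (simp add: ennreal_mult mult_ac)
          also have "ennreal (r powr - ?\<pi>) * ennreal (r powr (1 / n - 1)) = ennreal (r powr e)"
            by (simp add: ennreal_mult[symmetric] powr_add[symmetric] e_def)
          finally show ?thesis using True by simp
        next
          case False
          moreover have "rearrangement M \<phi> r = 0" if "r > L"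
            using that order_trans[OF M ennreal_leI[of L r]] by (intro rearrangement_eq_0) simp
          ultimately show ?thesis by (auto simp: indicator_def)
        qed
      qed
      also have "\<dots> = ennreal c * ?N * ennreal (L powr (e + 1) / (e + 1))"
        using e L by (simp add: nn_integral_cmult nn_integral_powr_below)
      also have "\<dots> = ennreal (c * (L powr (e + 1) / (e + 1))) * ?N"
        using c e ennreal_mult[of c "L powr (e + 1) / (e + 1)"] by (simp add: mult_ac)
      finally show "hardy_op n (rearrangement M \<phi>) \<sigma> \<le> ennreal (c * (L powr (e + 1) / (e + 1))) * ?N" .
    qed
  qed
qed

text \<open>The rearrangement inequality is applied to Lebesgue measure on \<open>\<Omega>\<close>,
  with exponent n and the volume of the unit ball as growth constant. Its right side is bounded
  uniformly in \<open>s\<close>, and letting \<open>s\<close> tend to 0 bounds the essential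
  supremum.\<close>

lemma supercritical_estimate:
  fixes p q :: ennreal and L :: real
  assumes n: "CARD('n::finite) \<ge> 2"
    and pq: "p = of_nat CARD('n) \<and> q = 1 \<or> p > of_nat CARD('n) \<and> 1 \<le> q" and adm: "lorentz_admissible p q"
  shows "\<exists>K>0. \<forall>(\<Omega>::(real^'n) set). open \<Omega> \<and> emeasure lebesgue \<Omega> = ennreal L \<longrightarrow>
           (\<forall>u \<in> E1 \<Omega> (lorentz_space (lebesgue_on \<Omega>) p q) \<inter> Cb (closure \<Omega>).
             Linf_norm (lebesgue_on \<Omega>) u
               \<le> ennreal K * (lorentz_norm (lebesgue_on \<Omega>) p q (sym_gradient \<Omega> u) + Linf_norm (boundary_measure \<Omega>) u))"
proof -
  let ?n = "real CARD('n)" let ?V = "unit_ball_vol ?n"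
  have n1: "?n > 1" using n by simp
  have pi: "enn2real (inverse p) = 1 / ?n \<and> q = 1 \<or>
      enn2real (inverse p) < 1 / ?n \<and> 1 \<le> q \<and> (0 < enn2real (inverse p) \<or> q = \<infinity>)"
  proof (cases p)
    case (real p')
    have "p = of_nat CARD('n) \<longrightarrow> p' = ?n" "p > of_nat CARD('n) \<longrightarrow> p' > ?n"
      using real by (auto simp: ennreal_of_nat_eq_real_of_nat ennreal_less_iff)
    then have "p' = ?n \<and> q = 1 \<or> p' > ?n \<and> 1 \<le> q" using pq by auto
    moreover from this have "p' > 0" using n1 by linarith
    then have "enn2real (inverse p) = 1 / p'" using real by (simp add: enn2real_inverse_ennreal)
    ultimately show ?thesis using n1 by (auto simp: divide_strict_left_mono)
  next
    case top
    then have "q = \<infinity>" using adm by (auto simp: lorentz_admissible_def)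
    then show ?thesis using top n1 by simp
  qed
  \<comment> \<open>The maximum with 1 supplies the positive bound on the volume that
    \<open>hardy_op_le_lorentz_norm\<close> expects, for any real \<open>L\<close>.\<close>
  have nn: "?n > ?n - 1" and V: "?V > 0" and mL: "max L 1 > 0" by simp_all
  obtain a K where a: "a > 0" and K: "K > 0" and bound:
    "\<And>(\<Omega>::(real^'n) set) \<mu> u s. open \<Omega> \<Longrightarrow> growth_measure \<Omega> ?n ?V \<mu> \<Longrightarrow> u \<in> Cb (closure \<Omega>)
      \<Longrightarrow> \<exists>E. is_sym_gradient \<Omega> u E \<Longrightarrow> (\<lambda>x. norm (sym_gradient \<Omega> u x)) \<in> borel_measurable (lebesgue_on \<Omega>) \<Longrightarrow> s > 0
      \<Longrightarrow> rearrangement \<mu> u s \<le> 2 * rearrangement (boundary_measure \<Omega>) u (a * s powr ((?n - 1) / ?n))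
        + ennreal K * hardy_op ?n (rearrangement (lebesgue_on \<Omega>) (sym_gradient \<Omega> u)) ((1/2) powr (?n / ?n) * s powr (?n / ?n))"
    by (rule rearrangement_riesz_bound[OF n nn V]) blast
  obtain c where c: "c > 0" and hc: "\<And>(M :: (real^'n) measure) (\<phi> :: real^'n \<Rightarrow> real^'n^'n) \<sigma>.
      emeasure M (space M) \<le> ennreal (max L 1) \<Longrightarrow> \<sigma> > 0 \<Longrightarrow> hardy_op ?n (rearrangement M \<phi>) \<sigma> \<le> ennreal c * lorentz_norm M p q \<phi>"
    by (rule hardy_op_le_lorentz_norm[OF n1 mL pi]) blast
  show ?thesis
  proof (intro exI[of _ "1 * (2 + K * c)"] conjI allI impI ballI)
    show "0 < 1 * (2 + K * c)" using K c by (simp add: add_pos_pos)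
    fix \<Omega> :: "(real^'n) set" and u
    assume "open \<Omega> \<and> emeasure lebesgue \<Omega> = ennreal L"
      and u: "u \<in> E1 \<Omega> (lorentz_space (lebesgue_on \<Omega>) p q) \<inter> Cb (closure \<Omega>)"
    then have op: "open \<Omega>" and \<Omega>L: "emeasure lebesgue \<Omega> = ennreal L" by auto
    note uD = E1_lorentz_spaceD[OF u]
    have uc: "continuous_on (closure \<Omega>) u" using uD(3) by (simp add: Cb_def)
    define \<nu> where "\<nu> = restrict_space lborel \<Omega>"
    have \<Omega>b: "\<Omega> \<in> sets lborel" using op by simp
    have sp: "space \<nu> = \<Omega>" by (simp add: \<nu>_def space_restrict_space)
    have e\<nu>: "emeasure \<nu> A = emeasure lborel A" if "A \<subseteq> \<Omega>" for A
      unfolding \<nu>_def using \<Omega>b that by (intro emeasure_restrict_space) auto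
    have gr: "growth_measure \<Omega> ?n ?V \<nu>"
      unfolding growth_measure_def
    proof (intro conjI ballI allI impI)
      show "sets \<nu> = sets (restrict_space borel \<Omega>)"
        unfolding \<nu>_def by (rule sets_restrict_space_cong) simp
      fix x and r :: real assume r: "r > 0"
      have "emeasure \<nu> (ball x r \<inter> \<Omega>) \<le> emeasure lborel (ball x r)"
        using op by (subst e\<nu>) (auto intro!: emeasure_mono)
      then show "emeasure \<nu> (ball x r \<inter> \<Omega>) \<le> ennreal (?V * r powr ?n)"
        using ball_growthD(2)[OF ball_growth_lborel r, of x] by simp
    qed
    define Nf where "Nf = lorentz_norm (lebesgue_on \<Omega>) p q (sym_gradient \<Omega> u)"
    define Ng where "Ng = Linf_norm (boundary_measure \<Omega>) u"
    let ?B = "ennreal (1 * (2 + K * c)) * (Nf + Ng)"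
    have re: "rearrangement \<nu> u s \<le> ?B" if s: "s > 0" for s
    proof -
      have "rearrangement \<nu> u s \<le> ennreal 1 * (ennreal 2 * rearrangement (boundary_measure \<Omega>) u (a * s powr ((?n - 1) / ?n))
        + ennreal K * hardy_op ?n (rearrangement (lebesgue_on \<Omega>) (sym_gradient \<Omega> u)) ((1/2) powr (?n / ?n) * s powr (?n / ?n)))"
        using bound[OF op gr uD(3,1,2) s] by simp
      moreover have "rearrangement (boundary_measure \<Omega>) u (a * s powr ((?n - 1) / ?n)) \<le> Ng"
        unfolding Ng_def Lq_norm_def
        using esssup_zero_measure[of "boundary_measure \<Omega>" "\<lambda>x. ennreal (norm (u x))"]
        by (intro rearrangement_leI) simp
      then have "ennreal 2 * rearrangement (boundary_measure \<Omega>) u (a * s powr ((?n - 1) / ?n)) \<le> ennreal 2 * Ng"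
        by (rule mult_left_mono) simp
      moreover have "ennreal K * hardy_op ?n (rearrangement (lebesgue_on \<Omega>) (sym_gradient \<Omega> u)) ((1/2) powr (?n / ?n) * s powr (?n / ?n))
        \<le> ennreal (K * c) * Nf"
      proof -
        have "emeasure (lebesgue_on \<Omega>) (space (lebesgue_on \<Omega>)) = ennreal L"
          using \<Omega>L op by (subst emeasure_restrict_space) auto
        also have "\<dots> \<le> ennreal (max L 1)" by (intro ennreal_leI) simp
        finally have "hardy_op ?n (rearrangement (lebesgue_on \<Omega>) (sym_gradient \<Omega> u)) ((1/2) powr (?n / ?n) * s powr (?n / ?n)) \<le> ennreal c * Nf"
          unfolding Nf_def using s by (intro hc) auto
        then have "ennreal K * hardy_op ?n (rearrangement (lebesgue_on \<Omega>) (sym_gradient \<Omega> u)) ((1/2) powr (?n / ?n) * s powr (?n / ?n)) \<le> ennreal K * (ennreal c * Nf)"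
          by (rule mult_left_mono) simp
        also have "\<dots> = ennreal (K * c) * Nf" using K c by (simp add: ennreal_mult mult.assoc)
        finally show ?thesis .
      qed
      ultimately show ?thesis by (rule ennreal_combination_le) (use K c in auto)
    qed
    have um: "u \<in> borel_measurable (restrict_space borel \<Omega>)"
      using continuous_on_subset[OF uc closure_subset] by (rule borel_measurable_continuous_on_restrict)
    then have um\<nu>: "u \<in> borel_measurable \<nu>"
      unfolding \<nu>_def by (simp cong: measurable_cong_sets add: sets_restrict_space)
    have nm: "(\<lambda>x. norm (u x)) \<in> borel_measurable \<nu>" using um\<nu> by measurable
    have "AE x in lebesgue_on \<Omega>. ennreal (norm (u x)) \<le> T" if T: "?B < T" for T
    proof -
      let ?N = "{x \<in> space \<nu>. T < ennreal (norm (u x))}"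
      \<comment> \<open>The super-level set above the bound has measure at most every positive
        \<open>s\<close>, hence is null.\<close>
      have le: "emeasure \<nu> ?N \<le> ennreal s" if "s > 0" for s
        using rearrangement_lessD[OF nm le_less_trans[OF re[OF that] T]] .
      have "emeasure \<nu> ?N \<le> 0"
      proof (rule ennreal_le_epsilon)
        fix e :: real assume "e > 0"
        then show "emeasure \<nu> ?N \<le> 0 + ennreal e" using le by simp
      qed
      then have z: "emeasure lborel ?N = 0" using e\<nu>[of ?N] sp by auto
      have "?N \<in> sets \<nu>" using nm by measurable
      then have Nb: "?N \<in> sets lborel" unfolding \<nu>_def using \<Omega>b by (simp add: sets_restrict_space_iff)
      have "emeasure (lebesgue_on \<Omega>) ?N = emeasure lebesgue ?N"
        using op sp by (intro emeasure_restrict_space) auto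
      also have "\<dots> = 0" using z Nb by simp
      finally have "emeasure (lebesgue_on \<Omega>) ?N = 0" .
      moreover have "?N \<in> sets (lebesgue_on \<Omega>)"
        using Nb op sp by (subst sets_restrict_space_iff) auto
      ultimately show ?thesis by (intro AE_I[of _ _ ?N]) (auto simp: sp not_le)
    qed
    note ae = this
    have ul: "(\<lambda>x. ennreal (norm (u x))) \<in> borel_measurable (lebesgue_on \<Omega>)"
    proof -
      have "continuous_on \<Omega> u" using continuous_on_subset[OF uc closure_subset] .
      then have "u \<in> borel_measurable (lebesgue_on \<Omega>)"
        using op by (intro continuous_imp_measurable_on_sets_lebesgue) auto
      then show ?thesis by measurable
    qed
    show "Linf_norm (lebesgue_on \<Omega>) u \<le> ennreal (1 * (2 + K * c)) *
        (lorentz_norm (lebesgue_on \<Omega>) p q (sym_gradient \<Omega> u) + Linf_norm (boundary_measure \<Omega>) u)"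
      unfolding Nf_def[symmetric] Ng_def[symmetric]
    proof (rule dense_ge)
      fix T assume "?B < T"
      from ae[OF this] show "Linf_norm (lebesgue_on \<Omega>) u \<le> T"
        unfolding Lq_norm_def using ul by (simp add: esssup_I)
    qed
  qed
qed

text \<open>The dependence of the constants is expressed by the order of the quantifiers: they are
  chosen before the domain, the measure and the function. An equation with \<open>ennreal L\<close>,
  \<open>ennreal m\<close> or \<open>ennreal h\<close> fixes a total mass and says at the same time
  that it is finite. In the third part \<open>p\<close> is extended real, and
  \<open>lorentz_admissible\<close> forces \<open>q = \<infinity>\<close> when
  \<open>p = \<infinity>\<close>.\<close>

theorem theorem4p5:
  fixes \<alpha> C\<^sub>\<mu> :: real
  assumes "CARD('n::finite) \<ge> 2"
    and "real CARD('n) - 1 < \<alpha>" and "\<alpha> \<le> real CARD('n)" and "C\<^sub>\<mu> > 0"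
  shows
    "(\<forall>(p::real) (q::ennreal). 1 < p \<and> p < real CARD('n) \<and> 1 \<le> q \<longrightarrow>
       (\<exists>C::real. C > 0 \<and>
         (\<forall>(\<Omega>::(real^'n) set) \<mu>. open \<Omega> \<and> growth_measure \<Omega> \<alpha> C\<^sub>\<mu> \<mu> \<longrightarrow>
           (\<forall>u \<in> E1 \<Omega> (lorentz_space (lebesgue_on \<Omega>) (ennreal p) q) \<inter> Cb (closure \<Omega>).
             lorentz_norm \<mu> (ennreal (\<alpha> * p / (real CARD('n) - p))) q u
               \<le> ennreal C *
                  (lorentz_norm (lebesgue_on \<Omega>) (ennreal p) q (sym_gradient \<Omega> u)
                   + lorentz_norm (boundary_measure \<Omega>)
                       (ennreal (p * (real CARD('n) - 1) / (real CARD('n) - p))) q u)))))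
     \<and>
     (\<forall>(q::real) L m h. 1 < q \<longrightarrow>
       (\<exists>C::real. C > 0 \<and>
         (\<forall>(\<Omega>::(real^'n) set) \<mu>. open \<Omega> \<and> growth_measure \<Omega> \<alpha> C\<^sub>\<mu> \<mu>
            \<and> emeasure lebesgue \<Omega> = ennreal L \<and> emeasure \<mu> \<Omega> = ennreal m
            \<and> emeasure (hausdorff_measure (CARD('n) - 1)) (frontier \<Omega>) = ennreal h \<longrightarrow>
           (\<forall>u \<in> E1 \<Omega> (lorentz_space (lebesgue_on \<Omega>) (of_nat CARD('n)) (ennreal q)) \<inter> Cb (closure \<Omega>).
             lorentz_zygmund_norm \<mu> q u
               \<le> ennreal C *
                  (lorentz_norm (lebesgue_on \<Omega>) (of_nat CARD('n)) (ennreal q) (sym_gradient \<Omega> u)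
                   + lorentz_zygmund_norm (boundary_measure \<Omega>) q u)))))
     \<and>
     (\<forall>(p::ennreal) (q::ennreal) L m h.
       (p = of_nat CARD('n) \<and> q = 1 \<or> p > of_nat CARD('n) \<and> 1 \<le> q) \<and> lorentz_admissible p q \<longrightarrow>
       (\<exists>C::real. C > 0 \<and>
         (\<forall>(\<Omega>::(real^'n) set) \<mu>. open \<Omega> \<and> growth_measure \<Omega> \<alpha> C\<^sub>\<mu> \<mu>
            \<and> emeasure lebesgue \<Omega> = ennreal L \<and> emeasure \<mu> \<Omega> = ennreal m
            \<and> emeasure (hausdorff_measure (CARD('n) - 1)) (frontier \<Omega>) = ennreal h \<longrightarrow>
           (\<forall>u \<in> E1 \<Omega> (lorentz_space (lebesgue_on \<Omega>) p q) \<inter> Cb (closure \<Omega>).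
             Linf_norm (lebesgue_on \<Omega>) u
               \<le> ennreal C *
                  (lorentz_norm (lebesgue_on \<Omega>) p q (sym_gradient \<Omega> u)
                   + Linf_norm (boundary_measure \<Omega>) u)))))"
proof (intro conjI allI impI, goal_cases)
  case (1 p q)
  then show ?case by (intro subcritical_estimate assms) auto
next
  case (2 q L m h)
  then show ?case by (intro critical_estimate assms)
next
  case (3 p q L m h)
  then obtain K where "K > 0" and K: "\<And>(\<Omega>::(real^'n) set) u. open \<Omega> \<Longrightarrow> emeasure lebesgue \<Omega> = ennreal L
      \<Longrightarrow> u \<in> E1 \<Omega> (lorentz_space (lebesgue_on \<Omega>) p q) \<inter> Cb (closure \<Omega>)
      \<Longrightarrow> Linf_norm (lebesgue_on \<Omega>) u
        \<le> ennreal K * (lorentz_norm (lebesgue_on \<Omega>) p q (sym_gradient \<Omega> u) + Linf_norm (boundary_measure \<Omega>) u)"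
    using supercritical_estimate[OF assms(1), of p q L] by blast
  then show ?case by (intro exI[of _ K] conjI allI impI ballI K) auto
qed

end
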